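(* For each admissible $\theta$ below, the implicit constants are independent of $f$ and of $t\in\mathbb{R}$ (they may depend on $\theta$), and the inequalities hold for all $t\in\mathbb{R}$. Consider the inequality $$(\ast)\qquad \|\langle x\rangle^{\theta} U(t)f\|_{L^2}\lesssim \langle t \rangle^{\theta}\big(\|\langle x\rangle^{\theta} f\|_{L^2}+\|f\|_{H^{\theta,0}}\big).$$ (i) Let $0<\theta<\frac12$ and $f\in H^{\theta,0}(\mathbb{R}\times\mathbb{T})\cap L^2(|x|^{2\theta}\,dxdy)$. Then $(\ast)$ holds. (ii) Let $\theta=\frac12$, $f\in H^{\frac12,0}(\mathbb{R}\times\mathbb{T})\cap L^2(|x|\,dxdy)$ and $\mathcal{H}_xf\in L^2(|x|\,dxdy)$. Then $$\|\langle x\rangle^{\frac12} U(t)f\|_{L^2}\lesssim \langle t \rangle^{\frac12}\big(\|\langle x\rangle^{\frac12} f\|_{L^2}+\|\langle x\rangle^{\frac12}\mathcal{H}_x f\|_{L^2}+\|f\|_{H^{\frac12,0}}\big).$$ (iii) Let $\frac12<\theta<\frac32$ and $f\in H^{\theta,0}(\mathbb{R}\times\mathbb{T})\cap L^2(|x|^{2\theta}\,dxdy)$. Assume that $$\int_{\mathbb{T}}\int_{\mathbb{R}}e^{-i\eta y}f(x,y)\,dxdy=0\quad\text{for all }\eta\in\mathbb{Z}\setminus\{0\}.$$ Then $(\ast)$ holds. (iv) Let $k\in\mathbb{Z}^+$ (a positive integer), $k+\frac12\le\theta<k+\frac32$, and $f\in H^{\theta,0}(\mathbb{R}\times\mathbb{T})\cap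 L^2(|x|^{2\theta}\,dxdy)$. Assume that $$\int_{\mathbb{T}}\int_{\mathbb{R}}e^{-i\eta y}x^{l}f(x,y)\,dxdy=0\quad\text{for all }\eta\in\mathbb{Z}\setminus\{0\}\text{ and } l=0,1,\dots,k-1,$$ and, if $k\ge2$, assume additionally that $$\int_{\mathbb{T}}\int_{\mathbb{R}}x^{l}f(x,y)\,dxdy=0\quad\text{for all } l=0,1,\dots,k-2.$$ - If $\theta=k+\frac12$, assume further that $\mathcal{H}_x(x^kf)\in L^2(|x|\,dxdy)$. Then $$\|\langle x\rangle^{k+\frac12} U(t)f\|_{L^2}\lesssim \langle t \rangle^{k+\frac12}\big(\|\langle x\rangle^{k+\frac12} f\|_{L^2}+\|\langle x\rangle^{\frac12}\mathcal{H}_x(x^k f)\|_{L^2}+\|f\|_{H^{k+\frac12,0}}\big).$$ - If $k+\frac12<\theta<k+\frac32$, assume further that $$\int_{\mathbb{T}}\int_{\mathbb{R}}e^{-i\eta y}x^{k}f(x,y)\,dxdy=0\quad\text{for all }\eta\in\mathbb{Z}\setminus\{0\}.$$ Then $(\ast)$ holds.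
   Context: $\mathbb{T}=\mathbb{R}/2\pi\mathbb{Z}$; $\langle x\rangle=(1+|x|^2)^{1/2}$; $L^2=L^2(\mathbb{R}\times\mathbb{T})$. $L^2(|x|^{2\theta}\,dxdy)$ is the space of functions on $\mathbb{R}\times\mathbb{T}$ that are square integrable with respect to $|x|^{2\theta}\,dxdy$. The Fourier transform is $\widehat f(\xi,\eta)=\int_{\mathbb{T}}\int_{\mathbb{R}}f(x,y)e^{-ix\xi-iy\eta}\,dxdy$, $\xi\in\mathbb{R}$, $\eta\in\mathbb{Z}$. $\mathcal{H}_x$ is the Hilbert transform in $x$: $\widehat{\mathcal{H}_xf}(\xi,\eta)=-i\,\mathrm{sign}(\xi)\widehat f(\xi,\eta)$. For $s\ge0$, $H^{s,0}(\mathbb{R}\times\mathbb{T})$ is defined by the norm $\|f\|_{H^{s,0}}=\|J_x^sf\|_{L^2}$, where $\widehat{J_x^sf}(\xi,\eta)=\langle\xi\rangle^s\widehat f(\xi,\eta)$. $\{U(t)\}_{t\in\mathbb{R}}$ is the unitary group of the linear equation $\partial_tv-\mathcal{H}_x\partial_x^2v-\mathcal{H}_x\partial_y^2v=0$ on $\mathbb{R}\times\mathbb{T}$, i.e. $$U(t)f(x,y)=\frac{1}{(2\pi)^2}\sum_{\eta\in\mathbb{Z}}\int_{\mathbb{R}}e^{it\omega(\xi,\eta)+ix\xi+iy\eta}\widehat f(\xi,\eta)\,d\xi,\qquad \omega(\xi,\eta)=\mathrm{sign}(\xi)\xi^2+\mathrm{sign}(\xi)\eta^2.$$ $a\lesssim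 b$ means $a\le cb$ for some constant $c>0$. *)

theory Defs
  imports "HOL-Analysis.Analysis"
begin

definition japanese :: "real \<Rightarrow> real" where
  "japanese x = sqrt (1 + \<bar>x\<bar>\<^sup>2)"

definition L2 :: "'a measure \<Rightarrow> ('a \<Rightarrow> complex) set" where
  "L2 M = {f \<in> borel_measurable M. integrable M (\<lambda>z. (cmod (f z))\<^sup>2)}"

text \<open>Meaningful as the \<open>L\<^sup>2\<close> norm only for members of \<open>L2 M\<close>: the Bochner integral of a
  non-integrable function is \<open>0\<close>.\<close>

definition L2_norm :: "'a measure \<Rightarrow> ('a \<Rightarrow> complex) \<Rightarrow> real" where
  "L2_norm M f = sqrt (LINT z|M. (cmod (f z))\<^sup>2)"

text \<open>The differences \<open>F n - g\<close> are measured by the nonnegative integral, so that convergence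
  cannot hold because a difference fails to be square integrable.\<close>

definition L2_tendsto :: "'a measure \<Rightarrow> (nat \<Rightarrow> 'a \<Rightarrow> complex) \<Rightarrow> ('a \<Rightarrow> complex) \<Rightarrow> bool" where
  "L2_tendsto M F g \<longleftrightarrow>
     g \<in> L2 M \<and> (\<lambda>n. \<integral>\<^sup>+ z. ennreal ((cmod (F n z - g z))\<^sup>2) \<partial>M) \<longlonglongrightarrow> 0"

text \<open>A function on \<open>\<real> \<times> \<real>/2\<pi>\<int>\<close> is represented by its values on the fundamental domain
  \<open>\<real> \<times> [0, 2\<pi>)\<close>; values at other points are irrelevant.\<close>

definition cylinder :: "(real \<times> real) measure" where
  "cylinder = lborel \<Otimes>\<^sub>M restrict_space lborel {0..<2 * pi}"

definition frequencies :: "(real \<times> int) measure" where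
  "frequencies = lborel \<Otimes>\<^sub>M count_space UNIV"

text \<open>For \<open>f\<close> in \<open>L\<^sup>1\<close> this is the Fourier transform; in general the integral need not converge.\<close>

definition fourier_integral :: "(real \<times> real \<Rightarrow> complex) \<Rightarrow> real \<times> int \<Rightarrow> complex" where
  "fourier_integral f = (\<lambda>(\<xi>, \<eta>).
     \<integral>(x, y). f (x, y) * exp (- \<i> * of_real (x * \<xi>) - \<i> * of_real (of_int \<eta> * y)) \<partial>cylinder)"

definition inverse_fourier_integral :: "(real \<times> int \<Rightarrow> complex) \<Rightarrow> real \<times> real \<Rightarrow> complex" where
  "inverse_fourier_integral g = (\<lambda>(x, y). 1 / (2 * of_real pi)\<^sup>2 *
     (\<integral>(\<xi>, \<eta>). exp (\<i> * of_real (x * \<xi>) + \<i> * of_real (of_int \<eta> * y)) * g (\<xi>, \<eta>) \<partial>frequencies))"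

text \<open>The Fourier transform of \<open>f \<in> L\<^sup>2\<close> is the \<open>L\<^sup>2\<close> limit of the Fourier transforms of the
  truncations of \<open>f\<close> to \<open>\<bar>x\<bar> \<le> n\<close>, which are in \<open>L\<^sup>1 \<inter> L\<^sup>2\<close>. The limit exists by
  Plancherel's theorem and is unique up to a null set; a representative is chosen.
  The inverse transform is treated in the same way.\<close>

definition fourier :: "(real \<times> real \<Rightarrow> complex) \<Rightarrow> real \<times> int \<Rightarrow> complex" where
  "fourier f = (SOME g. L2_tendsto frequencies
     (\<lambda>n. fourier_integral (\<lambda>(x, y). if \<bar>x\<bar> \<le> real n then f (x, y) else 0)) g)"

definition inverse_fourier :: "(real \<times> int \<Rightarrow> complex) \<Rightarrow> real \<times> real \<Rightarrow> complex" where
  "inverse_fourier g = (SOME f. L2_tendsto cylinder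
     (\<lambda>n. inverse_fourier_integral
        (\<lambda>(\<xi>, \<eta>). if \<bar>\<xi>\<bar> \<le> real n \<and> \<bar>\<eta>\<bar> \<le> int n then g (\<xi>, \<eta>) else 0)) f)"

definition fourier_multiplier ::
  "(real \<times> int \<Rightarrow> complex) \<Rightarrow> (real \<times> real \<Rightarrow> complex) \<Rightarrow> real \<times> real \<Rightarrow> complex" where
  "fourier_multiplier m f = inverse_fourier (\<lambda>\<zeta>. m \<zeta> * fourier f \<zeta>)"

definition hilbert_x :: "(real \<times> real \<Rightarrow> complex) \<Rightarrow> real \<times> real \<Rightarrow> complex" where
  "hilbert_x = fourier_multiplier (\<lambda>(\<xi>, \<eta>). - \<i> * of_real (sgn \<xi>))"

definition J_x :: "real \<Rightarrow> (real \<times> real \<Rightarrow> complex) \<Rightarrow> real \<times> real \<Rightarrow> complex" where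
  "J_x s = fourier_multiplier (\<lambda>(\<xi>, \<eta>). of_real (japanese \<xi> powr s))"

text \<open>The space \<open>H\<^sup>s\<^sup>,\<^sup>0\<close> for \<open>s \<ge> 0\<close>. The condition on the transform says that \<open>J_x s f\<close>
  exists as an \<open>L\<^sup>2\<close> function.\<close>

definition Hs0 :: "real \<Rightarrow> (real \<times> real \<Rightarrow> complex) set" where
  "Hs0 s = {f \<in> L2 cylinder.
     (\<lambda>(\<xi>, \<eta>). of_real (japanese \<xi> powr s) * fourier f (\<xi>, \<eta>)) \<in> L2 frequencies}"

definition Hs0_norm :: "real \<Rightarrow> (real \<times> real \<Rightarrow> complex) \<Rightarrow> real" where
  "Hs0_norm s f = L2_norm cylinder (J_x s f)"

definition omega :: "real \<Rightarrow> int \<Rightarrow> real" where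
  "omega \<xi> \<eta> = sgn \<xi> * \<xi>\<^sup>2 + sgn \<xi> * (of_int \<eta>)\<^sup>2"

definition U :: "real \<Rightarrow> (real \<times> real \<Rightarrow> complex) \<Rightarrow> real \<times> real \<Rightarrow> complex" where
  "U t = fourier_multiplier (\<lambda>(\<xi>, \<eta>). exp (\<i> * of_real (t * omega \<xi> \<eta>)))"

text \<open>The space \<open>L\<^sup>2(\<bar>x\<bar>\<^sup>2\<^sup>\<theta> dx dy)\<close>.\<close>

definition L2_weight :: "real \<Rightarrow> (real \<times> real \<Rightarrow> complex) set" where
  "L2_weight \<theta> = L2 (density cylinder (\<lambda>(x, y). ennreal (\<bar>x\<bar> powr (2 * \<theta>))))"

definition weighted :: "real \<Rightarrow> (real \<times> real \<Rightarrow> complex) \<Rightarrow> real \<times> real \<Rightarrow> complex" where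
  "weighted \<theta> f = (\<lambda>(x, y). of_real (japanese x powr \<theta>) * f (x, y))"

definition x_power :: "nat \<Rightarrow> (real \<times> real \<Rightarrow> complex) \<Rightarrow> real \<times> real \<Rightarrow> complex" where
  "x_power l f = (\<lambda>(x, y). of_real (x ^ l) * f (x, y))"

definition moment :: "(real \<times> real \<Rightarrow> complex) \<Rightarrow> nat \<Rightarrow> int \<Rightarrow> complex" where
  "moment f l \<eta> =
     (\<integral>(x, y). exp (- \<i> * of_real (of_int \<eta> * y)) * of_real (x ^ l) * f (x, y) \<partial>cylinder)"

text \<open>The integrability claim is part of the estimate: it expresses that the left-hand norm is
  finite, which \<open>L2_norm\<close> alone would not.\<close>

definition weighted_bound :: "real \<Rightarrow> (real \<times> real \<Rightarrow> complex) \<Rightarrow> real \<Rightarrow> bool" where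
  "weighted_bound \<theta> g B \<longleftrightarrow> weighted \<theta> g \<in> L2 cylinder \<and> L2_norm cylinder (weighted \<theta> g) \<le> B"

end

theory Submission
 imports Defs "HOL-Library.Nat_Bijection"
begin

text \<open>
 The weight \<open>\<bar>x\<bar>\<^sup>2\<^sup>\<theta>\<close> is turned into smoothness of the Fourier transform in \<open>\<xi>\<close>. If \<open>F\<close> is the transform of
 \<open>f\<close> and \<open>\<Delta>\<close> the difference with step \<open>h\<close> in \<open>\<xi>\<close>, then \<open>\<Delta>\<^sup>N F\<close> is the transform of
 \<open>(exp (- i x h) - 1)\<^sup>N f\<close>, and Plancherel's identity shows that for \<open>0 < \<theta> < N\<close> the difference energy
 \<open>\<integral> \<bar>h\<bar> powr (- 1 - 2 \<theta>) \<parallel>\<Delta>\<^sup>N F\<parallel>\<^sup>2 dh\<close> is a constant times \<open>\<integral> \<bar>x\<bar> powr (2 \<theta>) \<bar>f\<bar>\<^sup>2\<close>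
 (\<open>diff_energy_fourier\<close>). Differences of sufficiently high order treat all \<open>\<theta> > 0\<close> alike and require no derivatives.

 The evolution multiplies \<open>F\<close> by \<open>exp (i t \<omega>) = cos (t \<phi>) + i sgn \<xi> sin (t \<phi>)\<close> with \<open>\<phi> = \<xi>\<^sup>2 + \<eta>\<^sup>2\<close>. The factors
 \<open>exp (\<plusminus> i t \<eta>\<^sup>2)\<close> are constant in \<open>\<xi>\<close>. For the quadratic phases \<open>exp (\<plusminus> i t \<xi>\<^sup>2)\<close> a discrete Leibniz rule costs
 \<open>\<bar>t\<bar> powr (2 \<theta>) \<bar>\<xi>\<bar> powr (2 \<theta>)\<close> and \<open>\<bar>t\<bar> powr \<theta>\<close>, which the Sobolev norm and the factor \<open>\<langle>t\<rangle> powr \<theta>\<close>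
 of the theorem pay for. The jump of \<open>sgn \<xi>\<close> costs the singular weight \<open>\<integral> \<bar>\<xi>\<bar> powr (- 2 \<theta>) \<bar>sin (t \<phi>) F\<bar>\<^sup>2\<close>
 (\<open>diff_energy_propagator\<close>), and everything depends on bounding it.

 For \<open>\<theta> < 1/2\<close> it is bounded by Hardy's inequality for differences (\<open>hardy_low\<close>). At \<open>\<theta> = 1/2\<close> that inequality
 fails, but it holds for \<open>F\<close> and \<open>sgn \<xi> F\<close> together (\<open>hardy_half\<close>), which is what the hypothesis on the Hilbert
 transform provides. For \<open>k + 1/2 < \<theta> < k + 3/2\<close> the vanishing of the moments up to order \<open>k\<close> makes \<open>F\<close>
 vanish at \<open>\<xi> = 0\<close> to that order, and the weight is controlled by a Schur test (\<open>hardy_moments\<close>). In the mode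
 \<open>\<eta> = 0\<close> the sine contributes a factor \<open>min 1 (\<bar>t\<bar> \<xi>\<^sup>2)\<close>, hence two orders of vanishing; this is why only the
 moments up to order \<open>k - 2\<close> have to vanish there (\<open>zero_mode_sine\<close>). At \<open>\<theta> = k + 1/2\<close> the Taylor polynomial of
 \<open>F\<close> in \<open>\<xi>\<close> is subtracted; the integral form of the remainder reduces the weight to \<open>1/\<bar>\<xi>\<bar>\<close> against the transform of
 \<open>x\<^sup>k f\<close>, to which the case \<open>\<theta> = 1/2\<close> applies (\<open>endpoint_taylor\<close>, \<open>sine_endpoint\<close>).
\<close>

section \<open>Square integrable functions\<close>

abbreviation nsq :: "complex \<Rightarrow> ennreal" where
 "nsq w \<equiv> ennreal ((cmod w)\<^sup>2)"

abbreviation wave :: "real \<Rightarrow> complex" where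
 "wave u \<equiv> exp (\<i> * of_real u)"

abbreviation cowave :: "real \<Rightarrow> complex" where
 "cowave u \<equiv> exp (- \<i> * of_real u)"

abbreviation fst_powr :: "real \<Rightarrow> real \<times> 'b \<Rightarrow> ennreal" where
 "fst_powr s z \<equiv> ennreal (\<bar>fst z\<bar> powr s)"

abbreviation chirp :: "real \<Rightarrow> (real \<times> int \<Rightarrow> complex) \<Rightarrow> real \<times> int \<Rightarrow> complex" where
 "chirp t G \<equiv> \<lambda>z. wave (t * (fst z)\<^sup>2) * G z"

abbreviation freq_measurable :: "(real \<times> int \<Rightarrow> 'a :: topological_space) set" where
 "freq_measurable \<equiv> borel_measurable frequencies"

text \<open>The squared norm as an extended nonnegative number: it is meaningful without integrability, so that finiteness can be
 a conclusion.\<close>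

definition energy :: "'a measure \<Rightarrow> ('a \<Rightarrow> complex) \<Rightarrow> ennreal" where
 "energy M f = (\<integral>\<^sup>+ z. nsq (f z) \<partial>M)"

lemma L2_iff_energy: "f \<in> L2 M \<longleftrightarrow> f \<in> borel_measurable M \<and> energy M f < \<infinity>"
 unfolding L2_def energy_def by (auto simp: integrable_iff_bounded)

lemma L2_measurable: "f \<in> L2 M \<Longrightarrow> f \<in> borel_measurable M" by (simp add: L2_def)

lemma L2_norm_eq_energy:
 "f \<in> borel_measurable M \<Longrightarrow> L2_norm M f = sqrt (enn2real (energy M f))"
 unfolding L2_norm_def energy_def by (subst integral_eq_nn_integral) auto

lemma energy_eq_L2_norm:
 "f \<in> L2 M \<Longrightarrow> energy M f = ennreal ((L2_norm M f)\<^sup>2)"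
 by (subst L2_norm_eq_energy) (auto simp: L2_iff_energy less_top[symmetric])

lemma L2_norm_nonneg: "0 \<le> L2_norm M f" unfolding L2_norm_def by simp

lemma energy_cong_AE: "AE z in M. f z = g z \<Longrightarrow> energy M f = energy M g"
 unfolding energy_def by (rule nn_integral_cong_AE) auto

lemma energy_cmult:
 assumes "f \<in> borel_measurable M"
 shows "energy M (\<lambda>z. c * f z) = nsq c * energy M f" unfolding energy_def using assms
 by (subst nn_integral_cmult[symmetric]) (auto simp: norm_mult power_mult_distrib ennreal_mult)

lemma energy_mono:
 "(\<And>z. cmod (f z) \<le> cmod (g z)) \<Longrightarrow> energy M f \<le> energy M g"
 unfolding energy_def by (intro nn_integral_mono ennreal_leI power_mono) auto

lemma cmod_add_square_le:
 fixes a b :: complex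
 assumes "0 < d"
 shows "(cmod (a + b))\<^sup>2 \<le> (1 + d) * (cmod a)\<^sup>2 + (1 + 1/d) * (cmod b)\<^sup>2"
proof -
 have "0 \<le> (sqrt d * cmod a - cmod b / sqrt d)\<^sup>2" by simp
 also have "... = d * (cmod a)\<^sup>2 + (1/d) * (cmod b)\<^sup>2 - 2 * cmod a * cmod b"
  using assms by (simp add: power2_diff power_mult_distrib power_divide)
 finally have 1: "2 * cmod a * cmod b \<le> d * (cmod a)\<^sup>2 + (1/d) * (cmod b)\<^sup>2" by simp
 have "(cmod (a + b))\<^sup>2 \<le> (cmod a + cmod b)\<^sup>2" by (intro power_mono norm_triangle_ineq) auto
 then show ?thesis using 1 by (simp add: power2_sum algebra_simps)
qed

lemma energy_add_le:
 assumes [measurable]: "f \<in> borel_measurable M" "g \<in> borel_measurable M" and "0 < d"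
 shows "energy M (\<lambda>z. f z + g z) \<le> ennreal (1 + d) * energy M f + ennreal (1 + 1/d) * energy M g"
proof -
 have "energy M (\<lambda>z. f z + g z)
   \<le> (\<integral>\<^sup>+ z. ennreal (1 + d) * nsq (f z) + ennreal (1 + 1/d) * nsq (g z) \<partial>M)"
  unfolding energy_def using assms(3) cmod_add_square_le[OF assms(3)]
  by (intro nn_integral_mono) (auto simp flip: ennreal_mult ennreal_plus)
 also have "... = ennreal (1 + d) * energy M f + ennreal (1 + 1/d) * energy M g"
  unfolding energy_def by (simp add: nn_integral_add nn_integral_cmult)
 finally show ?thesis .
qed

lemma energy_add_le2:
 assumes "f \<in> borel_measurable M" "g \<in> borel_measurable M"
 shows "energy M (\<lambda>z. f z + g z) \<le> 2 * (energy M f + energy M g)"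
 using energy_add_le[OF assms, of 1] by (simp add: distrib_left)

lemma energy_diff_le2:
 assumes "f \<in> borel_measurable M" "g \<in> borel_measurable M"
 shows "energy M (\<lambda>z. f z - g z) \<le> 2 * (energy M f + energy M g)"
 using energy_add_le2[of f M "\<lambda>z. - g z"] assms by (simp add: energy_def)

lemma L2_add: "f \<in> L2 M \<Longrightarrow> g \<in> L2 M \<Longrightarrow> (\<lambda>z. f z + g z) \<in> L2 M"
 using energy_add_le2[of f M g] unfolding L2_iff_energy by (auto simp: ennreal_mult_less_top intro: le_less_trans)

lemma L2_diff: "f \<in> L2 M \<Longrightarrow> g \<in> L2 M \<Longrightarrow> (\<lambda>z. f z - g z) \<in> L2 M"
 using energy_diff_le2[of f M g] unfolding L2_iff_energy by (auto simp: ennreal_mult_less_top intro: le_less_trans)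

lemma L2_cmult: "f \<in> L2 M \<Longrightarrow> (\<lambda>z. c * f z) \<in> L2 M"
 unfolding L2_iff_energy by (auto simp: energy_cmult ennreal_mult_less_top)

lemma L2_norm_triangle:
 assumes f: "f \<in> L2 M" and g: "g \<in> L2 M"
 shows "L2_norm M (\<lambda>z. f z + g z) \<le> L2_norm M f + L2_norm M g"
proof (rule field_le_epsilon)
 fix e :: real assume e: "0 < e"
 define a where "a = L2_norm M f + e/2"
 define b where "b = L2_norm M g + e/2"
 have pos: "0 < a" "0 < b" using e L2_norm_nonneg[of M f] L2_norm_nonneg[of M g] unfolding a_def b_def by linarith+
 have ab: "(L2_norm M f)\<^sup>2 \<le> a\<^sup>2" "(L2_norm M g)\<^sup>2 \<le> b\<^sup>2"
  using e L2_norm_nonneg[of M f] L2_norm_nonneg[of M g] unfolding a_def b_def by (auto intro!: power_mono)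
 have "ennreal ((L2_norm M (\<lambda>z. f z + g z))\<^sup>2) = energy M (\<lambda>z. f z + g z)"
  using energy_eq_L2_norm[OF L2_add[OF f g]] by simp
 also have "... \<le> ennreal (1 + b/a) * energy M f + ennreal (1 + 1/(b/a)) * energy M g"
  using pos by (intro energy_add_le L2_measurable f g) auto
 also have "... \<le> ennreal (1 + b/a) * ennreal (a\<^sup>2) + ennreal (1 + 1/(b/a)) * ennreal (b\<^sup>2)"
  using ab unfolding energy_eq_L2_norm[OF f] energy_eq_L2_norm[OF g] by (intro add_mono mult_left_mono ennreal_leI) auto
 also have "... = ennreal ((a + b)\<^sup>2)"
  using pos by (simp add: field_simps power2_eq_square flip: ennreal_mult ennreal_plus)
 finally have "(L2_norm M (\<lambda>z. f z + g z))\<^sup>2 \<le> (a + b)\<^sup>2" by simp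
 then have "L2_norm M (\<lambda>z. f z + g z) \<le> a + b" by (rule power2_le_imp_le) (use pos in simp)
 then show "L2_norm M (\<lambda>z. f z + g z) \<le> L2_norm M f + L2_norm M g + e" by (simp add: a_def b_def)
qed

lemma L2_tendsto_def': "L2_tendsto M F g \<longleftrightarrow> g \<in> L2 M \<and> (\<lambda>n. energy M (\<lambda>z. F n z - g z)) \<longlonglongrightarrow> 0"
 unfolding L2_tendsto_def energy_def ..

lemma L2_tendsto_energy:
 assumes F: "\<And>n. F n \<in> L2 M" and lim: "L2_tendsto M F g"
 shows "(\<lambda>n. energy M (F n)) \<longlonglongrightarrow> energy M g"
proof -
 have g: "g \<in> L2 M" and l: "(\<lambda>n. energy M (\<lambda>z. F n z - g z)) \<longlonglongrightarrow> 0"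
  using lim by (auto simp: L2_tendsto_def')
 have d: "(\<lambda>z. F n z - g z) \<in> L2 M" "(\<lambda>z. g z - F n z) \<in> L2 M" for n by (intro L2_diff F g)+
 have "(\<lambda>n. ennreal ((L2_norm M (\<lambda>z. F n z - g z))\<^sup>2)) \<longlonglongrightarrow> ennreal 0"
  using l by (simp add: energy_eq_L2_norm[OF d(1)])
 then have "(\<lambda>n. (L2_norm M (\<lambda>z. F n z - g z))\<^sup>2) \<longlonglongrightarrow> 0"
  by (subst (asm) tendsto_ennreal_iff) auto
 then have "(\<lambda>n. sqrt ((L2_norm M (\<lambda>z. F n z - g z))\<^sup>2)) \<longlonglongrightarrow> sqrt 0"
  by (rule tendsto_real_sqrt)
 then have n0: "(\<lambda>n. L2_norm M (\<lambda>z. F n z - g z)) \<longlonglongrightarrow> 0" by (simp add: L2_norm_nonneg)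
 have eq: "L2_norm M (\<lambda>z. g z - F n z) = L2_norm M (\<lambda>z. F n z - g z)" for n
  by (simp add: L2_norm_def norm_minus_commute)
 have "\<bar>L2_norm M (F n) - L2_norm M g\<bar> \<le> L2_norm M (\<lambda>z. F n z - g z)" for n
  using L2_norm_triangle[OF d(1)[of n] g] L2_norm_triangle[OF d(2)[of n] F[of n]] by (simp add: eq)
 then have "(\<lambda>n. L2_norm M (F n) - L2_norm M g) \<longlonglongrightarrow> 0"
  by (intro Lim_null_comparison[OF _ n0]) auto
 then have "(\<lambda>n. L2_norm M (F n)) \<longlonglongrightarrow> L2_norm M g" by (simp add: LIM_zero_iff)
 then have "(\<lambda>n. ennreal ((L2_norm M (F n))\<^sup>2)) \<longlonglongrightarrow> ennreal ((L2_norm M g)\<^sup>2)"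
  by (intro tendsto_ennrealI tendsto_power)
 then show ?thesis by (simp add: energy_eq_L2_norm F g)
qed

lemma energy_eq_0_imp_AE:
 assumes "f \<in> borel_measurable M" "energy M f = 0"
 shows "AE z in M. f z = 0"
proof -
 have "AE z in M. nsq (f z) = 0" using assms unfolding energy_def by (subst (asm) nn_integral_0_iff_AE) auto
 then show ?thesis by auto
qed

lemma L2_tendsto_unique_AE:
 assumes F: "\<And>n. F n \<in> borel_measurable M" and "L2_tendsto M F g" "L2_tendsto M F h"
 shows "AE z in M. g z = h z"
proof -
 have [measurable]: "g \<in> borel_measurable M" "h \<in> borel_measurable M"
  using assms by (auto simp: L2_tendsto_def' L2_iff_energy)
 note [measurable] = F
 have "energy M (\<lambda>z. g z - h z) \<le> 2 * (energy M (\<lambda>z. F n z - h z) + energy M (\<lambda>z. F n z - g z))" for n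
  using energy_diff_le2[of "\<lambda>z. F n z - h z" M "\<lambda>z. F n z - g z"] by simp
 moreover have "(\<lambda>n. 2 * (energy M (\<lambda>z. F n z - h z) + energy M (\<lambda>z. F n z - g z))) \<longlonglongrightarrow> 2 * (0 + 0)"
  using assms unfolding L2_tendsto_def' by (intro ennreal_tendsto_cmult tendsto_add) auto
 ultimately have "energy M (\<lambda>z. g z - h z) \<le> 2 * (0 + 0)" by (intro LIMSEQ_le_const) auto
 then show ?thesis using energy_eq_0_imp_AE[of "\<lambda>z. g z - h z" M] by simp
qed

lemma energy_fatou:
 assumes [measurable]: "\<And>n. F n \<in> borel_measurable M"
  and "AE z in M. (\<lambda>n. F n z) \<longlonglongrightarrow> f z"
 shows "energy M f \<le> liminf (\<lambda>n. energy M (F n))"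
proof -
 have "energy M f = (\<integral>\<^sup>+ z. liminf (\<lambda>n. nsq (F n z)) \<partial>M)" unfolding energy_def
 proof (rule nn_integral_cong_AE)
  show "AE z in M. nsq (f z) = liminf (\<lambda>n. nsq (F n z))" using assms(2)
  proof eventually_elim
   case (elim z)
   then have "(\<lambda>n. nsq (F n z)) \<longlonglongrightarrow> nsq (f z)" by (intro tendsto_intros) auto
   then show ?case by (rule lim_imp_Liminf[OF sequentially_bot, symmetric])
  qed
 qed
 also have "... \<le> liminf (\<lambda>n. energy M (F n))" unfolding energy_def by (rule nn_integral_liminf) simp
 finally show ?thesis .
qed

lemma energy_limit_bound:
 assumes "\<And>n. F n \<in> borel_measurable M"
  and "AE z in M. (\<lambda>n. F n z) \<longlonglongrightarrow> f z"
  and "eventually (\<lambda>n. energy M (F n) \<le> B) sequentially"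
 shows "energy M f \<le> B"
proof -
 have "liminf (\<lambda>n. energy M (F n)) \<le> B" using assms(3) by (intro Liminf_le) auto
 then show ?thesis using energy_fatou[OF assms(1,2)] by (rule order_trans[rotated])
qed

text \<open>Norm limits and pointwise limits agree: by Fatou's lemma the pointwise limit has distance \<open>0\<close> from the
 norm limit.\<close>

lemma L2_tendsto_pointwise_AE:
 assumes F[measurable]: "\<And>n. F n \<in> borel_measurable M" and "L2_tendsto M F g"
  and p: "AE z in M. (\<lambda>n. F n z) \<longlonglongrightarrow> f z" and [measurable]: "f \<in> borel_measurable M"
 shows "AE z in M. f z = g z"
proof -
 have g[measurable]: "g \<in> borel_measurable M" and l: "(\<lambda>n. energy M (\<lambda>z. F n z - g z)) \<longlonglongrightarrow> 0"
  using assms by (auto simp: L2_tendsto_def' L2_iff_energy)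
 have "energy M (\<lambda>z. f z - g z) \<le> liminf (\<lambda>n. energy M (\<lambda>z. F n z - g z))"
  by (rule energy_fatou) (use p in \<open>auto elim!: eventually_mono intro!: tendsto_intros\<close>)
 also have "... = 0" using l by (simp add: lim_imp_Liminf)
 finally show ?thesis using energy_eq_0_imp_AE[of "\<lambda>z. f z - g z" M] by simp
qed

lemma borel_measurable_cnj[measurable (raw)]:
 "f \<in> borel_measurable M \<Longrightarrow> (\<lambda>x. cnj (f x)) \<in> borel_measurable M"
 by (rule borel_measurable_continuous_on) (intro continuous_intros)

lemma L2_product_integrable:
 assumes "f \<in> L2 M" "g \<in> L2 M"
 shows "integrable M (\<lambda>z. f z * cnj (g z))"
proof (rule Bochner_Integration.integrable_bound)
 have [measurable]: "f \<in> borel_measurable M" "g \<in> borel_measurable M" using assms by (auto simp: L2_def)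
 show "integrable M (\<lambda>z. (cmod (f z))\<^sup>2 + (cmod (g z))\<^sup>2)" using assms by (auto simp: L2_def)
 show "(\<lambda>z. f z * cnj (g z)) \<in> borel_measurable M" by measurable
 have "a * b \<le> a\<^sup>2 + b\<^sup>2" if "0 \<le> a" "0 \<le> b" for a b :: real
 proof -
  have "0 \<le> (a - b)\<^sup>2" by simp
  also have "... = a\<^sup>2 + b\<^sup>2 - 2 * (a * b)" by (simp add: power2_diff)
  finally show ?thesis using that mult_nonneg_nonneg[OF that] by linarith
 qed
 then show "AE z in M. norm (f z * cnj (g z)) \<le> norm ((cmod (f z))\<^sup>2 + (cmod (g z))\<^sup>2)"
  by (auto simp: norm_mult)
qed

lemma L2_inner_bound:
 assumes "f \<in> L2 M" "g \<in> L2 M"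
 shows "cmod (LINT z|M. f z * cnj (g z)) \<le> L2_norm M f * L2_norm M g"
proof -
 have [measurable]: "f \<in> borel_measurable M" "g \<in> borel_measurable M" using assms by (auto simp: L2_def)
 have "ennreal (cmod (LINT z|M. f z * cnj (g z)))
   \<le> (\<integral>\<^sup>+z. ennreal (cmod (f z * cnj (g z))) \<partial>M)"
  using L2_product_integrable[OF assms] by (rule integral_norm_bound_ennreal)
 also have "... = (\<integral>\<^sup>+z. ennreal (cmod (f z)) * ennreal (cmod (g z)) \<partial>M)"
  by (intro nn_integral_cong) (simp add: norm_mult ennreal_mult)
 finally have "(ennreal (cmod (LINT z|M. f z * cnj (g z))))\<^sup>2
   \<le> (\<integral>\<^sup>+z. ennreal (cmod (f z)) * ennreal (cmod (g z)) \<partial>M)\<^sup>2" by (rule power_mono) simp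
 also have "... \<le> (\<integral>\<^sup>+z. (ennreal (cmod (f z)))\<^sup>2 \<partial>M) * (\<integral>\<^sup>+z. (ennreal (cmod (g z)))\<^sup>2 \<partial>M)"
  by (rule Cauchy_Schwarz_nn_integral) auto
 also have "... = energy M f * energy M g" by (simp add: energy_def ennreal_power)
 also have "... = ennreal ((L2_norm M f * L2_norm M g)\<^sup>2)"
  by (simp add: energy_eq_L2_norm assms ennreal_mult power_mult_distrib)
 finally have "(cmod (LINT z|M. f z * cnj (g z)))\<^sup>2 \<le> (L2_norm M f * L2_norm M g)\<^sup>2"
  by (simp add: ennreal_power)
 then show ?thesis by (rule power2_le_imp_le) (simp add: L2_norm_nonneg)
qed

lemma L2_tendsto_norm:
 assumes "\<And>n. F n \<in> L2 M" and "L2_tendsto M F g"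
 shows "(\<lambda>n. L2_norm M (\<lambda>z. F n z - g z)) \<longlonglongrightarrow> 0"
proof -
 have g: "g \<in> L2 M" and l: "(\<lambda>n. energy M (\<lambda>z. F n z - g z)) \<longlonglongrightarrow> 0"
  using assms by (auto simp: L2_tendsto_def')
 have "(\<lambda>n. sqrt (enn2real (energy M (\<lambda>z. F n z - g z)))) \<longlonglongrightarrow> sqrt (enn2real 0)"
  using l by (intro tendsto_real_sqrt tendsto_enn2real) auto
 then show ?thesis using L2_measurable[OF L2_diff[OF assms(1) g]] by (simp add: L2_norm_eq_energy)
qed

lemma L2_tendsto_inner:
 assumes F: "\<And>n. F n \<in> L2 M" and lim: "L2_tendsto M F g" and h: "h \<in> L2 M"
 shows "(\<lambda>n. LINT z|M. F n z * cnj (h z)) \<longlonglongrightarrow> (LINT z|M. g z * cnj (h z))"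
proof -
 have g: "g \<in> L2 M" using lim by (auto simp: L2_tendsto_def')
 have "cmod ((LINT z|M. F n z * cnj (h z)) - (LINT z|M. g z * cnj (h z)))
   \<le> L2_norm M (\<lambda>z. F n z - g z) * L2_norm M h" for n
 proof -
  have "(LINT z|M. F n z * cnj (h z)) - (LINT z|M. g z * cnj (h z))
    = (LINT z|M. (F n z - g z) * cnj (h z))" by (subst Bochner_Integration.integral_diff[symmetric])
     (auto intro!: L2_product_integrable F g h simp: left_diff_distrib)
  then show ?thesis using L2_inner_bound[OF L2_diff[OF F[of n] g] h] by simp
 qed
 then have le: "\<forall>\<^sub>F n in sequentially. cmod ((LINT z|M. F n z * cnj (h z)) - (LINT z|M. g z * cnj (h z)))
   \<le> L2_norm M (\<lambda>z. F n z - g z) * L2_norm M h" by simp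
 have "(\<lambda>n. L2_norm M (\<lambda>z. F n z - g z) * L2_norm M h) \<longlonglongrightarrow> 0 * L2_norm M h"
  by (intro tendsto_intros L2_tendsto_norm F lim)
 then have "(\<lambda>n. (LINT z|M. F n z * cnj (h z)) - (LINT z|M. g z * cnj (h z))) \<longlonglongrightarrow> 0"
  using Lim_null_comparison[OF le] by simp
 then show ?thesis by (simp add: LIM_zero_iff)
qed

text \<open>Completeness, proved as in the Riesz--Fischer theorem: a subsequence with geometrically decaying increments converges
 almost everywhere, and Fatou's lemma identifies the limit in the norm.\<close>

lemma L2_complete:
 assumes F: "\<And>n. F n \<in> L2 M"
  and cauchy: "\<And>e::real. 0 < e \<Longrightarrow> \<exists>N. \<forall>m\<ge>N. \<forall>n\<ge>N. energy M (\<lambda>z. F m z - F n z) \<le> ennreal e"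
 shows "\<exists>g. L2_tendsto M F g"
proof -
 have [measurable]: "F n \<in> borel_measurable M" for n using F by (simp add: L2_def)
 have "\<forall>k. \<exists>N. \<forall>m\<ge>N. \<forall>n\<ge>N. energy M (\<lambda>z. F m z - F n z) \<le> ennreal ((1/4)^k)"
  using cauchy by simp
 then obtain N0 where N0: "\<And>k m n. m \<ge> N0 k \<Longrightarrow> n \<ge> N0 k \<Longrightarrow>
   energy M (\<lambda>z. F m z - F n z) \<le> ennreal ((1/4)^k)" by metis
 define r where "r k = (\<Sum>i\<le>k. N0 i)" for k
 have r: "r k \<ge> N0 k" "r (Suc k) \<ge> r k" for k unfolding r_def by (auto intro: member_le_sum)
 define a where "a k z = F (r (Suc k)) z - F (r k) z" for k z
 have [measurable]: "a k \<in> borel_measurable M" for k unfolding a_def by measurable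
 have ea: "energy M (a k) \<le> ennreal ((1/4)^k)" for k unfolding a_def using r[of k] by (intro N0) auto
 have "(\<integral>\<^sup>+z. (\<Sum>k. ennreal (2^k * (cmod (a k z))\<^sup>2)) \<partial>M) = (\<Sum>k. \<integral>\<^sup>+z. ennreal (2^k * (cmod (a k z))\<^sup>2) \<partial>M)"
  by (rule nn_integral_suminf) simp
 also have "... = (\<Sum>k. ennreal (2^k) * energy M (a k))"
  unfolding energy_def by (subst nn_integral_cmult[symmetric]) (auto simp: ennreal_mult)
 also have "... \<le> (\<Sum>k. ennreal ((1/2)^k))"
 proof (intro suminf_le allI)
  fix k
  have "ennreal (2^k) * energy M (a k) \<le> ennreal (2^k) * ennreal ((1/4)^k)" by (intro mult_left_mono ea) auto
  also have "... = ennreal ((1/2)^k)" by (simp add: power_mult_distrib[symmetric] flip: ennreal_mult)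
  finally show "ennreal (2^k) * energy M (a k) \<le> ennreal ((1/2)^k)" .
 qed auto
 also have "... < \<infinity>" by (subst suminf_ennreal2) auto
 finally have "AE z in M. (\<Sum>k. ennreal (2^k * (cmod (a k z))\<^sup>2)) \<noteq> \<infinity>"
  by (intro nn_integral_PInf_AE) auto
 then have conv: "AE z in M. convergent (\<lambda>k. F (r k) z)"
 proof eventually_elim
  case (elim z)
  have s2: "summable (\<lambda>k. 2^k * (cmod (a k z))\<^sup>2)" using elim by (intro summable_suminf_not_top) auto
  have s3: "summable (\<lambda>k. (1/2)^k + 2^k * (cmod (a k z))\<^sup>2 :: real)"
   by (intro summable_add s2 summable_geometric) auto
  have le: "norm (a k z) \<le> (1/2)^k + 2^k * (cmod (a k z))\<^sup>2" for k
  proof -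
   define p where "p = sqrt ((1/2::real)^k)"
   have p: "0 < p" "p\<^sup>2 = (1/2)^k" "(1/p)\<^sup>2 = 2^k" by (auto simp: p_def power_divide)
   have "0 \<le> (p - cmod (a k z) / p)\<^sup>2" by simp
   also have "... = p\<^sup>2 + (1/p)\<^sup>2 * (cmod (a k z))\<^sup>2 - 2 * cmod (a k z)"
    using p(1) by (simp add: power2_diff power_divide)
   also have "... = (1/2)^k + 2^k * (cmod (a k z))\<^sup>2 - 2 * cmod (a k z)" using p by simp
   finally have "2 * cmod (a k z) \<le> (1/2)^k + 2^k * (cmod (a k z))\<^sup>2" by simp
   then show ?thesis using norm_ge_zero[of "a k z"] by linarith
  qed
  have "summable (\<lambda>k. a k z)" by (rule summable_comparison_test'[OF s3, of 0]) (rule le)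
  then have "(\<lambda>n. \<Sum>k<n. a k z) \<longlonglongrightarrow> suminf (\<lambda>k. a k z)" by (rule summable_LIMSEQ)
  moreover have "(\<Sum>k<n. a k z) = F (r n) z - F (r 0) z" for n unfolding a_def by (rule sum_lessThan_telescope)
  ultimately have "(\<lambda>n. F (r n) z - F (r 0) z + F (r 0) z) \<longlonglongrightarrow> suminf (\<lambda>k. a k z) + F (r 0) z"
   by (intro tendsto_add) auto
  then show ?case by (auto simp: convergent_def)
 qed
 define g where "g z = lim (\<lambda>k. F (r k) z)" for z
 have g[measurable]: "g \<in> borel_measurable M" unfolding g_def by measurable
 have gl: "AE z in M. (\<lambda>k. F (r k) z) \<longlonglongrightarrow> g z"
  using conv unfolding g_def by eventually_elim (simp add: convergent_LIMSEQ_iff)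
 have bnd: "\<exists>N. \<forall>n\<ge>N. energy M (\<lambda>z. F n z - g z) \<le> ennreal e" if e: "0 < e" for e
 proof -
  obtain N where N: "\<And>m n. m \<ge> N \<Longrightarrow> n \<ge> N \<Longrightarrow> energy M (\<lambda>z. F m z - F n z) \<le> ennreal e"
   using cauchy[OF e] by auto
  obtain k0 where k0: "(1/4)^k0 < e" using real_arch_pow_inv[OF e, of "1/4"] by auto
  show ?thesis
  proof (intro exI allI impI)
   fix n assume n: "n \<ge> max N (N0 k0)"
   show "energy M (\<lambda>z. F n z - g z) \<le> ennreal e"
   proof (rule energy_limit_bound)
    show "AE z in M. (\<lambda>k. F n z - F (r k) z) \<longlonglongrightarrow> F n z - g z"
     using gl by eventually_elim (auto intro!: tendsto_intros)
    have rk: "r k \<ge> N0 k0" if "k \<ge> k0" for k unfolding r_def using that by (intro member_le_sum) auto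
    show "\<forall>\<^sub>F k in sequentially. energy M (\<lambda>z. F n z - F (r k) z) \<le> ennreal e"
     using eventually_ge_at_top[of k0]
    proof eventually_elim
     case (elim k)
     have "energy M (\<lambda>z. F n z - F (r k) z) \<le> ennreal ((1/4)^k0)" using rk[OF elim] n by (intro N0) auto
     also have "... \<le> ennreal e" using k0 by (intro ennreal_leI) auto
     finally show ?case .
    qed
   qed measurable
  qed
 qed
 have "g \<in> L2 M"
 proof -
  obtain N where "energy M (\<lambda>z. F N z - g z) \<le> ennreal 1" using bnd[of 1] by auto
  then have "(\<lambda>z. F N z - g z) \<in> L2 M" unfolding L2_iff_energy by (auto intro: le_less_trans)
  from L2_diff[OF F[of N] this] show ?thesis by simp
 qed
 moreover have "(\<lambda>n. energy M (\<lambda>z. F n z - g z)) \<longlonglongrightarrow> 0"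
 proof (rule order_tendstoI)
  fix a :: ennreal assume "0 < a"
  then obtain b where b: "0 < b" "b < a" using dense by blast
  then obtain e where "b = ennreal e" "0 \<le> e" by (cases b) (auto simp: less_top[symmetric])
  with b have e: "0 < e" "ennreal e < a" by auto
  from bnd[OF e(1)] e(2) show "\<forall>\<^sub>F n in sequentially. energy M (\<lambda>z. F n z - g z) < a"
   unfolding eventually_sequentially by (blast intro: le_less_trans)
 qed auto
 ultimately show ?thesis by (auto simp: L2_tendsto_def')
qed

section \<open>Parseval's identity on the circle\<close>

definition circle :: "real measure" where
 "circle = restrict_space lborel {0..<2 * pi}"

definition circle_coeff :: "(real \<Rightarrow> complex) \<Rightarrow> int \<Rightarrow> complex" where
 "circle_coeff f n = (LINT y|circle. f y * cowave (of_int n * y))"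

definition trig :: "(real \<Rightarrow> complex) \<Rightarrow> bool" where
 "trig p \<longleftrightarrow> (\<exists>S a. finite S \<and> p = (\<lambda>y. \<Sum>n\<in>S. a n * wave (of_int n * y)))"

lemma space_circle [simp]: "space circle = {0..<2 * pi}" by (simp add: circle_def space_restrict_space)

lemma sets_circle: "sets circle = sets (restrict_space borel {0..<2 * pi})"
 unfolding circle_def by (intro sets_restrict_space_cong) simp

lemma measurable_circleI [measurable (raw)]:
 "f \<in> borel \<rightarrow>\<^sub>M N \<Longrightarrow> f \<in> circle \<rightarrow>\<^sub>M N"
 unfolding circle_def by (intro measurable_restrict_space1) simp

lemma emeasure_circle: "emeasure circle (space circle) = ennreal (2 * pi)"
 unfolding circle_def by (subst emeasure_restrict_space) (auto simp: space_restrict_space)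

interpretation circle: finite_measure circle by standard (use emeasure_circle in simp)

lemma nn_integral_circle:
 "nn_integral circle f = (\<integral>\<^sup>+y. f y * indicator {0..<2*pi} y \<partial>lborel)"
 unfolding circle_def by (rule nn_integral_restrict_space) simp

lemma integral_circle_character:
 "(LINT y|circle. wave (of_int n * y)) = (if n = 0 then of_real (2 * pi) else 0)"
proof -
 have "(LINT y|circle. wave (of_int n * y))
   = (LINT y|lborel. indicator {0..<2*pi} y *\<^sub>R wave (of_int n * y))"
  unfolding circle_def by (rule integral_restrict_space) simp
 also have "... = (LINT y|lborel. indicator {0..2*pi} y *\<^sub>R wave (of_int n * y))"
 proof (rule integral_cong_AE)
  show "AE y in lborel. indicator {0..<2*pi} y *\<^sub>R wave (of_int n * y)
    = indicator {0..2*pi} y *\<^sub>R wave (of_int n * y)"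
   using AE_lborel_singleton[of "2*pi"] by eventually_elim (auto simp: indicator_def)
 qed measurable
 also have "... = (if n = 0 then of_real (2 * pi) else 0)"
 proof (cases "n = 0")
  case True then show ?thesis by (simp add: scaleR_conv_of_real)
 next
  case False
  have "(LINT y|lborel. indicator {0..2*pi} y *\<^sub>R wave (of_int n * y))
    = wave (of_int n * (2*pi)) / (\<i> * of_int n) - wave (of_int n * 0) / (\<i> * of_int n)"
  proof (rule integral_FTC_Icc)
   fix x :: real
   have "((\<lambda>y. exp (\<i> * of_int n * complex_of_real y) / (\<i> * of_int n)) has_vector_derivative
     (\<i> * of_int n) * exp (\<i> * of_int n * complex_of_real x) / (\<i> * of_int n)) (at x within {0..2*pi})"
    by (rule has_vector_derivative_real_field) (auto intro!: derivative_eq_intros)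
   then show "((\<lambda>y. wave (of_int n * y) / (\<i> * of_int n)) has_vector_derivative
     wave (of_int n * x)) (at x within {0..2*pi})" using False by (simp add: mult.assoc)
  qed (auto intro!: continuous_intros)
  also have "wave (of_int n * (2*pi)) = 1" using exp_integer_2pi[of "of_int n"] by (simp add: algebra_simps)
  finally show ?thesis using False by simp
 qed
 finally show ?thesis .
qed

lemma trig_character: "trig (\<lambda>y. c * wave (of_int n * y))"
 unfolding trig_def by (intro exI[of _ "{n}"] exI[of _ "\<lambda>_. c"]) auto

lemma trig_const: "trig (\<lambda>y. c)" using trig_character[of c 0] by simp

lemma trig_add:
 assumes "trig p" "trig q" shows "trig (\<lambda>y. p y + q y)"
proof -
 obtain S a T b where S: "finite S" "p = (\<lambda>y. \<Sum>n\<in>S. a n * wave (of_int n * y))"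
  and T: "finite T" "q = (\<lambda>y. \<Sum>n\<in>T. b n * wave (of_int n * y))" using assms unfolding trig_def by blast
 have "p y + q y = (\<Sum>n\<in>S\<union>T. ((if n \<in> S then a n else 0) + (if n \<in> T then b n else 0))
   * wave (of_int n * y))" for y
 proof -
  have "p y = (\<Sum>n\<in>S\<union>T. (if n \<in> S then a n else 0) * wave (of_int n * y))"
   unfolding S(2) using S(1) T(1) by (intro sum.mono_neutral_cong_left) auto
  moreover have "q y = (\<Sum>n\<in>S\<union>T. (if n \<in> T then b n else 0) * wave (of_int n * y))"
   unfolding T(2) using S(1) T(1) by (intro sum.mono_neutral_cong_left) auto
  ultimately show ?thesis by (simp add: sum.distrib distrib_right)
 qed
 then show ?thesis unfolding trig_def using S(1) T(1)
  by (intro exI[of _ "S\<union>T"] exI[of _ "\<lambda>n. (if n \<in> S then a n else 0) + (if n \<in> T then b n else 0)"]) auto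
qed

lemma trig_sum: "(\<And>i. i \<in> I \<Longrightarrow> trig (p i)) \<Longrightarrow> trig (\<lambda>y. \<Sum>i\<in>I. p i y)"
 by (induction I rule: infinite_finite_induct) (auto intro: trig_const trig_add)

lemma trig_mult:
 assumes "trig p" "trig q" shows "trig (\<lambda>y. p y * q y)"
proof -
 obtain S a T b where S: "finite S" "p = (\<lambda>y. \<Sum>n\<in>S. a n * wave (of_int n * y))"
  and T: "finite T" "q = (\<lambda>y. \<Sum>n\<in>T. b n * wave (of_int n * y))" using assms unfolding trig_def by blast
 have "p y * q y = (\<Sum>n\<in>S. \<Sum>m\<in>T. (a n * b m) * wave (of_int (n + m) * y))" for y
  unfolding S(2) T(2) sum_product by (intro sum.cong refl) (simp add: exp_add[symmetric] algebra_simps)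
 moreover have "trig (\<lambda>y. \<Sum>n\<in>S. \<Sum>m\<in>T. (a n * b m) * wave (of_int (n + m) * y))"
  by (intro trig_sum trig_character)
 ultimately show ?thesis by simp
qed

text \<open>Polynomials in the real and imaginary part of a point of the unit circle are trigonometric polynomials; this is what
 connects the Stone--Weierstrass theorem to \<open>trig\<close>.\<close>

lemma trig_real_polynomial:
 fixes g :: "complex \<Rightarrow> real"
 assumes "real_polynomial_function g"
 shows "trig (\<lambda>y. of_real (g (cis y)))" using assms
proof induction
 case (linear f)
 have "of_real (f (cis y)) = (of_real (f 1) / 2 + of_real (f \<i>) / (2 * \<i>)) * wave (of_int 1 * y)
   + (of_real (f 1) / 2 - of_real (f \<i>) / (2 * \<i>)) * wave (of_int (-1) * y)" for y
 proof -
  interpret bounded_linear f by fact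
  have "f (cis y) = f (cos y *\<^sub>R 1 + sin y *\<^sub>R \<i>)" by (rule arg_cong[where f=f]) (simp add: complex_eq_iff)
  also have "... = cos y * f 1 + sin y * f \<i>" by (simp only: add scaleR) simp
  finally have "of_real (f (cis y)) = complex_of_real (cos y * f 1 + sin y * f \<i>)" by simp
  moreover have e: "wave (of_int 1 * y) = Complex (cos y) (sin y)"
    "wave (of_int (-1) * y) = Complex (cos y) (- sin y)" by (auto simp: complex_eq_iff Re_exp Im_exp)
  ultimately show ?thesis by (simp add: e complex_eq_iff Re_divide Im_divide field_simps)
 qed
 then show ?case by (simp only:) (intro trig_add trig_character)
next
 case (mult f g) then show ?case by (simp add: trig_mult)
next
 case (add f g) then show ?case by (simp add: trig_add)
qed (auto intro: trig_const)

lemma trig_measurable: "trig p \<Longrightarrow> p \<in> borel_measurable circle" unfolding trig_def by auto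

text \<open>The closure of the trigonometric polynomials in the norm of \<open>L\<^sup>2\<close>. It is shown to be everything by
 the usual ladder: continuous functions by the Stone--Weierstrass theorem, then intervals, Borel sets, and
 \<open>L\<^sup>2\<close>.\<close>

definition trig_limit :: "(real \<Rightarrow> complex) \<Rightarrow> bool" where
 "trig_limit f \<longleftrightarrow> f \<in> borel_measurable circle \<and>
  (\<forall>e>0. \<exists>p. trig p \<and> energy circle (\<lambda>y. f y - p y) \<le> ennreal e)"

lemma trig_imp_trig_limit: "trig p \<Longrightarrow> trig_limit p"
 unfolding trig_limit_def by (auto simp: trig_measurable energy_def intro!: exI[of _ p])

lemma trig_limit_measurable: "trig_limit f \<Longrightarrow> f \<in> borel_measurable circle" by (simp add: trig_limit_def)

lemma trig_limit_closed:
 assumes [measurable]: "f \<in> borel_measurable circle"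
  and "\<And>e. 0 < e \<Longrightarrow> \<exists>g. trig_limit g \<and> energy circle (\<lambda>y. f y - g y) \<le> ennreal e"
 shows "trig_limit f" unfolding trig_limit_def
proof (intro conjI allI impI)
 fix e :: real assume e: "0 < e"
 obtain g where g: "trig_limit g" "energy circle (\<lambda>y. f y - g y) \<le> ennreal (e/4)" using assms(2)[of "e/4"] e by auto
 obtain p where p: "trig p" "energy circle (\<lambda>y. g y - p y) \<le> ennreal (e/4)"
  using g(1) e unfolding trig_limit_def by (metis divide_pos_pos zero_less_numeral)
 have [measurable]: "g \<in> borel_measurable circle" "p \<in> borel_measurable circle"
  using g p by (auto simp: trig_limit_def trig_measurable)
 have "energy circle (\<lambda>y. f y - p y) = energy circle (\<lambda>y. (f y - g y) + (g y - p y))" by simp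
 also have "... \<le> 2 * (energy circle (\<lambda>y. f y - g y) + energy circle (\<lambda>y. g y - p y))"
  by (rule energy_add_le2) measurable
 also have "... \<le> 2 * (ennreal (e/4) + ennreal (e/4))" using g p by (intro mult_left_mono add_mono) auto
 also have "... = ennreal (2 * (e/4 + e/4))"
  using e by (subst ennreal_mult) (auto simp del: ennreal_plus simp flip: ennreal_plus)
 also have "... = ennreal e" by simp
 finally show "\<exists>p. trig p \<and> energy circle (\<lambda>y. f y - p y) \<le> ennreal e" using p by blast
qed fact

lemma trig_limit_add:
 assumes "trig_limit f" "trig_limit g" shows "trig_limit (\<lambda>y. f y + g y)"
proof -
 have [measurable]: "f \<in> borel_measurable circle" "g \<in> borel_measurable circle"
  using assms by (auto simp: trig_limit_def)
 show ?thesis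
 proof (rule trig_limit_closed)
  fix e :: real assume e: "0 < e"
  obtain p q where p: "trig p" "energy circle (\<lambda>y. f y - p y) \<le> ennreal (e/4)"
   and q: "trig q" "energy circle (\<lambda>y. g y - q y) \<le> ennreal (e/4)"
   using assms e unfolding trig_limit_def by (metis divide_pos_pos zero_less_numeral)
  have [measurable]: "p \<in> borel_measurable circle" "q \<in> borel_measurable circle"
   using p q by (auto simp: trig_measurable)
  have "energy circle (\<lambda>y. f y + g y - (p y + q y)) = energy circle (\<lambda>y. (f y - p y) + (g y - q y))"
   by (simp add: algebra_simps)
  also have "... \<le> 2 * (energy circle (\<lambda>y. f y - p y) + energy circle (\<lambda>y. g y - q y))"
   by (rule energy_add_le2) measurable
  also have "... \<le> 2 * (ennreal (e/4) + ennreal (e/4))" using p q by (intro mult_left_mono add_mono) auto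
  also have "... = ennreal (2 * (e/4 + e/4))"
   using e by (subst ennreal_mult) (auto simp del: ennreal_plus simp flip: ennreal_plus)
  also have "... = ennreal e" by simp
  finally show "\<exists>h. trig_limit h \<and> energy circle (\<lambda>y. f y + g y - h y) \<le> ennreal e"
   using trig_imp_trig_limit[OF trig_add[OF p(1) q(1)]] by blast
 qed measurable
qed

lemma trig_limit_cmult:
 assumes "trig_limit f" shows "trig_limit (\<lambda>y. c * f y)"
proof (rule trig_limit_closed)
 have [measurable]: "f \<in> borel_measurable circle" using assms by (auto simp: trig_limit_def)
 show "(\<lambda>y. c * f y) \<in> borel_measurable circle" by measurable
 fix e :: real assume e: "0 < e"
 define d where "d = e / ((cmod c)\<^sup>2 + 1)"
 have d: "0 < d" using e by (simp add: d_def add_nonneg_pos)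
 have "(cmod c)\<^sup>2 * d \<le> ((cmod c)\<^sup>2 + 1) * d" using d by (simp add: distrib_right)
 also have "... = e" using add_nonneg_pos[of "(cmod c)\<^sup>2" 1] by (simp add: d_def)
 finally have d2: "(cmod c)\<^sup>2 * d \<le> e" .
 obtain p where p: "trig p" "energy circle (\<lambda>y. f y - p y) \<le> ennreal d"
  using assms d unfolding trig_limit_def by metis
 have [measurable]: "p \<in> borel_measurable circle" using p by (auto simp: trig_measurable)
 have "energy circle (\<lambda>y. c * f y - c * p y) = nsq c * energy circle (\<lambda>y. f y - p y)"
  by (subst energy_cmult[symmetric]) (auto simp: right_diff_distrib)
 also have "... \<le> nsq c * ennreal d" by (intro mult_left_mono p) simp
 also have "... \<le> ennreal e" using d2 d by (subst ennreal_mult[symmetric]) (auto intro: ennreal_leI)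
 finally show "\<exists>h. trig_limit h \<and> energy circle (\<lambda>y. c * f y - h y) \<le> ennreal e"
  using trig_imp_trig_limit[OF trig_mult[OF trig_const p(1)]] by blast
qed

lemma trig_limit_cong:
 assumes "trig_limit f" "\<And>y. 0 \<le> y \<Longrightarrow> y < 2 * pi \<Longrightarrow> f y = g y"
 shows "trig_limit g"
proof -
 have "energy circle (\<lambda>y. f y - p y) = energy circle (\<lambda>y. g y - p y)" for p
  unfolding energy_def by (intro nn_integral_cong) (simp add: assms(2))
 moreover have "g \<in> borel_measurable circle"
  using trig_limit_measurable[OF assms(1)] by (subst measurable_cong[of circle g f]) (auto simp: assms(2))
 ultimately show ?thesis using assms(1) unfolding trig_limit_def by simp
qed

lemma trig_limit_dominated:
 assumes F: "\<And>n. trig_limit (F n)"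
  and lim: "\<And>y. 0 \<le> y \<Longrightarrow> y < 2 * pi \<Longrightarrow> (\<lambda>n. F n y) \<longlonglongrightarrow> f y"
  and bound: "\<And>n y. 0 \<le> y \<Longrightarrow> y < 2 * pi \<Longrightarrow> cmod (F n y) \<le> w y"
  and [measurable]: "w \<in> borel_measurable circle" 
  and w: "(\<integral>\<^sup>+y. ennreal ((w y)\<^sup>2) \<partial>circle) < \<infinity>"
 shows "trig_limit f"
proof (rule trig_limit_closed)
 have [measurable]: "F n \<in> borel_measurable circle" for n using F by (simp add: trig_limit_def)
 show f[measurable]: "f \<in> borel_measurable circle" by (rule borel_measurable_LIMSEQ_metric[where f=F]) (auto intro: lim)
 have "(\<lambda>n. \<integral>\<^sup>+y. nsq (f y - F n y) \<partial>circle) \<longlonglongrightarrow> (\<integral>\<^sup>+y. 0 \<partial>circle)"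
 proof (rule nn_integral_dominated_convergence[where w="\<lambda>y. 4 * ennreal ((w y)\<^sup>2)"])
  show "(\<integral>\<^sup>+y. 4 * ennreal ((w y)\<^sup>2) \<partial>circle) < \<infinity>"
   using w by (simp add: nn_integral_cmult ennreal_mult_less_top)
  show "AE y in circle. nsq (f y - F n y) \<le> 4 * ennreal ((w y)\<^sup>2)" for n
  proof (rule AE_I2)
   fix y assume y: "y \<in> space circle"
   then have yy: "0 \<le> y" "y < 2 * pi" by auto
   have "cmod (f y) \<le> w y" by (rule LIMSEQ_le_const2[OF tendsto_norm[OF lim[OF yy]]]) (use bound yy in auto)
   then have "cmod (f y - F n y) \<le> 2 * w y" using norm_triangle_ineq4[of "f y" "F n y"] bound[OF yy, of n] by linarith
   then have "(cmod (f y - F n y))\<^sup>2 \<le> (2 * w y)\<^sup>2" by (intro power_mono) auto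
   then have "nsq (f y - F n y) \<le> ennreal (4 * (w y)\<^sup>2)" by (intro ennreal_leI) (simp add: power_mult_distrib)
   then show "nsq (f y - F n y) \<le> 4 * ennreal ((w y)\<^sup>2)" by (simp add: ennreal_mult)
  qed
  show "AE y in circle. (\<lambda>n. nsq (f y - F n y)) \<longlonglongrightarrow> 0"
  proof (rule AE_I2)
   fix y assume "y \<in> space circle"
   then have "(\<lambda>n. F n y) \<longlonglongrightarrow> f y" using lim by auto
   then have "(\<lambda>n. nsq (f y - F n y)) \<longlonglongrightarrow> nsq (f y - f y)" by (intro tendsto_intros)
   then show "(\<lambda>n. nsq (f y - F n y)) \<longlonglongrightarrow> 0" by simp
  qed
 qed measurable
 then have l: "(\<lambda>n. energy circle (\<lambda>y. f y - F n y)) \<longlonglongrightarrow> 0" by (simp add: energy_def)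
 fix e :: real assume "0 < e"
 then have "\<forall>\<^sub>F n in sequentially. energy circle (\<lambda>y. f y - F n y) < ennreal e"
  by (intro order_tendstoD(2)[OF l]) simp
 then obtain n where "energy circle (\<lambda>y. f y - F n y) < ennreal e" by (auto simp: eventually_sequentially)
 then show "\<exists>g. trig_limit g \<and> energy circle (\<lambda>y. f y - g y) \<le> ennreal e"
  using F by (auto intro: less_imp_le)
qed

lemma trig_limit_bounded:
 assumes "\<And>n. trig_limit (F n)"
  and "\<And>y. 0 \<le> y \<Longrightarrow> y < 2 * pi \<Longrightarrow> (\<lambda>n. F n y) \<longlonglongrightarrow> f y"
  and "\<And>n y. 0 \<le> y \<Longrightarrow> y < 2 * pi \<Longrightarrow> cmod (F n y) \<le> B"
 shows "trig_limit f"
proof (rule trig_limit_dominated[OF assms(1,2,3)])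
 show "(\<integral>\<^sup>+ y. ennreal (B\<^sup>2) \<partial>circle) < \<infinity>"
  using emeasure_circle by (simp add: ennreal_mult_less_top)
qed auto

lemma trig_limit_continuous:
 fixes g :: "complex \<Rightarrow> real"
 assumes "continuous_on (sphere 0 1) g"
 shows "trig_limit (\<lambda>y. of_real (g (cis y)))"
proof -
 have "\<exists>p. real_polynomial_function p \<and> (\<forall>z\<in>sphere 0 1. \<bar>g z - p z\<bar> < 1 / real (Suc n))" for n
  by (rule Stone_Weierstrass_real_polynomial_function[OF compact_sphere assms, of "1 / real (Suc n)"]) auto
 then obtain p where p: "\<And>n. real_polynomial_function (p n)"
  "\<And>n z. z \<in> sphere 0 1 \<Longrightarrow> \<bar>g z - p n z\<bar> < 1 / real (Suc n)" by metis
 have "bounded (g ` sphere 0 1)" by (intro compact_imp_bounded compact_continuous_image assms compact_sphere)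
 then obtain B where B: "\<And>z. z \<in> sphere 0 1 \<Longrightarrow> \<bar>g z\<bar> \<le> B"
  unfolding bounded_iff by (metis image_eqI real_norm_def)
 show ?thesis
 proof (rule trig_limit_bounded[where F="\<lambda>n y. of_real (p n (cis y))" and B="B + 1"])
  fix y :: real
  have y: "cis y \<in> sphere 0 1" by simp
  have "(\<lambda>n. p n (cis y) - g (cis y)) \<longlonglongrightarrow> 0"
  proof (rule Lim_null_comparison[OF _ LIMSEQ_inverse_real_of_nat], intro always_eventually allI)
   fix n show "norm (p n (cis y) - g (cis y)) \<le> inverse (real (Suc n))"
    using p(2)[OF y, of n] by (simp add: abs_minus_commute inverse_eq_divide less_imp_le)
  qed
  then have "(\<lambda>n. p n (cis y)) \<longlonglongrightarrow> g (cis y)" by (simp add: LIM_zero_iff)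
  then show "(\<lambda>n. complex_of_real (p n (cis y))) \<longlonglongrightarrow> of_real (g (cis y))"
   by (rule tendsto_of_real)
  show "cmod (of_real (p n (cis y))) \<le> B + 1" for n
  proof -
   have "1 / real (Suc n) \<le> 1" by simp
   then have "\<bar>p n (cis y)\<bar> \<le> B + 1" using p(2)[OF y, of n] B[OF y] by linarith
   then show ?thesis by simp
  qed
 qed (intro trig_imp_trig_limit trig_real_polynomial p)
qed

text \<open>The indicator of an arc containing the point \<open>1\<close> is the pointwise limit of continuous functions of the
 distance to the arc. The arc is closed, which is why the intervals are closed on the right.\<close>

lemma trig_limit_interval:
 assumes "0 \<le> a" "a < 2 * pi"
 shows "trig_limit (indicator {0..a})"
proof -
 define A where "A = cis ` {0..a}"
 have A: "closed A" "A \<noteq> {}"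
  unfolding A_def using assms by (auto intro!: compact_imp_closed compact_continuous_image continuous_intros)
 have mem: "cis y \<in> A \<longleftrightarrow> y \<le> a" if y: "0 \<le> y" "y < 2 * pi" for y
 proof
  assume "cis y \<in> A"
  then obtain x where x: "cis y = cis x" "0 \<le> x" "x \<le> a" unfolding A_def by auto
  then have "sin y = sin x \<and> cos y = cos x" by (simp add: complex_eq_iff)
  then obtain n :: int where n: "y = x + 2 * pi * of_int n" using sin_cos_eq_iff[of y x] by (auto simp: algebra_simps)
  have "n = 0"
  proof -
   have "2 * pi * of_int n < 2 * pi * 1" "2 * pi * (-1) < 2 * pi * of_int n" using n x y assms by linarith+
   then have "real_of_int n < 1" "-1 < real_of_int n" using mult_less_cancel_left_pos[of "2*pi" "real_of_int n" 1]
     mult_less_cancel_left_pos[of "2*pi" "-1" "real_of_int n"] pi_gt_zero by linarith+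
   then show ?thesis by linarith
  qed
  then show "y \<le> a" using n x by simp
 qed (use y in \<open>auto simp: A_def\<close>)
 define g where "g n z = max 0 (1 - real n * infdist z A)" for n and z :: complex
 show ?thesis
 proof (rule trig_limit_bounded[where F="\<lambda>n y. of_real (g n (cis y))" and B=1])
  show "trig_limit (\<lambda>y. of_real (g n (cis y)))" for n unfolding g_def by (intro trig_limit_continuous continuous_intros)
  show "cmod (of_real (g n (cis y))) \<le> 1" for n y using infdist_nonneg[of "cis y" A] by (auto simp: g_def max_def)
  fix y :: real assume y: "0 \<le> y" "y < 2 * pi"
  have "(\<lambda>n. g n (cis y)) \<longlonglongrightarrow> indicator {0..a} y"
  proof (cases "cis y \<in> A")
   case True
   then have "g n (cis y) = 1" for n by (simp add: g_def)
   then show ?thesis using True mem[OF y] y by simp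
  next
   case False
   then have d: "0 < infdist (cis y) A" using A infdist_pos_not_in_closed by blast
   obtain N where N: "1 / infdist (cis y) A < real N" using reals_Archimedean2 by blast
   have "\<forall>n\<ge>N. g n (cis y) = 0"
   proof (intro allI impI)
    fix n assume "n \<ge> N"
    then have "1 / infdist (cis y) A < real n" using N by linarith
    then have "1 < real n * infdist (cis y) A" using d by (simp add: field_simps)
    then show "g n (cis y) = 0" by (simp add: g_def)
   qed
   then have "(\<lambda>n. g n (cis y)) \<longlonglongrightarrow> 0"
    by (intro tendsto_eventually) (auto simp: eventually_sequentially)
   then show ?thesis using False mem[OF y] y by simp
  qed
  then have "(\<lambda>n. complex_of_real (g n (cis y))) \<longlonglongrightarrow> of_real (indicator {0..a} y)"
   by (rule tendsto_of_real)
  then show "(\<lambda>n. complex_of_real (g n (cis y))) \<longlonglongrightarrow> indicator {0..a} y"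
   by (cases "y \<in> {0..a}") simp_all
 qed
qed

text \<open>The intervals \<open>{..a}\<close> generate the Borel sets and are stable under intersection, so a Dynkin-system
 argument suffices.\<close>

lemma trig_limit_borel:
 assumes "B \<in> sets borel"
 shows "trig_limit (indicator B)"
proof -
 let ?G = "range (\<lambda>a::real. {..a})"
 have "Int_stable ?G" "?G \<subseteq> Pow UNIV" by (auto simp: Int_stable_def)
 moreover have "B \<in> sigma_sets UNIV ?G" using assms by (simp add: borel_eq_atMost)
 ultimately show ?thesis
 proof (induction rule: sigma_sets_induct_disjoint)
  case (basic A)
  then obtain a where A: "A = {..a}" by auto
  consider "a < 0" | "0 \<le> a" "a < 2 * pi" | "2 * pi \<le> a" by linarith
  then show ?case
  proof cases
   case 1 then show ?thesis by (intro trig_limit_cong[OF trig_imp_trig_limit[OF trig_const[of 0]]]) (auto simp: A)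
  next
   case 2 then show ?thesis by (intro trig_limit_cong[OF trig_limit_interval[OF 2]]) (auto simp: A indicator_def)
  next
   case 3 then show ?thesis by (intro trig_limit_cong[OF trig_imp_trig_limit[OF trig_const[of 1]]]) (auto simp: A)
  qed
 next
  case empty
  then show ?case using trig_imp_trig_limit[OF trig_const[of 0]] by (simp add: indicator_def)
 next
  case (compl A)
  have "trig_limit (\<lambda>y. 1 + (-1) * indicator A y)"
   by (intro trig_limit_add trig_limit_cmult compl trig_imp_trig_limit[OF trig_const])
  then show ?case by (rule trig_limit_cong) (auto simp: indicator_def)
 next
  case (union A)
  have s: "trig_limit (\<lambda>y. \<Sum>i<n. indicator (A i) y)" for n
   by (induction n) (auto intro: trig_limit_add union trig_imp_trig_limit[OF trig_const])
  have eq: "(\<Sum>i<n. indicator (A i) y) = (indicator (\<Union>i<n. A i) y :: complex)" for n y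
   using union(1) by (subst indicator_UN_disjoint) (auto simp: disjoint_family_on_def)
  show ?case
  proof (rule trig_limit_bounded[OF s, where B=1])
   show "(\<lambda>n. \<Sum>i<n. indicator (A i) y) \<longlonglongrightarrow> (indicator (\<Union>i. A i) y :: complex)" for y
    unfolding eq by (rule LIMSEQ_indicator_UN)
   show "cmod (\<Sum>i<n. indicator (A i) y) \<le> 1" for n y unfolding eq by (simp add: indicator_def)
  qed
 qed
qed

lemma trig_limit_L2:
 assumes f: "f \<in> L2 circle"
 shows "trig_limit f"
proof -
 have [measurable]: "f \<in> borel_measurable circle" using f by (rule L2_measurable)
 obtain s where s': "(\<forall>i. simple_function circle (s i)) \<and> (\<forall>x\<in>space circle. (\<lambda>i. s i x) \<longlonglongrightarrow> f x) \<and>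
  (\<forall>i. \<forall>x\<in>space circle. dist (s i x) 0 \<le> 2 * dist (f x) 0)"
  using borel_measurable_implies_sequence_metric[OF L2_measurable[OF f], of 0] by (rule exE)
 have s: "simple_function circle (s i)" "x \<in> space circle \<Longrightarrow> (\<lambda>i. s i x) \<longlonglongrightarrow> f x"
  "x \<in> space circle \<Longrightarrow> dist (s i x) 0 \<le> 2 * dist (f x) 0" for i x using s' by blast+
 have sl: "trig_limit (s i)" for i
 proof -
  have fin: "finite (s i ` space circle)" using s(1) by (rule simple_functionD)
  have "trig_limit (\<lambda>x. \<Sum>c\<in>s i ` space circle. c * indicator (s i -` {c} \<inter> space circle) x)" using fin
  proof induction
   case empty then show ?case by (simp add: trig_imp_trig_limit[OF trig_const])
  next
   case (insert c C)
   have "s i -` {c} \<inter> space circle \<in> sets circle" using s(1) by (rule simple_functionD)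
   then have "s i -` {c} \<inter> space circle \<in> sets borel"
    unfolding sets_circle by (subst (asm) sets_restrict_space_iff) auto
   then show ?case unfolding sum.insert[OF insert(1,2)] by (intro trig_limit_add trig_limit_cmult trig_limit_borel insert)
  qed
  then show ?thesis by (rule trig_limit_cong)
     (subst simple_function_indicator_representation_banach[OF s(1)],
      auto intro!: sum.cong simp: scaleR_conv_of_real indicator_def)
 qed
 show ?thesis
 proof (rule trig_limit_dominated[OF sl])
  show "(\<lambda>n. s n y) \<longlonglongrightarrow> f y" if "0 \<le> y" "y < 2 * pi" for y using s(2) that by auto
  show "cmod (s n y) \<le> 2 * cmod (f y)" if "0 \<le> y" "y < 2 * pi" for n y using s(3)[of y n] that by auto
  show "(\<integral>\<^sup>+ y. ennreal ((2 * cmod (f y))\<^sup>2) \<partial>circle) < \<infinity>"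
   using f energy_cmult[of f circle 2] unfolding L2_iff_energy by (simp add: energy_def norm_mult ennreal_mult_less_top)
 qed measurable
qed

lemma L2_circle_bounded:
 assumes "f \<in> borel_measurable circle" "\<And>y. cmod (f y) \<le> B"
 shows "f \<in> L2 circle"
proof -
 have "(cmod (f y))\<^sup>2 \<le> B\<^sup>2" for y by (intro power_mono assms) simp
 then have "energy circle f \<le> (\<integral>\<^sup>+y. ennreal (B\<^sup>2) \<partial>circle)"
  unfolding energy_def by (intro nn_integral_mono ennreal_leI) auto
 also have "... < \<infinity>" using emeasure_circle by (simp add: ennreal_mult_less_top)
 finally show ?thesis using assms by (simp add: L2_iff_energy)
qed

lemma L2_circle_trig:
 assumes "finite S"
 shows "(\<lambda>y. \<Sum>n\<in>S. a n * wave (of_int n * y)) \<in> L2 circle"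
proof (rule L2_circle_bounded)
 show "cmod (\<Sum>n\<in>S. a n * wave (of_int n * y)) \<le> (\<Sum>n\<in>S. cmod (a n))" for y
  by (rule order_trans[OF norm_sum]) (simp add: norm_mult)
qed measurable

lemma L2_circle_integrable:
 assumes "f \<in> L2 circle" shows "integrable circle f"
 using L2_product_integrable[OF assms L2_circle_bounded[of "\<lambda>_. 1" 1]] by simp

lemma circle_coeff_integrable:
 assumes "f \<in> L2 circle"
 shows "integrable circle (\<lambda>y. f y * cowave (of_int n * y))"
 using L2_product_integrable[OF assms L2_circle_trig[of "{n}" "\<lambda>_. 1"]] by (simp add: exp_cnj)

lemma inner_trig:
 assumes f: "f \<in> L2 circle" and "finite S"
 shows "(LINT y|circle. f y * cnj (\<Sum>n\<in>S. a n * wave (of_int n * y)))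
  = (\<Sum>n\<in>S. cnj (a n) * circle_coeff f n)"
proof -
 have "(LINT y|circle. f y * cnj (\<Sum>n\<in>S. a n * wave (of_int n * y)))
   = (LINT y|circle. (\<Sum>n\<in>S. cnj (a n) * (f y * cowave (of_int n * y))))"
  by (intro Bochner_Integration.integral_cong refl)
    (simp add: exp_cnj sum_distrib_left mult_ac)
 also have "... = (\<Sum>n\<in>S. LINT y|circle. cnj (a n) * (f y * cowave (of_int n * y)))"
  by (rule Bochner_Integration.integral_sum) (intro integrable_mult_right circle_coeff_integrable[OF f])
 also have "... = (\<Sum>n\<in>S. cnj (a n) * circle_coeff f n)" unfolding circle_coeff_def by simp
 finally show ?thesis .
qed

lemma circle_coeff_trig:
 fixes a :: "int \<Rightarrow> complex"
 assumes "finite S"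
 shows "circle_coeff (\<lambda>y. \<Sum>n\<in>S. a n * wave (of_int n * y)) m
  = (if m \<in> S then 2 * pi * a m else 0)"
proof -
 have int: "integrable circle (\<lambda>y. wave (of_int k * y))" for k
  by (intro L2_circle_integrable L2_circle_bounded[where B=1]) auto
 have "circle_coeff (\<lambda>y. \<Sum>n\<in>S. a n * wave (of_int n * y)) m
  = (LINT y|circle. (\<Sum>n\<in>S. a n * wave (of_int (n - m) * y)))"
  unfolding circle_coeff_def by (intro Bochner_Integration.integral_cong refl)
    (simp only: sum_distrib_right mult.assoc exp_add[symmetric], simp add: algebra_simps)
 also have "... = (\<Sum>n\<in>S. LINT y|circle. a n * wave (of_int (n - m) * y))"
  by (rule Bochner_Integration.integral_sum) (intro integrable_mult_right int)
 also have "... = (\<Sum>n\<in>S. a n * (if n = m then of_real (2 * pi) else 0))"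
  by (simp only: integral_mult_right_zero integral_circle_character) simp
 also have "... = (if m \<in> S then 2 * pi * a m else 0)"
  using assms by (simp add: if_distrib[where f="\<lambda>x. _ * x"] sum.delta cong: if_cong)
 finally show ?thesis .
qed

lemma inner_self: "(LINT z|M. f z * cnj (f z)) = of_real (LINT z|M. (cmod (f z))\<^sup>2)"
 by (simp add: complex_norm_square[symmetric] integral_complex_of_real[symmetric])

text \<open>Completing the square separates the distance to a trigonometric polynomial into the defect in Bessel's inequality and
 the deviation of its coefficients from the Fourier coefficients.\<close>

lemma trig_distance:
 assumes f: "f \<in> L2 circle" and S: "finite S"
 shows "(LINT y|circle. (cmod (f y - (\<Sum>n\<in>S. a n * wave (of_int n * y))))\<^sup>2)
  = (LINT y|circle. (cmod (f y))\<^sup>2) - (\<Sum>n\<in>S. (cmod (circle_coeff f n))\<^sup>2) / (2 * pi)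
   + 2 * pi * (\<Sum>n\<in>S. (cmod (a n - circle_coeff f n / (2 * pi)))\<^sup>2)"
proof -
 define p where "p = (\<lambda>y. \<Sum>n\<in>S. a n * wave (of_int n * y))"
 have p: "p \<in> L2 circle" unfolding p_def using S by (rule L2_circle_trig)
 have fp: "(LINT y|circle. f y * cnj (p y)) = (\<Sum>n\<in>S. cnj (a n) * circle_coeff f n)"
  unfolding p_def by (rule inner_trig[OF f S])
 have "(LINT y|circle. p y * cnj (f y)) = (LINT y|circle. cnj (f y * cnj (p y)))"
  by (rule Bochner_Integration.integral_cong) simp_all
 also have "... = cnj (LINT y|circle. f y * cnj (p y))" by (rule Bochner_Integration.integral_cnj)
 finally have pf: "(LINT y|circle. p y * cnj (f y)) = cnj (\<Sum>n\<in>S. cnj (a n) * circle_coeff f n)" unfolding fp .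
 have pp: "(LINT y|circle. p y * cnj (p y)) = (\<Sum>n\<in>S. cnj (a n) * (2 * pi * a n))"
  using inner_trig[OF p S, of a] circle_coeff_trig[OF S, of a] by (simp add: p_def cong: sum.cong)
 have "complex_of_real (LINT y|circle. (cmod (f y - p y))\<^sup>2) = (LINT y|circle. (f y - p y) * cnj (f y - p y))"
  by (rule inner_self[symmetric])
 also have "... = (LINT y|circle. (f y * cnj (f y) - f y * cnj (p y)) - (p y * cnj (f y) - p y * cnj (p y)))"
  by (simp add: algebra_simps)
 also have "... = of_real (LINT y|circle. (cmod (f y))\<^sup>2) - (\<Sum>n\<in>S. cnj (a n) * circle_coeff f n)
   - (cnj (\<Sum>n\<in>S. cnj (a n) * circle_coeff f n) - (\<Sum>n\<in>S. cnj (a n) * (2 * pi * a n)))"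
  by (simp only: Bochner_Integration.integral_diff[OF
     Bochner_Integration.integrable_diff[OF L2_product_integrable[OF f f] L2_product_integrable[OF f p]]
     Bochner_Integration.integrable_diff[OF L2_product_integrable[OF p f] L2_product_integrable[OF p p]]]
    Bochner_Integration.integral_diff[OF L2_product_integrable[OF f f] L2_product_integrable[OF f p]]
    Bochner_Integration.integral_diff[OF L2_product_integrable[OF p f] L2_product_integrable[OF p p]]
    fp pf pp inner_self[of circle f])
 also have "... = of_real ((LINT y|circle. (cmod (f y))\<^sup>2) - (\<Sum>n\<in>S. (cmod (circle_coeff f n))\<^sup>2) / (2 * pi)
   + 2 * pi * (\<Sum>n\<in>S. (cmod (a n - circle_coeff f n / (2 * pi)))\<^sup>2))"
 proof -
  have "- (cnj b * c) - (cnj (cnj b * c) - cnj b * (2 * pi * b))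
    = of_real (- (cmod c)\<^sup>2 / (2 * pi) + 2 * pi * (cmod (b - c / (2 * pi)))\<^sup>2)" for b c :: complex
  proof -
   have "complex_of_real (- (cmod c)\<^sup>2 / (2 * pi) + 2 * pi * (cmod (b - c / (2 * pi)))\<^sup>2)
    = - complex_of_real ((cmod c)\<^sup>2) / (2 * pi) + 2 * pi * complex_of_real ((cmod (b - c / (2 * pi)))\<^sup>2)" by simp
   also have "... = - (c * cnj c) / (2 * pi) + 2 * pi * ((b - c / (2 * pi)) * cnj (b - c / (2 * pi)))"
    by (simp only: complex_norm_square)
   also have "... = - (cnj b * c) - (cnj (cnj b * c) - cnj b * (2 * pi * b))" by (simp add: field_simps)
   finally show ?thesis by simp
  qed
  then have "(\<Sum>n\<in>S. - (cnj (a n) * circle_coeff f n)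
    - (cnj (cnj (a n) * circle_coeff f n) - cnj (a n) * (2 * pi * a n)))
    = (\<Sum>n\<in>S. of_real (- (cmod (circle_coeff f n))\<^sup>2 / (2 * pi)
    + 2 * pi * (cmod (a n - circle_coeff f n / (2 * pi)))\<^sup>2))" by (intro sum.cong refl)
  then show ?thesis by (simp add: sum_subtractf sum_negf sum.distrib sum_distrib_left sum_divide_distrib algebra_simps)
 qed
 finally show ?thesis unfolding p_def of_real_eq_iff .
qed

text \<open>By \<open>trig_distance\<close> the Fourier coefficients give the best approximation, so density of the trigonometric
 polynomials makes the defect in Bessel's inequality arbitrarily small.\<close>

theorem parseval_circle:
 assumes f: "f \<in> L2 circle"
 shows "(\<integral>\<^sup>+n. nsq (circle_coeff f n) \<partial>count_space UNIV) = ennreal (2 * pi) * energy circle f"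
proof (rule antisym)
 define E where "E = (LINT y|circle. (cmod (f y))\<^sup>2)"
 have E0: "0 \<le> E" unfolding E_def by simp
 have "integrable circle (\<lambda>y. (cmod (f y))\<^sup>2)" using f by (simp add: L2_def)
 then have eE: "energy circle f = ennreal E" unfolding energy_def E_def by (rule nn_integral_eq_integral) simp
 have bessel: "(\<Sum>n\<in>S. (cmod (circle_coeff f n))\<^sup>2) \<le> 2 * pi * E" if S: "finite S" for S
 proof -
  have "0 \<le> E - (\<Sum>n\<in>S. (cmod (circle_coeff f n))\<^sup>2) / (2 * pi)"
   using trig_distance[OF f S, of "\<lambda>n. circle_coeff f n / (2 * pi)"] unfolding E_def
   by (simp add: Bochner_Integration.integral_nonneg flip: E_def) (metis (no_types, lifting) Bochner_Integration.integral_nonneg zero_le_power2 diff_ge_0_iff_ge)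
  then show ?thesis by (simp add: field_simps)
 qed
 show "(\<integral>\<^sup>+n. nsq (circle_coeff f n) \<partial>count_space UNIV) \<le> ennreal (2 * pi) * energy circle f"
 proof -
  have "(\<integral>\<^sup>+n. nsq (circle_coeff f n) \<partial>count_space UNIV)
    = (\<integral>\<^sup>+k. nsq (circle_coeff f (int_decode k)) \<partial>count_space UNIV)"
   by (rule nn_integral_bij_count_space[symmetric]) (rule bij_int_decode)
  also have "... = (\<Sum>k. nsq (circle_coeff f (int_decode k)))" by (rule nn_integral_count_space_nat)
  also have "... \<le> ennreal (2 * pi * E)"
  proof (rule suminf_le_const)
   fix N
   have "(\<Sum>k<N. nsq (circle_coeff f (int_decode k)))
    = ennreal (\<Sum>n\<in>int_decode ` {..<N}. (cmod (circle_coeff f n))\<^sup>2)"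
    using inj_on_subset[OF inj_int_decode subset_UNIV, of "{..<N}"] by (subst sum_ennreal) (auto simp: sum.reindex)
   also have "... \<le> ennreal (2 * pi * E)" by (intro ennreal_leI bessel) simp
   finally show "(\<Sum>k<N. nsq (circle_coeff f (int_decode k))) \<le> ennreal (2 * pi * E)" .
  qed simp
  finally show ?thesis using E0 by (simp add: eE ennreal_mult)
 qed
 define T where "T = (\<integral>\<^sup>+n. nsq (circle_coeff f n) \<partial>count_space UNIV)"
 show "ennreal (2 * pi) * energy circle f \<le> T"
 proof (rule ennreal_le_epsilon)
  fix e :: real assume e: "0 < e"
  obtain p where p: "trig p" "energy circle (\<lambda>y. f y - p y) \<le> ennreal (e / (2 * pi))"
   using trig_limit_L2[OF f] e unfolding trig_limit_def by (meson divide_pos_pos mult_pos_pos pi_gt_zero zero_less_numeral)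
  obtain S a where S: "finite S" "p = (\<lambda>y. \<Sum>n\<in>S. a n * wave (of_int n * y))"
   using p(1) unfolding trig_def by blast
  define D where "D = (LINT y|circle. (cmod (f y - p y))\<^sup>2)"
  have "(\<lambda>y. f y - p y) \<in> L2 circle" unfolding S(2) by (intro L2_diff f L2_circle_trig S)
  then have "energy circle (\<lambda>y. f y - p y) = ennreal D"
   unfolding energy_def D_def L2_def by (intro nn_integral_eq_integral) auto
  then have D: "D \<le> e / (2 * pi)" using p(2) e by simp
  have "E - (\<Sum>n\<in>S. (cmod (circle_coeff f n))\<^sup>2) / (2 * pi) \<le> D"
   using trig_distance[OF f S(1), of a] unfolding D_def E_def S(2) by (simp add: sum_nonneg)
  then have "E * (2 * pi) \<le> (\<Sum>n\<in>S. (cmod (circle_coeff f n))\<^sup>2) + D * (2 * pi)" by (simp add: field_simps)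
  also have "D * (2 * pi) \<le> e" using D by (simp add: field_simps)
  finally have "ennreal (2 * pi * E) \<le> ennreal ((\<Sum>n\<in>S. (cmod (circle_coeff f n))\<^sup>2) + e)"
   by (intro ennreal_leI) (simp add: mult.commute)
  also have "... = (\<Sum>n\<in>S. nsq (circle_coeff f n)) + ennreal e" using e by (simp add: sum_nonneg sum_ennreal)
  also have "(\<Sum>n\<in>S. nsq (circle_coeff f n))
    = (\<integral>\<^sup>+n. nsq (circle_coeff f n) * indicator S n \<partial>count_space UNIV)"
   using S(1) by (subst nn_integral_indicator_finite) auto
  also have "... \<le> T" unfolding T_def by (intro nn_integral_mono) (auto simp: indicator_def)
  finally show "ennreal (2 * pi) * energy circle f \<le> T + ennreal e" using E0 by (simp add: eE ennreal_mult)
 qed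
qed

section \<open>Plancherel's identity on the line\<close>

definition line_transform :: "(real \<Rightarrow> complex) \<Rightarrow> real \<Rightarrow> complex" where
 "line_transform f \<xi> = (LINT x|lborel. f x * cowave (x * \<xi>))"

lemma borel_measurable_real_of_int [measurable (raw)]:
 "f \<in> M \<rightarrow>\<^sub>M count_space UNIV \<Longrightarrow> (\<lambda>x. real_of_int (f x)) \<in> borel_measurable M"
 by (rule measurable_compose) auto

lemma borel_measurable_complex_of_int [measurable (raw)]:
 "f \<in> M \<rightarrow>\<^sub>M count_space UNIV \<Longrightarrow> (\<lambda>x. complex_of_int (f x)) \<in> borel_measurable M"
 by (rule measurable_compose) auto

lemma borel_measurable_snd_circle [measurable (raw)]:
 "f \<in> M \<rightarrow>\<^sub>M N \<Otimes>\<^sub>M circle \<Longrightarrow> (\<lambda>x. snd (f x)) \<in> borel_measurable M"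
 by (rule measurable_compose[OF _ measurable_compose[OF measurable_snd]]) auto

interpretation line_int: pair_sigma_finite "lborel :: real measure" "count_space (UNIV :: int set)"
 by (intro pair_sigma_finite.intro sigma_finite_lborel sigma_finite_measure_count_space)

text \<open>The line is tiled by the translates of the unit interval by integers.\<close>

lemma nn_integral_unit_cells:
 fixes h :: "real \<Rightarrow> ennreal"
 assumes [measurable]: "h \<in> borel_measurable borel"
 shows "(\<integral>\<^sup>+s. indicator {0..<1} s * (\<integral>\<^sup>+n. h (of_int n + s) \<partial>count_space (UNIV::int set)) \<partial>lborel)
  = (\<integral>\<^sup>+v. h v \<partial>lborel)"
proof -
 have "(\<integral>\<^sup>+s. indicator {0..<1} s * (\<integral>\<^sup>+n. h (of_int n + s) \<partial>count_space (UNIV::int set)) \<partial>lborel)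
   = (\<integral>\<^sup>+s. (\<integral>\<^sup>+n. indicator {0..<1} s * h (of_int n + s) \<partial>count_space (UNIV::int set)) \<partial>lborel)"
  by (intro nn_integral_cong nn_integral_cmult[symmetric]) simp
 also have "... = (\<integral>\<^sup>+n. (\<integral>\<^sup>+s. indicator {0..<1} s * h (of_int n + s) \<partial>lborel) \<partial>count_space (UNIV::int set))"
  by (rule line_int.Fubini'[symmetric]) measurable
 also have "... = (\<integral>\<^sup>+n. (\<integral>\<^sup>+v. indicator {of_int n..<of_int n + 1} v * h v \<partial>lborel) \<partial>count_space (UNIV::int set))"
 proof (rule nn_integral_cong)
  fix n :: int
  have "(\<integral>\<^sup>+v. indicator {of_int n..<of_int n + 1} v * h v \<partial>lborel)
    = ennreal \<bar>1\<bar> * (\<integral>\<^sup>+s. indicator {of_int n..<of_int n + 1} (of_int n + 1 * s) * h (of_int n + 1 * s) \<partial>lborel)"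
   by (rule nn_integral_real_affine) auto
  also have "... = (\<integral>\<^sup>+s. indicator {0..<1} s * h (of_int n + s) \<partial>lborel)"
   by (simp add: indicator_def cong: nn_integral_cong)
  finally show "(\<integral>\<^sup>+s. indicator {0..<1} s * h (of_int n + s) \<partial>lborel)
    = (\<integral>\<^sup>+v. indicator {of_int n..<of_int n + 1} v * h v \<partial>lborel)" ..
 qed
 also have "... = (\<integral>\<^sup>+v. (\<integral>\<^sup>+n. indicator {of_int n..<of_int n + 1} v * h v \<partial>count_space (UNIV::int set)) \<partial>lborel)"
  by (rule line_int.Fubini') measurable
 also have "... = (\<integral>\<^sup>+v. h v \<partial>lborel)"
 proof (rule nn_integral_cong)
  fix v :: real
  have "(\<integral>\<^sup>+n. indicator {of_int n..<of_int n + 1} v * h v \<partial>count_space (UNIV::int set))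
    = (\<integral>\<^sup>+n. h v * indicator {\<lfloor>v\<rfloor>} n \<partial>count_space UNIV)"
  proof (rule nn_integral_cong)
   fix n :: int
   have "(of_int n \<le> v \<and> v < of_int n + 1) \<longleftrightarrow> n = \<lfloor>v\<rfloor>" by linarith
   then show "indicator {of_int n..<of_int n + 1} v * h v = h v * indicator {\<lfloor>v\<rfloor>} n"
    by (simp add: indicator_def)
  qed
  also have "... = h v" by simp
  finally show "(\<integral>\<^sup>+n. indicator {of_int n..<of_int n + 1} v * h v \<partial>count_space (UNIV::int set)) = h v" .
 qed
 finally show ?thesis .
qed

lemma line_transform_measurable [measurable]:
 assumes [measurable]: "f \<in> borel_measurable borel"
 shows "line_transform f \<in> borel_measurable borel" unfolding line_transform_def by measurable

text \<open>A function supported in an interval of length \<open>2 A\<close> is, up to scaling, a function on the circle.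
 Parseval's identity for it multiplied by a character of noninteger frequency \<open>s\<close> evaluates the transform
 on the translate by \<open>s\<close> of a lattice; averaging over \<open>s\<close> in a unit cell gives the integral
 over all frequencies.\<close>

theorem plancherel_compact_support:
 assumes f: "f \<in> L2 lborel" and "0 < A" and supp: "\<And>x. A \<le> \<bar>x\<bar> \<Longrightarrow> f x = 0"
 shows "energy lborel (line_transform f) = ennreal (2 * pi) * energy lborel f"
proof -
 have [measurable]: "f \<in> borel_measurable borel" using f by (simp add: L2_def)
 (* The substitution x = - A + c * u maps the circle [0, 2 pi) onto the support [-A, A). *)
 define c where "c = A / pi"
 have c: "0 < c" using assms by (simp add: c_def)
 define g where "g s u = f (- A + c * u) * cowave (s * u)" for s u
 have [measurable]: "g s \<in> borel_measurable borel" for s unfolding g_def by measurable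
 have supp': "f (- A + c * u) = 0" if "u \<notin> {0..<2*pi}" for u
 proof (rule supp)
  have "u < 0 \<or> 2 * pi \<le> u" using that by auto
  then show "A \<le> \<bar>- A + c * u\<bar>"
  proof
   assume "u < 0"
   then have "c * u < 0" using c by (simp add: mult_pos_neg)
   then show ?thesis using \<open>0 < A\<close> by linarith
  next
   assume "2 * pi \<le> u"
   then have "c * (2 * pi) \<le> c * u" using c by (intro mult_left_mono) auto
   moreover have "c * (2 * pi) = 2 * A" by (simp add: c_def)
   ultimately show ?thesis using \<open>0 < A\<close> by linarith
  qed
 qed
 have Ef: "energy lborel f = ennreal c * (\<integral>\<^sup>+u. nsq (f (- A + c * u)) \<partial>lborel)"
  unfolding energy_def using nn_integral_real_affine[of "\<lambda>x. nsq (f x)" c "-A"] c by simp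
 have Eg: "energy circle (g s) = (\<integral>\<^sup>+u. nsq (f (- A + c * u)) \<partial>lborel)" for s
  unfolding energy_def nn_integral_circle
 proof (rule nn_integral_cong)
  fix u :: real
  show "nsq (g s u) * indicator {0..<2 * pi} u = nsq (f (- A + c * u))"
   using supp'[of u] by (cases "u \<in> {0..<2*pi}") (simp_all add: g_def norm_mult)
 qed
 have gL2: "g s \<in> L2 circle" for s
 proof -
  have "ennreal c * energy circle (g s) < \<infinity>" using f unfolding L2_iff_energy Ef Eg[of s, symmetric] by simp
  then have "energy circle (g s) < \<infinity>" using c by (auto simp: ennreal_mult_less_top)
  then show ?thesis by (simp add: L2_iff_energy)
 qed
 have coeff: "(cmod (line_transform f ((of_int n + s) / c)))\<^sup>2 = c\<^sup>2 * (cmod (circle_coeff (g s) n))\<^sup>2" for n s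
 proof -
  have "circle_coeff (g s) n = (LINT u|lborel. indicator {0..<2*pi} u *\<^sub>R (g s u * cowave (of_int n * u)))"
   unfolding circle_coeff_def circle_def by (rule integral_restrict_space) simp
  also have "... = (LINT u|lborel. f (- A + c * u) * cowave ((of_int n + s) * u))"
  proof (rule Bochner_Integration.integral_cong)
   fix u :: real
   show "indicator {0..<2*pi} u *\<^sub>R (g s u * cowave (of_int n * u))
    = f (- A + c * u) * cowave ((of_int n + s) * u)"
    using supp'[of u] by (cases "u \<in> {0..<2*pi}") (simp_all add: g_def mult.assoc exp_add[symmetric] algebra_simps)
  qed simp
  finally have cc: "circle_coeff (g s) n = (LINT u|lborel. f (- A + c * u) * cowave ((of_int n + s) * u))" .
  have "line_transform f ((of_int n + s) / c)
   = \<bar>c\<bar> *\<^sub>R (LINT u|lborel. f (- A + c * u) * cowave ((- A + c * u) * ((of_int n + s) / c)))"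
   unfolding line_transform_def using c by (intro lborel_integral_real_affine) simp
  also have "(LINT u|lborel. f (- A + c * u) * cowave ((- A + c * u) * ((of_int n + s) / c)))
   = (LINT u|lborel. wave (A * (of_int n + s) / c) * (f (- A + c * u) * cowave ((of_int n + s) * u)))"
  proof (rule Bochner_Integration.integral_cong)
   fix u :: real
   have eq: "(- A + c * u) * ((of_int n + s) / c) = - (A * (of_int n + s) / c) + (of_int n + s) * u"
    using c by (simp add: field_simps)
   have ex: "exp (- \<i> * complex_of_real (- w + e)) = wave w * cowave e" for w e
    by (simp add: exp_add[symmetric] algebra_simps)
   have "exp (- \<i> * complex_of_real ((- A + c * u) * ((of_int n + s) / c)))
     = wave (A * (of_int n + s) / c) * cowave ((of_int n + s) * u)" unfolding eq by (rule ex)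
   then show "f (- A + c * u) * cowave ((- A + c * u) * ((of_int n + s) / c))
     = wave (A * (of_int n + s) / c) * (f (- A + c * u) * cowave ((of_int n + s) * u))" by (simp add: mult_ac)
  qed simp
  also have "... = wave (A * (of_int n + s) / c) * circle_coeff (g s) n" unfolding cc by (rule integral_mult_right_zero)
  finally show ?thesis using c by (simp add: norm_mult power_mult_distrib)
 qed
 have cell: "(\<integral>\<^sup>+n. nsq (line_transform f ((of_int n + s) / c)) \<partial>count_space UNIV)
   = ennreal (2 * pi * c) * energy lborel f" for s
 proof -
  have "(\<integral>\<^sup>+n. nsq (line_transform f ((of_int n + s) / c)) \<partial>count_space UNIV)
   = ennreal (c\<^sup>2) * (\<integral>\<^sup>+n. nsq (circle_coeff (g s) n) \<partial>count_space UNIV)"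
   unfolding coeff by (subst nn_integral_cmult[symmetric]) (auto simp: ennreal_mult)
  also have "... = ennreal (c\<^sup>2) * (ennreal (2 * pi) * energy circle (g s))" by (simp add: parseval_circle[OF gL2])
  also have "... = ennreal (2 * pi * c) * (ennreal c * energy circle (g s))"
   using c by (simp add: power2_eq_square ennreal_mult mult_ac)
  also have "ennreal c * energy circle (g s) = energy lborel f" by (simp add: Ef Eg)
  finally show ?thesis .
 qed
 have "ennreal (2 * pi * c) * energy lborel f
   = (\<integral>\<^sup>+s. indicator {0..<1} s * (ennreal (2 * pi * c) * energy lborel f) \<partial>(lborel :: real measure))"
  by (subst nn_integral_multc) auto
 also have "... = (\<integral>\<^sup>+s. indicator {0..<1} s *
   (\<integral>\<^sup>+n. nsq (line_transform f ((of_int n + s) / c)) \<partial>count_space (UNIV::int set)) \<partial>lborel)"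
  by (simp only: cell)
 also have "... = (\<integral>\<^sup>+v. nsq (line_transform f (v / c)) \<partial>lborel)"
  by (rule nn_integral_unit_cells) measurable
 finally have "ennreal (2 * pi * c) * energy lborel f = (\<integral>\<^sup>+v. nsq (line_transform f (v / c)) \<partial>lborel)" .
 moreover have "energy lborel (line_transform f)
   = ennreal (1/c) * (\<integral>\<^sup>+v. nsq (line_transform f (v / c)) \<partial>lborel)" unfolding energy_def
  using nn_integral_real_affine[of "\<lambda>x. nsq (line_transform f x)" "1/c" 0] c by simp
 ultimately have "energy lborel (line_transform f) = ennreal (1/c) * (ennreal (2 * pi * c) * energy lborel f)" by simp
 also have "... = ennreal (2 * pi) * energy lborel f" using c by (simp add: mult.assoc[symmetric] ennreal_mult[symmetric])
 finally show ?thesis .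
qed

section \<open>The Fourier transform on the cylinder\<close>

lemma cylinder_eq: "cylinder = lborel \<Otimes>\<^sub>M circle" by (simp add: cylinder_def circle_def)

interpretation cyl: pair_sigma_finite "lborel :: real measure" circle ..

lemma sigma_finite_cylinder: "sigma_finite_measure cylinder"
 unfolding cylinder_eq by (intro sigma_finite_pair_measure sigma_finite_lborel circle.sigma_finite_measure_axioms)

lemma sigma_finite_frequencies: "sigma_finite_measure frequencies"
 unfolding frequencies_def by (intro sigma_finite_pair_measure sigma_finite_lborel sigma_finite_measure_count_space)

interpretation cyl_freq: pair_sigma_finite cylinder frequencies
 by (intro pair_sigma_finite.intro sigma_finite_cylinder sigma_finite_frequencies)

lemma energy_cylinder:
 assumes "f \<in> borel_measurable cylinder"
 shows "energy cylinder f = (\<integral>\<^sup>+x. energy circle (\<lambda>y. f (x, y)) \<partial>lborel)"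
 unfolding energy_def using assms unfolding cylinder_eq by (subst circle.nn_integral_fst[symmetric]) auto

lemma energy_frequencies:
 assumes "g \<in> freq_measurable"
 shows "energy frequencies g = (\<integral>\<^sup>+\<eta>. energy lborel (\<lambda>\<xi>. g (\<xi>, \<eta>)) \<partial>count_space UNIV)"
 unfolding energy_def using assms unfolding frequencies_def by (subst line_int.nn_integral_snd[symmetric]) auto

text \<open>The Fourier coefficient in \<open>y\<close> as a function of \<open>x\<close>. The transform on the cylinder is the
 transform on the line of these slices, so identities in one variable can be used for each \<open>\<eta>\<close>.\<close>

definition slice :: "(real \<times> real \<Rightarrow> complex) \<Rightarrow> int \<Rightarrow> real \<Rightarrow> complex" where
 "slice f \<eta> x = circle_coeff (\<lambda>y. f (x, y)) \<eta>"

lemma slice_measurable [measurable]: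
 assumes "f \<in> borel_measurable cylinder"
 shows "slice f \<eta> \<in> borel_measurable borel"
proof -
 have [measurable]: "f \<in> borel_measurable (lborel \<Otimes>\<^sub>M circle)" using assms by (simp add: cylinder_eq)
 have "(\<lambda>x. LINT y|circle. f (x, y) * cowave (of_int \<eta> * y)) \<in> borel_measurable lborel" by measurable
 then show ?thesis by (simp add: slice_def[abs_def] circle_coeff_def)
qed

text \<open>Parseval's identity in \<open>y\<close> for almost every \<open>x\<close>, integrated against a weight in
 \<open>x\<close>.\<close>

lemma slice_parseval:
 assumes f: "f \<in> L2 cylinder" and w[measurable]: "w \<in> borel_measurable borel"
 shows "(\<integral>\<^sup>+\<eta>. (\<integral>\<^sup>+x. w x * nsq (slice f \<eta> x) \<partial>lborel) \<partial>count_space UNIV)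
  = ennreal (2 * pi) * (\<integral>\<^sup>+z. w (fst z) * nsq (f z) \<partial>cylinder)"
proof -
 have fm: "f \<in> borel_measurable cylinder" using f by (rule L2_measurable)
 then have [measurable]: "f \<in> borel_measurable (lborel \<Otimes>\<^sub>M circle)" by (simp add: cylinder_eq)
 note slice_measurable[OF fm, measurable]
 have [measurable]: "(\<lambda>p. slice f (snd p) (fst p)) \<in> borel_measurable (lborel \<Otimes>\<^sub>M count_space (UNIV :: int set))"
  unfolding slice_def circle_coeff_def by measurable
 have "(\<integral>\<^sup>+x. energy circle (\<lambda>y. f (x, y)) \<partial>lborel) \<noteq> \<infinity>"
  using f by (simp add: L2_iff_energy energy_cylinder[OF fm, symmetric] less_top)
 then have "AE x in lborel. energy circle (\<lambda>y. f (x, y)) \<noteq> \<infinity>"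
  by (intro nn_integral_PInf_AE) (auto simp: energy_def)
 then have ae: "AE x in lborel. (\<lambda>y. f (x, y)) \<in> L2 circle" by eventually_elim (simp add: L2_iff_energy less_top)
 have "(\<integral>\<^sup>+\<eta>. (\<integral>\<^sup>+x. w x * nsq (slice f \<eta> x) \<partial>lborel) \<partial>count_space UNIV)
   = (\<integral>\<^sup>+x. (\<integral>\<^sup>+\<eta>. w x * nsq (slice f \<eta> x) \<partial>count_space UNIV) \<partial>lborel)"
  by (rule line_int.Fubini') measurable
 also have "... = (\<integral>\<^sup>+x. w x * (\<integral>\<^sup>+\<eta>. nsq (slice f \<eta> x) \<partial>count_space UNIV) \<partial>lborel)"
  by (intro nn_integral_cong nn_integral_cmult) simp
 also have "... = (\<integral>\<^sup>+x. ennreal (2 * pi) * (w x * energy circle (\<lambda>y. f (x, y))) \<partial>lborel)"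
  using ae by (intro nn_integral_cong_AE, eventually_elim) (simp add: slice_def parseval_circle mult_ac)
 also have "... = ennreal (2 * pi) * (\<integral>\<^sup>+x. w x * energy circle (\<lambda>y. f (x, y)) \<partial>lborel)"
  unfolding energy_def by (intro nn_integral_cmult) measurable
 also have "(\<integral>\<^sup>+x. w x * energy circle (\<lambda>y. f (x, y)) \<partial>lborel)
   = (\<integral>\<^sup>+x. (\<integral>\<^sup>+y. w (fst (x, y)) * nsq (f (x, y)) \<partial>circle) \<partial>lborel)"
  unfolding energy_def by (intro nn_integral_cong) (simp add: nn_integral_cmult)
 also have "... = (\<integral>\<^sup>+z. w (fst z) * nsq (f z) \<partial>cylinder)"
  unfolding cylinder_eq by (rule circle.nn_integral_fst) measurable
 finally show ?thesis .
qed

lemma fourier_integral_character_integrable: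
 assumes f: "integrable cylinder f"
 shows "integrable cylinder (\<lambda>(x, y). f (x, y) * exp (- \<i> * of_real (x * \<xi>) - \<i> * of_real (of_int \<eta> * y)))"
proof (rule Bochner_Integration.integrable_bound[OF f])
 have [measurable]: "f \<in> borel_measurable (lborel \<Otimes>\<^sub>M circle)" using f by (auto simp: cylinder_eq)
 show "(\<lambda>(x, y). f (x, y) * exp (- \<i> * of_real (x * \<xi>) - \<i> * of_real (of_int \<eta> * y))) \<in> borel_measurable cylinder"
  unfolding cylinder_eq by measurable
 show "AE z in cylinder. norm (case z of (x, y) \<Rightarrow> f (x, y) * exp (- \<i> * of_real (x * \<xi>) - \<i> * of_real (of_int \<eta> * y))) \<le> norm (f z)"
  by (auto simp: norm_mult)
qed

lemma fourier_integral_slice: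
 assumes f: "integrable cylinder f"
 shows "fourier_integral f (\<xi>, \<eta>) = line_transform (slice f \<eta>) \<xi>"
proof -
 have "fourier_integral f (\<xi>, \<eta>) = (LINT x|lborel. LINT y|circle. f (x, y) * exp (- \<i> * of_real (x * \<xi>) - \<i> * of_real (of_int \<eta> * y)))"
  unfolding fourier_integral_def prod.case
  using cyl.integral_fst[of "\<lambda>x y. f (x, y) * exp (- \<i> * of_real (x * \<xi>) - \<i> * of_real (of_int \<eta> * y))"]
   fourier_integral_character_integrable[OF f, of \<xi> \<eta>] by (simp add: cylinder_eq)
 also have "... = (LINT x|lborel. LINT y|circle. cowave (x * \<xi>) * (f (x, y) * cowave (of_int \<eta> * y)))"
  by (intro Bochner_Integration.integral_cong refl) (simp add: exp_diff exp_minus field_simps)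
 also have "... = line_transform (slice f \<eta>) \<xi>" unfolding line_transform_def slice_def circle_coeff_def
  by (simp only: integral_mult_right_zero) (simp only: mult.commute)
 finally show ?thesis .
qed

lemma fourier_integral_measurable [measurable]:
 assumes "f \<in> borel_measurable cylinder"
 shows "fourier_integral f \<in> freq_measurable"
proof -
 have [measurable]: "f \<in> borel_measurable (lborel \<Otimes>\<^sub>M circle)" using assms by (simp add: cylinder_eq)
 interpret sigma_finite_measure "lborel \<Otimes>\<^sub>M circle :: (real \<times> real) measure" using sigma_finite_cylinder by (simp add: cylinder_eq)
 show ?thesis unfolding fourier_integral_def frequencies_def cylinder_eq by measurable
qed

lemma fourier_integral_diff:
 assumes "integrable cylinder f" "integrable cylinder g"
 shows "fourier_integral (\<lambda>z. f z - g z) q = fourier_integral f q - fourier_integral g q"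
proof (cases q)
 case (Pair \<xi> \<eta>)
 show ?thesis unfolding Pair fourier_integral_def prod.case by (subst Bochner_Integration.integral_diff[symmetric])
    (use assms[THEN fourier_integral_character_integrable, of \<xi> \<eta>] in
     \<open>auto simp: left_diff_distrib case_prod_unfold\<close>)
qed

lemma strip_L2: "(\<lambda>z. indicator {-A..A} (fst z)) \<in> L2 cylinder"
proof -
 have m: "(\<lambda>z. indicator {-A..A} (fst z) :: complex) \<in> borel_measurable cylinder"
  unfolding cylinder_eq by measurable
 have "energy cylinder (\<lambda>z. indicator {-A..A} (fst z)) = (\<integral>\<^sup>+x. (\<integral>\<^sup>+y. indicator {-A..A} x \<partial>circle) \<partial>lborel)"
  unfolding energy_cylinder[OF m] by (auto simp: energy_def indicator_def intro!: nn_integral_cong)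
 also have "... < \<infinity>" using emeasure_circle
  by (simp add: nn_integral_multc ennreal_mult_less_top emeasure_lborel_Icc_eq)
 finally show ?thesis using m by (simp add: L2_iff_energy)
qed

lemma strip_integrable:
 assumes f: "f \<in> L2 cylinder" and supp: "\<And>x y. A < \<bar>x\<bar> \<Longrightarrow> f (x, y) = 0"
 shows "integrable cylinder f"
proof -
 have eq: "f z * cnj (indicator {-A..A} (fst z)) = f z" for z
  using supp[of "fst z" "snd z"] by (cases "A < \<bar>fst z\<bar>") (auto simp: indicator_def)
 show ?thesis using L2_product_integrable[OF f strip_L2[of A]] by (simp only: eq)
qed

lemma slice_L2:
 assumes f: "f \<in> L2 cylinder" shows "slice f \<eta> \<in> L2 lborel"
proof -
 note [measurable] = slice_measurable[OF L2_measurable[OF f]]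
 have "energy lborel (slice f \<eta>) = (\<integral>\<^sup>+\<eta>'. energy lborel (slice f \<eta>') * indicator {\<eta>} \<eta>' \<partial>count_space UNIV)"
  by simp
 also have "... \<le> (\<integral>\<^sup>+\<eta>'. energy lborel (slice f \<eta>') \<partial>count_space UNIV)"
  by (intro nn_integral_mono) (auto simp: indicator_def)
 also have "... = ennreal (2 * pi) * energy cylinder f" using slice_parseval[OF f, of "\<lambda>_. 1"] by (simp add: energy_def)
 also have "... < \<infinity>" using f by (simp add: L2_iff_energy ennreal_mult_less_top)
 finally show ?thesis by (simp add: L2_iff_energy)
qed

lemma plancherel_strip:
 assumes f: "f \<in> L2 cylinder" and supp: "\<And>x y. A < \<bar>x\<bar> \<Longrightarrow> f (x, y) = 0" and "0 \<le> A"
 shows "energy frequencies (fourier_integral f) = ennreal ((2 * pi)\<^sup>2) * energy cylinder f"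
proof -
 have sl: "slice f \<eta> x = 0" if "A + 1 \<le> \<bar>x\<bar>" for \<eta> x
  using that supp[of x] by (simp add: slice_def circle_coeff_def)
 have "energy frequencies (fourier_integral f) = (\<integral>\<^sup>+\<eta>. energy lborel (line_transform (slice f \<eta>)) \<partial>count_space UNIV)"
  using fourier_integral_slice[OF strip_integrable[OF f supp]]
  unfolding energy_frequencies[OF fourier_integral_measurable[OF L2_measurable[OF f]]] by simp
 also have "... = (\<integral>\<^sup>+\<eta>. ennreal (2 * pi) * energy lborel (slice f \<eta>) \<partial>count_space UNIV)"
  using plancherel_compact_support[OF slice_L2[OF f], of "A + 1"] sl \<open>0 \<le> A\<close> by (intro nn_integral_cong) simp
 also have "... = ennreal (2 * pi) * (\<integral>\<^sup>+\<eta>. energy lborel (slice f \<eta>) \<partial>count_space UNIV)"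
  by (rule nn_integral_cmult) simp
 also have "(\<integral>\<^sup>+\<eta>. energy lborel (slice f \<eta>) \<partial>count_space UNIV) = ennreal (2 * pi) * energy cylinder f"
  using slice_parseval[OF f, of "\<lambda>_. 1"] by (simp add: energy_def)
 moreover have "ennreal ((2 * pi)\<^sup>2) = ennreal (2 * pi) * ennreal (2 * pi)"
  by (subst ennreal_mult[symmetric]) (auto simp: power2_eq_square)
 ultimately show ?thesis by (simp only: mult.assoc)
qed

text \<open>A multiple of an isometry that is given on an approximating sequence extends to the limit. It is applied to
 truncations, where the transforms are absolutely convergent integrals.\<close>

lemma isometry_extension:
 fixes c :: real
 assumes F: "\<And>n. F n \<in> L2 M" and lim: "L2_tendsto M F f"
  and G: "\<And>n. G n \<in> borel_measurable N"
  and e: "\<And>n. energy N (G n) = ennreal c * energy M (F n)"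
  and d: "\<And>m n. energy N (\<lambda>z. G m z - G n z) = ennreal c * energy M (\<lambda>z. F m z - F n z)"
  and c: "0 < c"
 shows "\<exists>g. L2_tendsto N G g" and "\<And>g. L2_tendsto N G g \<Longrightarrow> energy N g = ennreal c * energy M f"
  and "G n \<in> L2 N"
proof -
 have f: "f \<in> L2 M" and l: "(\<lambda>n. energy M (\<lambda>z. F n z - f z)) \<longlonglongrightarrow> 0"
  using lim by (auto simp: L2_tendsto_def')
 note [measurable] = L2_measurable[OF f] L2_measurable[OF F]
 have GL: "G n \<in> L2 N" for n using F[of n] G[of n] by (simp add: L2_iff_energy e ennreal_mult_less_top)
 then show "G n \<in> L2 N" .
 show "\<exists>g. L2_tendsto N G g"
 proof (rule L2_complete[OF GL])
  fix e :: real assume e: "0 < e"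
  then have "\<forall>\<^sub>F n in sequentially. energy M (\<lambda>z. F n z - f z) < ennreal (e / (4 * c))"
   using c by (intro order_tendstoD(2)[OF l]) simp
  then obtain N0 where N0: "\<And>n. n \<ge> N0 \<Longrightarrow> energy M (\<lambda>z. F n z - f z) < ennreal (e / (4 * c))"
   by (auto simp: eventually_sequentially)
  have "energy N (\<lambda>z. G m z - G n z) \<le> ennreal e" if "m \<ge> N0" "n \<ge> N0" for m n
  proof -
   have "energy M (\<lambda>z. F m z - F n z) = energy M (\<lambda>z. (F m z - f z) - (F n z - f z))" by simp
   also have "... \<le> 2 * (energy M (\<lambda>z. F m z - f z) + energy M (\<lambda>z. F n z - f z))"
    by (rule energy_diff_le2) measurable
   also have "... \<le> 2 * (ennreal (e / (4 * c)) + ennreal (e / (4 * c)))"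
    using N0 that by (intro mult_left_mono add_mono) (auto intro: less_imp_le)
   also have "... = ennreal (2 * (e / (4 * c) + e / (4 * c)))"
    using e c by (subst ennreal_mult) (auto simp del: ennreal_plus simp flip: ennreal_plus)
   finally have "ennreal c * energy M (\<lambda>z. F m z - F n z) \<le> ennreal c * ennreal (2 * (e / (4 * c) + e / (4 * c)))"
    by (rule mult_left_mono) simp
   also have "... = ennreal (c * (2 * (e / (4 * c) + e / (4 * c))))" using e c by (subst ennreal_mult) auto
   also have "c * (2 * (e / (4 * c) + e / (4 * c))) = e" using c by (simp add: field_simps)
   finally show ?thesis by (simp add: d)
  qed
  then show "\<exists>N0. \<forall>m\<ge>N0. \<forall>n\<ge>N0. energy N (\<lambda>z. G m z - G n z) \<le> ennreal e" by blast
 qed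
 fix g assume g: "L2_tendsto N G g"
 have "(\<lambda>n. energy N (G n)) \<longlonglongrightarrow> energy N g" by (rule L2_tendsto_energy[OF GL g])
 moreover have "(\<lambda>n. energy N (G n)) \<longlonglongrightarrow> ennreal c * energy M f"
  unfolding e by (intro ennreal_tendsto_cmult L2_tendsto_energy[OF F lim]) simp
 ultimately show "energy N g = ennreal c * energy M f" by (rule LIMSEQ_unique)
qed

definition x_trunc :: "nat \<Rightarrow> (real \<times> real \<Rightarrow> complex) \<Rightarrow> real \<times> real \<Rightarrow> complex" where
 "x_trunc n f = (\<lambda>(x, y). if \<bar>x\<bar> \<le> real n then f (x, y) else 0)"

lemma x_trunc_measurable [measurable]:
 assumes "f \<in> borel_measurable cylinder" shows "x_trunc n f \<in> borel_measurable cylinder"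
proof -
 have [measurable]: "f \<in> borel_measurable (lborel \<Otimes>\<^sub>M circle)" using assms by (simp add: cylinder_eq)
 show ?thesis unfolding x_trunc_def cylinder_eq by measurable
qed

lemma truncation_L2_tendsto:
 assumes f: "f \<in> L2 M" and F[measurable]: "\<And>n. F n \<in> borel_measurable M"
  and le: "\<And>n z. cmod (F n z) \<le> cmod (f z)"
  and ev: "\<And>z. \<forall>\<^sub>F n in sequentially. F n z = f z"
 shows "F n \<in> L2 M" "L2_tendsto M F f"
proof -
 note [measurable] = L2_measurable[OF f]
 show "F n \<in> L2 M" for n using energy_mono[of "F n" f M] le[of n] f F[of n]
  by (auto simp: L2_iff_energy intro: le_less_trans)
 have "(\<lambda>n. \<integral>\<^sup>+z. nsq (F n z - f z) \<partial>M) \<longlonglongrightarrow> (\<integral>\<^sup>+z. 0 \<partial>M)"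
 proof (rule nn_integral_dominated_convergence[where w="\<lambda>z. 4 * nsq (f z)"])
  show "(\<integral>\<^sup>+z. 4 * nsq (f z) \<partial>M) < \<infinity>"
   using f by (simp add: nn_integral_cmult L2_iff_energy energy_def ennreal_mult_less_top)
  show "AE z in M. nsq (F n z - f z) \<le> 4 * nsq (f z)" for n
  proof (rule AE_I2)
   fix z
   have "cmod (F n z - f z) \<le> 2 * cmod (f z)" using norm_triangle_ineq4[of "F n z" "f z"] le[of n z] by linarith
   then have "(cmod (F n z - f z))\<^sup>2 \<le> (2 * cmod (f z))\<^sup>2" by (intro power_mono) auto
   then have "nsq (F n z - f z) \<le> ennreal (4 * (cmod (f z))\<^sup>2)" by (intro ennreal_leI) (simp add: power_mult_distrib)
   then show "nsq (F n z - f z) \<le> 4 * nsq (f z)" by (simp add: ennreal_mult)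
  qed
  show "AE z in M. (\<lambda>n. nsq (F n z - f z)) \<longlonglongrightarrow> 0"
   by (rule AE_I2, rule tendsto_eventually, rule eventually_mono[OF ev]) simp
 qed measurable
 then show "L2_tendsto M F f" using f by (simp add: L2_tendsto_def)
qed

lemma x_trunc_L2:
 assumes f: "f \<in> L2 cylinder"
 shows "x_trunc n f \<in> L2 cylinder" "L2_tendsto cylinder (\<lambda>n. x_trunc n f) f"
proof -
 have ev: "\<forall>\<^sub>F n in sequentially. x_trunc n f z = f z" for z
 proof -
  obtain N where "\<bar>fst z\<bar> \<le> real N" using real_arch_simple by blast
  then have "\<forall>n\<ge>N. x_trunc n f z = f z" by (auto simp: x_trunc_def split: prod.splits)
  then show ?thesis by (auto simp: eventually_sequentially)
 qed
 have le: "cmod (x_trunc n f z) \<le> cmod (f z)" for n z by (auto simp: x_trunc_def split: prod.splits)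
 show "x_trunc n f \<in> L2 cylinder" "L2_tendsto cylinder (\<lambda>n. x_trunc n f) f"
  using truncation_L2_tendsto[OF f x_trunc_measurable[OF L2_measurable[OF f]] le ev] by auto
qed

lemma x_trunc_integrable:
 assumes f: "f \<in> L2 cylinder" shows "integrable cylinder (x_trunc n f)"
 by (rule strip_integrable[OF x_trunc_L2(1)[OF f], of "real n"]) (simp add: x_trunc_def)

text \<open>The transform is a multiple of an isometry on functions supported in a strip, hence it converges along truncations and
 inherits the energy identity.\<close>

lemma fourier_x_trunc:
 assumes f: "f \<in> L2 cylinder"
 shows fourier_L2_tendsto: "L2_tendsto frequencies (\<lambda>n. fourier_integral (x_trunc n f)) (fourier f)"
  and fourier_energy: "energy frequencies (fourier f) = ennreal ((2 * pi)\<^sup>2) * energy cylinder f"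
  and fourier_integral_x_trunc_L2: "fourier_integral (x_trunc n f) \<in> L2 frequencies"
proof -
 note tr = x_trunc_L2[OF f]
 have 1: "energy frequencies (fourier_integral (x_trunc n f)) = ennreal ((2 * pi)\<^sup>2) * energy cylinder (x_trunc n f)" for n
  by (rule plancherel_strip[OF tr(1), where A="real n"]) (auto simp: x_trunc_def)
 have 2: "energy frequencies (\<lambda>z. fourier_integral (x_trunc m f) z - fourier_integral (x_trunc n f) z)
  = ennreal ((2 * pi)\<^sup>2) * energy cylinder (\<lambda>z. x_trunc m f z - x_trunc n f z)" for m n
 proof -
  have "(\<lambda>z. fourier_integral (x_trunc m f) z - fourier_integral (x_trunc n f) z)
   = fourier_integral (\<lambda>z. x_trunc m f z - x_trunc n f z)"
   by (rule ext) (simp add: fourier_integral_diff x_trunc_integrable f)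
  moreover have "energy frequencies ... = ennreal ((2 * pi)\<^sup>2) * energy cylinder (\<lambda>z. x_trunc m f z - x_trunc n f z)"
   by (rule plancherel_strip[OF L2_diff[OF tr(1) tr(1)], where A="real (max m n)"]) (auto simp: x_trunc_def)
  ultimately show ?thesis by simp
 qed
 note ext = isometry_extension[where F="\<lambda>n. x_trunc n f" and G="\<lambda>n. fourier_integral (x_trunc n f)" and c="(2*pi)\<^sup>2" and N=frequencies,
   OF tr(1) tr(2) fourier_integral_measurable[OF L2_measurable[OF tr(1)]] 1 2]
 show "L2_tendsto frequencies (\<lambda>n. fourier_integral (x_trunc n f)) (fourier f)"
  unfolding fourier_def using someI_ex[OF ext(1)] by (simp add: x_trunc_def)
 then show "energy frequencies (fourier f) = ennreal ((2 * pi)\<^sup>2) * energy cylinder f" by (rule ext(2)[rotated]) simp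
 show "fourier_integral (x_trunc n f) \<in> L2 frequencies" by (rule ext(3)) simp
qed

lemma fourier_L2: "f \<in> L2 cylinder \<Longrightarrow> fourier f \<in> L2 frequencies"
 using fourier_L2_tendsto by (simp add: L2_tendsto_def)

section \<open>Fourier inversion\<close>

lemma inverse_character_integrable:
 assumes g: "integrable frequencies g"
 shows "integrable frequencies (\<lambda>(\<xi>, \<eta>). exp (\<i> * of_real (x * \<xi>) + \<i> * of_real (of_int \<eta> * y)) * g (\<xi>, \<eta>))"
proof (rule Bochner_Integration.integrable_bound[OF g])
 have [measurable]: "g \<in> borel_measurable (lborel \<Otimes>\<^sub>M count_space UNIV)" using g by (auto simp: frequencies_def)
 show "(\<lambda>(\<xi>, \<eta>). exp (\<i> * of_real (x * \<xi>) + \<i> * of_real (of_int \<eta> * y)) * g (\<xi>, \<eta>)) \<in> freq_measurable"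
  unfolding frequencies_def by measurable
qed (auto simp: norm_mult)

lemma inverse_fourier_integral_measurable:
 assumes "g \<in> freq_measurable"
 shows "inverse_fourier_integral g \<in> borel_measurable cylinder"
proof -
 have [measurable]: "g \<in> borel_measurable (lborel \<Otimes>\<^sub>M count_space UNIV)" using assms by (simp add: frequencies_def)
 interpret sigma_finite_measure "lborel \<Otimes>\<^sub>M count_space UNIV :: (real \<times> int) measure"
  using sigma_finite_frequencies by (simp add: frequencies_def)
 show ?thesis unfolding inverse_fourier_integral_def frequencies_def cylinder_eq by measurable
qed

lemma inverse_fourier_integral_diff:
 assumes "integrable frequencies f" "integrable frequencies g"
 shows "inverse_fourier_integral (\<lambda>q. f q - g q) z = inverse_fourier_integral f z - inverse_fourier_integral g z"
proof (cases z)
 case (Pair x y)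
 have "(\<integral>(\<xi>, \<eta>). exp (\<i> * of_real (x * \<xi>) + \<i> * of_real (of_int \<eta> * y)) * (f (\<xi>, \<eta>) - g (\<xi>, \<eta>)) \<partial>frequencies)
  = (\<integral>q. (case q of (\<xi>, \<eta>) \<Rightarrow> exp (\<i> * of_real (x * \<xi>) + \<i> * of_real (of_int \<eta> * y)) * f (\<xi>, \<eta>))
    - (case q of (\<xi>, \<eta>) \<Rightarrow> exp (\<i> * of_real (x * \<xi>) + \<i> * of_real (of_int \<eta> * y)) * g (\<xi>, \<eta>)) \<partial>frequencies)"
  by (intro Bochner_Integration.integral_cong refl) (auto simp: right_diff_distrib)
 also have "... = (\<integral>(\<xi>, \<eta>). exp (\<i> * of_real (x * \<xi>) + \<i> * of_real (of_int \<eta> * y)) * f (\<xi>, \<eta>) \<partial>frequencies)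
   - (\<integral>(\<xi>, \<eta>). exp (\<i> * of_real (x * \<xi>) + \<i> * of_real (of_int \<eta> * y)) * g (\<xi>, \<eta>) \<partial>frequencies)"
  by (intro Bochner_Integration.integral_diff inverse_character_integrable assms)
 finally show ?thesis unfolding Pair inverse_fourier_integral_def prod.case by (simp add: right_diff_distrib)
qed

lemma energy_frequencies_slice:
 assumes "g \<in> L2 frequencies"
 shows "(\<lambda>\<xi>. g (\<xi>, \<eta>)) \<in> L2 lborel"
proof -
 have gm: "g \<in> freq_measurable" using assms by (rule L2_measurable)
 then have [measurable]: "g \<in> borel_measurable (lborel \<Otimes>\<^sub>M count_space UNIV)" by (simp add: frequencies_def)
 have "energy lborel (\<lambda>\<xi>. g (\<xi>, \<eta>)) = (\<integral>\<^sup>+\<eta>'. energy lborel (\<lambda>\<xi>. g (\<xi>, \<eta>')) * indicator {\<eta>} \<eta>' \<partial>count_space UNIV)"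
  by simp
 also have "... \<le> energy frequencies g"
  unfolding energy_frequencies[OF gm] by (intro nn_integral_mono) (auto simp: indicator_def)
 also have "... < \<infinity>" using assms by (simp add: L2_iff_energy)
 finally show ?thesis by (simp add: L2_iff_energy)
qed

lemma box_indicator_measurable:
 fixes n :: int
 shows "(\<lambda>z. indicator {-A..A} (fst z) * indicator {-n..n} (snd z) :: complex) \<in> freq_measurable"
proof -
 have [measurable]: "(\<lambda>z. indicator {-n..n} (snd z) :: complex) \<in> borel_measurable (lborel \<Otimes>\<^sub>M count_space UNIV)"
  by (rule measurable_compose[OF measurable_snd]) simp
 show ?thesis unfolding frequencies_def by measurable
qed

lemma box_integrable:
 assumes g: "g \<in> L2 frequencies" and supp: "\<And>\<xi> \<eta>. \<not> (\<bar>\<xi>\<bar> \<le> A \<and> \<bar>\<eta>\<bar> \<le> n) \<Longrightarrow> g (\<xi>, \<eta>) = 0"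
 shows "integrable frequencies g"
proof -
 define b :: "real \<times> int \<Rightarrow> complex" where "b = (\<lambda>z. indicator {-A..A} (fst z) * indicator {-n..n} (snd z))"
 have bm: "b \<in> freq_measurable" unfolding b_def by (rule box_indicator_measurable)
 have "energy frequencies b = (\<integral>\<^sup>+\<eta>. (\<integral>\<^sup>+\<xi>. indicator {-A..A} \<xi> \<partial>lborel) * indicator {-n..n} \<eta> \<partial>count_space UNIV)"
  unfolding energy_frequencies[OF bm]
  by (intro nn_integral_cong) (auto simp: energy_def b_def indicator_def norm_mult intro!: nn_integral_cong)
 also have "... < \<infinity>" by (simp add: nn_integral_cmult ennreal_mult_less_top emeasure_lborel_Icc_eq of_nat_less_top)
 finally have b: "b \<in> L2 frequencies" using bm by (simp add: L2_iff_energy)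
 have eq: "g z * cnj (b z) = g z" for z
  using supp[of "fst z" "snd z"] by (cases "\<bar>fst z\<bar> \<le> A \<and> \<bar>snd z\<bar> \<le> n") (auto simp: b_def indicator_def)
 show ?thesis using L2_product_integrable[OF g b] by (simp only: eq)
qed

lemma inverse_fourier_integral_box:
 assumes g: "g \<in> L2 frequencies" and supp: "\<And>\<xi> \<eta>. \<not> (\<bar>\<xi>\<bar> \<le> A \<and> \<bar>\<eta>\<bar> \<le> n) \<Longrightarrow> g (\<xi>, \<eta>) = 0"
 shows "inverse_fourier_integral g (x, y) = 1 / (2 * of_real pi)\<^sup>2 *
  (\<Sum>\<eta>\<in>{-n..n}. line_transform (\<lambda>\<xi>. g (\<xi>, \<eta>)) (- x) * wave (of_int \<eta> * y))"
proof -
 have gi: "integrable frequencies g" by (rule box_integrable[OF g supp])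
 have "(\<integral>(\<xi>, \<eta>). exp (\<i> * of_real (x * \<xi>) + \<i> * of_real (of_int \<eta> * y)) * g (\<xi>, \<eta>) \<partial>frequencies)
  = (LINT \<eta>|count_space UNIV. LINT \<xi>|lborel. exp (\<i> * of_real (x * \<xi>) + \<i> * of_real (of_int \<eta> * y)) * g (\<xi>, \<eta>))"
  using line_int.integral_snd[of "\<lambda>\<xi> \<eta>. exp (\<i> * of_real (x * \<xi>) + \<i> * of_real (of_int \<eta> * y)) * g (\<xi>, \<eta>)"]
   inverse_character_integrable[OF gi, of x y] by (simp add: frequencies_def)
 also have "... = (LINT \<eta>|count_space UNIV. line_transform (\<lambda>\<xi>. g (\<xi>, \<eta>)) (- x) * wave (of_int \<eta> * y))"
 proof (rule Bochner_Integration.integral_cong[OF refl])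
  fix \<eta> :: int
  have "(LINT \<xi>|lborel. exp (\<i> * of_real (x * \<xi>) + \<i> * of_real (of_int \<eta> * y)) * g (\<xi>, \<eta>))
   = (LINT \<xi>|lborel. wave (of_int \<eta> * y) * (g (\<xi>, \<eta>) * cowave (\<xi> * (- x))))"
   by (intro Bochner_Integration.integral_cong refl) (simp add: exp_add mult_ac)
  then show "(LINT \<xi>|lborel. exp (\<i> * of_real (x * \<xi>) + \<i> * of_real (of_int \<eta> * y)) * g (\<xi>, \<eta>))
   = line_transform (\<lambda>\<xi>. g (\<xi>, \<eta>)) (- x) * wave (of_int \<eta> * y)"
   unfolding line_transform_def by (simp only: integral_mult_right_zero mult.commute)
 qed
 also have "... = (\<Sum>\<eta>\<in>{-n..n}. line_transform (\<lambda>\<xi>. g (\<xi>, \<eta>)) (- x) * wave (of_int \<eta> * y))"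
 proof -
  define h where "h \<eta> = line_transform (\<lambda>\<xi>. g (\<xi>, \<eta>)) (- x) * wave (of_int \<eta> * y)" for \<eta>
  have z: "h \<eta> = 0" if "\<eta> \<notin> {-n..n}" for \<eta>
  proof -
   have "g (\<xi>, \<eta>) = 0" for \<xi> using that by (intro supp) auto
   then show ?thesis by (simp add: line_transform_def h_def)
  qed
  have sub: "{\<eta>. h \<eta> \<noteq> 0} \<subseteq> {-n..n}" using z by blast
  then have "finite {\<eta>. h \<eta> \<noteq> 0}" by (rule finite_subset) simp
  then have "(LINT \<eta>|count_space UNIV. h \<eta>) = (\<Sum>\<eta> | h \<eta> \<noteq> 0. h \<eta>)"
   by (subst lebesgue_integral_count_space_finite_support) auto
  also have "... = (\<Sum>\<eta>\<in>{-n..n}. h \<eta>)" by (rule sum.mono_neutral_left) (use sub in auto)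
  finally show ?thesis unfolding h_def .
 qed
 finally show ?thesis unfolding inverse_fourier_integral_def prod.case by simp
qed

lemma energy_circle_trig:
 fixes a :: "int \<Rightarrow> complex"
 assumes "finite S"
 shows "energy circle (\<lambda>y. \<Sum>n\<in>S. a n * wave (of_int n * y)) = ennreal (2 * pi) * (\<Sum>n\<in>S. nsq (a n))"
proof -
 let ?p = "\<lambda>y. \<Sum>n\<in>S. a n * wave (of_int n * y)"
 have "(LINT y|circle. (cmod (?p y))\<^sup>2) = 2 * pi * (\<Sum>n\<in>S. (cmod (a n))\<^sup>2)"
  using trig_distance[OF L2_circle_bounded[of "\<lambda>_. 0" 0] assms, of a] by (simp add: circle_coeff_def)
 moreover have "energy circle ?p = ennreal (LINT y|circle. (cmod (?p y))\<^sup>2)"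
  using L2_circle_trig[OF assms, of a] unfolding energy_def L2_def by (intro nn_integral_eq_integral) auto
 ultimately show ?thesis by (simp add: ennreal_mult sum_nonneg sum_ennreal)
qed

text \<open>On a box in frequency the inverse transform is a finite sum over \<open>\<eta>\<close> of transforms on the line, so
 Plancherel's identity on the line can be used for each summand.\<close>

lemma inverse_plancherel_box:
 assumes g: "g \<in> L2 frequencies" and supp: "\<And>\<xi> \<eta>. \<not> (\<bar>\<xi>\<bar> \<le> A \<and> \<bar>\<eta>\<bar> \<le> n) \<Longrightarrow> g (\<xi>, \<eta>) = 0" and A: "0 \<le> A"
 shows "energy cylinder (inverse_fourier_integral g) = ennreal (1 / (2 * pi)\<^sup>2) * energy frequencies g"
proof -
 define p where "p = 2 * pi"
 have p: "0 < p" by (simp add: p_def)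
 have gm: "g \<in> freq_measurable" using g by (rule L2_measurable)
 then have [measurable]: "g \<in> borel_measurable (lborel \<Otimes>\<^sub>M count_space UNIV)" by (simp add: frequencies_def)
 have box: "inverse_fourier_integral g (x, y) = 1 / (2 * of_real pi)\<^sup>2 *
  (\<Sum>\<eta>\<in>{-n..n}. line_transform (\<lambda>\<xi>. g (\<xi>, \<eta>)) (- x) * wave (of_int \<eta> * y))" for x y
  by (rule inverse_fourier_integral_box[OF g]) (rule supp)
 have c2: "(cmod (1 / (2 * of_real pi)\<^sup>2))\<^sup>2 = 1 / p^4"
  by (simp add: p_def norm_divide norm_power norm_mult power_divide power_mult_distrib flip: power_mult)
 have "energy cylinder (inverse_fourier_integral g) = (\<integral>\<^sup>+x. energy circle (\<lambda>y. inverse_fourier_integral g (x, y)) \<partial>lborel)"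
  by (rule energy_cylinder[OF inverse_fourier_integral_measurable[OF gm]])
 also have "... = (\<integral>\<^sup>+x. ennreal (1 / p^4) * (ennreal p * (\<Sum>\<eta>\<in>{-n..n}. nsq (line_transform (\<lambda>\<xi>. g (\<xi>, \<eta>)) (- x)))) \<partial>lborel)"
 proof (rule nn_integral_cong)
  fix x
  show "energy circle (\<lambda>y. inverse_fourier_integral g (x, y))
   = ennreal (1 / p^4) * (ennreal p * (\<Sum>\<eta>\<in>{-n..n}. nsq (line_transform (\<lambda>\<xi>. g (\<xi>, \<eta>)) (- x))))"
   unfolding box by (subst energy_cmult, measurable) (simp only: c2 energy_circle_trig[OF finite_atLeastAtMost_int] p_def)
 qed
 also have "... = ennreal (1 / p^4) * (ennreal p * (\<Sum>\<eta>\<in>{-n..n}. \<integral>\<^sup>+x. nsq (line_transform (\<lambda>\<xi>. g (\<xi>, \<eta>)) (- x)) \<partial>lborel))"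
  by (simp add: nn_integral_cmult nn_integral_sum del: sum_ennreal)
 also have "(\<Sum>\<eta>\<in>{-n..n}. \<integral>\<^sup>+x. nsq (line_transform (\<lambda>\<xi>. g (\<xi>, \<eta>)) (- x)) \<partial>lborel)
  = (\<Sum>\<eta>\<in>{-n..n}. ennreal p * energy lborel (\<lambda>\<xi>. g (\<xi>, \<eta>)))"
 proof (rule sum.cong[OF refl])
  fix \<eta>
  have "(\<integral>\<^sup>+x. nsq (line_transform (\<lambda>\<xi>. g (\<xi>, \<eta>)) (- x)) \<partial>lborel) = energy lborel (line_transform (\<lambda>\<xi>. g (\<xi>, \<eta>)))"
   unfolding energy_def
   using nn_integral_real_affine[of "\<lambda>x. nsq (line_transform (\<lambda>\<xi>. g (\<xi>, \<eta>)) x)" "-1" 0] by simp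
  also have "... = ennreal p * energy lborel (\<lambda>\<xi>. g (\<xi>, \<eta>))" unfolding p_def
   by (rule plancherel_compact_support[OF energy_frequencies_slice[OF g], of "A + 1"]) (use A supp in auto)
  finally show "(\<integral>\<^sup>+x. nsq (line_transform (\<lambda>\<xi>. g (\<xi>, \<eta>)) (- x)) \<partial>lborel) = ennreal p * energy lborel (\<lambda>\<xi>. g (\<xi>, \<eta>))" .
 qed
 also have "... = ennreal p * (\<Sum>\<eta>\<in>{-n..n}. energy lborel (\<lambda>\<xi>. g (\<xi>, \<eta>)))"
  by (simp add: sum_distrib_left)
 also have "(\<Sum>\<eta>\<in>{-n..n}. energy lborel (\<lambda>\<xi>. g (\<xi>, \<eta>)))
   = (\<integral>\<^sup>+\<eta>. energy lborel (\<lambda>\<xi>. g (\<xi>, \<eta>)) * indicator {-n..n} \<eta> \<partial>count_space UNIV)"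
  by (subst nn_integral_indicator_finite) auto
 also have "... = energy frequencies g" unfolding energy_frequencies[OF gm]
 proof (rule nn_integral_cong)
  fix \<eta> :: int
  have "g (\<xi>, \<eta>) = 0" if "\<eta> \<notin> {-n..n}" for \<xi> using that by (intro supp) auto
  then show "energy lborel (\<lambda>\<xi>. g (\<xi>, \<eta>)) * indicator {-n..n} \<eta> = energy lborel (\<lambda>\<xi>. g (\<xi>, \<eta>))"
   by (cases "\<eta> \<in> {-n..n}") (auto simp: energy_def)
 qed
 also have "ennreal (1 / p^4) * (ennreal p * (ennreal p * energy frequencies g)) = ennreal (1 / p^4 * p * p) * energy frequencies g"
  using p by (subst ennreal_mult, simp, simp, subst ennreal_mult) (simp_all only: mult.assoc zero_le_divide_1_iff zero_le_power less_imp_le)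
 also have "1 / p^4 * p * p = 1 / p\<^sup>2" using p by (simp add: field_simps power2_eq_square power4_eq_xxxx)
 finally show ?thesis by (simp add: p_def)
qed

definition freq_trunc :: "nat \<Rightarrow> (real \<times> int \<Rightarrow> complex) \<Rightarrow> real \<times> int \<Rightarrow> complex" where
 "freq_trunc n g = (\<lambda>(\<xi>, \<eta>). if \<bar>\<xi>\<bar> \<le> real n \<and> \<bar>\<eta>\<bar> \<le> int n then g (\<xi>, \<eta>) else 0)"

lemma freq_trunc_L2:
 assumes g: "g \<in> L2 frequencies"
 shows "freq_trunc n g \<in> L2 frequencies" "L2_tendsto frequencies (\<lambda>n. freq_trunc n g) g"
proof -
 have eq: "freq_trunc n g = (\<lambda>z. (indicator {- real n..real n} (fst z) * indicator {- int n..int n} (snd z)) * g z)" for n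
  by (auto simp: freq_trunc_def indicator_def fun_eq_iff)
 have m: "freq_trunc n g \<in> freq_measurable" for n
  unfolding eq by (intro borel_measurable_times box_indicator_measurable L2_measurable[OF g])
 have ev: "\<forall>\<^sub>F n in sequentially. freq_trunc n g z = g z" for z
 proof -
  obtain N where N: "\<bar>fst z\<bar> \<le> real N" using real_arch_simple by blast
  have "\<forall>n\<ge>max N (nat \<bar>snd z\<bar>). freq_trunc n g z = g z"
   using N by (auto simp: freq_trunc_def split: prod.splits)
  then show ?thesis unfolding eventually_sequentially by blast
 qed
 have le: "cmod (freq_trunc n g z) \<le> cmod (g z)" for n z by (auto simp: freq_trunc_def split: prod.splits)
 show "freq_trunc n g \<in> L2 frequencies" "L2_tendsto frequencies (\<lambda>n. freq_trunc n g) g"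
  using truncation_L2_tendsto[OF g m le ev] by auto
qed

lemma freq_trunc_integrable:
 assumes g: "g \<in> L2 frequencies" shows "integrable frequencies (freq_trunc n g)"
 by (rule box_integrable[OF freq_trunc_L2(1)[OF g], where A="real n" and n="int n"]) (auto simp: freq_trunc_def)

lemma inverse_fourier_trunc:
 assumes g: "g \<in> L2 frequencies"
 shows inverse_fourier_L2_tendsto: "L2_tendsto cylinder (\<lambda>n. inverse_fourier_integral (freq_trunc n g)) (inverse_fourier g)"
  and inverse_fourier_energy: "energy cylinder (inverse_fourier g) = ennreal (1 / (2 * pi)\<^sup>2) * energy frequencies g"
  and inverse_fourier_integral_trunc_L2: "inverse_fourier_integral (freq_trunc n g) \<in> L2 cylinder"
proof -
 note tr = freq_trunc_L2[OF g]
 have 1: "energy cylinder (inverse_fourier_integral (freq_trunc n g)) = ennreal (1 / (2 * pi)\<^sup>2) * energy frequencies (freq_trunc n g)" for n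
  by (rule inverse_plancherel_box[OF tr(1), where A="real n" and n="int n"]) (auto simp: freq_trunc_def)
 have 2: "energy cylinder (\<lambda>z. inverse_fourier_integral (freq_trunc m g) z - inverse_fourier_integral (freq_trunc n g) z)
  = ennreal (1 / (2 * pi)\<^sup>2) * energy frequencies (\<lambda>z. freq_trunc m g z - freq_trunc n g z)" for m n
 proof -
  have "(\<lambda>z. inverse_fourier_integral (freq_trunc m g) z - inverse_fourier_integral (freq_trunc n g) z)
   = inverse_fourier_integral (\<lambda>z. freq_trunc m g z - freq_trunc n g z)"
   by (rule ext) (simp add: inverse_fourier_integral_diff freq_trunc_integrable g)
  moreover have "energy cylinder ... = ennreal (1 / (2 * pi)\<^sup>2) * energy frequencies (\<lambda>z. freq_trunc m g z - freq_trunc n g z)"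
   by (rule inverse_plancherel_box[OF L2_diff[OF tr(1) tr(1)], where A="real (max m n)" and n="int (max m n)"])
     (auto simp: freq_trunc_def)
  ultimately show ?thesis by simp
 qed
 note ext = isometry_extension[where F="\<lambda>n. freq_trunc n g" and G="\<lambda>n. inverse_fourier_integral (freq_trunc n g)"
   and c="1 / (2*pi)\<^sup>2" and N=cylinder,
   OF tr(1) tr(2) inverse_fourier_integral_measurable[OF L2_measurable[OF tr(1)]] 1 2]
 show "L2_tendsto cylinder (\<lambda>n. inverse_fourier_integral (freq_trunc n g)) (inverse_fourier g)"
  unfolding inverse_fourier_def using someI_ex[OF ext(1)] by (simp add: freq_trunc_def)
 then show "energy cylinder (inverse_fourier g) = ennreal (1 / (2 * pi)\<^sup>2) * energy frequencies g"
  by (rule ext(2)[rotated]) simp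
 show "inverse_fourier_integral (freq_trunc n g) \<in> L2 cylinder" by (rule ext(3)) simp
qed

lemma inverse_fourier_L2: "g \<in> L2 frequencies \<Longrightarrow> inverse_fourier g \<in> L2 cylinder"
 using inverse_fourier_L2_tendsto by (simp add: L2_tendsto_def)

lemma fourier_adjoint_integrable:
 assumes f: "integrable cylinder f" and g: "integrable frequencies g"
 shows "(LINT q|frequencies. fourier_integral f q * cnj (g q))
  = (2 * of_real pi)\<^sup>2 * (LINT z|cylinder. f z * cnj (inverse_fourier_integral g z))"
proof -
 define e :: "real \<times> real \<Rightarrow> real \<times> int \<Rightarrow> complex" where
  "e z q = exp (- \<i> * of_real (fst z * fst q) - \<i> * of_real (of_int (snd q) * snd z))" for z q
 have [measurable]: "f \<in> borel_measurable (lborel \<Otimes>\<^sub>M circle)" using f by (auto simp: cylinder_eq)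
 have [measurable]: "g \<in> borel_measurable (lborel \<Otimes>\<^sub>M count_space UNIV)" using g by (auto simp: frequencies_def)
 have m: "(\<lambda>(z, q). f z * e z q * cnj (g q)) \<in> borel_measurable (cylinder \<Otimes>\<^sub>M frequencies)"
  unfolding e_def cylinder_eq frequencies_def by measurable
 have int: "integrable (cylinder \<Otimes>\<^sub>M frequencies) (\<lambda>(z, q). f z * e z q * cnj (g q))"
 proof (rule integrableI_bounded[OF m])
  have "(\<integral>\<^sup>+p. ennreal (norm (case p of (z, q) \<Rightarrow> f z * e z q * cnj (g q))) \<partial>(cylinder \<Otimes>\<^sub>M frequencies))
   = (\<integral>\<^sup>+z. (\<integral>\<^sup>+q. ennreal (norm (f z * e z q * cnj (g q))) \<partial>frequencies) \<partial>cylinder)"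
   using m by (subst cyl_freq.M2.nn_integral_fst[symmetric]) (auto simp: case_prod_unfold)
  also have "... = (\<integral>\<^sup>+z. (\<integral>\<^sup>+q. ennreal (norm (f z)) * ennreal (norm (g q)) \<partial>frequencies) \<partial>cylinder)"
   by (intro nn_integral_cong) (simp add: e_def norm_mult ennreal_mult)
  also have "... = (\<integral>\<^sup>+z. ennreal (norm (f z)) \<partial>cylinder) * (\<integral>\<^sup>+q. ennreal (norm (g q)) \<partial>frequencies)"
   using borel_measurable_integrable[OF f] borel_measurable_integrable[OF g] by (simp add: nn_integral_cmult nn_integral_multc)
  also have "... < \<infinity>" using f g by (auto simp: integrable_iff_bounded ennreal_mult_less_top)
  finally show "(\<integral>\<^sup>+p. ennreal (norm (case p of (z, q) \<Rightarrow> f z * e z q * cnj (g q))) \<partial>(cylinder \<Otimes>\<^sub>M frequencies)) < \<infinity>" .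
 qed
 have F: "fourier_integral f q = (LINT z|cylinder. f z * e z q)" for q
  by (simp add: fourier_integral_def e_def case_prod_unfold)
 have I: "(2 * of_real pi)\<^sup>2 * inverse_fourier_integral g z = (LINT q|frequencies. cnj (e z q) * g q)" for z
  by (simp add: inverse_fourier_integral_def e_def case_prod_unfold exp_cnj)
 have "(LINT q|frequencies. fourier_integral f q * cnj (g q))
   = (LINT q|frequencies. LINT z|cylinder. f z * e z q * cnj (g q))" by (simp add: F integral_mult_left_zero)
 also have "... = (LINT z|cylinder. LINT q|frequencies. f z * e z q * cnj (g q))" using cyl_freq.Fubini_integral[OF int] .
 also have "... = (LINT z|cylinder. f z * cnj ((2 * of_real pi)\<^sup>2 * inverse_fourier_integral g z))"
 proof (rule Bochner_Integration.integral_cong[OF refl])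
  fix z
  have "(LINT q|frequencies. f z * e z q * cnj (g q)) = (LINT q|frequencies. f z * cnj (cnj (e z q) * g q))"
   by (rule Bochner_Integration.integral_cong) simp_all
  also have "... = f z * (LINT q|frequencies. cnj (cnj (e z q) * g q))" by (rule integral_mult_right_zero)
  also have "(LINT q|frequencies. cnj (cnj (e z q) * g q)) = cnj (LINT q|frequencies. cnj (e z q) * g q)"
   by (rule Bochner_Integration.integral_cnj)
  finally show "(LINT q|frequencies. f z * e z q * cnj (g q))
   = f z * cnj ((2 * of_real pi)\<^sup>2 * inverse_fourier_integral g z)" unfolding I .
 qed
 also have "... = (LINT z|cylinder. (2 * of_real pi)\<^sup>2 * (f z * cnj (inverse_fourier_integral g z)))"
  by (simp add: mult_ac)
 also have "... = (2 * of_real pi)\<^sup>2 * (LINT z|cylinder. f z * cnj (inverse_fourier_integral g z))"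
  by (rule integral_mult_right_zero)
 finally show ?thesis .
qed

text \<open>For integrable functions the adjoint relation is Fubini's theorem; both sides are continuous in the norm.\<close>

lemma fourier_adjoint:
 assumes f: "f \<in> L2 cylinder" and g: "g \<in> L2 frequencies"
 shows "(LINT q|frequencies. fourier f q * cnj (g q)) = (2 * of_real pi)\<^sup>2 * (LINT z|cylinder. f z * cnj (inverse_fourier g z))"
proof -
 have step: "(LINT q|frequencies. fourier f q * cnj (freq_trunc n g q))
   = (2 * of_real pi)\<^sup>2 * (LINT z|cylinder. f z * cnj (inverse_fourier_integral (freq_trunc n g) z))" for n
 proof (rule LIMSEQ_unique)
  show "(\<lambda>m. LINT q|frequencies. fourier_integral (x_trunc m f) q * cnj (freq_trunc n g q))
    \<longlonglongrightarrow> (LINT q|frequencies. fourier f q * cnj (freq_trunc n g q))"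
   by (rule L2_tendsto_inner[OF fourier_integral_x_trunc_L2[OF f] fourier_L2_tendsto[OF f] freq_trunc_L2(1)[OF g]])
  show "(\<lambda>m. LINT q|frequencies. fourier_integral (x_trunc m f) q * cnj (freq_trunc n g q))
    \<longlonglongrightarrow> (2 * of_real pi)\<^sup>2 * (LINT z|cylinder. f z * cnj (inverse_fourier_integral (freq_trunc n g) z))"
   unfolding fourier_adjoint_integrable[OF x_trunc_integrable[OF f] freq_trunc_integrable[OF g]]
   by (intro tendsto_mult tendsto_const
     L2_tendsto_inner[OF x_trunc_L2(1)[OF f] x_trunc_L2(2)[OF f] inverse_fourier_integral_trunc_L2[OF g]])
 qed
 have cj: "(LINT z|M. a z * cnj (b z)) = cnj (LINT z|M. b z * cnj (a z))" for M :: "'c measure" and a b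
 proof -
  have "(LINT z|M. a z * cnj (b z)) = (LINT z|M. cnj (b z * cnj (a z)))" by (rule Bochner_Integration.integral_cong) simp_all
  also have "... = cnj (LINT z|M. b z * cnj (a z))" by (rule Bochner_Integration.integral_cnj)
  finally show ?thesis .
 qed
 show ?thesis
 proof (rule LIMSEQ_unique)
  show "(\<lambda>n. LINT q|frequencies. fourier f q * cnj (freq_trunc n g q))
    \<longlonglongrightarrow> (LINT q|frequencies. fourier f q * cnj (g q))" unfolding cj[of frequencies "fourier f"]
   by (intro tendsto_cnj L2_tendsto_inner[OF freq_trunc_L2(1)[OF g] freq_trunc_L2(2)[OF g] fourier_L2[OF f]])
  show "(\<lambda>n. LINT q|frequencies. fourier f q * cnj (freq_trunc n g q))
    \<longlonglongrightarrow> (2 * of_real pi)\<^sup>2 * (LINT z|cylinder. f z * cnj (inverse_fourier g z))"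
   unfolding step cj[of cylinder f] by (intro tendsto_mult tendsto_const tendsto_cnj
     L2_tendsto_inner[OF inverse_fourier_integral_trunc_L2[OF g] inverse_fourier_L2_tendsto[OF g] f])
 qed
qed

text \<open>Both transforms are multiples of isometries and adjoint to each other. Expanding the squared norm of the difference
 between \<open>g\<close> and the transform of its inverse transform, all terms cancel.\<close>

theorem fourier_inverse_fourier:
 assumes g: "g \<in> L2 frequencies"
 shows "AE q in frequencies. fourier (inverse_fourier g) q = g q"
proof -
 define f where "f = inverse_fourier g"
 have f: "f \<in> L2 cylinder" unfolding f_def by (rule inverse_fourier_L2[OF g])
 define F where "F = fourier f"
 have F: "F \<in> L2 frequencies" unfolding F_def by (rule fourier_L2[OF f])
 define a where "a = (LINT z|cylinder. (cmod (f z))\<^sup>2)"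
 define b where "b = (LINT z|frequencies. (cmod (g z))\<^sup>2)"
 define c where "c = (LINT z|frequencies. (cmod (F z))\<^sup>2)"
 have nn: "energy M h = ennreal (LINT z|M. (cmod (h z))\<^sup>2)" if "h \<in> L2 M" for h and M :: "'c measure"
  using that unfolding energy_def L2_def by (intro nn_integral_eq_integral) auto
 have pos: "0 \<le> a" "0 \<le> b" "0 \<le> c" unfolding a_def b_def c_def by simp_all
 have "ennreal a = ennreal (1 / (2 * pi)\<^sup>2 * b)"
  using inverse_fourier_energy[OF g] unfolding f_def[symmetric] nn[OF f] nn[OF g] a_def[symmetric] b_def[symmetric]
  using pos by (subst ennreal_mult) auto
 then have ab: "(2 * pi)\<^sup>2 * a = b" using pos by (simp add: field_simps)
 have "ennreal c = ennreal ((2 * pi)\<^sup>2 * a)"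
  using fourier_energy[OF f] unfolding F_def[symmetric] nn[OF f] nn[OF F] a_def[symmetric] c_def[symmetric]
  using pos by (subst ennreal_mult) auto
 then have cb: "c = b" using pos ab by simp
 have Fg: "(LINT z|frequencies. F z * cnj (g z)) = of_real b"
  using fourier_adjoint[OF f g] unfolding F_def[symmetric] f_def[symmetric] inner_self a_def[symmetric] ab[symmetric] by simp
 have "(LINT z|frequencies. g z * cnj (F z)) = (LINT z|frequencies. cnj (F z * cnj (g z)))"
  by (rule Bochner_Integration.integral_cong) simp_all
 also have "... = of_real b" by (subst Bochner_Integration.integral_cnj) (simp add: Fg)
 finally have gF: "(LINT z|frequencies. g z * cnj (F z)) = of_real b" .
 have "complex_of_real (LINT z|frequencies. (cmod (F z - g z))\<^sup>2) = (LINT z|frequencies. (F z - g z) * cnj (F z - g z))"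
  by (rule inner_self[symmetric])
 also have "... = (LINT z|frequencies. (F z * cnj (F z) - F z * cnj (g z)) - (g z * cnj (F z) - g z * cnj (g z)))"
  by (simp add: algebra_simps)
 also have "... = 0" by (simp only: Bochner_Integration.integral_diff[OF
     Bochner_Integration.integrable_diff[OF L2_product_integrable[OF F F] L2_product_integrable[OF F g]]
     Bochner_Integration.integrable_diff[OF L2_product_integrable[OF g F] L2_product_integrable[OF g g]]]
    Bochner_Integration.integral_diff[OF L2_product_integrable[OF F F] L2_product_integrable[OF F g]]
    Bochner_Integration.integral_diff[OF L2_product_integrable[OF g F] L2_product_integrable[OF g g]]
    Fg gF inner_self c_def[symmetric] b_def[symmetric] cb) simp
 finally have "energy frequencies (\<lambda>z. F z - g z) = 0" using nn[OF L2_diff[OF F g]] by simp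
 then have "AE z in frequencies. F z - g z = 0" by (rule energy_eq_0_imp_AE[OF L2_measurable[OF L2_diff[OF F g]]])
 then show ?thesis by (simp add: F_def f_def)
qed

section \<open>Finite differences of quadratic phases\<close>

text \<open>The \<open>n\<close>-th forward difference of a sequence, started at the index \<open>k\<close>.\<close>

primrec fdiff :: "nat \<Rightarrow> (nat \<Rightarrow> complex) \<Rightarrow> nat \<Rightarrow> complex" where
 "fdiff 0 a k = a k"
| "fdiff (Suc n) a k = fdiff n a (Suc k) - fdiff n a k"

lemma fdiff_shift: "fdiff n (\<lambda>j. a (Suc j)) k = fdiff n a (Suc k)" by (induction n arbitrary: k) auto

lemma fdiff_add: "fdiff n (\<lambda>j. a j + b j) k = fdiff n a k + fdiff n b k" by (induction n arbitrary: k) auto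

lemma fdiff_diff: "fdiff n (\<lambda>j. a j - b j) k = fdiff n a k - fdiff n b k" by (induction n arbitrary: k) auto

lemma fdiff_cmult: "fdiff n (\<lambda>j. c * a j) k = c * fdiff n a k"
 by (induction n arbitrary: k) (auto simp: right_diff_distrib)

lemma fdiff_zero: "fdiff n (\<lambda>j. 0) k = 0" by (induction n arbitrary: k) auto

lemma fdiff_sum: "fdiff n (\<lambda>j. \<Sum>i\<in>I. a i j) k = (\<Sum>i\<in>I. fdiff n (a i) k)"
 by (induction I rule: infinite_finite_induct) (auto simp: fdiff_zero fdiff_add)

lemma fdiff_fdiff: "fdiff m (fdiff n a) k = fdiff (m + n) a k" by (induction m arbitrary: k) auto

lemma fdiff_cong: "(\<And>j. k \<le> j \<Longrightarrow> j \<le> k + n \<Longrightarrow> a j = b j) \<Longrightarrow> fdiff n a k = fdiff n b k"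
 by (induction n arbitrary: k) auto

lemma fdiff_bound: "cmod (fdiff n a k) \<le> 2 ^ n * (\<Sum>l\<le>n. cmod (a (k + l)))"
proof (induction n arbitrary: k)
 case (Suc n)
 have 1: "(\<Sum>l\<le>n. cmod (a (Suc k + l))) \<le> (\<Sum>l\<le>Suc n. cmod (a (k + l)))"
  by (simp add: sum.atMost_Suc_shift del: sum.atMost_Suc)
 have 2: "(\<Sum>l\<le>n. cmod (a (k + l))) \<le> (\<Sum>l\<le>Suc n. cmod (a (k + l)))" by simp
 have "cmod (fdiff (Suc n) a k) \<le> cmod (fdiff n a (Suc k)) + cmod (fdiff n a k)" by (simp add: norm_triangle_ineq4)
 also have "... \<le> 2 ^ n * (\<Sum>l\<le>Suc n. cmod (a (k + l))) + 2 ^ n * (\<Sum>l\<le>Suc n. cmod (a (k + l)))"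
  by (intro add_mono order_trans[OF Suc] mult_left_mono 1 2) auto
 finally show ?case by simp
qed auto

lemma sum_binomial_Suc:
 fixes f :: "nat \<Rightarrow> complex"
 shows "(\<Sum>i\<le>Suc n. of_nat (Suc n choose i) * f i)
  = (\<Sum>i\<le>n. of_nat (n choose i) * f (Suc i)) + (\<Sum>i\<le>n. of_nat (n choose i) * f i)"
proof -
 have "(\<Sum>i\<le>Suc n. of_nat (Suc n choose i) * f i)
   = (\<Sum>i\<le>n. of_nat (n choose i) * f (Suc i)) + (f 0 + (\<Sum>i\<le>n. of_nat (n choose Suc i) * f (Suc i)))"
  by (simp add: sum.atMost_Suc_shift distrib_right sum.distrib del: sum.atMost_Suc)
 also have "f 0 + (\<Sum>i\<le>n. of_nat (n choose Suc i) * f (Suc i)) = (\<Sum>i\<le>Suc n. of_nat (n choose i) * f i)"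
  by (simp add: sum.atMost_Suc_shift del: sum.atMost_Suc)
 also have "... = (\<Sum>i\<le>n. of_nat (n choose i) * f i)" by simp
 finally show ?thesis .
qed

text \<open>The discrete Leibniz rule; the shift of the index in the first factor is what distinguishes it from the rule for
 derivatives.\<close>

lemma fdiff_leibniz:
 "fdiff n (\<lambda>j. a j * b j) k = (\<Sum>i\<le>n. of_nat (n choose i) * (fdiff i a k * fdiff (n - i) b (k + i)))"
proof (induction n arbitrary: k)
 case (Suc n)
 have step: "fdiff i a (Suc k) * fdiff (n - i) b (Suc k + i) - fdiff i a k * fdiff (n - i) b (k + i)
  = fdiff (Suc i) a k * fdiff (Suc n - Suc i) b (k + Suc i) + fdiff i a k * fdiff (Suc n - i) b (k + i)"
  if "i \<le> n" for i using that by (simp add: Suc_diff_le algebra_simps)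
 have "fdiff (Suc n) (\<lambda>j. a j * b j) k = (\<Sum>i\<le>n. of_nat (n choose i) *
   (fdiff i a (Suc k) * fdiff (n - i) b (Suc k + i) - fdiff i a k * fdiff (n - i) b (k + i)))"
  by (simp add: Suc.IH sum_subtractf right_diff_distrib)
 also have "... = (\<Sum>i\<le>n. of_nat (n choose i) *
   (fdiff (Suc i) a k * fdiff (Suc n - Suc i) b (k + Suc i) + fdiff i a k * fdiff (Suc n - i) b (k + i)))"
  by (intro sum.cong refl) (simp only: step atMost_iff)
 also have "... = (\<Sum>i\<le>Suc n. of_nat (Suc n choose i) * (fdiff i a k * fdiff (Suc n - i) b (k + i)))"
  by (subst sum_binomial_Suc) (simp only: distrib_left sum.distrib)
 finally show ?case .
qed simp

lemma fdiff_power_eq_0: "p < n \<Longrightarrow> fdiff n (\<lambda>j. of_nat j ^ p) k = 0"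
proof (induction n arbitrary: p k)
 case (Suc n)
 have "(of_nat (Suc j) ^ p :: complex) - of_nat j ^ p = (\<Sum>q<p. of_nat (p choose q) * of_nat j ^ q)" for j
 proof -
  have "(of_nat j + 1 :: complex) ^ p = (\<Sum>q\<le>p. of_nat (p choose q) * of_nat j ^ q * 1 ^ (p - q))"
   by (rule binomial_ring)
  also have "... = (\<Sum>q<p. of_nat (p choose q) * of_nat j ^ q) + of_nat j ^ p" by (simp add: lessThan_Suc_atMost[symmetric])
  finally show ?thesis by (simp add: add.commute)
 qed
 then have "fdiff (Suc n) (\<lambda>j. of_nat j ^ p) k = fdiff n (\<lambda>j. \<Sum>q<p. of_nat (p choose q) * of_nat j ^ q) k"
  by (simp only: fdiff.simps fdiff_shift[symmetric] fdiff_diff[symmetric])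
 also have "... = (\<Sum>q<p. of_nat (p choose q) * fdiff n (\<lambda>j. of_nat j ^ q) k)" by (simp add: fdiff_sum fdiff_cmult)
 also have "... = 0" using Suc by (intro sum.neutral) auto
 finally show ?case .
qed simp

text \<open>Differences of order at least \<open>2 m\<close> annihilate the Taylor polynomial of the exponential of order \<open>m
 - 1\<close>, because its terms are polynomials in \<open>j\<close> of degree at most \<open>2 m - 2\<close>. What
 remains is of order \<open>m\<close> in the coefficients.\<close>

lemma fdiff_chirp_bound:
 fixes m n K :: nat
 assumes m: "1 \<le> m" and n: "2 * m \<le> n"
 shows "\<exists>C\<ge>0. \<forall>A B :: real. \<forall>k\<le>K.
  cmod (fdiff n (\<lambda>j. wave (real j * A + (real j)\<^sup>2 * B)) k) \<le> C * min 1 (\<bar>A\<bar> + \<bar>B\<bar>) ^ m"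
proof (intro exI conjI allI impI)
 define L where "L = real ((K + n)\<^sup>2)"
 define C where "C = 2 ^ n * real (Suc n) * max 1 (L ^ m)"
 show "0 \<le> C" unfolding C_def by simp
 fix A B :: real and k assume k: "k \<le> K"
 define s where "s = \<bar>A\<bar> + \<bar>B\<bar>"
 have s: "0 \<le> s" by (simp add: s_def)
 define u where "u j = real j * A + (real j)\<^sup>2 * B" for j
 show "cmod (fdiff n (\<lambda>j. wave (real j * A + (real j)\<^sup>2 * B)) k) \<le> C * min 1 (\<bar>A\<bar> + \<bar>B\<bar>) ^ m"
 proof (cases "1 \<le> s")
  case True
  have "cmod (fdiff n (\<lambda>j. wave (u j)) k) \<le> 2 ^ n * (\<Sum>l\<le>n. 1)" by (rule order_trans[OF fdiff_bound]) simp
  also have "... \<le> C" unfolding C_def by simp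
  finally show ?thesis using True by (simp add: s_def u_def)
 next
  case False
  (* Taylor polynomial of the exponential at 0; it has degree at most 2 m - 2 in j. *)
  define T where "T j = (\<Sum>p\<le>m - 1. (\<i> * of_real (u j)) ^ p / fact p)" for j
  have T0: "fdiff n T k = 0"
  proof -
   have "T j = (\<Sum>p\<le>m - 1. \<Sum>q\<le>p. (\<i> ^ p / fact p * of_nat (p choose q) * of_real A ^ q * of_real B ^ (p - q)) * of_nat j ^ (2 * p - q))" for j
    unfolding T_def
   proof (rule sum.cong[OF refl])
    fix p
    have "(\<i> * complex_of_real (u j)) ^ p = \<i> ^ p * (of_nat j * of_real A + (of_nat j)\<^sup>2 * of_real B) ^ p"
     by (simp add: u_def power_mult_distrib)
    also have "(of_nat j * complex_of_real A + (of_nat j)\<^sup>2 * of_real B) ^ p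
     = (\<Sum>q\<le>p. of_nat (p choose q) * (of_nat j * of_real A) ^ q * ((of_nat j)\<^sup>2 * of_real B) ^ (p - q))"
     by (rule binomial_ring)
    also have "... = (\<Sum>q\<le>p. of_nat (p choose q) * of_real A ^ q * of_real B ^ (p - q) * of_nat j ^ (2 * p - q))"
    proof (rule sum.cong[OF refl])
     fix q assume "q \<in> {..p}"
     then have e: "2 * p - q = q + 2 * (p - q)" by auto
     show "of_nat (p choose q) * (of_nat j * complex_of_real A) ^ q * ((of_nat j)\<^sup>2 * of_real B) ^ (p - q)
      = of_nat (p choose q) * of_real A ^ q * of_real B ^ (p - q) * of_nat j ^ (2 * p - q)"
      unfolding e power_add power_mult power_mult_distrib by (simp add: mult_ac)
    qed
    finally show "(\<i> * complex_of_real (u j)) ^ p / fact p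
     = (\<Sum>q\<le>p. (\<i> ^ p / fact p * of_nat (p choose q) * of_real A ^ q * of_real B ^ (p - q)) * of_nat j ^ (2 * p - q))"
     by (simp add: sum_distrib_left sum_divide_distrib mult_ac)
   qed
   then have T: "T = (\<lambda>j. \<Sum>p\<le>m - 1. \<Sum>q\<le>p. (\<i> ^ p / fact p * of_nat (p choose q) * of_real A ^ q * of_real B ^ (p - q)) * of_nat j ^ (2 * p - q))"
    by (rule ext)
   have "fdiff n T k = (\<Sum>p\<le>m - 1. \<Sum>q\<le>p. (\<i> ^ p / fact p * of_nat (p choose q) * of_real A ^ q * of_real B ^ (p - q))
     * fdiff n (\<lambda>j. of_nat j ^ (2 * p - q)) k)" unfolding T by (simp only: fdiff_sum fdiff_cmult)
   also have "... = 0" using m n by (intro sum.neutral ballI, subst fdiff_power_eq_0) auto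
   finally show ?thesis .
  qed
  have rem: "cmod (wave (u (k + l)) - T (k + l)) \<le> L ^ m * s ^ m" if l: "l \<le> n" for l
  proof -
   define j where "j = k + l"
   have "real j \<le> (real j)\<^sup>2" by (cases j) (auto simp: power2_eq_square)
   then have "\<bar>u j\<bar> \<le> (real j)\<^sup>2 * s" unfolding u_def s_def distrib_left
    by (intro order_trans[OF abs_triangle_ineq] add_mono) (auto simp: abs_mult intro!: mult_right_mono)
   also have "... \<le> L * s"
   proof (rule mult_right_mono[OF _ s])
    have "(real j)\<^sup>2 \<le> (real (K + n))\<^sup>2" using k l by (intro power_mono) (auto simp: j_def)
    then show "(real j)\<^sup>2 \<le> L" by (simp add: L_def)
   qed
   finally have uj: "\<bar>u j\<bar> \<le> L * s" .
   have "cmod (wave (u j) - T j)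
    \<le> exp \<bar>Re (\<i> * of_real (u j))\<bar> * cmod (\<i> * of_real (u j)) ^ Suc (m - 1) / fact (m - 1)"
    unfolding T_def by (rule Taylor_exp)
   also have "... = \<bar>u j\<bar> ^ m / fact (m - 1)" using m by (simp add: norm_mult)
   also have "... \<le> \<bar>u j\<bar> ^ m / 1" by (intro divide_left_mono) auto
   also have "... \<le> (L * s) ^ m" using uj by (auto intro: power_mono)
   finally show ?thesis by (simp add: j_def power_mult_distrib)
  qed
  have "fdiff n (\<lambda>j. wave (u j)) k = fdiff n (\<lambda>j. wave (u j) - T j) k" by (simp add: fdiff_diff T0)
  also have "cmod ... \<le> 2 ^ n * (\<Sum>l\<le>n. cmod (wave (u (k + l)) - T (k + l)))" by (rule fdiff_bound)
  also have "... \<le> 2 ^ n * (\<Sum>l\<le>n. L ^ m * s ^ m)" by (intro mult_left_mono sum_mono rem) auto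
  also have "... = (2 ^ n * real (Suc n) * L ^ m) * s ^ m" by simp
  also have "... \<le> C * s ^ m" unfolding C_def using s by (intro mult_right_mono mult_left_mono) auto
  finally show ?thesis using False by (simp add: s_def u_def min_def)
 qed
qed

text \<open>In the Leibniz rule for a difference of order \<open>3 m\<close>, either at least \<open>m\<close> differences fall on
 \<open>a\<close> or at least \<open>2 m\<close> of them fall on the quadratic phase, where
 \<open>fdiff_chirp_bound\<close> applies. This is the reason for the order \<open>3 m\<close>.\<close>

lemma fdiff_chirp_mult:
 fixes m :: nat
 assumes m: "1 \<le> m"
 shows "\<exists>C\<ge>0. \<forall>(A :: real) (B :: real) a.
  cmod (fdiff (3 * m) (\<lambda>j. wave (real j * A + (real j)\<^sup>2 * B) * a j) 0)
  \<le> C * ((\<Sum>l\<le>3 * m. cmod (fdiff m a l)) + min 1 (\<bar>A\<bar> + \<bar>B\<bar>) ^ m * (\<Sum>l\<le>3 * m. cmod (a l)))"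
proof -
 define N where "N = 3 * m"
 have "\<forall>n. \<exists>C. 0 \<le> C \<and> (2 * m \<le> n \<longrightarrow> (\<forall>A B :: real. \<forall>k\<le>N.
  cmod (fdiff n (\<lambda>j. wave (real j * A + (real j)\<^sup>2 * B)) k) \<le> C * min 1 (\<bar>A\<bar> + \<bar>B\<bar>) ^ m))"
  (is "\<forall>n. \<exists>C. ?P n C")
 proof
  fix n show "\<exists>C. ?P n C"
  proof (cases "2 * m \<le> n")
   case True
   from fdiff_chirp_bound[OF m True, of N] show ?thesis by blast
  next
   case False then show ?thesis by (intro exI[of _ 0]) simp
  qed
 qed
 then obtain c where "\<forall>n. ?P n (c n)" by (rule choice[THEN exE])
 then have c0: "0 \<le> c n" and c: "2 * m \<le> n \<Longrightarrow> k \<le> N \<Longrightarrow>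
  cmod (fdiff n (\<lambda>j. wave (real j * A + (real j)\<^sup>2 * B)) k) \<le> c n * min 1 (\<bar>A\<bar> + \<bar>B\<bar>) ^ m"
  for n A B k by blast+
 define C where "C = (\<Sum>i\<le>N. real (N choose i) * (2 ^ N * (2 ^ N * real (Suc N)) + 2 ^ N * c (N - i)))"
 show ?thesis
 proof (intro exI[of _ C] conjI allI)
  show "0 \<le> C" unfolding C_def by (intro sum_nonneg mult_nonneg_nonneg add_nonneg_nonneg c0) auto
  fix A B :: real and a :: "nat \<Rightarrow> complex"
  define b where "b j = wave (real j * A + (real j)\<^sup>2 * B)" for j
  define \<mu> where "\<mu> = min 1 (\<bar>A\<bar> + \<bar>B\<bar>) ^ m"
  have \<mu>: "0 \<le> \<mu>" unfolding \<mu>_def by simp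
  define S1 where "S1 = (\<Sum>l\<le>N. cmod (fdiff m a l))"
  define S0 where "S0 = (\<Sum>l\<le>N. cmod (a l))"
  have S: "0 \<le> S1" "0 \<le> S0" unfolding S1_def S0_def by (auto intro: sum_nonneg)
  have bb: "cmod (fdiff n b k) \<le> 2 ^ N * real (Suc N)" if "n \<le> N" for n k
  proof -
   have "cmod (fdiff n b k) \<le> 2 ^ n * (\<Sum>l\<le>n. cmod (b (k + l)))" by (rule fdiff_bound)
   also have "... = 2 ^ n * real (Suc n)" by (simp add: b_def)
   also have "... \<le> 2 ^ N * real (Suc N)" using that by (intro mult_mono power_increasing) auto
   finally show ?thesis .
  qed
  have partial: "(\<Sum>l\<le>p. cmod (g l)) \<le> (\<Sum>l\<le>N. cmod (g l))" if "p \<le> N" for p and g :: "nat \<Rightarrow> complex"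
   using that by (intro sum_mono2) auto
  have summand: "cmod (fdiff i a 0 * fdiff (N - i) b (0 + i))
   \<le> (2 ^ N * (2 ^ N * real (Suc N)) + 2 ^ N * c (N - i)) * (S1 + \<mu> * S0)" if i: "i \<le> N" for i
  proof (cases "m \<le> i")
   case True
   have "cmod (fdiff i a 0) = cmod (fdiff (i - m) (fdiff m a) 0)" using True by (simp add: fdiff_fdiff)
   also have "... \<le> 2 ^ (i - m) * (\<Sum>l\<le>i - m. cmod (fdiff m a (0 + l)))" by (rule fdiff_bound)
   also have "... \<le> 2 ^ N * S1" unfolding S1_def add_0 using i
    by (intro mult_mono power_increasing partial) (auto intro: sum_nonneg)
   finally have "cmod (fdiff i a 0 * fdiff (N - i) b (0 + i)) \<le> (2 ^ N * S1) * (2 ^ N * real (Suc N))"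
    unfolding norm_mult using S by (intro mult_mono bb) auto
   also have "... = (2 ^ N * (2 ^ N * real (Suc N))) * S1" by simp
   also have "... \<le> (2 ^ N * (2 ^ N * real (Suc N)) + 2 ^ N * c (N - i)) * (S1 + \<mu> * S0)"
    using S \<mu> c0[of "N - i"] by (intro mult_mono) auto
   finally show ?thesis .
  next
   case False
   have "cmod (fdiff i a 0) \<le> 2 ^ i * (\<Sum>l\<le>i. cmod (a (0 + l)))" by (rule fdiff_bound)
   also have "... \<le> 2 ^ N * S0" unfolding S0_def add_0 using i
    by (intro mult_mono power_increasing partial) (auto intro: sum_nonneg)
   finally have 1: "cmod (fdiff i a 0) \<le> 2 ^ N * S0" .
   have "2 * m \<le> N - i" using False by (simp add: N_def)
   then have 2: "cmod (fdiff (N - i) b (0 + i)) \<le> c (N - i) * \<mu>" unfolding b_def \<mu>_def using i by (intro c) auto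
   have "cmod (fdiff i a 0 * fdiff (N - i) b (0 + i)) \<le> (2 ^ N * S0) * (c (N - i) * \<mu>)"
    unfolding norm_mult using S by (intro mult_mono 1 2) auto
   also have "... = (2 ^ N * c (N - i)) * (\<mu> * S0)" by simp
   also have "... \<le> (2 ^ N * (2 ^ N * real (Suc N)) + 2 ^ N * c (N - i)) * (S1 + \<mu> * S0)"
    using S \<mu> c0[of "N - i"] by (intro mult_mono) auto
   finally show ?thesis .
  qed
  have "fdiff N (\<lambda>j. b j * a j) 0 = fdiff N (\<lambda>j. a j * b j) 0" by (simp add: mult.commute)
  also have "... = (\<Sum>i\<le>N. of_nat (N choose i) * (fdiff i a 0 * fdiff (N - i) b (0 + i)))" by (rule fdiff_leibniz)
  also have "cmod ... \<le> (\<Sum>i\<le>N. real (N choose i) * ((2 ^ N * (2 ^ N * real (Suc N)) + 2 ^ N * c (N - i)) * (S1 + \<mu> * S0)))"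
   using summand by (intro sum_norm_le) (simp add: norm_mult mult_left_mono del: add_0)
  also have "... = C * (S1 + \<mu> * S0)" unfolding C_def sum_distrib_right by (simp add: mult.assoc)
  finally show "cmod (fdiff (3 * m) (\<lambda>j. wave (real j * A + (real j)\<^sup>2 * B) * a j) 0)
   \<le> C * ((\<Sum>l\<le>3 * m. cmod (fdiff m a l)) + min 1 (\<bar>A\<bar> + \<bar>B\<bar>) ^ m * (\<Sum>l\<le>3 * m. cmod (a l)))"
   by (simp add: b_def \<mu>_def S1_def S0_def N_def)
 qed
qed

section \<open>The singular weight of the difference energy\<close>

lemma nn_integral_even:
 fixes \<phi> :: "real \<Rightarrow> ennreal"
 assumes [measurable]: "\<phi> \<in> borel_measurable borel"
 shows "(\<integral>\<^sup>+x. \<phi> \<bar>x\<bar> \<partial>lborel) = 2 * (\<integral>\<^sup>+x. \<phi> x * indicator {0..} x \<partial>lborel)"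
proof -
 have "(\<integral>\<^sup>+x. \<phi> \<bar>x\<bar> \<partial>lborel) = (\<integral>\<^sup>+x. \<phi> \<bar>x\<bar> * indicator {0..} x + \<phi> \<bar>x\<bar> * indicator {..<0} x \<partial>lborel)"
  by (intro nn_integral_cong) (auto simp: indicator_def)
 also have "... = (\<integral>\<^sup>+x. \<phi> \<bar>x\<bar> * indicator {0..} x \<partial>lborel) + (\<integral>\<^sup>+x. \<phi> \<bar>x\<bar> * indicator {..<0} x \<partial>lborel)"
  by (rule nn_integral_add) measurable
 also have "(\<integral>\<^sup>+x. \<phi> \<bar>x\<bar> * indicator {..<0} x \<partial>lborel) = (\<integral>\<^sup>+x. \<phi> \<bar>0 + (-1) * x\<bar> * indicator {..<0} (0 + (-1) * x) \<partial>lborel)"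
  using nn_integral_real_affine[of "\<lambda>x. \<phi> \<bar>x\<bar> * indicator {..<0} x" "-1" 0] by simp
 also have "... = (\<integral>\<^sup>+x. \<phi> x * indicator {0..} x \<partial>lborel)"
  using AE_lborel_singleton[of "0::real"] by (intro nn_integral_cong_AE, eventually_elim) (auto simp: indicator_def)
 also have "(\<integral>\<^sup>+x. \<phi> \<bar>x\<bar> * indicator {0..} x \<partial>lborel) = (\<integral>\<^sup>+x. \<phi> x * indicator {0..} x \<partial>lborel)"
  by (intro nn_integral_cong) (auto simp: indicator_def)
 finally show ?thesis by (simp add: mult_2)
qed

lemma nn_integral_powr_at_0:
 fixes s :: real assumes "-1 < s"
 shows "(\<integral>\<^sup>+x. ennreal (x powr s) * indicator {0..1} x \<partial>lborel) < \<infinity>"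
proof -
 have "((\<lambda>x. x powr s) has_integral (1 powr (s + 1) / (s + 1))) {0..1}"
  using has_integral_powr_from_0[of s 1] assms by simp
 from nn_integral_has_integral_lebesgue'[OF _ this] show ?thesis by simp
qed

lemma nn_integral_powr_at_top:
 fixes s :: real assumes "s < -1"
 shows "(\<integral>\<^sup>+x. ennreal (x powr s) * indicator {1..} x \<partial>lborel) < \<infinity>"
proof -
 have "((\<lambda>x. x powr s) has_integral (- (1 powr (s + 1)) / (s + 1))) {1..}"
  using has_integral_powr_to_inf[of s 1] assms by simp
 from nn_integral_has_integral_lebesgue'[OF _ this] show ?thesis by simp
qed

lemma nn_integral_min_powr_finite:
 fixes p q :: real assumes p: "-1 < p" and q: "q < -1"
 shows "(\<integral>\<^sup>+x. ennreal (min (\<bar>x\<bar> powr p) (\<bar>x\<bar> powr q)) \<partial>lborel) < \<infinity>"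
proof -
 have 1: "(\<integral>\<^sup>+x. ennreal (min (\<bar>x\<bar> powr p) (\<bar>x\<bar> powr q)) \<partial>lborel)
   = 2 * (\<integral>\<^sup>+x. ennreal (min (x powr p) (x powr q)) * indicator {0..} x \<partial>lborel)"
  by (rule nn_integral_even[of "\<lambda>x. ennreal (min (x powr p) (x powr q))"]) measurable
 have "(\<integral>\<^sup>+x. ennreal (min (x powr p) (x powr q)) * indicator {0..} x \<partial>lborel)
   \<le> (\<integral>\<^sup>+x. ennreal (x powr p) * indicator {0..1} x + ennreal (x powr q) * indicator {1..} x \<partial>lborel)"
  by (intro nn_integral_mono) (auto simp: indicator_def intro!: ennreal_leI)
 also have "... = (\<integral>\<^sup>+x. ennreal (x powr p) * indicator {0..1} x \<partial>lborel) + (\<integral>\<^sup>+x. ennreal (x powr q) * indicator {1..} x \<partial>lborel)"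
  by (rule nn_integral_add) measurable
 also have "... < \<infinity>" using nn_integral_powr_at_0[OF p] nn_integral_powr_at_top[OF q] by simp
 finally show ?thesis unfolding 1 by (simp add: ennreal_mult_less_top)
qed

text \<open>The kernel of the Gagliardo seminorm of order \<open>\<theta>\<close> in one dimension.\<close>

definition sing :: "real \<Rightarrow> real \<Rightarrow> ennreal" where
 "sing \<theta> h = ennreal (\<bar>h\<bar> powr (- 1 - 2 * \<theta>))"

lemma sing_measurable [measurable]: "sing \<theta> \<in> borel_measurable borel" unfolding sing_def by measurable

lemma sing_scale:
 assumes [measurable]: "\<phi> \<in> borel_measurable borel" and a: "a \<noteq> 0"
 shows "(\<integral>\<^sup>+h. sing \<theta> h * \<phi> (a * h) \<partial>lborel) = ennreal (\<bar>a\<bar> powr (2 * \<theta>)) * (\<integral>\<^sup>+h. sing \<theta> h * \<phi> h \<partial>lborel)"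
proof -
 have s: "sing \<theta> (a * h) = ennreal (\<bar>a\<bar> powr (- 1 - 2 * \<theta>)) * sing \<theta> h" for h
  unfolding sing_def by (simp add: abs_mult powr_mult ennreal_mult)
 have "(\<integral>\<^sup>+h. sing \<theta> h * \<phi> h \<partial>lborel) = ennreal \<bar>a\<bar> * (\<integral>\<^sup>+h. sing \<theta> (a * h) * \<phi> (a * h) \<partial>lborel)"
  using nn_integral_real_affine[of "\<lambda>h. sing \<theta> h * \<phi> h" a 0] a by simp
 also have "... = ennreal \<bar>a\<bar> * (ennreal (\<bar>a\<bar> powr (- 1 - 2 * \<theta>)) * (\<integral>\<^sup>+h. sing \<theta> h * \<phi> (a * h) \<partial>lborel))"
  unfolding s mult.assoc by (subst nn_integral_cmult) auto
 finally have "ennreal (\<bar>a\<bar> powr (2 * \<theta>)) * (\<integral>\<^sup>+h. sing \<theta> h * \<phi> h \<partial>lborel)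
  = ennreal (\<bar>a\<bar> powr (2 * \<theta>) * (\<bar>a\<bar> * \<bar>a\<bar> powr (- 1 - 2 * \<theta>))) * (\<integral>\<^sup>+h. sing \<theta> h * \<phi> (a * h) \<partial>lborel)"
  by (simp add: ennreal_mult mult.assoc)
 also have "\<bar>a\<bar> powr (2 * \<theta>) * (\<bar>a\<bar> * \<bar>a\<bar> powr (- 1 - 2 * \<theta>)) = \<bar>a\<bar> powr (2 * \<theta> + (1 + (- 1 - 2 * \<theta>)))"
  using a by (simp only: powr_add) simp
 also have "... = 1" using a by simp
 finally show ?thesis by simp
qed

definition cutoff_const :: "nat \<Rightarrow> real \<Rightarrow> ennreal" where
 "cutoff_const p \<theta> = (\<integral>\<^sup>+h. sing \<theta> h * ennreal (min 1 \<bar>h\<bar> ^ p) \<partial>lborel)"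

lemma cutoff_const_finite:
 assumes "0 < \<theta>" "2 * \<theta> < real p"
 shows "cutoff_const p \<theta> < \<infinity>"
proof -
 have "cutoff_const p \<theta> \<le> (\<integral>\<^sup>+h. ennreal (min (\<bar>h\<bar> powr (real p - 1 - 2 * \<theta>)) (\<bar>h\<bar> powr (- 1 - 2 * \<theta>))) \<partial>lborel)"
  unfolding cutoff_const_def
 proof (rule nn_integral_mono)
  fix h :: real
  have "\<bar>h\<bar> powr (- 1 - 2 * \<theta>) * min 1 \<bar>h\<bar> ^ p \<le> min (\<bar>h\<bar> powr (real p - 1 - 2 * \<theta>)) (\<bar>h\<bar> powr (- 1 - 2 * \<theta>))"
  proof (cases "h = 0")
   case False
   have "\<bar>h\<bar> powr (- 1 - 2 * \<theta>) * min 1 \<bar>h\<bar> ^ p \<le> \<bar>h\<bar> powr (- 1 - 2 * \<theta>) * \<bar>h\<bar> ^ p"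
    by (intro mult_left_mono power_mono) auto
   also have "... = \<bar>h\<bar> powr (real p - 1 - 2 * \<theta>)"
    using False by (simp add: powr_realpow[symmetric] powr_add[symmetric] algebra_simps)
   finally have 1: "\<bar>h\<bar> powr (- 1 - 2 * \<theta>) * min 1 \<bar>h\<bar> ^ p \<le> \<bar>h\<bar> powr (real p - 1 - 2 * \<theta>)" .
   have "\<bar>h\<bar> powr (- 1 - 2 * \<theta>) * min 1 \<bar>h\<bar> ^ p \<le> \<bar>h\<bar> powr (- 1 - 2 * \<theta>) * 1"
    by (intro mult_left_mono power_le_one) auto
   then show ?thesis using 1 by simp
  qed simp
  then show "sing \<theta> h * ennreal (min 1 \<bar>h\<bar> ^ p) \<le> ennreal (min (\<bar>h\<bar> powr (real p - 1 - 2 * \<theta>)) (\<bar>h\<bar> powr (- 1 - 2 * \<theta>)))"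
   unfolding sing_def by (subst ennreal_mult[symmetric]) (auto intro: ennreal_leI)
 qed
 also have "... < \<infinity>" using assms by (intro nn_integral_min_powr_finite) auto
 finally show ?thesis .
qed

section \<open>Difference energies and spatial weights\<close>

definition xdiff :: "nat \<Rightarrow> real \<Rightarrow> (real \<times> int \<Rightarrow> complex) \<Rightarrow> real \<times> int \<Rightarrow> complex" where
 "xdiff N h G z = fdiff N (\<lambda>j. G (fst z + real j * h, snd z)) 0"

lemma xdiff_0: "xdiff 0 h G = G" by (simp add: xdiff_def fun_eq_iff)

lemma xdiff_Suc: "xdiff (Suc N) h G = xdiff N h (\<lambda>z. G (fst z + h, snd z) - G z)" unfolding xdiff_def fdiff.simps
 by (rule ext, simp only: fdiff_shift[symmetric] fdiff_diff[symmetric]) (simp add: algebra_simps)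

lemma measurable_frequencies_iff:
 "G \<in> freq_measurable \<longleftrightarrow> G \<in> borel_measurable (lborel \<Otimes>\<^sub>M count_space UNIV)"
 by (simp add: frequencies_def)

lemma freq_shift_measurable:
 assumes "G \<in> measurable frequencies N"
 shows "(\<lambda>z. G (fst z + h, snd z)) \<in> measurable frequencies N"
proof -
 have [measurable]: "G \<in> measurable (lborel \<Otimes>\<^sub>M count_space UNIV) N" using assms by (simp add: frequencies_def)
 show ?thesis unfolding frequencies_def by measurable
qed

lemma nn_integral_freq_shift:
 assumes "f \<in> freq_measurable"
 shows "(\<integral>\<^sup>+z. f (fst z + h, snd z) \<partial>frequencies) = (\<integral>\<^sup>+z. f z \<partial>frequencies)"
proof -
 have [measurable]: "f \<in> borel_measurable (lborel \<Otimes>\<^sub>M count_space UNIV)" using assms by (simp add: frequencies_def)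
 have "(\<integral>\<^sup>+z. f (fst z + h, snd z) \<partial>frequencies) = (\<integral>\<^sup>+\<eta>. (\<integral>\<^sup>+\<xi>. f (\<xi> + h, \<eta>) \<partial>lborel) \<partial>count_space UNIV)"
  unfolding frequencies_def by (subst line_int.nn_integral_snd[symmetric]) auto
 also have "... = (\<integral>\<^sup>+\<eta>. (\<integral>\<^sup>+\<xi>. f (\<xi>, \<eta>) \<partial>lborel) \<partial>count_space UNIV)"
 proof (rule nn_integral_cong)
  fix \<eta> :: int
  show "(\<integral>\<^sup>+\<xi>. f (\<xi> + h, \<eta>) \<partial>lborel) = (\<integral>\<^sup>+\<xi>. f (\<xi>, \<eta>) \<partial>lborel)"
   using nn_integral_real_affine[of "\<lambda>\<xi>. f (\<xi>, \<eta>)" 1 h] by (simp add: add.commute)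
 qed
 also have "... = (\<integral>\<^sup>+z. f z \<partial>frequencies)"
  unfolding frequencies_def by (subst line_int.nn_integral_snd[symmetric]) auto
 finally show ?thesis .
qed

lemma energy_freq_shift:
 assumes "G \<in> freq_measurable"
 shows "energy frequencies (\<lambda>z. G (fst z + h, snd z)) = energy frequencies G"
 unfolding energy_def using assms by (intro nn_integral_freq_shift[of "\<lambda>z. nsq (G z)"]) measurable

lemma AE_freq_shift:
 fixes G G' :: "real \<times> int \<Rightarrow> complex"
 assumes "G \<in> freq_measurable" "G' \<in> freq_measurable"
  and "AE z in frequencies. G z = G' z"
 shows "AE z in frequencies. G (fst z + h, snd z) = G' (fst z + h, snd z)"
proof -
 have m: "(\<lambda>z. G z - G' z) \<in> freq_measurable" using assms by simp
 have "energy frequencies (\<lambda>z. G z - G' z) = energy frequencies (\<lambda>z. 0)"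
  using assms(3) by (intro energy_cong_AE) auto
 then have "energy frequencies (\<lambda>z. G (fst z + h, snd z) - G' (fst z + h, snd z)) = 0"
  using energy_freq_shift[OF m, of h] by (simp add: energy_def)
 then show ?thesis using energy_eq_0_imp_AE[OF freq_shift_measurable[OF m, of h]] by simp
qed

lemma xdiff_measurable:
 assumes "G \<in> freq_measurable"
 shows "xdiff N h G \<in> freq_measurable" using assms
proof (induction N arbitrary: G)
 case (Suc N) then show ?case unfolding xdiff_Suc by (intro Suc.IH borel_measurable_diff freq_shift_measurable Suc.prems)
qed (simp add: xdiff_0)

lemma xdiff_joint_measurable:
 assumes "G \<in> freq_measurable"
 shows "(\<lambda>(h, z). xdiff N h G z) \<in> borel_measurable (lborel \<Otimes>\<^sub>M frequencies)"
proof -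
 have [measurable]: "G \<in> borel_measurable (lborel \<Otimes>\<^sub>M count_space UNIV)" using assms by (simp add: frequencies_def)
 have "(\<lambda>p. fdiff N (\<lambda>j. G (fst (snd p) + real j * fst p, snd (snd p))) k) \<in> borel_measurable (lborel \<Otimes>\<^sub>M (lborel \<Otimes>\<^sub>M count_space UNIV))" for k
 proof (induction N arbitrary: k)
  case 0 show ?case unfolding fdiff.simps by measurable
 next
  case (Suc N) show ?case unfolding fdiff.simps by (intro borel_measurable_diff Suc.IH)
 qed
 then show ?thesis unfolding xdiff_def frequencies_def by (simp add: case_prod_unfold)
qed

lemma xdiff_cong_AE:
 assumes "G \<in> freq_measurable" "G' \<in> freq_measurable"
  and "AE z in frequencies. G z = G' z"
 shows "AE z in frequencies. xdiff N h G z = xdiff N h G' z" using assms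
proof (induction N arbitrary: G G')
 case (Suc N)
 show ?case unfolding xdiff_Suc
 proof (rule Suc.IH)
  show "AE z in frequencies. G (fst z + h, snd z) - G z = G' (fst z + h, snd z) - G' z"
   using Suc.prems(3) AE_freq_shift[OF Suc.prems, of h] by eventually_elim simp
 qed (intro borel_measurable_diff freq_shift_measurable Suc.prems)+
qed (simp add: xdiff_0)

text \<open>The multiplier in \<open>x\<close> that corresponds to the \<open>N\<close>-th difference with step \<open>h\<close>
 in \<open>\<xi>\<close>.\<close>

definition modulate :: "nat \<Rightarrow> real \<Rightarrow> (real \<times> real \<Rightarrow> complex) \<Rightarrow> real \<times> real \<Rightarrow> complex" where
 "modulate N h f z = (cowave (fst z * h) - 1) ^ N * f z"

lemma modulate_L2:
 assumes f: "f \<in> L2 cylinder"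
 shows "modulate N h f \<in> L2 cylinder"
proof -
 have [measurable]: "f \<in> borel_measurable (lborel \<Otimes>\<^sub>M circle)" using L2_measurable[OF f] by (simp add: cylinder_eq)
 have m: "modulate N h f \<in> borel_measurable cylinder" unfolding modulate_def cylinder_eq by measurable
 have "cmod (modulate N h f z) \<le> cmod (2 ^ N * f z)" for z
 proof -
  have "cmod (cowave (fst z * h) - 1) \<le> 1 + 1" by (rule order_trans[OF norm_triangle_ineq4]) simp
  then have "cmod (cowave (fst z * h) - 1) ^ N \<le> 2 ^ N" by (intro power_mono) auto
  then show ?thesis by (simp add: modulate_def norm_mult norm_power mult_right_mono)
 qed
 then have "energy cylinder (modulate N h f) \<le> energy cylinder (\<lambda>z. 2 ^ N * f z)" by (rule energy_mono)
 also have "... < \<infinity>" using L2_cmult[OF f] by (simp add: L2_iff_energy)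
 finally show ?thesis using m by (simp add: L2_iff_energy)
qed

text \<open>For truncations the identity is evident from the integrals. It passes to the limit since a translation in frequency
 preserves the norm.\<close>

lemma fourier_modulate_1:
 assumes f: "f \<in> L2 cylinder"
 shows "AE q in frequencies. fourier (modulate 1 h f) q = fourier f (fst q + h, snd q) - fourier f q"
proof -
 let ?g = "modulate 1 h f"
 have g: "?g \<in> L2 cylinder" by (rule modulate_L2[OF f])
 define F where "F n = fourier_integral (x_trunc n f)" for n
 have Fm: "F n \<in> freq_measurable" for n unfolding F_def by (intro L2_measurable fourier_integral_x_trunc_L2 f)
 have ff: "fourier f \<in> freq_measurable" by (intro L2_measurable fourier_L2 f)
 have eq: "fourier_integral (x_trunc n ?g) q = F n (fst q + h, snd q) - F n q" for n q
 proof (cases q)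
  case (Pair \<xi> \<eta>)
  have "fourier_integral (x_trunc n ?g) (\<xi>, \<eta>)
   = (\<integral>z. (case z of (x, y) \<Rightarrow> x_trunc n f (x, y) * exp (- \<i> * of_real (x * (\<xi> + h)) - \<i> * of_real (of_int \<eta> * y)))
    - (case z of (x, y) \<Rightarrow> x_trunc n f (x, y) * exp (- \<i> * of_real (x * \<xi>) - \<i> * of_real (of_int \<eta> * y))) \<partial>cylinder)"
   unfolding fourier_integral_def prod.case
  proof (rule Bochner_Integration.integral_cong[OF refl], clarify)
   fix x y :: real
   have "exp (- \<i> * of_real (x * (\<xi> + h)) - \<i> * of_real (of_int \<eta> * y))
    = cowave (x * h) * exp (- \<i> * of_real (x * \<xi>) - \<i> * of_real (of_int \<eta> * y))"
    by (simp add: exp_add[symmetric] algebra_simps)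
   then show "x_trunc n ?g (x, y) * exp (- \<i> * of_real (x * \<xi>) - \<i> * of_real (of_int \<eta> * y))
    = x_trunc n f (x, y) * exp (- \<i> * of_real (x * (\<xi> + h)) - \<i> * of_real (of_int \<eta> * y))
    - x_trunc n f (x, y) * exp (- \<i> * of_real (x * \<xi>) - \<i> * of_real (of_int \<eta> * y))"
    by (simp add: x_trunc_def modulate_def left_diff_distrib right_diff_distrib mult_ac)
  qed
  also have "... = F n (\<xi> + h, \<eta>) - F n (\<xi>, \<eta>)" unfolding F_def fourier_integral_def prod.case
   by (intro Bochner_Integration.integral_diff fourier_integral_character_integrable x_trunc_integrable f)
  finally show ?thesis using Pair by simp
 qed
 have l: "(\<lambda>n. energy frequencies (\<lambda>q. F n q - fourier f q)) \<longlonglongrightarrow> 0"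
  using fourier_L2_tendsto[OF f] by (simp add: L2_tendsto_def' F_def)
 define G where "G q = fourier f (fst q + h, snd q) - fourier f q" for q
 have sh: "(\<lambda>q. fourier f (fst q + h, snd q)) \<in> L2 frequencies"
  using fourier_L2[OF f] freq_shift_measurable[OF ff] energy_freq_shift[OF ff] by (simp add: L2_iff_energy)
 have "L2_tendsto frequencies (\<lambda>n. fourier_integral (x_trunc n ?g)) G" unfolding L2_tendsto_def'
 proof
  show "G \<in> L2 frequencies" unfolding G_def by (intro L2_diff sh fourier_L2 f)
  have "energy frequencies (\<lambda>q. fourier_integral (x_trunc n ?g) q - G q)
    \<le> 2 * (energy frequencies (\<lambda>q. F n q - fourier f q) + energy frequencies (\<lambda>q. F n q - fourier f q))" for n
  proof -
   have d: "(\<lambda>q. F n q - fourier f q) \<in> freq_measurable" using Fm ff by simp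
   have "energy frequencies (\<lambda>q. fourier_integral (x_trunc n ?g) q - G q)
    = energy frequencies (\<lambda>q. (F n (fst q + h, snd q) - fourier f (fst q + h, snd q)) - (F n q - fourier f q))"
    by (simp only: eq G_def) (simp add: algebra_simps)
   also have "... \<le> 2 * (energy frequencies (\<lambda>q. F n (fst q + h, snd q) - fourier f (fst q + h, snd q)) + energy frequencies (\<lambda>q. F n q - fourier f q))"
    by (rule energy_diff_le2[OF freq_shift_measurable[OF d] d])
   finally show ?thesis by (simp add: energy_freq_shift[OF d])
  qed
  then have up: "\<forall>\<^sub>F n in sequentially. energy frequencies (\<lambda>q. fourier_integral (x_trunc n ?g) q - G q)
    \<le> 2 * (energy frequencies (\<lambda>q. F n q - fourier f q) + energy frequencies (\<lambda>q. F n q - fourier f q))"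
   by (rule always_eventually[OF allI])
  have lo: "\<forall>\<^sub>F n in sequentially. 0 \<le> energy frequencies (\<lambda>q. fourier_integral (x_trunc n ?g) q - G q)"
   by (rule always_eventually) simp
  have "(\<lambda>n. 2 * (energy frequencies (\<lambda>q. F n q - fourier f q) + energy frequencies (\<lambda>q. F n q - fourier f q))) \<longlonglongrightarrow> 2 * (0 + 0)"
   by (intro ennreal_tendsto_cmult tendsto_add l) simp
  then have lim: "(\<lambda>n. 2 * (energy frequencies (\<lambda>q. F n q - fourier f q) + energy frequencies (\<lambda>q. F n q - fourier f q))) \<longlonglongrightarrow> 0"
   by simp
  show "(\<lambda>n. energy frequencies (\<lambda>q. fourier_integral (x_trunc n ?g) q - G q)) \<longlonglongrightarrow> 0"
   by (rule tendsto_sandwich[OF lo up tendsto_const lim])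
 qed
 from L2_tendsto_unique_AE[OF L2_measurable[OF fourier_integral_x_trunc_L2[OF g]] fourier_L2_tendsto[OF g] this]
 show ?thesis unfolding G_def .
qed

lemma fourier_modulate:
 assumes f: "f \<in> L2 cylinder"
 shows "AE z in frequencies. fourier (modulate N h f) z = xdiff N h (fourier f) z" using f
proof (induction N arbitrary: f)
 case 0
 have "modulate 0 h f = f" by (simp add: modulate_def fun_eq_iff)
 then show ?case by (simp add: xdiff_0)
next
 case (Suc N)
 have ff: "fourier f \<in> freq_measurable" by (intro L2_measurable fourier_L2 Suc.prems)
 have e: "modulate (Suc N) h f = modulate N h (modulate 1 h f)" by (simp add: modulate_def fun_eq_iff mult_ac)
 have "AE z in frequencies. xdiff N h (fourier (modulate 1 h f)) z = xdiff (Suc N) h (fourier f) z" unfolding xdiff_Suc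
  by (intro xdiff_cong_AE fourier_modulate_1 L2_measurable fourier_L2 modulate_L2 Suc.prems borel_measurable_diff freq_shift_measurable)
 with Suc.IH[OF modulate_L2[OF Suc.prems, of 1 h]] show ?case unfolding e by eventually_elim simp
qed

lemma energy_xdiff_fourier:
 assumes f: "f \<in> L2 cylinder"
 shows "energy frequencies (xdiff N h (fourier f)) = ennreal ((2 * pi)\<^sup>2) * energy cylinder (modulate N h f)"
 using energy_cong_AE[OF fourier_modulate[OF f, of N h]] fourier_energy[OF modulate_L2[OF f, of N h]] by simp

text \<open>The squared Gagliardo seminorm of order \<open>\<theta>\<close> in \<open>\<xi>\<close>, with differences of order
 \<open>N\<close>.\<close>

definition diff_energy :: "nat \<Rightarrow> real \<Rightarrow> (real \<times> int \<Rightarrow> complex) \<Rightarrow> ennreal" where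
 "diff_energy N \<theta> G = (\<integral>\<^sup>+h. sing \<theta> h * energy frequencies (xdiff N h G) \<partial>lborel)"

lemma diff_energy_cong_AE:
 assumes "G \<in> freq_measurable" "G' \<in> freq_measurable"
  and "AE z in frequencies. G z = G' z"
 shows "diff_energy N \<theta> G = diff_energy N \<theta> G'"
 unfolding diff_energy_def using energy_cong_AE[OF xdiff_cong_AE[OF assms]] by simp

definition diff_const :: "nat \<Rightarrow> real \<Rightarrow> ennreal" where
 "diff_const N \<theta> = (\<integral>\<^sup>+h. sing \<theta> h * ennreal (cmod (cowave h - 1) ^ (2 * N)) \<partial>lborel)"

lemma diff_const_finite:
 assumes "0 < \<theta>" "\<theta> < real N"
 shows "diff_const N \<theta> < \<infinity>"
proof -
 have "diff_const N \<theta> \<le> (\<integral>\<^sup>+h. ennreal (2 ^ (2 * N)) * (sing \<theta> h * ennreal (min 1 \<bar>h\<bar> ^ (2 * N))) \<partial>lborel)"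
  unfolding diff_const_def
 proof (rule nn_integral_mono)
  fix h :: real
  have "cmod (cowave h - 1) \<le> 2" by (rule order_trans[OF norm_triangle_ineq4]) simp
  moreover have "cmod (cowave h - 1) \<le> \<bar>h\<bar>" using Taylor_exp[of "- \<i> * of_real h" 0] by (simp add: norm_mult)
  ultimately have "cmod (cowave h - 1) \<le> 2 * min 1 \<bar>h\<bar>" by auto
  then have "cmod (cowave h - 1) ^ (2 * N) \<le> (2 * min 1 \<bar>h\<bar>) ^ (2 * N)" by (intro power_mono) auto
  also have "... = 2 ^ (2 * N) * min 1 \<bar>h\<bar> ^ (2 * N)" by (simp only: power_mult_distrib)
  finally have "sing \<theta> h * ennreal (cmod (cowave h - 1) ^ (2 * N)) \<le> sing \<theta> h * ennreal (2 ^ (2 * N) * min 1 \<bar>h\<bar> ^ (2 * N))"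
   by (intro mult_left_mono ennreal_leI) auto
  also have "... = ennreal (2 ^ (2 * N)) * (sing \<theta> h * ennreal (min 1 \<bar>h\<bar> ^ (2 * N)))"
   by (subst ennreal_mult) (auto simp: mult_ac)
  finally show "sing \<theta> h * ennreal (cmod (cowave h - 1) ^ (2 * N)) \<le> ennreal (2 ^ (2 * N)) * (sing \<theta> h * ennreal (min 1 \<bar>h\<bar> ^ (2 * N)))" .
 qed
 also have "... = ennreal (2 ^ (2 * N)) * cutoff_const (2 * N) \<theta>"
  unfolding cutoff_const_def by (rule nn_integral_cmult) measurable
 also have "... < \<infinity>" using cutoff_const_finite[of \<theta> "2 * N"] assms by (auto simp: ennreal_mult_less_top)
 finally show ?thesis .
qed

lemma diff_const_pos: "0 < diff_const N \<theta>"
proof (rule ccontr)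
 assume "\<not> 0 < diff_const N \<theta>"
 then have "diff_const N \<theta> = 0" by simp
 then have "AE h in lborel. sing \<theta> h * ennreal (cmod (cowave h - 1) ^ (2 * N)) = 0"
  unfolding diff_const_def by (subst (asm) nn_integral_0_iff_AE) auto
 moreover have "sing \<theta> h * ennreal (cmod (cowave h - 1) ^ (2 * N)) \<noteq> 0" if "h \<in> {0<..<1}" for h
 proof -
  have "cowave h \<noteq> 1"
  proof
   assume "cowave h = 1"
   then have "Im (cowave h) = 0" by simp
   then have "sin h = 0" by (simp add: Im_exp)
   moreover have "0 < sin h" using that pi_gt3 by (intro sin_gt_zero) auto
   ultimately show False by simp
  qed
  then show ?thesis using that by (simp add: sing_def)
 qed
 ultimately have "AE h in lborel. h \<notin> {0<..<1::real}" by (auto elim!: eventually_mono)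
 then have "emeasure lborel {0<..<1::real} = 0" by (subst (asm) AE_iff_measurable[where N="{0<..<1}"]) auto
 then show False by simp
qed

definition x_energy :: "real \<Rightarrow> (real \<times> real \<Rightarrow> complex) \<Rightarrow> ennreal" where
 "x_energy \<theta> f = (\<integral>\<^sup>+z. fst_powr (2 * \<theta>) z * nsq (f z) \<partial>cylinder)"

text \<open>By Plancherel's identity the step \<open>h\<close> contributes \<open>\<bar>exp (- i x h) - 1\<bar>\<close> to the
 power \<open>2 N\<close>, integrated against \<open>\<bar>f\<bar>\<^sup>2\<close>; substituting \<open>x h\<close> for
 \<open>h\<close> in the integral over the steps extracts the factor \<open>\<bar>x\<bar> powr (2 \<theta>)\<close>.\<close>

theorem diff_energy_fourier:
 assumes f: "f \<in> L2 cylinder" and N: "1 \<le> N"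
 shows "diff_energy N \<theta> (fourier f) = ennreal ((2 * pi)\<^sup>2) * diff_const N \<theta> *
  x_energy \<theta> f"
proof -
 interpret pair_sigma_finite "lborel :: real measure" cylinder
  by (intro pair_sigma_finite.intro sigma_finite_lborel sigma_finite_cylinder)
 have [measurable]: "f \<in> borel_measurable (lborel \<Otimes>\<^sub>M circle)" using L2_measurable[OF f] by (simp add: cylinder_eq)
 define q where "q h = ennreal (cmod (cowave h - 1) ^ (2 * N))" for h
 have [measurable]: "q \<in> borel_measurable borel" unfolding q_def by measurable
 have jm: "(\<lambda>(h, z). sing \<theta> h * (q (fst z * h) * nsq (f z))) \<in> borel_measurable (lborel \<Otimes>\<^sub>M cylinder)"
  unfolding cylinder_eq by measurable
 have m1: "(\<lambda>z. q (fst z * h) * nsq (f z)) \<in> borel_measurable cylinder" for h unfolding cylinder_eq by measurable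
 have e: "energy cylinder (modulate N h f) = (\<integral>\<^sup>+z. q (fst z * h) * nsq (f z) \<partial>cylinder)" for h
  unfolding energy_def modulate_def q_def by (intro nn_integral_cong)
    (simp add: norm_mult norm_power power_mult_distrib ennreal_mult power_mult[symmetric] mult.commute[of 2])
 have "diff_energy N \<theta> (fourier f) = (\<integral>\<^sup>+h. sing \<theta> h * (ennreal ((2 * pi)\<^sup>2) * energy cylinder (modulate N h f)) \<partial>lborel)"
  unfolding diff_energy_def energy_xdiff_fourier[OF f] ..
 also have "... = (\<integral>\<^sup>+h. ennreal ((2 * pi)\<^sup>2) * (\<integral>\<^sup>+z. sing \<theta> h * (q (fst z * h) * nsq (f z)) \<partial>cylinder) \<partial>lborel)"
  unfolding e nn_integral_cmult[OF m1] by (rule nn_integral_cong) (rule mult.left_commute)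
 also have "... = ennreal ((2 * pi)\<^sup>2) * (\<integral>\<^sup>+h. (\<integral>\<^sup>+z. sing \<theta> h * (q (fst z * h) * nsq (f z)) \<partial>cylinder) \<partial>lborel)"
  using cyl_freq.M1.borel_measurable_nn_integral_fst[OF jm] by (intro nn_integral_cmult) simp
 also have "(\<integral>\<^sup>+h. (\<integral>\<^sup>+z. sing \<theta> h * (q (fst z * h) * nsq (f z)) \<partial>cylinder) \<partial>lborel)
   = (\<integral>\<^sup>+z. (\<integral>\<^sup>+h. sing \<theta> h * (q (fst z * h) * nsq (f z)) \<partial>lborel) \<partial>cylinder)"
  using Fubini'[OF jm] by simp
 also have "... = (\<integral>\<^sup>+z. diff_const N \<theta> * (fst_powr (2 * \<theta>) z * nsq (f z)) \<partial>cylinder)"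
 proof (rule nn_integral_cong)
  fix z :: "real \<times> real"
  have "(\<integral>\<^sup>+h. sing \<theta> h * (q (fst z * h) * nsq (f z)) \<partial>lborel)
   = (\<integral>\<^sup>+h. sing \<theta> h * q (fst z * h) \<partial>lborel) * nsq (f z)"
   by (subst nn_integral_multc[symmetric]) (auto simp: mult.assoc)
  also have "(\<integral>\<^sup>+h. sing \<theta> h * q (fst z * h) \<partial>lborel) = fst_powr (2 * \<theta>) z * diff_const N \<theta>"
  proof (cases "fst z = 0")
   case True then show ?thesis using N by (simp add: q_def power_0_left)
  next
   case False then show ?thesis using sing_scale[of q "fst z" \<theta>] by (simp add: diff_const_def q_def)
  qed
  finally show "(\<integral>\<^sup>+h. sing \<theta> h * (q (fst z * h) * nsq (f z)) \<partial>lborel)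
   = diff_const N \<theta> * (fst_powr (2 * \<theta>) z * nsq (f z))" by (simp add: mult_ac)
 qed
 also have "... = diff_const N \<theta> * x_energy \<theta> f"
  unfolding x_energy_def by (intro nn_integral_cmult) (simp add: cylinder_eq)
 finally show ?thesis by (simp add: mult.assoc)
qed

section \<open>The propagator acting on difference energies\<close>

interpretation line_freq: pair_sigma_finite "lborel :: real measure" frequencies
 by (intro pair_sigma_finite.intro sigma_finite_lborel sigma_finite_frequencies)

lemma energy_xdiff_measurable:
 assumes "G \<in> freq_measurable"
 shows "(\<lambda>h. energy frequencies (xdiff N h G)) \<in> borel_measurable borel"
proof -
 have "(\<lambda>p. nsq (case p of (h, z) \<Rightarrow> xdiff N h G z)) \<in> borel_measurable (lborel \<Otimes>\<^sub>M frequencies)"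
  using xdiff_joint_measurable[OF assms, of N] by measurable
 from cyl_freq.M2.borel_measurable_nn_integral_fst[OF this]
 show ?thesis by (simp add: energy_def)
qed

definition freq_weight :: "real \<Rightarrow> (real \<times> int \<Rightarrow> complex) \<Rightarrow> ennreal" where
 "freq_weight s G = (\<integral>\<^sup>+z. fst_powr s z * nsq (G z) \<partial>frequencies)"

lemma fst_frequencies_measurable [measurable]: "fst \<in> freq_measurable" unfolding frequencies_def by simp

lemma sum_squared_le:
 fixes u :: "nat \<Rightarrow> real"
 shows "(\<Sum>l\<le>n. u l)\<^sup>2 \<le> real (Suc n) * (\<Sum>l\<le>n. (u l)\<^sup>2)"
 using Cauchy_Schwarz_ineq_sum[of "\<lambda>_. 1" u "{..n}"] by simp

lemma power_add_le_2:
 fixes a b :: real assumes "0 \<le> a" "0 \<le> b"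
 shows "(a + b) ^ p \<le> 2 ^ p * (a ^ p + b ^ p)"
proof -
 have "(a + b) ^ p \<le> (2 * max a b) ^ p" using assms by (intro power_mono) auto
 also have "... = 2 ^ p * max a b ^ p" by (rule power_mult_distrib)
 also have "max a b ^ p \<le> a ^ p + b ^ p" using assms by (auto simp: max_def)
 finally show ?thesis by simp
qed

lemma min_one_square: "0 \<le> a \<Longrightarrow> min 1 (a\<^sup>2) = (min 1 a)\<^sup>2" for a :: real
 by (cases "1 \<le> a") (use one_le_power[of a 2] power_le_one[of a 2] in \<open>auto simp: min_def\<close>)

text \<open>The shifts of \<open>\<xi>\<close> by multiples of \<open>h\<close> change the local frequency \<open>2 t
 \<xi>\<close> of the phase by multiples of \<open>2 t h\<close>; the resulting error is absorbed by the quadratic term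
 \<open>t h\<^sup>2\<close>.\<close>

lemma cutoff_shift:
 fixes x y :: real and l n m :: nat
 assumes "0 \<le> x" "0 \<le> y" "l \<le> n" "z \<le> x + 2 * real l * y" "0 \<le> z"
 shows "min 1 (z + y) ^ p \<le> (2 * real n + 1) ^ p * (2 ^ p * (min 1 x ^ p + min 1 y ^ p))"
proof -
 have "min 1 (z + y) \<le> (2 * real n + 1) * (min 1 x + min 1 y)"
 proof -
  have y: "2 * real l * y \<le> 2 * real n * y" using assms by (intro mult_right_mono) auto
  have K: "1 \<le> 2 * real n + 1" by simp
  show ?thesis
  proof (cases "1 \<le> x \<or> 1 \<le> y")
   case True
   then have "1 \<le> min 1 x + min 1 y" using assms by auto
   then have "1 * 1 \<le> (2 * real n + 1) * (min 1 x + min 1 y)" using K by (intro mult_mono) auto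
   then show ?thesis by simp
  next
   case False
   have "z + y \<le> x + (2 * real n + 1) * y" using assms y by (simp add: distrib_right)
   also have "... \<le> (2 * real n + 1) * x + (2 * real n + 1) * y" using mult_right_mono[OF K, of x] assms by simp
   also have "... = (2 * real n + 1) * (min 1 x + min 1 y)" using False by (simp add: distrib_left)
   finally show ?thesis by simp
  qed
 qed
 then have "min 1 (z + y) ^ p \<le> ((2 * real n + 1) * (min 1 x + min 1 y)) ^ p" using assms by (intro power_mono) auto
 also have "... = (2 * real n + 1) ^ p * (min 1 x + min 1 y) ^ p" by (rule power_mult_distrib)
 also have "... \<le> (2 * real n + 1) ^ p * (2 ^ p * (min 1 x ^ p + min 1 y ^ p))"
  using assms by (intro mult_left_mono power_add_le_2) auto
 finally show ?thesis .
qed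

lemma cutoff_scaled:
 assumes p: "1 \<le> p"
 shows "(\<integral>\<^sup>+h. sing \<theta> h * ennreal (min 1 \<bar>a * h\<bar> ^ p) \<partial>lborel) = ennreal (\<bar>a\<bar> powr (2 * \<theta>)) * cutoff_const p \<theta>"
proof (cases "a = 0")
 case True then show ?thesis using p by (simp add: power_0_left)
next
 case False
 then show ?thesis unfolding cutoff_const_def
  by (subst sing_scale[of "\<lambda>h. ennreal (min 1 \<bar>h\<bar> ^ p)" a \<theta>, symmetric]) auto
qed

text \<open>The values of the phase along \<open>\<xi> + j h\<close> are \<open>j A + j\<^sup>2 B\<close> with \<open>A = 2 t
 \<xi> h\<close> and \<open>B = t h\<^sup>2\<close>, up to a constant, so that \<open>fdiff_chirp_mult\<close> applies
 at each point. Translation invariance then removes the shifts in the sums.\<close>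

lemma energy_xdiff_chirp:
 fixes m :: nat
 assumes m: "1 \<le> m"
 shows "\<exists>C\<ge>0. \<forall>t h. \<forall>G\<in>freq_measurable.
  energy frequencies (xdiff (3 * m) h (chirp t G))
  \<le> ennreal C * (energy frequencies (xdiff m h G)
   + (\<integral>\<^sup>+z. ennreal (min 1 \<bar>(2 * t * fst z) * h\<bar> ^ (2 * m) + min 1 \<bar>sqrt \<bar>t\<bar> * h\<bar> ^ (4 * m)) * nsq (G z) \<partial>frequencies))"
proof -
 define N where "N = 3 * m"
 obtain c where c0: "0 \<le> c" and c: "\<And>(A :: real) (B :: real) a.
  cmod (fdiff (3 * m) (\<lambda>j. wave (real j * A + (real j)\<^sup>2 * B) * a j) 0)
  \<le> c * ((\<Sum>l\<le>3 * m. cmod (fdiff m a l)) + min 1 (\<bar>A\<bar> + \<bar>B\<bar>) ^ m * (\<Sum>l\<le>3 * m. cmod (a l)))"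
  using fdiff_chirp_mult[OF m] by blast
 define K where "K = 2 * c\<^sup>2 * real (Suc N)"
 (* The constant of cutoff_shift for n = N and p = 2 m. *)
 define R where "R = (2 * real N + 1) ^ (2 * m) * 2 ^ (2 * m)"
 have "1 * 1 \<le> R" unfolding R_def by (intro mult_mono one_le_power) auto
 then have KR: "0 \<le> K" "1 \<le> R" unfolding K_def using c0 by auto
 define C where "C = K * real (Suc N) * R"
 show ?thesis
 proof (intro exI[of _ C] conjI allI ballI)
  show "0 \<le> C" unfolding C_def using KR by simp
  fix t h :: real and G :: "real \<times> int \<Rightarrow> complex" assume G[measurable]: "G \<in> freq_measurable"
  define g where "g z = (cmod (G z))\<^sup>2" for z
  define d where "d z = (cmod (xdiff m h G z))\<^sup>2" for z
  define \<mu> where "\<mu> \<xi> = min 1 (\<bar>2 * t * \<xi> * h\<bar> + \<bar>t * h\<^sup>2\<bar>) ^ (2 * m)" for \<xi>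
  define \<nu> where "\<nu> \<xi> = min 1 \<bar>(2 * t * \<xi>) * h\<bar> ^ (2 * m) + min 1 \<bar>sqrt \<bar>t\<bar> * h\<bar> ^ (4 * m)" for \<xi>
  have [measurable]: "g \<in> freq_measurable" "d \<in> freq_measurable"
   unfolding g_def d_def using xdiff_measurable[OF G] by measurable
  have gd0: "0 \<le> g z" "0 \<le> d z" "0 \<le> \<mu> \<xi>" "0 \<le> \<nu> \<xi>" for z \<xi> by (auto simp: g_def d_def \<mu>_def \<nu>_def)
  have point: "(cmod (xdiff N h (chirp t G) z))\<^sup>2
   \<le> K * ((\<Sum>l\<le>N. d (fst z + real l * h, snd z)) + (\<Sum>l\<le>N. \<mu> (fst z) * g (fst z + real l * h, snd z)))" for z
  proof -
   define a where "a j = G (fst z + real j * h, snd z)" for j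
   define A where "A = 2 * t * fst z * h"
   define B where "B = t * h\<^sup>2"
   have "xdiff N h (chirp t G) z
    = fdiff N (\<lambda>j. wave (t * (fst z)\<^sup>2) * (wave (real j * A + (real j)\<^sup>2 * B) * a j)) 0"
   proof -
    have "t * (fst z + real j * h)\<^sup>2 = t * (fst z)\<^sup>2 + (real j * A + (real j)\<^sup>2 * B)" for j
     by (simp add: A_def B_def power2_eq_square algebra_simps)
    then have "exp (\<i> * complex_of_real (t * (fst z + real j * h)\<^sup>2))
     = wave (t * (fst z)\<^sup>2) * wave (real j * A + (real j)\<^sup>2 * B)" for j
     by (simp only: of_real_add distrib_left exp_add)
    then show ?thesis by (simp add: xdiff_def a_def mult.assoc)
   qed
   then have eq: "cmod (xdiff N h (chirp t G) z)
    = cmod (fdiff N (\<lambda>j. wave (real j * A + (real j)\<^sup>2 * B) * a j) 0)" by (simp add: fdiff_cmult norm_mult)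
   define S1 where "S1 = (\<Sum>l\<le>N. cmod (fdiff m a l))"
   define S0 where "S0 = (\<Sum>l\<le>N. cmod (a l))"
   have S: "0 \<le> S1" "0 \<le> S0" unfolding S1_def S0_def by (auto intro: sum_nonneg)
   define v where "v = min 1 (\<bar>A\<bar> + \<bar>B\<bar>) ^ m"
   have v: "0 \<le> v" "v\<^sup>2 = \<mu> (fst z)" unfolding v_def \<mu>_def A_def B_def by (auto simp: power_mult[symmetric] mult.commute)
   have fd: "fdiff m a l = xdiff m h G (fst z + real l * h, snd z)" for l
   proof -
    have "xdiff m h G (fst z + real l * h, snd z) = fdiff m (\<lambda>j. a (j + l)) 0"
     unfolding xdiff_def a_def by (simp add: algebra_simps)
    also have "... = fdiff m a l" by (induction l arbitrary: a) (auto simp: fdiff_shift[symmetric])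
    finally show ?thesis ..
   qed
   have "(cmod (fdiff N (\<lambda>j. wave (real j * A + (real j)\<^sup>2 * B) * a j) 0))\<^sup>2 \<le> (c * (S1 + v * S0))\<^sup>2"
    using c[of A B a] unfolding N_def S1_def S0_def v_def by (intro power_mono) auto
   also have "... = c\<^sup>2 * (S1 + v * S0)\<^sup>2" by (rule power_mult_distrib)
   also have "... \<le> c\<^sup>2 * (2 * (S1\<^sup>2 + (v * S0)\<^sup>2))"
   proof -
    have "0 \<le> (S1 - v * S0)\<^sup>2" by simp
    then have "(S1 + v * S0)\<^sup>2 \<le> 2 * (S1\<^sup>2 + (v * S0)\<^sup>2)" by (simp add: power2_sum power2_diff)
    then show ?thesis by (intro mult_left_mono) auto
   qed
   also have "... = 2 * c\<^sup>2 * (S1\<^sup>2 + \<mu> (fst z) * S0\<^sup>2)" by (simp add: power_mult_distrib v)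
   also have "... \<le> 2 * c\<^sup>2 * (real (Suc N) * (\<Sum>l\<le>N. (cmod (fdiff m a l))\<^sup>2) + \<mu> (fst z) * (real (Suc N) * (\<Sum>l\<le>N. (cmod (a l))\<^sup>2)))"
    unfolding S1_def S0_def by (intro mult_left_mono add_mono sum_squared_le gd0) auto
   also have "... = K * ((\<Sum>l\<le>N. (cmod (fdiff m a l))\<^sup>2) + (\<Sum>l\<le>N. \<mu> (fst z) * (cmod (a l))\<^sup>2))"
    unfolding K_def sum_distrib_left[symmetric] by (simp add: algebra_simps)
   finally show ?thesis unfolding eq by (simp only: fd d_def g_def a_def)
  qed
  have shift_d: "(\<integral>\<^sup>+z. ennreal (d (fst z + real l * h, snd z)) \<partial>frequencies) = energy frequencies (xdiff m h G)" for l
  proof -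
   have dm: "(\<lambda>z. ennreal (d z)) \<in> freq_measurable" by measurable
   show ?thesis using nn_integral_freq_shift[OF dm, of "real l * h"] by (simp add: d_def energy_def)
  qed
  have shift_g: "(\<integral>\<^sup>+z. ennreal (\<mu> (fst z) * g (fst z + real l * h, snd z)) \<partial>frequencies)
   \<le> ennreal R * (\<integral>\<^sup>+z. ennreal (\<nu> (fst z)) * ennreal (g z) \<partial>frequencies)" if l: "l \<le> N" for l
  proof -
   have [measurable]: "\<mu> \<in> borel_measurable borel" "\<nu> \<in> borel_measurable borel"
    unfolding \<mu>_def \<nu>_def by measurable
   have "(\<integral>\<^sup>+z. ennreal (\<mu> (fst z) * g (fst z + real l * h, snd z)) \<partial>frequencies)
    = (\<integral>\<^sup>+z. ennreal (\<mu> (fst z - real l * h) * g z) \<partial>frequencies)"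
    using nn_integral_freq_shift[of "\<lambda>z. ennreal (\<mu> (fst z - real l * h) * g z)" "real l * h"] by simp
   also have "... \<le> (\<integral>\<^sup>+z. ennreal R * (ennreal (\<nu> (fst z)) * ennreal (g z)) \<partial>frequencies)"
   proof (rule nn_integral_mono)
    fix z :: "real \<times> int"
    have "\<bar>2 * t * (fst z - real l * h) * h\<bar> \<le> \<bar>(2 * t * fst z) * h\<bar> + 2 * real l * \<bar>t * h\<^sup>2\<bar>"
    proof -
     have "2 * t * (fst z - real l * h) * h = (2 * t * fst z) * h - 2 * real l * (t * h\<^sup>2)"
      by (simp add: power2_eq_square algebra_simps)
     then show ?thesis using abs_triangle_ineq4[of "(2 * t * fst z) * h" "2 * real l * (t * h\<^sup>2)"] by (simp add: abs_mult)
    qed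
    then have "\<mu> (fst z - real l * h) \<le> (2 * real N + 1) ^ (2 * m) * (2 ^ (2 * m) * (min 1 \<bar>(2 * t * fst z) * h\<bar> ^ (2 * m) + min 1 \<bar>t * h\<^sup>2\<bar> ^ (2 * m)))"
     unfolding \<mu>_def using l by (intro cutoff_shift) auto
    also have "min 1 \<bar>t * h\<^sup>2\<bar> ^ (2 * m) = min 1 \<bar>sqrt \<bar>t\<bar> * h\<bar> ^ (4 * m)"
    proof -
     have "\<bar>t * h\<^sup>2\<bar> = \<bar>sqrt \<bar>t\<bar> * h\<bar>\<^sup>2" by (simp add: power_mult_distrib abs_mult)
     then have "min 1 \<bar>t * h\<^sup>2\<bar> = (min 1 \<bar>sqrt \<bar>t\<bar> * h\<bar>)\<^sup>2"
      by (simp only: min_one_square abs_ge_zero)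
     then show ?thesis by (simp add: power_mult[symmetric])
    qed
    finally have "\<mu> (fst z - real l * h) \<le> R * \<nu> (fst z)" unfolding R_def \<nu>_def by (simp add: mult.assoc)
    then have "\<mu> (fst z - real l * h) * g z \<le> R * (\<nu> (fst z) * g z)"
     using mult_right_mono[OF _ gd0(1), of _ "R * \<nu> (fst z)" z] by (simp add: mult.assoc)
    then show "ennreal (\<mu> (fst z - real l * h) * g z) \<le> ennreal R * (ennreal (\<nu> (fst z)) * ennreal (g z))"
     using KR gd0 by (subst ennreal_mult[symmetric], simp, simp, subst ennreal_mult[symmetric]) (auto intro: ennreal_leI)
   qed
   also have "... = ennreal R * (\<integral>\<^sup>+z. ennreal (\<nu> (fst z)) * ennreal (g z) \<partial>frequencies)"
    by (rule nn_integral_cmult) measurable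
   finally show ?thesis .
  qed
  define I where "I = (\<integral>\<^sup>+z. ennreal (\<nu> (fst z)) * ennreal (g z) \<partial>frequencies)"
  define E where "E = energy frequencies (xdiff m h G)"
  have md: "(\<lambda>z. ennreal (d (fst z + real l * h, snd z))) \<in> freq_measurable" for l
   by (rule freq_shift_measurable[of "\<lambda>z. ennreal (d z)"]) simp
  have mg: "(\<lambda>z. ennreal (\<mu> (fst z) * g (fst z + real l * h, snd z))) \<in> freq_measurable" for l
  proof -
   have [measurable]: "(\<lambda>z. g (fst z + real l * h, snd z)) \<in> freq_measurable" by (rule freq_shift_measurable) simp
   show ?thesis unfolding \<mu>_def by measurable
  qed
  have "energy frequencies (xdiff N h (chirp t G))
   \<le> (\<integral>\<^sup>+z. ennreal K * ((\<Sum>l\<le>N. ennreal (d (fst z + real l * h, snd z))) + (\<Sum>l\<le>N. ennreal (\<mu> (fst z) * g (fst z + real l * h, snd z)))) \<partial>frequencies)"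
   unfolding energy_def
  proof (rule nn_integral_mono)
   fix z :: "real \<times> int"
   have "nsq (xdiff N h (chirp t G) z)
    \<le> ennreal (K * ((\<Sum>l\<le>N. d (fst z + real l * h, snd z)) + (\<Sum>l\<le>N. \<mu> (fst z) * g (fst z + real l * h, snd z))))"
    by (rule ennreal_leI[OF point])
   also have "... = ennreal K * ((\<Sum>l\<le>N. ennreal (d (fst z + real l * h, snd z))) + (\<Sum>l\<le>N. ennreal (\<mu> (fst z) * g (fst z + real l * h, snd z))))"
    using KR gd0 by (simp add: ennreal_mult[of K] sum_nonneg)
   finally show "nsq (xdiff N h (chirp t G) z)
    \<le> ennreal K * ((\<Sum>l\<le>N. ennreal (d (fst z + real l * h, snd z))) + (\<Sum>l\<le>N. ennreal (\<mu> (fst z) * g (fst z + real l * h, snd z))))" .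
  qed
  also have "... = ennreal K * ((\<Sum>l\<le>N. \<integral>\<^sup>+z. ennreal (d (fst z + real l * h, snd z)) \<partial>frequencies)
   + (\<Sum>l\<le>N. \<integral>\<^sup>+z. ennreal (\<mu> (fst z) * g (fst z + real l * h, snd z)) \<partial>frequencies))"
   using md mg by (simp add: nn_integral_cmult nn_integral_add nn_integral_sum del: sum_ennreal)
  also have "... \<le> ennreal K * ((\<Sum>l\<le>N. ennreal R * E) + (\<Sum>l\<le>N. ennreal R * I))"
  proof (intro mult_left_mono add_mono sum_mono)
   show "(\<integral>\<^sup>+z. ennreal (d (fst z + real l * h, snd z)) \<partial>frequencies) \<le> ennreal R * E" for l
    using mult_right_mono[of 1 "ennreal R" E] KR unfolding shift_d E_def by simp
   show "(\<integral>\<^sup>+z. ennreal (\<mu> (fst z) * g (fst z + real l * h, snd z)) \<partial>frequencies) \<le> ennreal R * I" if "l \<in> {..N}" for l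
    using shift_g that unfolding I_def by simp
  qed simp
  also have "... = ennreal C * (E + I)"
  proof -
   have "ennreal C = ennreal K * (of_nat (Suc N) * ennreal R)"
    unfolding C_def using KR by (simp add: ennreal_mult ennreal_of_nat_eq_real_of_nat mult.assoc del: of_nat_Suc)
   then show ?thesis by (simp add: distrib_left mult.assoc del: of_nat_Suc)
  qed
  finally show "energy frequencies (xdiff (3 * m) h (chirp t G))
   \<le> ennreal C * (energy frequencies (xdiff m h G)
   + (\<integral>\<^sup>+z. ennreal (min 1 \<bar>(2 * t * fst z) * h\<bar> ^ (2 * m) + min 1 \<bar>sqrt \<bar>t\<bar> * h\<bar> ^ (4 * m)) * nsq (G z) \<partial>frequencies))"
   by (simp add: N_def E_def I_def \<nu>_def g_def)
 qed
qed

text \<open>Integrating the cutoffs \<open>min 1 \<bar>2 t \<xi> h\<bar>\<close> and \<open>min 1 (\<bar>t\<bar>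
 h\<^sup>2)\<close> against the singular kernel gives, by scaling, the factors \<open>\<bar>t \<xi>\<bar> powr (2
 \<theta>)\<close> and \<open>\<bar>t\<bar> powr \<theta>\<close>. The integrals converge because the powers \<open>2
 m\<close> and \<open>4 m\<close> exceed \<open>2 \<theta>\<close>.\<close>

theorem diff_energy_chirp:
 fixes m :: nat
 assumes m: "1 \<le> m" and \<theta>: "0 < \<theta>" "\<theta> < real m"
 shows "\<exists>C\<ge>0. \<forall>t. \<forall>G\<in>freq_measurable.
  diff_energy (3 * m) \<theta> (chirp t G)
  \<le> ennreal C * (diff_energy m \<theta> G + ennreal (\<bar>t\<bar> powr (2 * \<theta>)) * freq_weight (2 * \<theta>) G
   + ennreal (\<bar>t\<bar> powr \<theta>) * energy frequencies G)"
proof -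
 obtain C0 where C0: "0 \<le> C0" and main: "\<And>t h G. G \<in> freq_measurable \<Longrightarrow>
  energy frequencies (xdiff (3 * m) h (chirp t G))
  \<le> ennreal C0 * (energy frequencies (xdiff m h G)
   + (\<integral>\<^sup>+z. ennreal (min 1 \<bar>(2 * t * fst z) * h\<bar> ^ (2 * m) + min 1 \<bar>sqrt \<bar>t\<bar> * h\<bar> ^ (4 * m)) * nsq (G z) \<partial>frequencies))"
  using energy_xdiff_chirp[OF m] by blast
 have f1: "cutoff_const (2 * m) \<theta> < \<infinity>" using \<theta> by (intro cutoff_const_finite) auto
 have f2: "cutoff_const (4 * m) \<theta> < \<infinity>" using \<theta> by (intro cutoff_const_finite) auto
 obtain c1 where c1: "cutoff_const (2 * m) \<theta> = ennreal c1" "0 \<le> c1" using f1 by (cases "cutoff_const (2 * m) \<theta>") auto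
 obtain c2 where c2: "cutoff_const (4 * m) \<theta> = ennreal c2" "0 \<le> c2" using f2 by (cases "cutoff_const (4 * m) \<theta>") auto
 define D where "D = 1 + 2 powr (2 * \<theta>) * c1 + c2"
 have D: "1 \<le> D" "2 powr (2 * \<theta>) * c1 \<le> D" "c2 \<le> D" using c1 c2 by (auto simp: D_def add_nonneg_nonneg)
 show ?thesis
 proof (intro exI[of _ "C0 * D"] conjI allI ballI)
  show "0 \<le> C0 * D" using C0 D by simp
  fix t :: real and G :: "real \<times> int \<Rightarrow> complex" assume G[measurable]: "G \<in> freq_measurable"
  define g where "g z = nsq (G z)" for z
  have gm[measurable]: "g \<in> freq_measurable" unfolding g_def by measurable
  define q where "q \<xi> h = ennreal (min 1 \<bar>(2 * t * \<xi>) * h\<bar> ^ (2 * m) + min 1 \<bar>sqrt \<bar>t\<bar> * h\<bar> ^ (4 * m))" for \<xi> h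
  have qm: "(\<lambda>(h, z). sing \<theta> h * (q (fst z) h * g z)) \<in> borel_measurable (lborel \<Otimes>\<^sub>M frequencies)"
  proof -
   have [measurable]: "g \<in> borel_measurable (lborel \<Otimes>\<^sub>M count_space UNIV)" using gm by (simp add: frequencies_def)
   show ?thesis unfolding q_def frequencies_def by measurable
  qed
  have qz: "(\<lambda>z. q (fst z) h * g z) \<in> freq_measurable" for h unfolding q_def by measurable
  note em[measurable] = energy_xdiff_measurable[OF G, of m]
  have inner: "(\<integral>\<^sup>+h. (\<integral>\<^sup>+z. sing \<theta> h * (q (fst z) h * g z) \<partial>frequencies) \<partial>lborel)
   = (\<integral>\<^sup>+z. ennreal (2 powr (2 * \<theta>) * c1 * \<bar>t\<bar> powr (2 * \<theta>)) * (fst_powr (2 * \<theta>) z * g z)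
     + ennreal (c2 * \<bar>t\<bar> powr \<theta>) * g z \<partial>frequencies)"
  proof -
   have "(\<integral>\<^sup>+h. (\<integral>\<^sup>+z. sing \<theta> h * (q (fst z) h * g z) \<partial>frequencies) \<partial>lborel)
    = (\<integral>\<^sup>+z. (\<integral>\<^sup>+h. sing \<theta> h * (q (fst z) h * g z) \<partial>lborel) \<partial>frequencies)"
    using line_freq.Fubini'[OF qm] by simp
   also have "... = (\<integral>\<^sup>+z. ennreal (2 powr (2 * \<theta>) * c1 * \<bar>t\<bar> powr (2 * \<theta>)) * (fst_powr (2 * \<theta>) z * g z)
     + ennreal (c2 * \<bar>t\<bar> powr \<theta>) * g z \<partial>frequencies)"
   proof (rule nn_integral_cong)
    fix z :: "real \<times> int"
    have "(\<integral>\<^sup>+h. sing \<theta> h * (q (fst z) h * g z) \<partial>lborel)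
     = (\<integral>\<^sup>+h. (sing \<theta> h * ennreal (min 1 \<bar>(2 * t * fst z) * h\<bar> ^ (2 * m)) + sing \<theta> h * ennreal (min 1 \<bar>sqrt \<bar>t\<bar> * h\<bar> ^ (4 * m))) * g z \<partial>lborel)"
     by (intro nn_integral_cong) (simp add: q_def distrib_left distrib_right mult.assoc)
    also have "... = ((\<integral>\<^sup>+h. sing \<theta> h * ennreal (min 1 \<bar>(2 * t * fst z) * h\<bar> ^ (2 * m)) \<partial>lborel)
      + (\<integral>\<^sup>+h. sing \<theta> h * ennreal (min 1 \<bar>sqrt \<bar>t\<bar> * h\<bar> ^ (4 * m)) \<partial>lborel)) * g z"
     by (subst nn_integral_multc, measurable) (subst nn_integral_add, auto)
    also have "... = (ennreal (\<bar>2 * t * fst z\<bar> powr (2 * \<theta>)) * ennreal c1 + ennreal (\<bar>sqrt \<bar>t\<bar>\<bar> powr (2 * \<theta>)) * ennreal c2) * g z"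
     using m by (subst cutoff_scaled, simp, subst cutoff_scaled) (simp_all add: c1 c2)
    also have "\<bar>sqrt \<bar>t\<bar>\<bar> powr (2 * \<theta>) = \<bar>t\<bar> powr \<theta>"
     by (simp add: powr_half_sqrt[symmetric] powr_powr)
    also have "\<bar>2 * t * fst z\<bar> powr (2 * \<theta>) = 2 powr (2 * \<theta>) * \<bar>t\<bar> powr (2 * \<theta>) * \<bar>fst z\<bar> powr (2 * \<theta>)"
     by (simp add: abs_mult powr_mult)
    finally show "(\<integral>\<^sup>+h. sing \<theta> h * (q (fst z) h * g z) \<partial>lborel)
     = ennreal (2 powr (2 * \<theta>) * c1 * \<bar>t\<bar> powr (2 * \<theta>)) * (fst_powr (2 * \<theta>) z * g z)
     + ennreal (c2 * \<bar>t\<bar> powr \<theta>) * g z"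
     using c1 c2 by (simp add: distrib_right distrib_left ennreal_mult mult_ac)
   qed
   finally show ?thesis .
  qed
  have "diff_energy (3 * m) \<theta> (chirp t G)
   \<le> (\<integral>\<^sup>+h. ennreal C0 * (sing \<theta> h * energy frequencies (xdiff m h G)
     + (\<integral>\<^sup>+z. sing \<theta> h * (q (fst z) h * g z) \<partial>frequencies)) \<partial>lborel)"
   unfolding diff_energy_def
  proof (rule nn_integral_mono)
   fix h :: real
   have "sing \<theta> h * energy frequencies (xdiff (3 * m) h (chirp t G))
    \<le> sing \<theta> h * (ennreal C0 * (energy frequencies (xdiff m h G) + (\<integral>\<^sup>+z. q (fst z) h * g z \<partial>frequencies)))"
    unfolding q_def g_def by (intro mult_left_mono main G) auto
   also have "... = ennreal C0 * (sing \<theta> h * energy frequencies (xdiff m h G)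
     + (\<integral>\<^sup>+z. sing \<theta> h * (q (fst z) h * g z) \<partial>frequencies))"
    by (subst nn_integral_cmult[OF qz]) (simp add: distrib_left mult_ac)
   finally show "sing \<theta> h * energy frequencies (xdiff (3 * m) h (chirp t G))
    \<le> ennreal C0 * (sing \<theta> h * energy frequencies (xdiff m h G)
     + (\<integral>\<^sup>+z. sing \<theta> h * (q (fst z) h * g z) \<partial>frequencies))" .
  qed
  also have "... = ennreal C0 * (diff_energy m \<theta> G + (\<integral>\<^sup>+h. (\<integral>\<^sup>+z. sing \<theta> h * (q (fst z) h * g z) \<partial>frequencies) \<partial>lborel))"
   unfolding diff_energy_def using cyl_freq.M2.borel_measurable_nn_integral_fst[OF qm]
   by (subst nn_integral_cmult, simp, subst nn_integral_add) auto
  also have "... = ennreal C0 * (diff_energy m \<theta> G + (ennreal (2 powr (2 * \<theta>) * c1 * \<bar>t\<bar> powr (2 * \<theta>)) * freq_weight (2 * \<theta>) G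
    + ennreal (c2 * \<bar>t\<bar> powr \<theta>) * energy frequencies G))"
   unfolding inner freq_weight_def energy_def g_def[symmetric]
   by (subst nn_integral_add, measurable) (simp add: nn_integral_cmult)
  also have "... \<le> ennreal C0 * (ennreal D * diff_energy m \<theta> G + (ennreal D * (ennreal (\<bar>t\<bar> powr (2 * \<theta>)) * freq_weight (2 * \<theta>) G)
    + ennreal D * (ennreal (\<bar>t\<bar> powr \<theta>) * energy frequencies G)))"
  proof (intro mult_left_mono add_mono)
   show "diff_energy m \<theta> G \<le> ennreal D * diff_energy m \<theta> G"
    using mult_right_mono[of 1 "ennreal D" "diff_energy m \<theta> G"] D by simp
   show "ennreal (2 powr (2 * \<theta>) * c1 * \<bar>t\<bar> powr (2 * \<theta>)) * freq_weight (2 * \<theta>) G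
    \<le> ennreal D * (ennreal (\<bar>t\<bar> powr (2 * \<theta>)) * freq_weight (2 * \<theta>) G)"
    unfolding mult.assoc[symmetric] using D c1 by (subst ennreal_mult[symmetric]) (auto intro!: mult_right_mono ennreal_leI)
   show "ennreal (c2 * \<bar>t\<bar> powr \<theta>) * energy frequencies G \<le> ennreal D * (ennreal (\<bar>t\<bar> powr \<theta>) * energy frequencies G)"
    unfolding mult.assoc[symmetric] using D c2 by (subst ennreal_mult[symmetric]) (auto intro!: mult_right_mono ennreal_leI)
  qed simp
  also have "... = ennreal (C0 * D) * (diff_energy m \<theta> G + ennreal (\<bar>t\<bar> powr (2 * \<theta>)) * freq_weight (2 * \<theta>) G
   + ennreal (\<bar>t\<bar> powr \<theta>) * energy frequencies G)"
   using C0 D by (simp add: ennreal_mult distrib_left mult.assoc add.assoc)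
  finally show "diff_energy (3 * m) \<theta> (chirp t G)
   \<le> ennreal (C0 * D) * (diff_energy m \<theta> G + ennreal (\<bar>t\<bar> powr (2 * \<theta>)) * freq_weight (2 * \<theta>) G
   + ennreal (\<bar>t\<bar> powr \<theta>) * energy frequencies G)" .
 qed
qed

lemma AE_frequencies_nonzero: "AE z in frequencies. fst z \<noteq> 0" unfolding frequencies_def
proof (rule line_int.AE_pair_measure)
 show "AE x in lborel. AE y in count_space UNIV. fst (x::real, y::int) \<noteq> 0"
  using AE_lborel_singleton[of "0::real"] by eventually_elim simp
qed measurable

lemma xdiff_add: "xdiff N h (\<lambda>z. a z + b z) z = xdiff N h a z + xdiff N h b z" by (simp add: xdiff_def fdiff_add)

lemma xdiff_cmult_snd: "xdiff N h (\<lambda>z. c (snd z) * a z) z = c (snd z) * xdiff N h a z"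
 by (simp add: xdiff_def fdiff_cmult)

lemma diff_energy_add_le:
 assumes "a \<in> freq_measurable" "b \<in> freq_measurable"
 shows "diff_energy N \<theta> (\<lambda>z. a z + b z) \<le> 2 * (diff_energy N \<theta> a + diff_energy N \<theta> b)"
proof -
 note [measurable] = energy_xdiff_measurable[OF assms(1), of N] energy_xdiff_measurable[OF assms(2), of N]
 have "diff_energy N \<theta> (\<lambda>z. a z + b z)
  \<le> (\<integral>\<^sup>+h. 2 * (sing \<theta> h * energy frequencies (xdiff N h a) + sing \<theta> h * energy frequencies (xdiff N h b)) \<partial>lborel)"
  unfolding diff_energy_def
 proof (rule nn_integral_mono)
  fix h :: real
  have "energy frequencies (xdiff N h (\<lambda>z. a z + b z)) = energy frequencies (\<lambda>z. xdiff N h a z + xdiff N h b z)"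
   by (simp add: xdiff_add[abs_def] energy_def)
  also have "... \<le> 2 * (energy frequencies (xdiff N h a) + energy frequencies (xdiff N h b))"
   by (intro energy_add_le2 xdiff_measurable assms)
  finally have "sing \<theta> h * energy frequencies (xdiff N h (\<lambda>z. a z + b z))
   \<le> sing \<theta> h * (2 * (energy frequencies (xdiff N h a) + energy frequencies (xdiff N h b)))"
   by (rule mult_left_mono) simp
  then show "sing \<theta> h * energy frequencies (xdiff N h (\<lambda>z. a z + b z))
   \<le> 2 * (sing \<theta> h * energy frequencies (xdiff N h a) + sing \<theta> h * energy frequencies (xdiff N h b))"
   by (simp add: distrib_left mult.left_commute)
 qed
 also have "... = 2 * (diff_energy N \<theta> a + diff_energy N \<theta> b)"
  unfolding diff_energy_def by (simp add: nn_integral_cmult nn_integral_add)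
 finally show ?thesis .
qed

lemma diff_energy_unimodular:
 assumes "\<And>\<eta>. cmod (c \<eta>) = r"
 shows "diff_energy N \<theta> (\<lambda>z. c (snd z) * a z) = diff_energy N \<theta> (\<lambda>z. of_real r * a z)"
proof -
 have "0 \<le> r" using assms[of 0] by (metis norm_ge_zero)
 then show ?thesis unfolding diff_energy_def energy_def xdiff_cmult_snd
  by (subst xdiff_cmult_snd[where c="\<lambda>_. of_real r"]) (simp add: norm_mult assms)
qed

lemma diff_energy_cmult_half:
 assumes "a \<in> freq_measurable" and c: "cmod c \<le> 1"
 shows "diff_energy N \<theta> (\<lambda>z. c * a z) \<le> diff_energy N \<theta> a" unfolding diff_energy_def
proof (intro nn_integral_mono mult_left_mono)
 fix h
 show "energy frequencies (xdiff N h (\<lambda>z. c * a z)) \<le> energy frequencies (xdiff N h a)"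
 proof (rule energy_mono)
  fix z
  show "cmod (xdiff N h (\<lambda>z. c * a z) z) \<le> cmod (xdiff N h a z)"
   using c mult_right_mono[of "cmod c" 1 "cmod (xdiff N h a z)"]
   by (subst xdiff_cmult_snd[where c="\<lambda>_. c"]) (simp add: norm_mult)
 qed
qed simp

text \<open>If all points of the difference lie on the same side of the jump, the sign drops out. Otherwise they all lie within
 the distance \<open>N \<bar>h\<bar>\<close> of it, since they span an interval of that length; for such points the
 trivial bound is kept.\<close>

lemma xdiff_sgn_bound:
 shows "(cmod (xdiff N h (\<lambda>z. of_real (sgn (fst z)) * G z) z))\<^sup>2
  \<le> 2 * (cmod (xdiff N h G z))\<^sup>2 + 4 ^ N * real (Suc N) *
   (\<Sum>l\<le>N. indicator {..real N * \<bar>h\<bar>} \<bar>fst z + real l * h\<bar> * (cmod (G (fst z + real l * h, snd z)))\<^sup>2)"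
  (is "?L \<le> 2 * ?D + ?S")
proof -
 have S: "0 \<le> ?S" by (intro mult_nonneg_nonneg sum_nonneg) auto
 have same: ?thesis if s: "\<And>j. j \<le> N \<Longrightarrow> sgn (fst z + real j * h) = s" "\<bar>s\<bar> = 1" for s
 proof -
  have "xdiff N h (\<lambda>z. of_real (sgn (fst z)) * G z) z = of_real s * xdiff N h G z"
   unfolding xdiff_def by (subst fdiff_cmult[symmetric]) (auto intro!: fdiff_cong simp: s)
  then have "?L = ?D" using s(2) by (simp add: norm_mult)
  then show ?thesis using S by simp
 qed
 consider "\<forall>j\<le>N. 0 < fst z + real j * h" | "\<forall>j\<le>N. fst z + real j * h < 0"
  | j j' where "j \<le> N" "j' \<le> N" "fst z + real j * h \<le> 0" "0 \<le> fst z + real j' * h" by (metis not_le)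
 then show ?thesis
 proof cases
  case 1 then show ?thesis by (intro same[of 1]) auto
 next
  case 2 then show ?thesis by (intro same[of "-1"]) auto
 next
  case 3
  have near: "\<bar>fst z + real l * h\<bar> \<le> real N * \<bar>h\<bar>" if "l \<le> N" for l
  proof -
   have b: "\<bar>(real l - real i) * h\<bar> \<le> real N * \<bar>h\<bar>" if "i \<le> N" for i
    unfolding abs_mult using that \<open>l \<le> N\<close> by (intro mult_right_mono) auto
   have "fst z + real l * h = (fst z + real j * h) + (real l - real j) * h"
    "fst z + real l * h = (fst z + real j' * h) + (real l - real j') * h" by (simp_all add: algebra_simps)
   then show ?thesis using b[OF 3(1)] b[OF 3(2)] 3(3,4) by linarith
  qed
  have "cmod (xdiff N h (\<lambda>z. of_real (sgn (fst z)) * G z) z)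
   \<le> 2 ^ N * (\<Sum>l\<le>N. cmod (of_real (sgn (fst z + real l * h)) * G (fst z + real l * h, snd z)))"
   unfolding xdiff_def by (rule order_trans[OF fdiff_bound]) simp
  also have "... \<le> 2 ^ N * (\<Sum>l\<le>N. cmod (G (fst z + real l * h, snd z)))"
   by (intro mult_left_mono sum_mono) (auto simp: norm_mult abs_sgn_eq)
  finally have "?L \<le> (2 ^ N * (\<Sum>l\<le>N. cmod (G (fst z + real l * h, snd z))))\<^sup>2" by (intro power_mono) auto
  also have "... = 4 ^ N * (\<Sum>l\<le>N. cmod (G (fst z + real l * h, snd z)))\<^sup>2"
   by (simp add: power_mult_distrib power_mult[symmetric] mult.commute[of N] power_mult)
  also have "... \<le> 4 ^ N * (real (Suc N) * (\<Sum>l\<le>N. (cmod (G (fst z + real l * h, snd z)))\<^sup>2))"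
   by (intro mult_left_mono sum_squared_le) auto
  also have "(\<Sum>l\<le>N. (cmod (G (fst z + real l * h, snd z)))\<^sup>2)
   = (\<Sum>l\<le>N. indicator {..real N * \<bar>h\<bar>} \<bar>fst z + real l * h\<bar> * (cmod (G (fst z + real l * h, snd z)))\<^sup>2)"
   using near by (intro sum.cong) auto
  finally show ?thesis by (simp add: mult.assoc add_increasing)
 qed
qed

lemma sing_tail_finite:
 assumes "0 < \<theta>"
 shows "(\<integral>\<^sup>+h. sing \<theta> h * indicator {1..} \<bar>h\<bar> \<partial>lborel) < \<infinity>"
proof -
 obtain p :: nat where p: "2 * \<theta> < real p" using reals_Archimedean2 by blast
 have "(\<integral>\<^sup>+h. sing \<theta> h * indicator {1..} \<bar>h\<bar> \<partial>lborel) \<le> cutoff_const p \<theta>"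
  unfolding cutoff_const_def by (intro nn_integral_mono mult_left_mono) (auto simp: indicator_def)
 also have "... < \<infinity>" by (rule cutoff_const_finite[OF assms p])
 finally show ?thesis .
qed

text \<open>Steps \<open>h\<close> with \<open>N \<bar>h\<bar> \<ge> \<bar>\<xi>\<bar>\<close> see the jump; the mass of the
 singular kernel on them is a constant times \<open>\<bar>\<xi>\<bar> powr (- 2 \<theta>)\<close>.\<close>

theorem diff_energy_sgn:
 assumes N: "1 \<le> N" and \<theta>: "0 < \<theta>"
 shows "\<exists>C\<ge>0. \<forall>G\<in>freq_measurable.
  diff_energy N \<theta> (\<lambda>z. of_real (sgn (fst z)) * G z) \<le> ennreal C * (diff_energy N \<theta> G + freq_weight (- 2 * \<theta>) G)"
proof -
 define J where "J = (\<integral>\<^sup>+h. sing \<theta> h * indicator {1..} \<bar>h\<bar> \<partial>lborel)"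
 have "J < \<infinity>" unfolding J_def by (rule sing_tail_finite[OF \<theta>])
 then obtain j where j: "J = ennreal j" "0 \<le> j" by (cases J) auto
 define K where "K = 4 ^ N * real (Suc N)"
 have K: "0 \<le> K" unfolding K_def by simp
 define c where "c = real N powr (2 * \<theta>) * j"
 have c: "0 \<le> c" using j by (simp add: c_def)
 define C where "C = 2 + K * real (Suc N) * c"
 show ?thesis
 proof (intro exI[of _ C] conjI ballI)
  show "0 \<le> C" unfolding C_def using K c by simp
  fix G :: "real \<times> int \<Rightarrow> complex" assume G[measurable]: "G \<in> freq_measurable"
  define g where "g z = nsq (G z)" for z
  have gm[measurable]: "g \<in> freq_measurable" unfolding g_def by measurable
  define q :: "real \<Rightarrow> real \<Rightarrow> ennreal" where "q \<xi> h = indicator {..real N * \<bar>h\<bar>} \<bar>\<xi>\<bar>" for \<xi> h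
  have q_alt: "q \<xi> h = (if \<bar>\<xi>\<bar> \<le> real N * \<bar>h\<bar> then 1 else 0)" for \<xi> h by (simp add: q_def indicator_def)
  have qm: "(\<lambda>(h, z). sing \<theta> h * (q (fst z) h * g z)) \<in> borel_measurable (lborel \<Otimes>\<^sub>M frequencies)"
  proof -
   have [measurable]: "g \<in> borel_measurable (lborel \<Otimes>\<^sub>M count_space UNIV)" using gm by (simp add: frequencies_def)
   show ?thesis unfolding q_alt frequencies_def by measurable
  qed
  have qz[measurable]: "(\<lambda>z. q (fst z) h * g z) \<in> freq_measurable" for h unfolding q_alt by measurable
  note em[measurable] = energy_xdiff_measurable[OF G, of N]
  have step: "energy frequencies (xdiff N h (\<lambda>z. of_real (sgn (fst z)) * G z))
   \<le> 2 * energy frequencies (xdiff N h G) + ennreal (K * real (Suc N)) * (\<integral>\<^sup>+z. q (fst z) h * g z \<partial>frequencies)" for h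
  proof -
   have ml: "(\<lambda>z. q (fst z + real l * h) h * g (fst z + real l * h, snd z)) \<in> freq_measurable" for l
    using freq_shift_measurable[OF qz[of h], of "real l * h"] by simp
   note [measurable] = xdiff_measurable[OF G, of N h]
   have "energy frequencies (xdiff N h (\<lambda>z. of_real (sgn (fst z)) * G z))
    \<le> (\<integral>\<^sup>+z. 2 * nsq (xdiff N h G z)
     + ennreal K * (\<Sum>l\<le>N. q (fst z + real l * h) h * g (fst z + real l * h, snd z)) \<partial>frequencies)"
    unfolding energy_def
   proof (rule nn_integral_mono)
    fix z :: "real \<times> int"
    have "nsq (xdiff N h (\<lambda>z. of_real (sgn (fst z)) * G z) z)
     \<le> ennreal (2 * (cmod (xdiff N h G z))\<^sup>2 + K *
   (\<Sum>l\<le>N. indicator {..real N * \<bar>h\<bar>} \<bar>fst z + real l * h\<bar> * (cmod (G (fst z + real l * h, snd z)))\<^sup>2))"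
     unfolding K_def by (rule ennreal_leI[OF xdiff_sgn_bound])
    also have "... = 2 * nsq (xdiff N h G z)
     + ennreal K * (\<Sum>l\<le>N. ennreal (indicator {..real N * \<bar>h\<bar>} \<bar>fst z + real l * h\<bar> * (cmod (G (fst z + real l * h, snd z)))\<^sup>2))"
     using K by (simp add: ennreal_mult[of K] ennreal_mult[of 2] sum_nonneg)
    also have "(\<Sum>l\<le>N. ennreal (indicator {..real N * \<bar>h\<bar>} \<bar>fst z + real l * h\<bar> * (cmod (G (fst z + real l * h, snd z)))\<^sup>2))
     = (\<Sum>l\<le>N. q (fst z + real l * h) h * g (fst z + real l * h, snd z))"
     by (intro sum.cong refl) (simp add: q_def g_def indicator_def)
    finally show "nsq (xdiff N h (\<lambda>z. of_real (sgn (fst z)) * G z) z)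
     \<le> 2 * nsq (xdiff N h G z)
     + ennreal K * (\<Sum>l\<le>N. q (fst z + real l * h) h * g (fst z + real l * h, snd z))" .
   qed
   also have "... = 2 * energy frequencies (xdiff N h G)
     + ennreal K * (\<Sum>l\<le>N. \<integral>\<^sup>+z. q (fst z + real l * h) h * g (fst z + real l * h, snd z) \<partial>frequencies)"
    unfolding energy_def using ml by (simp add: nn_integral_cmult nn_integral_add nn_integral_sum)
   also have "(\<Sum>l\<le>N. \<integral>\<^sup>+z. q (fst z + real l * h) h * g (fst z + real l * h, snd z) \<partial>frequencies)
     = (\<Sum>l\<le>N. \<integral>\<^sup>+z. q (fst z) h * g z \<partial>frequencies)"
   proof (rule sum.cong[OF refl])
    fix l
    show "(\<integral>\<^sup>+z. q (fst z + real l * h) h * g (fst z + real l * h, snd z) \<partial>frequencies) = (\<integral>\<^sup>+z. q (fst z) h * g z \<partial>frequencies)"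
     using nn_integral_freq_shift[OF qz[of h], of "real l * h"] by simp
   qed
   also have "ennreal K * (\<Sum>l\<le>N. \<integral>\<^sup>+z. q (fst z) h * g z \<partial>frequencies)
    = ennreal (K * real (Suc N)) * (\<integral>\<^sup>+z. q (fst z) h * g z \<partial>frequencies)"
    using K by (simp add: ennreal_mult ennreal_of_nat_eq_real_of_nat mult.assoc del: of_nat_Suc)
   finally show ?thesis .
  qed
  have inner: "(\<integral>\<^sup>+h. (\<integral>\<^sup>+z. sing \<theta> h * (q (fst z) h * g z) \<partial>frequencies) \<partial>lborel) = ennreal c * freq_weight (- 2 * \<theta>) G"
  proof -
   have "(\<integral>\<^sup>+h. (\<integral>\<^sup>+z. sing \<theta> h * (q (fst z) h * g z) \<partial>frequencies) \<partial>lborel)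
    = (\<integral>\<^sup>+z. (\<integral>\<^sup>+h. sing \<theta> h * (q (fst z) h * g z) \<partial>lborel) \<partial>frequencies)"
    using line_freq.Fubini'[OF qm] by simp
   also have "... = (\<integral>\<^sup>+z. ennreal c * (fst_powr (- 2 * \<theta>) z * g z) \<partial>frequencies)"
   proof (rule nn_integral_cong_AE)
    show "AE z in frequencies. (\<integral>\<^sup>+h. sing \<theta> h * (q (fst z) h * g z) \<partial>lborel) = ennreal c * (fst_powr (- 2 * \<theta>) z * g z)"
     using AE_frequencies_nonzero
    proof eventually_elim
     case (elim z)
     define a where "a = real N / \<bar>fst z\<bar>"
     have a: "0 < a" using elim N by (simp add: a_def)
     have "q (fst z) h = indicator {1..} \<bar>a * h\<bar>" for h
      using elim a by (simp add: q_def indicator_def a_def abs_mult field_simps)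
     then have "(\<integral>\<^sup>+h. sing \<theta> h * (q (fst z) h * g z) \<partial>lborel) = (\<integral>\<^sup>+h. sing \<theta> h * indicator {1..} \<bar>a * h\<bar> * g z \<partial>lborel)"
      by (simp add: mult.assoc)
     also have "... = (\<integral>\<^sup>+h. sing \<theta> h * indicator {1..} \<bar>a * h\<bar> \<partial>lborel) * g z"
      by (rule nn_integral_multc) measurable
     also have "(\<integral>\<^sup>+h. sing \<theta> h * indicator {1..} \<bar>a * h\<bar> \<partial>lborel) = ennreal (\<bar>a\<bar> powr (2 * \<theta>)) * J"
      unfolding J_def using a by (intro sing_scale[of "\<lambda>h. indicator {1..} \<bar>h\<bar>"]) auto
     also have "\<bar>a\<bar> powr (2 * \<theta>) = real N powr (2 * \<theta>) * \<bar>fst z\<bar> powr (- 2 * \<theta>)"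
      by (simp add: a_def powr_divide powr_minus_divide)
     finally show ?case using j by (simp add: c_def ennreal_mult mult_ac)
    qed
   qed
   also have "... = ennreal c * freq_weight (- 2 * \<theta>) G"
    unfolding freq_weight_def g_def[symmetric] by (rule nn_integral_cmult) measurable
   finally show ?thesis .
  qed
  have "diff_energy N \<theta> (\<lambda>z. of_real (sgn (fst z)) * G z)
   \<le> (\<integral>\<^sup>+h. 2 * (sing \<theta> h * energy frequencies (xdiff N h G))
     + ennreal (K * real (Suc N)) * (\<integral>\<^sup>+z. sing \<theta> h * (q (fst z) h * g z) \<partial>frequencies) \<partial>lborel)"
   unfolding diff_energy_def
  proof (rule nn_integral_mono)
   fix h :: real
   have "sing \<theta> h * energy frequencies (xdiff N h (\<lambda>z. of_real (sgn (fst z)) * G z))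
    \<le> sing \<theta> h * (2 * energy frequencies (xdiff N h G) + ennreal (K * real (Suc N)) * (\<integral>\<^sup>+z. q (fst z) h * g z \<partial>frequencies))"
    by (intro mult_left_mono step) simp
   also have "... = 2 * (sing \<theta> h * energy frequencies (xdiff N h G))
     + ennreal (K * real (Suc N)) * (\<integral>\<^sup>+z. sing \<theta> h * (q (fst z) h * g z) \<partial>frequencies)"
    by (subst nn_integral_cmult[OF qz]) (simp add: distrib_left mult.left_commute)
   finally show "sing \<theta> h * energy frequencies (xdiff N h (\<lambda>z. of_real (sgn (fst z)) * G z))
    \<le> 2 * (sing \<theta> h * energy frequencies (xdiff N h G))
     + ennreal (K * real (Suc N)) * (\<integral>\<^sup>+z. sing \<theta> h * (q (fst z) h * g z) \<partial>frequencies)" .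
  qed
  also have "... = 2 * diff_energy N \<theta> G + ennreal (K * real (Suc N)) * (ennreal c * freq_weight (- 2 * \<theta>) G)"
   unfolding diff_energy_def inner[symmetric]
   using cyl_freq.M2.borel_measurable_nn_integral_fst[OF qm] by (subst nn_integral_add) (auto simp: nn_integral_cmult)
  also have "... = 2 * diff_energy N \<theta> G + ennreal (K * real (Suc N) * c) * freq_weight (- 2 * \<theta>) G"
   using K c by (simp add: ennreal_mult mult.assoc del: of_nat_Suc)
  also have "... \<le> ennreal C * diff_energy N \<theta> G + ennreal C * freq_weight (- 2 * \<theta>) G"
  proof (intro add_mono mult_right_mono)
   have "ennreal 2 \<le> ennreal C" unfolding C_def using K c by (intro ennreal_leI) simp
   then show "2 \<le> ennreal C" by simp
   show "ennreal (K * real (Suc N) * c) \<le> ennreal C" unfolding C_def by (intro ennreal_leI) simp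
  qed auto
  finally show "diff_energy N \<theta> (\<lambda>z. of_real (sgn (fst z)) * G z) \<le> ennreal C * (diff_energy N \<theta> G + freq_weight (- 2 * \<theta>) G)"
   by (simp add: distrib_left)
 qed
qed

text \<open>The propagator is split into \<open>cos (t \<phi>)\<close> and \<open>i sgn \<xi> sin (t \<phi>)\<close>, each a
 combination of chirps with phases \<open>\<plusminus> t \<phi>\<close>. Only the second part carries the jump, so only
 the sine enters the singular weight.\<close>

theorem diff_energy_propagator:
 fixes m :: nat
 assumes m: "1 \<le> m" and \<theta>: "0 < \<theta>" "\<theta> < real m"
 shows "\<exists>C\<ge>0. \<forall>t. \<forall>F\<in>freq_measurable.
  diff_energy (3 * m) \<theta> (\<lambda>z. wave (t * omega (fst z) (snd z)) * F z)
  \<le> ennreal C * (diff_energy m \<theta> F + ennreal (\<bar>t\<bar> powr (2 * \<theta>)) * freq_weight (2 * \<theta>) F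
   + ennreal (\<bar>t\<bar> powr \<theta>) * energy frequencies F
   + freq_weight (- 2 * \<theta>) (\<lambda>z. of_real (sin (t * ((fst z)\<^sup>2 + (of_int (snd z))\<^sup>2))) * F z))"
proof -
 obtain C1 where C1: "0 \<le> C1" and chirp: "\<And>t G. G \<in> freq_measurable \<Longrightarrow>
  diff_energy (3 * m) \<theta> (chirp t G)
  \<le> ennreal C1 * (diff_energy m \<theta> G + ennreal (\<bar>t\<bar> powr (2 * \<theta>)) * freq_weight (2 * \<theta>) G
   + ennreal (\<bar>t\<bar> powr \<theta>) * energy frequencies G)" using diff_energy_chirp[OF m \<theta>] by blast
 have m3: "1 \<le> 3 * m" using m by simp
 obtain C2 where C2: "0 \<le> C2" and sg: "\<And>G. G \<in> freq_measurable \<Longrightarrow>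
  diff_energy (3 * m) \<theta> (\<lambda>z. of_real (sgn (fst z)) * G z) \<le> ennreal C2 * (diff_energy (3 * m) \<theta> G + freq_weight (- 2 * \<theta>) G)"
  using diff_energy_sgn[OF m3 \<theta>(1)] by blast
 define C where "C = 8 * C1 + 8 * C1 * C2 + 2 * C2"
 show ?thesis
 proof (intro exI[of _ C] conjI allI ballI)
  show "0 \<le> C" unfolding C_def using C1 C2 by simp
  fix t :: real and F :: "real \<times> int \<Rightarrow> complex" assume F[measurable]: "F \<in> freq_measurable"
  have sm[measurable]: "(\<lambda>z. real_of_int (snd z)) \<in> freq_measurable" unfolding frequencies_def by measurable
  define E where "E s z = wave (s * ((fst z)\<^sup>2 + (of_int (snd z))\<^sup>2)) * F z" for s z
  have Em[measurable]: "E s \<in> freq_measurable" for s unfolding E_def by measurable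
  define X where "X = diff_energy m \<theta> F + ennreal (\<bar>t\<bar> powr (2 * \<theta>)) * freq_weight (2 * \<theta>) F + ennreal (\<bar>t\<bar> powr \<theta>) * energy frequencies F"
  have DE: "diff_energy (3 * m) \<theta> (E s) \<le> ennreal C1 * X" if s: "\<bar>s\<bar> = \<bar>t\<bar>" for s
  proof -
   define G where "G z = wave (s * (of_int (snd z))\<^sup>2) * F z" for z
   have Gm: "G \<in> freq_measurable" unfolding G_def by measurable
   have nG: "cmod (G z) = cmod (F z)" for z by (simp add: G_def norm_mult)
   have "E s = (\<lambda>z. wave (s * (fst z)\<^sup>2) * G z)"
    by (simp add: E_def G_def fun_eq_iff distrib_left exp_add mult.assoc)
   then have "diff_energy (3 * m) \<theta> (E s) \<le> ennreal C1 * (diff_energy m \<theta> G + ennreal (\<bar>s\<bar> powr (2 * \<theta>)) * freq_weight (2 * \<theta>) G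
    + ennreal (\<bar>s\<bar> powr \<theta>) * energy frequencies G)" using chirp[OF Gm, of s] by simp
   also have "diff_energy m \<theta> G = diff_energy m \<theta> F"
    using diff_energy_unimodular[of "\<lambda>\<eta>. wave (s * (of_int \<eta>)\<^sup>2)" 1 m \<theta> F] unfolding G_def by simp
   finally show ?thesis unfolding X_def s freq_weight_def energy_def nG .
  qed
  define a where "a z = (1/2) * E t z + (1/2) * E (- t) z" for z
  define b where "b z = (1/2) * E t z + (- 1/2) * E (- t) z" for z
  have abm[measurable]: "a \<in> freq_measurable" "b \<in> freq_measurable" unfolding a_def b_def by measurable
  have half: "diff_energy (3 * m) \<theta> (\<lambda>z. c1 * E t z + c2 * E (- t) z) \<le> ennreal (4 * C1) * X"
   if "cmod c1 \<le> 1" "cmod c2 \<le> 1" for c1 c2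
  proof -
   have "diff_energy (3 * m) \<theta> (\<lambda>z. c1 * E t z + c2 * E (- t) z)
    \<le> 2 * (diff_energy (3 * m) \<theta> (\<lambda>z. c1 * E t z) + diff_energy (3 * m) \<theta> (\<lambda>z. c2 * E (- t) z))"
    by (rule diff_energy_add_le) measurable
   also have "... \<le> 2 * (ennreal C1 * X + ennreal C1 * X)"
    by (intro mult_left_mono add_mono order_trans[OF diff_energy_cmult_half[OF Em]] DE that) auto
   also have "... = ennreal (4 * C1) * X" using C1 by (simp add: ennreal_mult mult_2[symmetric] mult.assoc[symmetric])
   finally show ?thesis .
  qed
  have Da: "diff_energy (3 * m) \<theta> a \<le> ennreal (4 * C1) * X" unfolding a_def by (rule half) auto
  have Db: "diff_energy (3 * m) \<theta> b \<le> ennreal (4 * C1) * X" unfolding b_def by (rule half) auto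
  define S where "S = freq_weight (- 2 * \<theta>) (\<lambda>z. of_real (sin (t * ((fst z)\<^sup>2 + (of_int (snd z))\<^sup>2))) * F z)"
  have b_eq: "b z = \<i> * of_real (sin (t * ((fst z)\<^sup>2 + (of_int (snd z))\<^sup>2))) * F z" for z
  proof -
   define s where "s = t * ((fst z)\<^sup>2 + (of_int (snd z))\<^sup>2)"
   have "wave s - exp (- (\<i> * of_real s)) = 2 * \<i> * of_real (sin s)" by (simp add: complex_eq_iff Re_exp Im_exp)
   moreover have "b z = (1/2) * (wave s - exp (- (\<i> * of_real s))) * F z"
   proof -
    have "E t z = wave s * F z" "E (- t) z = exp (- (\<i> * of_real s)) * F z"
     by (simp_all only: E_def s_def mult_minus_left of_real_minus mult_minus_right)
    then show ?thesis unfolding b_def by (simp only:) (simp add: algebra_simps)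
   qed
   ultimately show ?thesis by (simp add: s_def)
  qed
  have Sb: "freq_weight (- 2 * \<theta>) b = S" unfolding S_def freq_weight_def b_eq by (simp add: norm_mult)
  have ae: "AE z in frequencies. wave (t * omega (fst z) (snd z)) * F z = a z + of_real (sgn (fst z)) * b z"
   using AE_frequencies_nonzero
  proof eventually_elim
   case (elim z)
   define s where "s = t * ((fst z)\<^sup>2 + (of_int (snd z))\<^sup>2)"
   have E1: "E t z = wave s * F z" "E (- t) z = exp (- (\<i> * of_real s)) * F z"
    by (simp_all only: E_def s_def mult_minus_left of_real_minus mult_minus_right)
   have om: "t * omega (fst z) (snd z) = sgn (fst z) * s" by (simp add: omega_def s_def algebra_simps)
   show ?case
   proof (cases "0 < fst z")
    case True then show ?thesis unfolding om a_def b_def E1 by (simp add: field_simps)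
   next
    case False
    then have "sgn (fst z) = -1" using elim by simp
    then show ?thesis unfolding om a_def b_def E1 by (simp add: field_simps)
   qed
  qed
  have mm: "(\<lambda>z. wave (t * omega (fst z) (snd z)) * F z) \<in> freq_measurable" unfolding omega_def by measurable
  have "diff_energy (3 * m) \<theta> (\<lambda>z. wave (t * omega (fst z) (snd z)) * F z)
   = diff_energy (3 * m) \<theta> (\<lambda>z. a z + of_real (sgn (fst z)) * b z)"
   by (rule diff_energy_cong_AE[OF mm _ ae]) measurable
  also have "... \<le> 2 * (diff_energy (3 * m) \<theta> a + diff_energy (3 * m) \<theta> (\<lambda>z. of_real (sgn (fst z)) * b z))"
   by (rule diff_energy_add_le) measurable
  also have "... \<le> 2 * (ennreal (4 * C1) * X + ennreal C2 * (ennreal (4 * C1) * X + S))"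
   unfolding Sb[symmetric] by (intro mult_left_mono add_mono Da order_trans[OF sg[OF abm(2)]] Db) auto
  also have "... = ennreal (8 * C1 + 8 * C1 * C2) * X + ennreal (2 * C2) * S"
   using C1 C2 by (simp add: ennreal_mult distrib_left distrib_right mult_ac)
  also have "... \<le> ennreal C * X + ennreal C * S"
  proof (intro add_mono mult_right_mono ennreal_leI)
   show "8 * C1 + 8 * C1 * C2 \<le> C" using C2 by (simp add: C_def)
   have "0 \<le> 8 * C1 + 8 * C1 * C2" using C1 C2 by (intro add_nonneg_nonneg mult_nonneg_nonneg) auto
   then show "2 * C2 \<le> C" unfolding C_def by linarith
  qed auto
  finally show "diff_energy (3 * m) \<theta> (\<lambda>z. wave (t * omega (fst z) (snd z)) * F z)
  \<le> ennreal C * (diff_energy m \<theta> F + ennreal (\<bar>t\<bar> powr (2 * \<theta>)) * freq_weight (2 * \<theta>) F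
   + ennreal (\<bar>t\<bar> powr \<theta>) * energy frequencies F
   + freq_weight (- 2 * \<theta>) (\<lambda>z. of_real (sin (t * ((fst z)\<^sup>2 + (of_int (snd z))\<^sup>2))) * F z))"
   by (simp add: X_def S_def distrib_left)
 qed
qed

section \<open>Hardy inequalities in frequency\<close>

text \<open>The Schur test for a kernel depending on the product \<open>x \<xi>\<close>, with test function \<open>\<bar>x\<bar>
 powr (- 1/2)\<close>; the same constant occurs for rows and columns because the kernel is symmetric.\<close>

lemma schur_product_kernel:
 fixes \<kappa> :: "real \<Rightarrow> real" and \<phi> :: "real \<Rightarrow> ennreal"
 assumes [measurable]: "\<kappa> \<in> borel_measurable borel" "\<phi> \<in> borel_measurable borel"
  and \<kappa>: "\<And>u. 0 \<le> \<kappa> u"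
  and c: "c = (\<integral>\<^sup>+u. ennreal (\<kappa> u * \<bar>u\<bar> powr (-1/2)) \<partial>lborel)"
 shows "(\<integral>\<^sup>+\<xi>. (\<integral>\<^sup>+x. ennreal (\<kappa> (x * \<xi>)) * \<phi> x \<partial>lborel)\<^sup>2 \<partial>lborel) \<le> c\<^sup>2 * (\<integral>\<^sup>+x. (\<phi> x)\<^sup>2 \<partial>lborel)"
proof -
 define r where "r u = \<kappa> u * \<bar>u\<bar> powr (-1/2)" for u
 define r' where "r' u = \<kappa> u * \<bar>u\<bar> powr (1/2)" for u
 have [measurable]: "r \<in> borel_measurable borel" "r' \<in> borel_measurable borel" unfolding r_def r'_def by measurable
 have r0: "0 \<le> r u" "0 \<le> r' u" for u using \<kappa> by (auto simp: r_def r'_def)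
 have cs: "(\<integral>\<^sup>+x. ennreal (\<kappa> (x * \<xi>)) * \<phi> x \<partial>lborel)\<^sup>2
   \<le> c * (\<integral>\<^sup>+x. ennreal (r' (x * \<xi>) / \<bar>\<xi>\<bar>) * (\<phi> x)\<^sup>2 \<partial>lborel)" if \<xi>: "\<xi> \<noteq> 0" for \<xi>
 proof -
  have "(\<integral>\<^sup>+x. ennreal (\<kappa> (x * \<xi>)) * \<phi> x \<partial>lborel)
   = (\<integral>\<^sup>+x. ennreal (sqrt (r (x * \<xi>))) * (ennreal (sqrt (r' (x * \<xi>))) * \<phi> x) \<partial>lborel)"
   using AE_lborel_singleton[of "0::real"]
  proof (intro nn_integral_cong_AE, eventually_elim)
   case (elim x)
   have "sqrt (r (x * \<xi>)) * sqrt (r' (x * \<xi>)) = sqrt ((\<kappa> (x * \<xi>))\<^sup>2 * (\<bar>x * \<xi>\<bar> powr (-1/2) * \<bar>x * \<xi>\<bar> powr (1/2)))"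
    by (simp add: r_def r'_def real_sqrt_mult[symmetric] power2_eq_square mult_ac)
   also have "\<bar>x * \<xi>\<bar> powr (-1/2) * \<bar>x * \<xi>\<bar> powr (1/2) = 1" using elim \<xi> by (simp add: powr_add[symmetric])
   finally have "sqrt (r (x * \<xi>)) * sqrt (r' (x * \<xi>)) = \<kappa> (x * \<xi>)" using \<kappa> by simp
   then show ?case using r0 by (simp add: mult.assoc[symmetric] ennreal_mult[symmetric])
  qed
  then have "(\<integral>\<^sup>+x. ennreal (\<kappa> (x * \<xi>)) * \<phi> x \<partial>lborel)\<^sup>2
   \<le> (\<integral>\<^sup>+x. (ennreal (sqrt (r (x * \<xi>))))\<^sup>2 \<partial>lborel) * (\<integral>\<^sup>+x. (ennreal (sqrt (r' (x * \<xi>))) * \<phi> x)\<^sup>2 \<partial>lborel)"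
   by (simp only:) (rule Cauchy_Schwarz_nn_integral; measurable)
  also have "(\<integral>\<^sup>+x. (ennreal (sqrt (r (x * \<xi>))))\<^sup>2 \<partial>lborel) = (\<integral>\<^sup>+x. ennreal (r (x * \<xi>)) \<partial>lborel)"
   using r0 by (simp add: ennreal_power)
  also have "... = ennreal (1 / \<bar>\<xi>\<bar>) * c"
  proof -
   have "c = ennreal \<bar>\<xi>\<bar> * (\<integral>\<^sup>+x. ennreal (r (x * \<xi>)) \<partial>lborel)"
    unfolding c r_def[symmetric] using nn_integral_real_affine[of "\<lambda>u. ennreal (r u)" \<xi> 0] \<xi> by (simp add: mult.commute)
   then have "ennreal (1 / \<bar>\<xi>\<bar>) * c = ennreal (1 / \<bar>\<xi>\<bar> * \<bar>\<xi>\<bar>) * (\<integral>\<^sup>+x. ennreal (r (x * \<xi>)) \<partial>lborel)"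
    by (subst ennreal_mult) (auto simp: mult.assoc)
   then show ?thesis using \<xi> by simp
  qed
  also have "ennreal (1 / \<bar>\<xi>\<bar>) * c * (\<integral>\<^sup>+x. (ennreal (sqrt (r' (x * \<xi>))) * \<phi> x)\<^sup>2 \<partial>lborel)
   = c * (ennreal (1 / \<bar>\<xi>\<bar>) * (\<integral>\<^sup>+x. ennreal (r' (x * \<xi>)) * (\<phi> x)\<^sup>2 \<partial>lborel))"
   using r0 by (simp add: power_mult_distrib ennreal_power mult_ac)
  also have "ennreal (1 / \<bar>\<xi>\<bar>) * (\<integral>\<^sup>+x. ennreal (r' (x * \<xi>)) * (\<phi> x)\<^sup>2 \<partial>lborel)
   = (\<integral>\<^sup>+x. ennreal (r' (x * \<xi>) / \<bar>\<xi>\<bar>) * (\<phi> x)\<^sup>2 \<partial>lborel)"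
  proof -
   have "ennreal (r' (x * \<xi>) / \<bar>\<xi>\<bar>) = ennreal (1 / \<bar>\<xi>\<bar>) * ennreal (r' (x * \<xi>))" for x
    using r0 by (subst ennreal_mult[symmetric]) auto
   then show ?thesis by (simp add: mult.assoc nn_integral_cmult)
  qed
  finally show ?thesis .
 qed
 have "(\<integral>\<^sup>+\<xi>. (\<integral>\<^sup>+x. ennreal (\<kappa> (x * \<xi>)) * \<phi> x \<partial>lborel)\<^sup>2 \<partial>lborel)
   \<le> (\<integral>\<^sup>+\<xi>. c * (\<integral>\<^sup>+x. ennreal (r' (x * \<xi>) / \<bar>\<xi>\<bar>) * (\<phi> x)\<^sup>2 \<partial>lborel) \<partial>lborel)"
  using AE_lborel_singleton[of "0::real"] by (intro nn_integral_mono_AE) (auto elim!: eventually_mono intro: cs)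
 also have "... = c * (\<integral>\<^sup>+\<xi>. (\<integral>\<^sup>+x. ennreal (r' (x * \<xi>) / \<bar>\<xi>\<bar>) * (\<phi> x)\<^sup>2 \<partial>lborel) \<partial>lborel)"
  by (rule nn_integral_cmult) measurable
 also have "(\<integral>\<^sup>+\<xi>. (\<integral>\<^sup>+x. ennreal (r' (x * \<xi>) / \<bar>\<xi>\<bar>) * (\<phi> x)\<^sup>2 \<partial>lborel) \<partial>lborel)
   = (\<integral>\<^sup>+x. (\<integral>\<^sup>+\<xi>. ennreal (r' (x * \<xi>) / \<bar>\<xi>\<bar>) * (\<phi> x)\<^sup>2 \<partial>lborel) \<partial>lborel)"
  by (rule lborel_pair.Fubini') measurable
 also have "... = (\<integral>\<^sup>+x. c * (\<phi> x)\<^sup>2 \<partial>lborel)" using AE_lborel_singleton[of "0::real"]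
 proof (intro nn_integral_cong_AE, eventually_elim)
  case (elim x)
  have "c = ennreal \<bar>x\<bar> * (\<integral>\<^sup>+\<xi>. ennreal (r (x * \<xi>)) \<partial>lborel)"
   unfolding c r_def[symmetric] using nn_integral_real_affine[of "\<lambda>u. ennreal (r u)" x 0] elim by simp
  also have "... = (\<integral>\<^sup>+\<xi>. ennreal (\<bar>x\<bar> * r (x * \<xi>)) \<partial>lborel)"
   using r0 by (subst nn_integral_cmult[symmetric]) (auto simp: ennreal_mult)
  also have "... = (\<integral>\<^sup>+\<xi>. ennreal (r' (x * \<xi>) / \<bar>\<xi>\<bar>) \<partial>lborel)"
   using AE_lborel_singleton[of "0::real"]
  proof (intro nn_integral_cong_AE, eventually_elim)
   case (elim \<xi>)
   have "\<bar>x * \<xi>\<bar> * \<bar>x * \<xi>\<bar> powr (-1/2) = \<bar>x * \<xi>\<bar> powr (1/2)"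
    using \<open>x \<noteq> 0\<close> elim by (subst powr_mult_base) auto
   then have "\<bar>x\<bar> * r (x * \<xi>) = r' (x * \<xi>) / \<bar>\<xi>\<bar>"
    using elim by (simp add: r_def r'_def abs_mult field_simps)
   then show ?case by simp
  qed
  finally show ?case by (subst nn_integral_multc) auto
 qed
 also have "... = c * (\<integral>\<^sup>+x. (\<phi> x)\<^sup>2 \<partial>lborel)" by (rule nn_integral_cmult) measurable
 finally show ?thesis by (simp add: power2_eq_square mult.assoc)
qed

lemma exp_taylor_bound:
 fixes u :: real
 shows "cmod (cowave u - (\<Sum>l\<le>k. (- \<i> * of_real u) ^ l / fact l)) \<le> 2 * min (\<bar>u\<bar> ^ k) (\<bar>u\<bar> ^ Suc k)"
proof -
 have f: "(1::real) \<le> fact n" for n by (rule fact_ge_1)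
 have 1: "cmod (cowave u - (\<Sum>l\<le>k. (- \<i> * of_real u) ^ l / fact l)) \<le> \<bar>u\<bar> ^ Suc k"
 proof -
  have "cmod (cowave u - (\<Sum>l\<le>k. (- \<i> * of_real u) ^ l / fact l)) \<le> \<bar>u\<bar> ^ Suc k / fact k"
   using Taylor_exp[of "- \<i> * of_real u" k] by (simp add: norm_mult)
  also have "... \<le> \<bar>u\<bar> ^ Suc k / 1" using f by (intro divide_left_mono) auto
  finally show ?thesis by simp
 qed
 have 2: "cmod (cowave u - (\<Sum>l\<le>k. (- \<i> * of_real u) ^ l / fact l)) \<le> 2 * \<bar>u\<bar> ^ k"
 proof (cases k)
  case 0
  have "cmod (cowave u - 1) \<le> 1 + 1" by (rule order_trans[OF norm_triangle_ineq4]) simp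
  then show ?thesis using 0 by simp
 next
  case (Suc n)
  have "cmod (cowave u - (\<Sum>l\<le>k. (- \<i> * of_real u) ^ l / fact l))
   = cmod ((cowave u - (\<Sum>l\<le>n. (- \<i> * of_real u) ^ l / fact l)) - (- \<i> * of_real u) ^ k / fact k)"
   by (simp only: Suc sum.atMost_Suc diff_diff_eq)
  also have "... \<le> cmod (cowave u - (\<Sum>l\<le>n. (- \<i> * of_real u) ^ l / fact l)) + cmod ((- \<i> * of_real u) ^ k / fact k)"
   by (rule norm_triangle_ineq4)
  also have "cmod (cowave u - (\<Sum>l\<le>n. (- \<i> * of_real u) ^ l / fact l)) \<le> \<bar>u\<bar> ^ k / fact n"
   using Taylor_exp[of "- \<i> * of_real u" n] Suc by (simp add: norm_mult)
  also have "\<bar>u\<bar> ^ k / fact n \<le> \<bar>u\<bar> ^ k / 1" using f by (intro divide_left_mono) auto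
  also have "cmod ((- \<i> * of_real u) ^ k / fact k) = \<bar>u\<bar> ^ k / fact k" by (simp add: norm_divide norm_power norm_mult)
  also have "\<bar>u\<bar> ^ k / fact k \<le> \<bar>u\<bar> ^ k / 1" using f by (intro divide_left_mono) auto
  finally show ?thesis by simp
 qed
 have "\<bar>u\<bar> ^ Suc k \<le> 2 * \<bar>u\<bar> ^ Suc k" using zero_le_power[of "\<bar>u\<bar>" "Suc k"] by linarith
 with 1 have "cmod (cowave u - (\<Sum>l\<le>k. (- \<i> * of_real u) ^ l / fact l)) \<le> 2 * \<bar>u\<bar> ^ Suc k"
  by (rule order_trans)
 with 2 show ?thesis unfolding min_def by (auto split: if_split simp del: power_Suc)
qed

text \<open>Vanishing moments allow subtracting the Taylor polynomial of the exponential. Taking one term more or less gives two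
 consecutive powers; the smaller power is better for large \<open>x \<xi>\<close>, the larger one near
 \<open>0\<close>.\<close>

lemma line_transform_moments:
 fixes s :: "real \<Rightarrow> complex"
 assumes int: "\<And>l. l \<le> k \<Longrightarrow> integrable lborel (\<lambda>x. of_real (x ^ l) * s x)"
  and mom: "\<And>l. l \<le> k \<Longrightarrow> (LINT x|lborel. of_real (x ^ l) * s x) = 0"
 shows "ennreal (cmod (line_transform s \<xi>)) \<le> (\<integral>\<^sup>+x. ennreal (2 * min (\<bar>x * \<xi>\<bar> ^ k) (\<bar>x * \<xi>\<bar> ^ Suc k) * cmod (s x)) \<partial>lborel)"
proof -
 have s: "integrable lborel s" using int[of 0] by simp
 then have [measurable]: "s \<in> borel_measurable borel" by auto
 have e: "integrable lborel (\<lambda>x. s x * cowave (x * \<xi>))"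
  by (rule Bochner_Integration.integrable_bound[OF s]) (auto simp: norm_mult)
 have t: "integrable lborel (\<lambda>x. ((- \<i> * of_real \<xi>) ^ l / fact l) * (of_real (x ^ l) * s x))" if "l \<le> k" for l
  by (intro integrable_mult_right int that)
 have pw: "(- \<i> * of_real (x * \<xi>)) ^ l = (- \<i> * of_real \<xi>) ^ l * complex_of_real (x ^ l)" for x l
  by (simp only: of_real_mult of_real_power power_mult_distrib[symmetric]) (simp only: mult_ac)
 have eq: "s x * (cowave (x * \<xi>) - (\<Sum>l\<le>k. (- \<i> * of_real (x * \<xi>)) ^ l / fact l))
  = s x * cowave (x * \<xi>) - (\<Sum>l\<le>k. ((- \<i> * of_real \<xi>) ^ l / fact l) * (of_real (x ^ l) * s x))" for x
  unfolding pw right_diff_distrib sum_distrib_left by (intro arg_cong2[where f="(-)"] refl sum.cong) (simp add: mult_ac)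
 have "(LINT x|lborel. s x * (cowave (x * \<xi>) - (\<Sum>l\<le>k. (- \<i> * of_real (x * \<xi>)) ^ l / fact l)))
  = line_transform s \<xi> - (\<Sum>l\<le>k. LINT x|lborel. ((- \<i> * of_real \<xi>) ^ l / fact l) * (of_real (x ^ l) * s x))"
  unfolding eq line_transform_def using t
  by (subst Bochner_Integration.integral_diff[OF e], (intro Bochner_Integration.integrable_sum, simp)+)
    (subst Bochner_Integration.integral_sum, auto)
 also have "... = line_transform s \<xi>" using mom by (simp only: integral_mult_right_zero atMost_iff) simp
 finally have lt: "(LINT x|lborel. s x * (cowave (x * \<xi>) - (\<Sum>l\<le>k. (- \<i> * of_real (x * \<xi>)) ^ l / fact l))) = line_transform s \<xi>" .
 have ii: "integrable lborel (\<lambda>x. s x * (cowave (x * \<xi>) - (\<Sum>l\<le>k. (- \<i> * of_real (x * \<xi>)) ^ l / fact l)))"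
  unfolding eq by (intro Bochner_Integration.integrable_diff Bochner_Integration.integrable_sum e t) simp
 have "ennreal (cmod (line_transform s \<xi>))
  \<le> (\<integral>\<^sup>+x. ennreal (cmod (s x * (cowave (x * \<xi>) - (\<Sum>l\<le>k. (- \<i> * of_real (x * \<xi>)) ^ l / fact l)))) \<partial>lborel)"
  using integral_norm_bound_ennreal[OF ii] unfolding lt .
 also have "... \<le> (\<integral>\<^sup>+x. ennreal (2 * min (\<bar>x * \<xi>\<bar> ^ k) (\<bar>x * \<xi>\<bar> ^ Suc k) * cmod (s x)) \<partial>lborel)"
  unfolding norm_mult by (intro nn_integral_mono ennreal_leI) (subst mult.commute, intro mult_right_mono exp_taylor_bound, simp)
 finally show ?thesis .
qed

lemma mult_min_mult:
 fixes A B p q :: real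
 assumes "0 \<le> A" "0 \<le> B"
 shows "A * min p q * B = min (A * p * B) (A * q * B)"
proof (cases "p \<le> q")
 case True
 then have "A * p * B \<le> A * q * B" using assms by (intro mult_right_mono mult_left_mono)
 then show ?thesis using True by (simp add: min_absorb1)
next
 case False
 then have "A * q * B \<le> A * p * B" using assms by (intro mult_right_mono mult_left_mono) auto
 then show ?thesis using False by (simp add: min_absorb2)
qed

text \<open>With the weights moved into the kernel, \<open>line_transform_moments\<close> bounds the transform by an operator with
 kernel \<open>\<kappa> (x \<xi>)\<close>. The condition of the Schur test is exactly that \<open>\<theta>\<close> lies
 between \<open>k + 1/2\<close> and \<open>k + 3/2\<close>.\<close>

lemma hardy_moments:
 fixes k :: nat
 assumes \<theta>: "real k + 1/2 < \<theta>" "\<theta> < real k + 3/2"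
 shows "\<exists>C\<ge>0. \<forall>s :: real \<Rightarrow> complex.
  (\<forall>l\<le>k. integrable lborel (\<lambda>x. of_real (x ^ l) * s x) \<and> (LINT x|lborel. of_real (x ^ l) * s x) = 0) \<longrightarrow>
  (\<integral>\<^sup>+\<xi>. ennreal (\<bar>\<xi>\<bar> powr (- 2 * \<theta>)) * nsq (line_transform s \<xi>) \<partial>lborel)
  \<le> ennreal C * (\<integral>\<^sup>+x. ennreal (\<bar>x\<bar> powr (2 * \<theta>)) * nsq (s x) \<partial>lborel)"
proof -
 define \<kappa> where "\<kappa> u = 2 * (\<bar>u\<bar> powr (- \<theta>) * min (\<bar>u\<bar> ^ k) (\<bar>u\<bar> ^ Suc k))" for u :: real
 have \<kappa>m[measurable]: "\<kappa> \<in> borel_measurable borel" unfolding \<kappa>_def by measurable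
 have \<kappa>0: "0 \<le> \<kappa> u" for u unfolding \<kappa>_def by auto
 define c where "c = (\<integral>\<^sup>+u. ennreal (\<kappa> u * \<bar>u\<bar> powr (-1/2)) \<partial>lborel)"
 have "c = (\<integral>\<^sup>+u. 2 * ennreal (min (\<bar>u\<bar> powr (real k + 1/2 - \<theta>)) (\<bar>u\<bar> powr (real k - 1/2 - \<theta>))) \<partial>lborel)"
  unfolding c_def using AE_lborel_singleton[of "0::real"]
 proof (intro nn_integral_cong_AE, eventually_elim)
  case (elim u)
  have "\<bar>u\<bar> powr (- \<theta>) * \<bar>u\<bar> ^ n * \<bar>u\<bar> powr (-1/2) = \<bar>u\<bar> powr (real n - 1/2 - \<theta>)" for n
   using elim by (simp add: powr_realpow[symmetric] powr_add[symmetric] algebra_simps)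
  from this[of k] this[of "Suc k"]
  have "\<kappa> u * \<bar>u\<bar> powr (-1/2) = 2 * min (\<bar>u\<bar> powr (real k - 1/2 - \<theta>)) (\<bar>u\<bar> powr (real k + 1/2 - \<theta>))"
   using mult_min_mult[of "\<bar>u\<bar> powr (- \<theta>)" "\<bar>u\<bar> powr (-1/2)" "\<bar>u\<bar> ^ k" "\<bar>u\<bar> ^ Suc k"] unfolding \<kappa>_def
   by (simp del: power_Suc add: algebra_simps)
  then show ?case by (simp add: ennreal_mult min.commute)
 qed
 also have "... = 2 * (\<integral>\<^sup>+u. ennreal (min (\<bar>u\<bar> powr (real k + 1/2 - \<theta>)) (\<bar>u\<bar> powr (real k - 1/2 - \<theta>))) \<partial>lborel)"
  by (rule nn_integral_cmult) measurable
 also have "... < \<infinity>" using nn_integral_min_powr_finite[of "real k + 1/2 - \<theta>" "real k - 1/2 - \<theta>"] \<theta>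
  by (simp add: ennreal_mult_less_top)
 finally obtain c' where c': "c = ennreal c'" "0 \<le> c'" by (cases c) auto
 show ?thesis
 proof (intro exI[of _ "c'\<^sup>2"] conjI allI impI)
  show "0 \<le> c'\<^sup>2" by simp
  fix s :: "real \<Rightarrow> complex"
  assume s: "\<forall>l\<le>k. integrable lborel (\<lambda>x. of_real (x ^ l) * s x) \<and> (LINT x|lborel. of_real (x ^ l) * s x) = 0"
  then have "integrable lborel (\<lambda>x. of_real (x ^ 0) * s x)" by blast
  then have [measurable]: "s \<in> borel_measurable borel" by auto
  define \<phi> where "\<phi> x = ennreal (\<bar>x\<bar> powr \<theta> * cmod (s x))" for x
  have [measurable]: "\<phi> \<in> borel_measurable borel" unfolding \<phi>_def by measurable
  have pt: "ennreal (\<bar>\<xi>\<bar> powr (- 2 * \<theta>)) * nsq (line_transform s \<xi>)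
   \<le> (\<integral>\<^sup>+x. ennreal (\<kappa> (x * \<xi>)) * \<phi> x \<partial>lborel)\<^sup>2" if \<xi>: "\<xi> \<noteq> 0" for \<xi>
  proof -
   have "ennreal (\<bar>\<xi>\<bar> powr (- \<theta>)) * ennreal (cmod (line_transform s \<xi>))
    \<le> ennreal (\<bar>\<xi>\<bar> powr (- \<theta>)) * (\<integral>\<^sup>+x. ennreal (2 * min (\<bar>x * \<xi>\<bar> ^ k) (\<bar>x * \<xi>\<bar> ^ Suc k) * cmod (s x)) \<partial>lborel)"
    using s by (intro mult_left_mono line_transform_moments) auto
   also have "... = (\<integral>\<^sup>+x. ennreal (\<bar>\<xi>\<bar> powr (- \<theta>)) * ennreal (2 * min (\<bar>x * \<xi>\<bar> ^ k) (\<bar>x * \<xi>\<bar> ^ Suc k) * cmod (s x)) \<partial>lborel)"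
    by (rule nn_integral_cmult[symmetric]) measurable
   also have "... = (\<integral>\<^sup>+x. ennreal (\<kappa> (x * \<xi>)) * \<phi> x \<partial>lborel)"
    using AE_lborel_singleton[of "0::real"]
   proof (intro nn_integral_cong_AE, eventually_elim)
    case (elim x)
    have "\<bar>\<xi>\<bar> powr (- \<theta>) = \<bar>x * \<xi>\<bar> powr (- \<theta>) * \<bar>x\<bar> powr \<theta>"
     using elim \<xi> by (simp add: abs_mult powr_mult powr_minus field_simps)
    then have "\<bar>\<xi>\<bar> powr (- \<theta>) * (2 * min (\<bar>x * \<xi>\<bar> ^ k) (\<bar>x * \<xi>\<bar> ^ Suc k) * cmod (s x))
     = \<kappa> (x * \<xi>) * (\<bar>x\<bar> powr \<theta> * cmod (s x))" unfolding \<kappa>_def by (simp only: mult_ac)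
    moreover have "ennreal (\<bar>\<xi>\<bar> powr (- \<theta>)) * ennreal (2 * min (\<bar>x * \<xi>\<bar> ^ k) (\<bar>x * \<xi>\<bar> ^ Suc k) * cmod (s x))
     = ennreal (\<bar>\<xi>\<bar> powr (- \<theta>) * (2 * min (\<bar>x * \<xi>\<bar> ^ k) (\<bar>x * \<xi>\<bar> ^ Suc k) * cmod (s x)))"
     by (rule ennreal_mult[symmetric]) auto
    moreover have "ennreal (\<kappa> (x * \<xi>) * (\<bar>x\<bar> powr \<theta> * cmod (s x))) = ennreal (\<kappa> (x * \<xi>)) * \<phi> x"
     unfolding \<phi>_def by (rule ennreal_mult) (auto simp: \<kappa>0)
    ultimately show ?case by (simp only:)
   qed
   finally have "(ennreal (\<bar>\<xi>\<bar> powr (- \<theta>)) * ennreal (cmod (line_transform s \<xi>)))\<^sup>2 \<le> (\<integral>\<^sup>+x. ennreal (\<kappa> (x * \<xi>)) * \<phi> x \<partial>lborel)\<^sup>2"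
    by (rule power_mono) simp
   moreover have "(\<bar>\<xi>\<bar> powr (- \<theta>))\<^sup>2 = \<bar>\<xi>\<bar> powr (- 2 * \<theta>)"
    using \<xi> by (simp add: power2_eq_square powr_add[symmetric])
   ultimately show ?thesis by (simp add: power_mult_distrib ennreal_power)
  qed
  have "(\<integral>\<^sup>+\<xi>. ennreal (\<bar>\<xi>\<bar> powr (- 2 * \<theta>)) * nsq (line_transform s \<xi>) \<partial>lborel)
   \<le> (\<integral>\<^sup>+\<xi>. (\<integral>\<^sup>+x. ennreal (\<kappa> (x * \<xi>)) * \<phi> x \<partial>lborel)\<^sup>2 \<partial>lborel)"
   by (intro nn_integral_mono_AE eventually_mono[OF AE_lborel_singleton[of "0::real"]] pt)
  also have "... \<le> c\<^sup>2 * (\<integral>\<^sup>+x. (\<phi> x)\<^sup>2 \<partial>lborel)"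
   by (rule schur_product_kernel[OF _ _ \<kappa>0 c_def]) measurable
  also have "c\<^sup>2 = ennreal (c'\<^sup>2)" using c' by (simp add: ennreal_power)
  also have "(\<integral>\<^sup>+x. (\<phi> x)\<^sup>2 \<partial>lborel) = (\<integral>\<^sup>+x. ennreal (\<bar>x\<bar> powr (2 * \<theta>)) * nsq (s x) \<partial>lborel)"
  proof (rule nn_integral_cong)
   fix x :: real
   have "(\<bar>x\<bar> powr \<theta>)\<^sup>2 = \<bar>x\<bar> powr (2 * \<theta>)" by (simp add: power2_eq_square powr_add[symmetric])
   then show "(\<phi> x)\<^sup>2 = ennreal (\<bar>x\<bar> powr (2 * \<theta>)) * nsq (s x)"
    unfolding \<phi>_def by (simp add: ennreal_mult power_mult_distrib ennreal_power)
  qed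
  finally show "(\<integral>\<^sup>+\<xi>. ennreal (\<bar>\<xi>\<bar> powr (- 2 * \<theta>)) * nsq (line_transform s \<xi>) \<partial>lborel)
   \<le> ennreal (c'\<^sup>2) * (\<integral>\<^sup>+x. ennreal (\<bar>x\<bar> powr (2 * \<theta>)) * nsq (s x) \<partial>lborel)" .
 qed
qed

lemma nn_integral_freq_scale:
 assumes "f \<in> freq_measurable" and a: "0 < a"
 shows "(\<integral>\<^sup>+z. f (a * fst z, snd z) \<partial>frequencies) = ennreal (1 / a) * (\<integral>\<^sup>+z. f z \<partial>frequencies)"
proof -
 have [measurable]: "f \<in> borel_measurable (lborel \<Otimes>\<^sub>M count_space UNIV)" using assms by (simp add: frequencies_def)
 have "(\<integral>\<^sup>+z. f (a * fst z, snd z) \<partial>frequencies) = (\<integral>\<^sup>+\<eta>. (\<integral>\<^sup>+\<xi>. f (a * \<xi>, \<eta>) \<partial>lborel) \<partial>count_space UNIV)"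
  unfolding frequencies_def by (subst line_int.nn_integral_snd[symmetric]) auto
 also have "... = (\<integral>\<^sup>+\<eta>. ennreal (1 / a) * (\<integral>\<^sup>+\<xi>. f (\<xi>, \<eta>) \<partial>lborel) \<partial>count_space UNIV)"
 proof (rule nn_integral_cong)
  fix \<eta> :: int
  have "(\<integral>\<^sup>+\<xi>. f (\<xi>, \<eta>) \<partial>lborel) = ennreal a * (\<integral>\<^sup>+\<xi>. f (a * \<xi>, \<eta>) \<partial>lborel)"
   using nn_integral_real_affine[of "\<lambda>\<xi>. f (\<xi>, \<eta>)" a 0] a by simp
  then show "(\<integral>\<^sup>+\<xi>. f (a * \<xi>, \<eta>) \<partial>lborel) = ennreal (1 / a) * (\<integral>\<^sup>+\<xi>. f (\<xi>, \<eta>) \<partial>lborel)"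
   using a by (simp add: mult.assoc[symmetric] ennreal_mult[symmetric])
 qed
 also have "... = ennreal (1 / a) * (\<integral>\<^sup>+z. f z \<partial>frequencies)"
  unfolding frequencies_def by (subst nn_integral_cmult, simp, subst line_int.nn_integral_snd[symmetric]) auto
 finally show ?thesis .
qed

text \<open>The dilation by \<open>r\<close> is the shift by \<open>h = (r - 1) \<xi>\<close>; for \<open>r\<close> between
 \<open>2\<close> and \<open>3\<close> the step is comparable to \<open>\<xi>\<close>, so that the kernel
 \<open>\<bar>h\<bar> powr (- 1 - 2 \<theta>)\<close> supplies the weight.\<close>

lemma freq_dilation_average:
 assumes G: "G \<in> freq_measurable" and \<theta>: "0 < \<theta>"
 shows "(\<integral>\<^sup>+r. indicator {2..3} r * (\<integral>\<^sup>+z. fst_powr (- 2 * \<theta>) z *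
   nsq (G (r * fst z, snd z) - G z) \<partial>frequencies) \<partial>lborel)
  \<le> ennreal (2 powr (1 + 2 * \<theta>)) * diff_energy 1 \<theta> G"
proof -
 have [measurable]: "G \<in> borel_measurable (lborel \<Otimes>\<^sub>M count_space UNIV)" using G by (simp add: frequencies_def)
 define p where "p z h = nsq (G (fst z + h, snd z) - G z)" for z h
 define w where "w \<xi> = ennreal (\<bar>\<xi>\<bar> powr (- 2 * \<theta>))" for \<xi> :: real
 have p_m: "(\<lambda>(h, z). p z h) \<in> borel_measurable (lborel \<Otimes>\<^sub>M frequencies)"
  unfolding p_def frequencies_def by measurable
 have l_m: "(\<lambda>(r, z). indicator {2..3} r * (w (fst z) * nsq (G (r * fst z, snd z) - G z))) \<in> borel_measurable (lborel \<Otimes>\<^sub>M frequencies)"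
  unfolding w_def frequencies_def by measurable
 have s_m: "(\<lambda>(h, z). sing \<theta> h * p z h) \<in> borel_measurable (lborel \<Otimes>\<^sub>M frequencies)"
  unfolding p_def frequencies_def by measurable
 have "(\<integral>\<^sup>+r. indicator {2..3} r * (\<integral>\<^sup>+z. w (fst z) * nsq (G (r * fst z, snd z) - G z) \<partial>frequencies) \<partial>lborel)
  = (\<integral>\<^sup>+r. (\<integral>\<^sup>+z. indicator {2..3} r * (w (fst z) * nsq (G (r * fst z, snd z) - G z)) \<partial>frequencies) \<partial>lborel)"
  unfolding w_def frequencies_def by (intro nn_integral_cong nn_integral_cmult[symmetric]) measurable
 also have "... = (\<integral>\<^sup>+z. (\<integral>\<^sup>+r. indicator {2..3} r * (w (fst z) * nsq (G (r * fst z, snd z) - G z)) \<partial>lborel) \<partial>frequencies)"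
  using line_freq.Fubini'[OF l_m] by simp
 also have "... \<le> (\<integral>\<^sup>+z. (\<integral>\<^sup>+h. ennreal (2 powr (1 + 2 * \<theta>)) * (sing \<theta> h * p z h) \<partial>lborel) \<partial>frequencies)"
 proof (rule nn_integral_mono_AE)
  show "AE z in frequencies. (\<integral>\<^sup>+r. indicator {2..3} r * (w (fst z) * nsq (G (r * fst z, snd z) - G z)) \<partial>lborel)
    \<le> (\<integral>\<^sup>+h. ennreal (2 powr (1 + 2 * \<theta>)) * (sing \<theta> h * p z h) \<partial>lborel)"
   using AE_frequencies_nonzero
  proof eventually_elim
   case (elim z)
   define \<xi> where "\<xi> = fst z"
   have \<xi>: "\<xi> \<noteq> 0" using elim by (simp add: \<xi>_def)
   have [measurable]: "p z \<in> borel_measurable borel" unfolding p_def by measurable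
   have "(\<integral>\<^sup>+r. indicator {2..3} r * (w \<xi> * nsq (G (r * \<xi>, snd z) - G z)) \<partial>lborel)
    = ennreal \<bar>1/\<xi>\<bar> * (\<integral>\<^sup>+h. indicator {2..3} (1 + (1/\<xi>) * h) * (w \<xi> * nsq (G ((1 + (1/\<xi>) * h) * \<xi>, snd z) - G z)) \<partial>lborel)"
    using \<xi> by (intro nn_integral_real_affine) auto
   also have "ennreal \<bar>1/\<xi>\<bar> * (\<integral>\<^sup>+h. indicator {2..3} (1 + (1/\<xi>) * h) * (w \<xi> * nsq (G ((1 + (1/\<xi>) * h) * \<xi>, snd z) - G z)) \<partial>lborel)
    = (\<integral>\<^sup>+h. ennreal \<bar>1/\<xi>\<bar> * (indicator {2..3} (1 + (1/\<xi>) * h) * (w \<xi> * p z h)) \<partial>lborel)"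
   proof -
    have e: "(1 + (1/\<xi>) * h) * \<xi> = fst z + h" for h using \<xi> by (simp add: field_simps \<xi>_def)
    show ?thesis unfolding e p_def by (rule nn_integral_cmult[symmetric]) measurable
   qed
   also have "... \<le> (\<integral>\<^sup>+h. ennreal (2 powr (1 + 2 * \<theta>)) * (sing \<theta> h * p z h) \<partial>lborel)"
   proof (rule nn_integral_mono)
    fix h :: real
    show "ennreal \<bar>1/\<xi>\<bar> * (indicator {2..3} (1 + (1/\<xi>) * h) * (w \<xi> * p z h)) \<le> ennreal (2 powr (1 + 2 * \<theta>)) * (sing \<theta> h * p z h)"
    proof (cases "1 + (1/\<xi>) * h \<in> {2..3}")
     case True
     then have q: "1 \<le> h / \<xi>" "h / \<xi> \<le> 2" by auto
     then have "\<bar>h / \<xi>\<bar> \<le> 2" "1 \<le> \<bar>h / \<xi>\<bar>" by linarith+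
     then have h: "\<bar>h\<bar> \<le> 2 * \<bar>\<xi>\<bar>" "\<bar>\<xi>\<bar> \<le> \<bar>h\<bar>" using \<xi> by (simp_all add: abs_divide field_simps)
     then have h0: "0 < \<bar>h\<bar>" using \<xi> by auto
     have "\<bar>1/\<xi>\<bar> * \<bar>\<xi>\<bar> powr (- 2 * \<theta>) = \<bar>\<xi>\<bar> powr (- 1 - 2 * \<theta>)"
      using \<xi> by (simp add: powr_diff powr_minus abs_divide field_simps)
     also have "... \<le> (\<bar>h\<bar> / 2) powr (- 1 - 2 * \<theta>)" using h h0 \<theta> by (intro powr_mono2') auto
     also have "... = 2 powr (1 + 2 * \<theta>) * \<bar>h\<bar> powr (- 1 - 2 * \<theta>)"
      using h0 by (simp add: powr_divide powr_minus_divide[of 2 "1 + 2 * \<theta>", symmetric] field_simps powr_minus powr_diff powr_add)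
     finally have "ennreal (\<bar>1/\<xi>\<bar> * \<bar>\<xi>\<bar> powr (- 2 * \<theta>)) * p z h \<le> ennreal (2 powr (1 + 2 * \<theta>) * \<bar>h\<bar> powr (- 1 - 2 * \<theta>)) * p z h"
      by (intro mult_right_mono ennreal_leI) auto
     moreover have "ennreal (\<bar>1/\<xi>\<bar> * \<bar>\<xi>\<bar> powr (- 2 * \<theta>)) = ennreal \<bar>1/\<xi>\<bar> * w \<xi>"
      unfolding w_def by (rule ennreal_mult) auto
     moreover have "ennreal (2 powr (1 + 2 * \<theta>) * \<bar>h\<bar> powr (- 1 - 2 * \<theta>)) = ennreal (2 powr (1 + 2 * \<theta>)) * sing \<theta> h"
      unfolding sing_def by (rule ennreal_mult) auto
     ultimately show ?thesis unfolding indicator_simps(1)[OF True] mult_1 by (simp only: mult.assoc)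
    qed simp
   qed
   finally show ?case by (simp add: \<xi>_def)
  qed
 qed
 also have "... = (\<integral>\<^sup>+h. (\<integral>\<^sup>+z. ennreal (2 powr (1 + 2 * \<theta>)) * (sing \<theta> h * p z h) \<partial>frequencies) \<partial>lborel)"
  by (rule line_freq.Fubini') (use s_m in measurable)
 also have "... = (\<integral>\<^sup>+h. ennreal (2 powr (1 + 2 * \<theta>)) * (sing \<theta> h * energy frequencies (xdiff 1 h G)) \<partial>lborel)"
 proof (rule nn_integral_cong)
  fix h :: real
  have "(\<lambda>z. p z h) \<in> freq_measurable" unfolding p_def frequencies_def by measurable
  then have "(\<integral>\<^sup>+z. ennreal (2 powr (1 + 2 * \<theta>)) * (sing \<theta> h * p z h) \<partial>frequencies)
    = ennreal (2 powr (1 + 2 * \<theta>)) * (sing \<theta> h * (\<integral>\<^sup>+z. p z h \<partial>frequencies))"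
   by (simp add: nn_integral_cmult)
  also have "(\<integral>\<^sup>+z. p z h \<partial>frequencies) = energy frequencies (xdiff 1 h G)"
   by (simp add: energy_def p_def xdiff_def)
  finally show "(\<integral>\<^sup>+z. ennreal (2 powr (1 + 2 * \<theta>)) * (sing \<theta> h * p z h) \<partial>frequencies)
    = ennreal (2 powr (1 + 2 * \<theta>)) * (sing \<theta> h * energy frequencies (xdiff 1 h G))" .
 qed
 also have "... = ennreal (2 powr (1 + 2 * \<theta>)) * diff_energy 1 \<theta> G"
  unfolding diff_energy_def using energy_xdiff_measurable[OF G, of 1] by (intro nn_integral_cmult) auto
 finally show ?thesis by (simp add: w_def)
qed

text \<open>Dilation by \<open>r \<ge> 2\<close> multiplies the weighted integral by \<open>r powr (2 \<theta> - 1)\<close>, which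
 is less than \<open>1\<close> precisely for \<open>\<theta> < 1/2\<close>. Hence the integral can be absorbed when
 \<open>G\<close> is compared with its dilate. The weight is first capped at \<open>n\<close>, since absorbing requires
 a finite quantity; this is where the finite energy enters.\<close>

lemma hardy_low:
 assumes \<theta>: "0 < \<theta>" "\<theta> < 1/2"
 shows "\<exists>C\<ge>0. \<forall>G\<in>freq_measurable. energy frequencies G < \<infinity> \<longrightarrow>
  freq_weight (- 2 * \<theta>) G \<le> ennreal C * diff_energy 1 \<theta> G"
proof -
 (* d is chosen such that (1 + d) * \<rho>0 < 1, so that the dilated integral can be absorbed on the left. *)
 define \<rho>0 where "\<rho>0 = 2 powr (2 * \<theta> - 1)"
 have \<rho>0: "0 < \<rho>0" "\<rho>0 < 1" using \<theta> powr_less_mono[of "2 * \<theta> - 1" 0 2] by (auto simp: \<rho>0_def)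
 define d where "d = (1 / \<rho>0 - 1) / 2"
 have d: "0 < d" using \<rho>0 by (simp add: d_def)
 define \<rho> where "\<rho> = (1 + d) * \<rho>0"
 have \<rho>: "\<rho> = (1 + \<rho>0) / 2" using \<rho>0 by (simp add: \<rho>_def d_def field_simps)
 then have \<rho>1: "0 < \<rho>" "\<rho> < 1" using \<rho>0 by auto
 define c where "c = (1 - \<rho>) / (1 + 1 / d)"
 have c: "0 < c" using \<rho>1 d by (simp add: c_def add_pos_pos)
 define C where "C = 2 powr (1 + 2 * \<theta>) / c"
 show ?thesis
 proof (intro exI[of _ C] conjI ballI impI)
  show "0 \<le> C" unfolding C_def using c by simp
  fix G :: "real \<times> int \<Rightarrow> complex" assume G: "G \<in> freq_measurable" and fin: "energy frequencies G < \<infinity>"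
  note [measurable] = G
  define D where "D = diff_energy 1 \<theta> G"
  define w where "w n \<xi> = min (\<bar>\<xi>\<bar> powr (- 2 * \<theta>)) (real n)" for n :: nat and \<xi> :: real
  have [measurable]: "w n \<in> borel_measurable borel" for n unfolding w_def by measurable
  have w0: "0 \<le> w n \<xi>" for n \<xi> by (simp add: w_def)
  define I where "I n = (\<integral>\<^sup>+z. ennreal (w n (fst z)) * nsq (G z) \<partial>frequencies)" for n
  define Q where "Q r = (\<integral>\<^sup>+z. fst_powr (- 2 * \<theta>) z * nsq (G (r * fst z, snd z) - G z) \<partial>frequencies)" for r
  have "I n \<le> (\<integral>\<^sup>+z. ennreal (real n) * nsq (G z) \<partial>frequencies)" for n
   unfolding I_def w_def by (intro nn_integral_mono mult_right_mono ennreal_leI) auto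
  then have "I n \<le> ennreal (real n) * energy frequencies G" for n
   unfolding energy_def by (subst nn_integral_cmult[symmetric]) auto
  moreover have "ennreal (real n) * energy frequencies G < \<infinity>" for n using fin by (auto simp: ennreal_mult_less_top)
  ultimately have Ifin: "I n < \<infinity>" for n by (rule le_less_trans)
  have step: "ennreal c * I n \<le> Q r" if r: "2 \<le> r" for n r
  proof -
   have Gr[measurable]: "(\<lambda>z. G (r * fst z, snd z)) \<in> freq_measurable"
   proof -
    have [measurable]: "G \<in> borel_measurable (lborel \<Otimes>\<^sub>M count_space UNIV)" using G by (simp add: frequencies_def)
    show ?thesis unfolding frequencies_def by measurable
   qed
   have dil: "(\<integral>\<^sup>+z. ennreal (w n (fst z)) * nsq (G (r * fst z, snd z)) \<partial>frequencies) \<le> ennreal \<rho>0 * I n"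
   proof -
    have "(\<integral>\<^sup>+z. ennreal (w n (fst z)) * nsq (G (r * fst z, snd z)) \<partial>frequencies)
     = ennreal (1 / r) * (\<integral>\<^sup>+z. ennreal (w n (fst z / r)) * nsq (G z) \<partial>frequencies)"
     using nn_integral_freq_scale[of "\<lambda>z. ennreal (w n (fst z / r)) * nsq (G z)" r] r by simp
    also have "... \<le> ennreal (1 / r) * (\<integral>\<^sup>+z. ennreal (r powr (2 * \<theta>)) * (ennreal (w n (fst z)) * nsq (G z)) \<partial>frequencies)"
    proof (intro mult_left_mono nn_integral_mono)
     fix z :: "real \<times> int"
     have "(\<bar>fst z\<bar> / r) powr (- 2 * \<theta>) = r powr (2 * \<theta>) * \<bar>fst z\<bar> powr (- 2 * \<theta>)"
      using r by (simp add: powr_divide powr_minus field_simps)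
     moreover have "real n \<le> r powr (2 * \<theta>) * real n"
      using ge_one_powr_ge_zero[of r "2 * \<theta>"] mult_right_mono[of 1 "r powr (2 * \<theta>)" "real n"] r \<theta> by simp
     ultimately have "w n (fst z / r) \<le> r powr (2 * \<theta>) * w n (fst z)"
      using r unfolding w_def min_mult_distrib_left by (simp add: abs_divide min_le_iff_disj)
     then show "ennreal (w n (fst z / r)) * nsq (G z) \<le> ennreal (r powr (2 * \<theta>)) * (ennreal (w n (fst z)) * nsq (G z))"
      unfolding mult.assoc[symmetric] using w0 by (subst ennreal_mult[symmetric]) (auto intro!: mult_right_mono ennreal_leI)
    qed simp
    also have "... = ennreal (1 / r) * (ennreal (r powr (2 * \<theta>)) * I n)"
     unfolding I_def by (subst nn_integral_cmult) auto
    also have "... = ennreal (r powr (2 * \<theta> - 1)) * I n"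
     using r by (simp add: mult.assoc[symmetric] ennreal_mult[symmetric] powr_diff)
    also have "... \<le> ennreal \<rho>0 * I n"
     unfolding \<rho>0_def using r \<theta> by (intro mult_right_mono ennreal_leI powr_mono2') auto
    finally show ?thesis .
   qed
   have "I n \<le> (\<integral>\<^sup>+z. ennreal (1 + d) * (ennreal (w n (fst z)) * nsq (G (r * fst z, snd z)))
     + ennreal (1 + 1 / d) * (fst_powr (- 2 * \<theta>) z * nsq (G (r * fst z, snd z) - G z)) \<partial>frequencies)"
    unfolding I_def
   proof (rule nn_integral_mono)
    fix z :: "real \<times> int"
    define A where "A = (cmod (G (r * fst z, snd z)))\<^sup>2"
    define B where "B = (cmod (G (r * fst z, snd z) - G z))\<^sup>2"
    have AB: "0 \<le> A" "0 \<le> B" by (auto simp: A_def B_def)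
    have "(cmod (G z))\<^sup>2 \<le> (1 + d) * A + (1 + 1 / d) * B"
     using cmod_add_square_le[OF d, of "G (r * fst z, snd z)" "G z - G (r * fst z, snd z)"]
     by (simp add: A_def B_def norm_minus_commute)
    then have "w n (fst z) * (cmod (G z))\<^sup>2 \<le> w n (fst z) * ((1 + d) * A + (1 + 1 / d) * B)"
     using w0 by (intro mult_left_mono) auto
    also have "... = (1 + d) * (w n (fst z) * A) + (1 + 1 / d) * (w n (fst z) * B)" by (simp add: algebra_simps)
    also have "... \<le> (1 + d) * (w n (fst z) * A) + (1 + 1 / d) * (\<bar>fst z\<bar> powr (- 2 * \<theta>) * B)"
     using d AB by (intro add_left_mono mult_left_mono mult_right_mono) (auto simp: w_def)
    finally have "ennreal (w n (fst z) * (cmod (G z))\<^sup>2) \<le> ennreal ((1 + d) * (w n (fst z) * A) + (1 + 1 / d) * (\<bar>fst z\<bar> powr (- 2 * \<theta>) * B))"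
     by (rule ennreal_leI)
    then show "ennreal (w n (fst z)) * nsq (G z)
     \<le> ennreal (1 + d) * (ennreal (w n (fst z)) * ennreal A) + ennreal (1 + 1 / d) * (fst_powr (- 2 * \<theta>) z * ennreal B)"
     using d w0 AB by (simp add: ennreal_mult)
   qed
   also have "... = ennreal (1 + d) * (\<integral>\<^sup>+z. ennreal (w n (fst z)) * nsq (G (r * fst z, snd z)) \<partial>frequencies)
     + ennreal (1 + 1 / d) * Q r" unfolding Q_def by (subst nn_integral_add) (auto simp: nn_integral_cmult)
   also have "... \<le> ennreal (1 + d) * (ennreal \<rho>0 * I n) + ennreal (1 + 1 / d) * Q r"
    by (intro add_right_mono mult_left_mono dil) simp
   also have "... = ennreal \<rho> * I n + ennreal (1 + 1 / d) * Q r"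
    unfolding \<rho>_def using d \<rho>0 by (simp add: ennreal_mult mult.assoc)
   finally have main: "I n \<le> ennreal \<rho> * I n + ennreal (1 + 1 / d) * Q r" .
   obtain i where i: "I n = ennreal i" "0 \<le> i" using Ifin[of n] by (cases "I n") auto
   show ?thesis
   proof (cases "Q r")
    case (real q)
    have "ennreal i \<le> ennreal (\<rho> * i + (1 + 1 / d) * q)" using main i real d \<rho>1 by (simp add: ennreal_mult)
    then have "i \<le> \<rho> * i + (1 + 1 / d) * q" using i real d \<rho>1 by (subst (asm) ennreal_le_iff) auto
    then have "(1 - \<rho>) * i \<le> (1 + 1 / d) * q" by (simp add: algebra_simps)
    moreover have "0 < 1 + 1 / d" using d by (simp add: add_pos_pos)
    ultimately have "c * i \<le> q" by (simp add: c_def field_simps)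
    then show ?thesis using i real c by (simp add: ennreal_mult[symmetric] ennreal_leI)
   qed simp
  qed
  have In: "I n \<le> ennreal C * D" for n
  proof -
   have "ennreal c * I n = (\<integral>\<^sup>+r. indicator {2..3} r * (ennreal c * I n) \<partial>(lborel :: real measure))"
    by (subst nn_integral_multc) auto
   also have "... \<le> (\<integral>\<^sup>+r. indicator {2..3} r * Q r \<partial>(lborel :: real measure))"
    using step by (intro nn_integral_mono) (auto simp: indicator_def)
   also have "... \<le> ennreal (2 powr (1 + 2 * \<theta>)) * D"
    unfolding Q_def D_def by (rule freq_dilation_average[OF G \<theta>(1)])
   finally have "ennreal (1 / c) * (ennreal c * I n) \<le> ennreal (1 / c) * (ennreal (2 powr (1 + 2 * \<theta>)) * D)"
    by (rule mult_left_mono) simp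
   then show ?thesis using c by (simp add: mult.assoc[symmetric] ennreal_mult[symmetric] C_def)
  qed
  have "freq_weight (- 2 * \<theta>) G = (\<integral>\<^sup>+z. liminf (\<lambda>n. ennreal (w n (fst z)) * nsq (G z)) \<partial>frequencies)"
   unfolding freq_weight_def
  proof (rule nn_integral_cong)
   fix z :: "real \<times> int"
   obtain N where N: "\<bar>fst z\<bar> powr (- 2 * \<theta>) \<le> real N" using real_arch_simple by blast
   have "\<forall>\<^sub>F n in sequentially. ennreal (w n (fst z)) * nsq (G z) = fst_powr (- 2 * \<theta>) z * nsq (G z)"
    using eventually_ge_at_top[of N] by eventually_elim (use N in \<open>auto simp: w_def min_def\<close>)
   then have "(\<lambda>n. ennreal (w n (fst z)) * nsq (G z)) \<longlonglongrightarrow> fst_powr (- 2 * \<theta>) z * nsq (G z)"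
    by (rule tendsto_eventually)
   then show "fst_powr (- 2 * \<theta>) z * nsq (G z) = liminf (\<lambda>n. ennreal (w n (fst z)) * nsq (G z))"
    by (rule lim_imp_Liminf[OF sequentially_bot, symmetric])
  qed
  also have "... \<le> liminf I" unfolding I_def by (rule nn_integral_liminf) measurable
  also have "... \<le> ennreal C * D" by (intro Liminf_le always_eventually allI In) simp
  finally show "freq_weight (- 2 * \<theta>) G \<le> ennreal C * diff_energy 1 \<theta> G" by (simp add: D_def)
 qed
qed

lemma half_sum:
 fixes p q r s :: real
 assumes "p + q = 2 * r + 2 * s" "0 \<le> r"
 shows "s \<le> 1/2 * (q + p)"
proof -
 have "2 * s \<le> p + q" using assms by simp
 then show ?thesis by simp
qed

text \<open>If \<open>\<xi>\<close> and \<open>\<xi> + h\<close> have opposite signs, the differences of \<open>G\<close> and of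
 \<open>sgn \<xi> G\<close> are, up to sign, \<open>v - u\<close> and \<open>v + u\<close>, and the parallelogram
 identity recovers \<open>\<bar>u\<bar>\<^sup>2\<close>. Integrating the kernel over such steps yields
 \<open>1/\<bar>\<xi>\<bar>\<close>.\<close>

lemma hardy_half:
 assumes G: "G \<in> freq_measurable"
 shows "freq_weight (- 1) G \<le> ennreal (9/2) * (diff_energy 1 (1/2) G + diff_energy 1 (1/2) (\<lambda>q. of_real (sgn (fst q)) * G q))"
proof -
 define H where "H q = of_real (sgn (fst q)) * G q" for q :: "real \<times> int"
 note [measurable] = G
 have Hm[measurable]: "H \<in> freq_measurable" unfolding H_def by measurable
 define J where "J = (\<integral>\<^sup>+h. sing (1/2) h * indicator {..< -1} h \<partial>lborel)"
 (* Any positive lower bound for J serves; the kernel is at least 1/9 on the interval from -3 to -2, which has length 1. *)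
 have J: "ennreal (1/9) \<le> J"
 proof -
  have "ennreal (1/9) = (\<integral>\<^sup>+h. ennreal (1/9) * indicator {-3..-2::real} h \<partial>lborel)"
   by (subst nn_integral_cmult_indicator) auto
  also have "... \<le> J" unfolding J_def
  proof (rule nn_integral_mono)
   fix h :: real
   show "ennreal (1/9) * indicator {-3..-2} h \<le> sing (1/2) h * indicator {..< -1} h"
   proof (cases "h \<in> {-3..-2}")
    case True
    then have "3 powr (-2) \<le> \<bar>h\<bar> powr (-2)" by (intro powr_mono2') auto
    moreover have "3 powr (-2) = (1/9 :: real)" by (simp add: powr_minus powr_numeral)
    ultimately show ?thesis using True by (simp add: sing_def ennreal_leI)
   qed simp
  qed
  finally show ?thesis .
 qed
 define a where "a h q = nsq (xdiff 1 h G q)" for h q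
 define b where "b h q = nsq (xdiff 1 h H q)" for h q
 have am: "(\<lambda>(h, q). sing (1/2) h * (a h q + b h q)) \<in> borel_measurable (lborel \<Otimes>\<^sub>M frequencies)"
 proof -
  have [measurable]: "(\<lambda>p. xdiff 1 (fst p) G (snd p)) \<in> borel_measurable (lborel \<Otimes>\<^sub>M frequencies)"
   "(\<lambda>p. xdiff 1 (fst p) H (snd p)) \<in> borel_measurable (lborel \<Otimes>\<^sub>M frequencies)"
   using xdiff_joint_measurable[OF G, of 1] xdiff_joint_measurable[OF Hm, of 1] by (simp_all add: case_prod_unfold)
  show ?thesis unfolding a_def b_def case_prod_unfold by measurable
 qed
 have "ennreal (1/9) * freq_weight (- 1) G \<le> J * freq_weight (- 1) G" by (intro mult_right_mono J) simp
 also have "... = (\<integral>\<^sup>+q. J * (ennreal (\<bar>fst q\<bar> powr - 1) * nsq (G q)) \<partial>frequencies)"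
  unfolding freq_weight_def by (rule nn_integral_cmult[symmetric]) measurable
 also have "... \<le> (\<integral>\<^sup>+q. ennreal (1/2) * (\<integral>\<^sup>+h. sing (1/2) h * (a h q + b h q) \<partial>lborel) \<partial>frequencies)"
 proof (rule nn_integral_mono_AE)
  show "AE q in frequencies. J * (ennreal (\<bar>fst q\<bar> powr - 1) * nsq (G q))
   \<le> ennreal (1/2) * (\<integral>\<^sup>+h. sing (1/2) h * (a h q + b h q) \<partial>lborel)"
   using AE_frequencies_nonzero AE_space
  proof eventually_elim
   case (elim q)
   have z: "q \<in> space frequencies" by (simp add: frequencies_def space_pair_measure)
   have [measurable]: "(\<lambda>h. sing (1/2) h * (a h q + b h q)) \<in> borel_measurable lborel"
    using measurable_compose[OF measurable_Pair2'[OF z, of lborel] am] by simp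
   have sc: "(\<integral>\<^sup>+h. sing (1/2) h * indicator {..< -1} (1 / fst q * h) \<partial>lborel) = ennreal (\<bar>1 / fst q\<bar> powr (2 * (1/2))) * J"
    unfolding J_def using elim by (intro sing_scale[of "indicator {..< -1}"]) auto
   have "\<bar>1 / fst q\<bar> powr (2 * (1/2)) = \<bar>fst q\<bar> powr - 1" using elim by (simp add: powr_minus abs_divide field_simps)
   then have "J * (ennreal (\<bar>fst q\<bar> powr - 1) * nsq (G q))
    = (\<integral>\<^sup>+h. sing (1/2) h * indicator {..< -1} (1 / fst q * h) \<partial>lborel) * nsq (G q)"
    unfolding sc by (simp add: mult_ac)
   also have "... = (\<integral>\<^sup>+h. sing (1/2) h * indicator {..< -1} (1 / fst q * h) * nsq (G q) \<partial>lborel)"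
    by (rule nn_integral_multc[symmetric]) measurable
   also have "... \<le> (\<integral>\<^sup>+h. ennreal (1/2) * (sing (1/2) h * (a h q + b h q)) \<partial>lborel)"
   proof (rule nn_integral_mono)
    fix h :: real
    show "sing (1/2) h * indicator {..< -1} (1 / fst q * h) * nsq (G q) \<le> ennreal (1/2) * (sing (1/2) h * (a h q + b h q))"
    proof (cases "1 / fst q * h < -1")
     case True
     define u where "u = G q"
     define v where "v = G (fst q + h, snd q)"
     have "fst q + h = fst q * (1 + 1 / fst q * h)" using elim by (simp add: field_simps)
     then have "sgn (fst q + h) = sgn (fst q * (1 + 1 / fst q * h))" by (rule arg_cong)
     also have "... = sgn (fst q) * sgn (1 + 1 / fst q * h)" by (rule sgn_mult)
     also have "sgn (1 + 1 / fst q * h) = -1" using True by (subst sgn_neg) auto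
     finally have sg: "sgn (fst q + h) = - sgn (fst q)" by simp
     have "xdiff 1 h H q = - of_real (sgn (fst q)) * (v + u)"
     proof -
      have xd: "xdiff 1 h H q = H (fst q + h, snd q) - H q" by (simp add: xdiff_def)
      show ?thesis unfolding xd unfolding H_def fst_conv snd_conv sg u_def v_def by (simp add: algebra_simps)
     qed
     then have n2: "cmod (xdiff 1 h H q) = cmod (v + u)" using elim by (simp add: norm_mult abs_sgn_eq)
     have n1: "cmod (xdiff 1 h G q) = cmod (v - u)" by (simp add: xdiff_def u_def v_def)
     have "(cmod (v + u))\<^sup>2 + (cmod (v - u))\<^sup>2 = 2 * (cmod v)\<^sup>2 + 2 * (cmod u)\<^sup>2"
      by (simp only: cmod_power2) (simp add: power2_eq_square algebra_simps)
     then have "(cmod u)\<^sup>2 \<le> 1/2 * ((cmod (v - u))\<^sup>2 + (cmod (v + u))\<^sup>2)" by (rule half_sum) simp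
     then have "nsq u \<le> ennreal (1/2 * ((cmod (v - u))\<^sup>2 + (cmod (v + u))\<^sup>2))" by (rule ennreal_leI)
     also have "... = ennreal (1/2) * (a h q + b h q)" unfolding a_def b_def n1 n2 by (subst ennreal_mult) auto
     finally have "sing (1/2) h * nsq (G q) \<le> sing (1/2) h * (ennreal (1/2) * (a h q + b h q))"
      unfolding u_def by (rule mult_left_mono) simp
     then show ?thesis using True by (simp only: indicator_simps lessThan_iff mult_1_right mult.left_commute)
    qed simp
   qed
   also have "... = ennreal (1/2) * (\<integral>\<^sup>+h. sing (1/2) h * (a h q + b h q) \<partial>lborel)"
    by (rule nn_integral_cmult) measurable
   finally show ?case .
  qed
 qed
 also have "... = ennreal (1/2) * (\<integral>\<^sup>+q. (\<integral>\<^sup>+h. sing (1/2) h * (a h q + b h q) \<partial>lborel) \<partial>frequencies)"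
 proof (rule nn_integral_cmult)
  have "(\<lambda>(q, h). sing (1/2) h * (a h q + b h q)) \<in> borel_measurable (frequencies \<Otimes>\<^sub>M lborel)"
   using measurable_pair_swap[OF am] by simp
  from lborel.borel_measurable_nn_integral_fst[OF this]
  show "(\<lambda>q. \<integral>\<^sup>+h. sing (1/2) h * (a h q + b h q) \<partial>lborel) \<in> freq_measurable" by simp
 qed
 also have "(\<integral>\<^sup>+q. (\<integral>\<^sup>+h. sing (1/2) h * (a h q + b h q) \<partial>lborel) \<partial>frequencies)
  = (\<integral>\<^sup>+h. (\<integral>\<^sup>+q. sing (1/2) h * (a h q + b h q) \<partial>frequencies) \<partial>lborel)"
  using line_freq.Fubini'[OF am] by simp
 also have "... = (\<integral>\<^sup>+h. sing (1/2) h * energy frequencies (xdiff 1 h G) + sing (1/2) h * energy frequencies (xdiff 1 h H) \<partial>lborel)"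
 proof (rule nn_integral_cong)
  fix h :: real
  have [measurable]: "a h \<in> freq_measurable" "b h \<in> freq_measurable"
   unfolding a_def b_def using xdiff_measurable[OF G, of 1 h] xdiff_measurable[OF Hm, of 1 h] by measurable
  show "(\<integral>\<^sup>+q. sing (1/2) h * (a h q + b h q) \<partial>frequencies) = sing (1/2) h * energy frequencies (xdiff 1 h G) + sing (1/2) h * energy frequencies (xdiff 1 h H)"
  proof -
   have e: "energy frequencies (xdiff 1 h G) = (\<integral>\<^sup>+q. a h q \<partial>frequencies)" "energy frequencies (xdiff 1 h H) = (\<integral>\<^sup>+q. b h q \<partial>frequencies)"
    by (simp_all only: energy_def a_def b_def)
   have "(\<integral>\<^sup>+q. sing (1/2) h * (a h q + b h q) \<partial>frequencies) = sing (1/2) h * (\<integral>\<^sup>+q. a h q + b h q \<partial>frequencies)"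
    by (rule nn_integral_cmult) measurable
   also have "(\<integral>\<^sup>+q. a h q + b h q \<partial>frequencies) = (\<integral>\<^sup>+q. a h q \<partial>frequencies) + (\<integral>\<^sup>+q. b h q \<partial>frequencies)"
    by (rule nn_integral_add) measurable
   finally show ?thesis unfolding e distrib_left .
  qed
 qed
 also have "... = diff_energy 1 (1/2) G + diff_energy 1 (1/2) H"
  unfolding diff_energy_def using energy_xdiff_measurable[OF G, of 1] energy_xdiff_measurable[OF Hm, of 1]
  by (intro nn_integral_add) auto
 finally have "ennreal 9 * (ennreal (1/9) * freq_weight (- 1) G) \<le> ennreal 9 * (ennreal (1/2) * (diff_energy 1 (1/2) G + diff_energy 1 (1/2) H))"
  by (rule mult_left_mono) simp
 moreover have "ennreal 9 * ennreal (1/9) = 1" "ennreal 9 * ennreal (1/2) = ennreal (9/2)"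
  by (subst ennreal_mult[symmetric]; simp)+
 ultimately show ?thesis unfolding H_def[abs_def] by (simp only: mult.assoc[symmetric] mult_1)
qed

section \<open>Moments and spatial weights\<close>

lemma japanese_ge: "1 \<le> japanese x" "\<bar>x\<bar> \<le> japanese x" unfolding japanese_def by (simp_all add: real_le_rsqrt)

lemma weighted_eq: "weighted \<theta> f z = of_real (japanese (fst z) powr \<theta>) * f z"
 by (simp add: weighted_def case_prod_unfold)

lemma japanese_measurable [measurable]: "japanese \<in> borel_measurable borel" unfolding japanese_def by measurable

lemma power_over_japanese_L2:
 assumes l: "real l + 1/2 < \<theta>"
 shows "(\<lambda>z. of_real (fst z ^ l * japanese (fst z) powr (- \<theta>))) \<in> L2 cylinder" (is "?g \<in> _")
proof -
 have m: "?g \<in> borel_measurable cylinder" unfolding cylinder_eq by measurable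
 have "energy cylinder ?g = (\<integral>\<^sup>+x. (\<integral>\<^sup>+y. nsq (of_real (x ^ l * japanese x powr (- \<theta>))) \<partial>circle) \<partial>lborel)"
  by (subst energy_cylinder[OF m]) (simp add: energy_def)
 also have "... \<le> (\<integral>\<^sup>+x. ennreal (2 * pi) * ennreal (min (\<bar>x\<bar> powr 0) (\<bar>x\<bar> powr (2 * (real l - \<theta>)))) \<partial>lborel)"
  using AE_lborel_singleton[of "0::real"]
 proof (intro nn_integral_mono_AE, eventually_elim)
  case (elim x)
  have j: "0 < japanese x" using japanese_ge(1)[of x] by simp
  have "\<bar>x\<bar> ^ l \<le> japanese x ^ l" using japanese_ge(2)[of x] by (intro power_mono) auto
  then have "cmod (of_real (x ^ l * japanese x powr (- \<theta>))) \<le> japanese x ^ l * japanese x powr (- \<theta>)"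
   unfolding norm_of_real abs_mult power_abs by (simp add: mult_right_mono)
  also have "... = japanese x powr (real l - \<theta>)" using j by (simp add: powr_realpow[symmetric] powr_add[symmetric])
  finally have "(cmod (of_real (x ^ l * japanese x powr (- \<theta>))))\<^sup>2 \<le> (japanese x powr (real l - \<theta>))\<^sup>2"
   by (intro power_mono) auto
  also have "... = japanese x powr (2 * (real l - \<theta>))" by (simp add: power2_eq_square powr_add[symmetric])
  also have "... \<le> min (\<bar>x\<bar> powr 0) (\<bar>x\<bar> powr (2 * (real l - \<theta>)))"
  proof (rule min.boundedI)
   have "japanese x powr (2 * (real l - \<theta>)) \<le> japanese x powr 0"
    using japanese_ge(1)[of x] l by (intro powr_mono) auto
   then show "japanese x powr (2 * (real l - \<theta>)) \<le> \<bar>x\<bar> powr 0" using elim j by simp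
   show "japanese x powr (2 * (real l - \<theta>)) \<le> \<bar>x\<bar> powr (2 * (real l - \<theta>))"
    using japanese_ge(2)[of x] elim l by (intro powr_mono2') auto
  qed
  finally have "nsq (of_real (x ^ l * japanese x powr (- \<theta>))) \<le> ennreal (min (\<bar>x\<bar> powr 0) (\<bar>x\<bar> powr (2 * (real l - \<theta>))))"
   by (rule ennreal_leI)
  then have "ennreal (2 * pi) * nsq (of_real (x ^ l * japanese x powr (- \<theta>)))
   \<le> ennreal (2 * pi) * ennreal (min (\<bar>x\<bar> powr 0) (\<bar>x\<bar> powr (2 * (real l - \<theta>))))"
   by (rule mult_left_mono) simp
  then show ?case using emeasure_circle by (simp only: nn_integral_const mult.commute)
 qed
 also have "... = ennreal (2 * pi) * (\<integral>\<^sup>+x. ennreal (min (\<bar>x\<bar> powr 0) (\<bar>x\<bar> powr (2 * (real l - \<theta>)))) \<partial>lborel)"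
  by (rule nn_integral_cmult) measurable
 also have "... < \<infinity>" using nn_integral_min_powr_finite[of 0 "2 * (real l - \<theta>)"] l
  by (auto simp: ennreal_mult_less_top)
 finally show ?thesis using m by (simp add: L2_iff_energy)
qed

lemma weighted_cancel:
 "of_real (fst z ^ l) * f z = weighted \<theta> f z * cnj (of_real (fst z ^ l * japanese (fst z) powr (- \<theta>)))"
proof -
 have "japanese (fst z) powr \<theta> * japanese (fst z) powr (- \<theta>) = 1"
  using japanese_ge(1)[of "fst z"] by (simp add: powr_minus)
 then have "complex_of_real (japanese (fst z) powr \<theta>) * of_real (japanese (fst z) powr (- \<theta>)) = 1"
  by (metis of_real_1 of_real_mult)
 then show ?thesis by (simp add: weighted_eq mult_ac)
qed

lemma weighted_power_integrable:
 assumes f: "weighted \<theta> f \<in> L2 cylinder" and l: "real l + 1/2 < \<theta>"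
 shows "integrable cylinder (\<lambda>z. of_real (fst z ^ l) * f z)"
 unfolding weighted_cancel[of _ l f \<theta>] by (rule L2_product_integrable[OF f power_over_japanese_L2[OF l]])

text \<open>A moment is the pairing of the weighted function with a fixed square integrable function, so it is controlled by the
 weighted norm.\<close>

lemma moment_bound:
 fixes l :: nat
 assumes l: "real l + 1/2 < \<theta>"
 shows "\<exists>C\<ge>0. \<forall>f. weighted \<theta> f \<in> L2 cylinder \<longrightarrow> nsq (moment f l 0) \<le> ennreal C * energy cylinder (weighted \<theta> f)"
proof (intro exI conjI allI impI)
 let ?g = "\<lambda>z :: real \<times> real. complex_of_real (fst z ^ l * japanese (fst z) powr (- \<theta>))"
 show "0 \<le> (L2_norm cylinder ?g)\<^sup>2" by simp
 fix f assume f: "weighted \<theta> f \<in> L2 cylinder"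
 have "moment f l 0 = (LINT z|cylinder. of_real (fst z ^ l) * f z)" by (simp add: moment_def case_prod_unfold)
 also have "... = (LINT z|cylinder. weighted \<theta> f z * cnj (?g z))" by (simp only: weighted_cancel[of _ l f \<theta>])
 finally have "cmod (moment f l 0) \<le> L2_norm cylinder (weighted \<theta> f) * L2_norm cylinder ?g"
  using L2_inner_bound[OF f power_over_japanese_L2[OF l]] by simp
 then have "(cmod (moment f l 0))\<^sup>2 \<le> (L2_norm cylinder (weighted \<theta> f) * L2_norm cylinder ?g)\<^sup>2"
  by (intro power_mono) auto
 also have "... = (L2_norm cylinder ?g)\<^sup>2 * (L2_norm cylinder (weighted \<theta> f))\<^sup>2" by (simp add: power_mult_distrib mult.commute)
 finally have "nsq (moment f l 0) \<le> ennreal ((L2_norm cylinder ?g)\<^sup>2 * (L2_norm cylinder (weighted \<theta> f))\<^sup>2)"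
  by (rule ennreal_leI)
 also have "... = ennreal ((L2_norm cylinder ?g)\<^sup>2) * energy cylinder (weighted \<theta> f)"
  unfolding energy_eq_L2_norm[OF f] by (rule ennreal_mult) auto
 finally show "nsq (moment f l 0) \<le> ennreal ((L2_norm cylinder ?g)\<^sup>2) * energy cylinder (weighted \<theta> f)" .
qed

lemma slice_power:
 assumes int: "integrable cylinder (\<lambda>z. of_real (fst z ^ l) * f z)"
 shows "integrable lborel (\<lambda>x. of_real (x ^ l) * slice f \<eta> x)"
  and "moment f l \<eta> = (LINT x|lborel. of_real (x ^ l) * slice f \<eta> x)"
proof -
 have i: "integrable (lborel \<Otimes>\<^sub>M circle) (\<lambda>(x, y). of_real (x ^ l) * (f (x, y) * cowave (of_int \<eta> * y)))"
  using fourier_integral_character_integrable[OF int, of 0 \<eta>] by (simp add: cylinder_eq case_prod_unfold mult.assoc)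
 have s: "(LINT y|circle. of_real (x ^ l) * (f (x, y) * cowave (of_int \<eta> * y))) = of_real (x ^ l) * slice f \<eta> x" for x
  unfolding slice_def circle_coeff_def by (rule integral_mult_right_zero)
 from cyl.integrable_fst[OF i] show "integrable lborel (\<lambda>x. of_real (x ^ l) * slice f \<eta> x)" by (simp only: s)
 have "moment f l \<eta> = integral\<^sup>L (lborel \<Otimes>\<^sub>M circle) (\<lambda>(x, y). of_real (x ^ l) * (f (x, y) * cowave (of_int \<eta> * y)))"
  unfolding moment_def cylinder_eq by (intro Bochner_Integration.integral_cong refl) (auto simp: mult_ac)
 also have "... = (LINT x|lborel. of_real (x ^ l) * slice f \<eta> x)" unfolding cyl.integral_fst[OF i, symmetric] s ..
 finally show "moment f l \<eta> = (LINT x|lborel. of_real (x ^ l) * slice f \<eta> x)" .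
qed

lemma truncated_integral_tendsto:
 fixes g :: "real \<Rightarrow> complex"
 assumes g: "integrable lborel g"
 shows "(\<lambda>n. LINT x|lborel. (if \<bar>x\<bar> \<le> real n then g x else 0)) \<longlonglongrightarrow> (LINT x|lborel. g x)"
proof (rule integral_dominated_convergence[where w="\<lambda>x. norm (g x)"])
 have [measurable]: "g \<in> borel_measurable borel" using g by auto
 show "g \<in> borel_measurable lborel" "(\<lambda>x. if \<bar>x\<bar> \<le> real n then g x else 0) \<in> borel_measurable lborel" for n by measurable
 show "AE x in lborel. (\<lambda>n. if \<bar>x\<bar> \<le> real n then g x else 0) \<longlonglongrightarrow> g x"
 proof (rule AE_I2, rule tendsto_eventually)
  fix x :: real
  obtain N where "\<bar>x\<bar> \<le> real N" using real_arch_simple by blast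
  then show "\<forall>\<^sub>F n in sequentially. (if \<bar>x\<bar> \<le> real n then g x else 0) = g x"
   by (intro eventually_sequentiallyI[of N]) auto
 qed
qed (use g in auto)

lemma slice_x_trunc: "slice (x_trunc n f) \<eta> x = (if \<bar>x\<bar> \<le> real n then slice f \<eta> x else 0)"
 by (simp add: slice_def x_trunc_def circle_coeff_def)

lemma line_transform_integrable:
 assumes "integrable lborel s" shows "integrable lborel (\<lambda>x. s x * cowave (x * \<xi>))"
proof -
 have [measurable]: "s \<in> borel_measurable borel" using assms by auto
 show ?thesis by (rule Bochner_Integration.integrable_bound[OF assms]) (auto simp: norm_mult)
qed

lemma fourier_integral_x_trunc_tendsto:
 assumes f: "f \<in> L2 cylinder" and int: "integrable cylinder f"
 shows "(\<lambda>n. fourier_integral (x_trunc n f) (\<xi>, \<eta>)) \<longlonglongrightarrow> line_transform (slice f \<eta>) \<xi>"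
proof -
 have "integrable lborel (slice f \<eta>)" using slice_power(1)[of 0 f \<eta>] int by simp
 from truncated_integral_tendsto[OF line_transform_integrable[OF this, of \<xi>]]
 have "(\<lambda>n. LINT x|lborel. slice (x_trunc n f) \<eta> x * cowave (x * \<xi>)) \<longlonglongrightarrow> line_transform (slice f \<eta>) \<xi>"
  unfolding line_transform_def slice_x_trunc by (simp add: if_distrib[where f="\<lambda>u. u * _"] cong: if_cong)
 then show ?thesis unfolding fourier_integral_slice[OF x_trunc_integrable[OF f]] line_transform_def .
qed

lemma fourier_eq_line_transform:
 assumes f: "f \<in> L2 cylinder" and int: "integrable cylinder f"
 shows "AE q in frequencies. fourier f q = line_transform (slice f (snd q)) (fst q)"
proof -
 have fi: "fourier_integral f q = line_transform (slice f (snd q)) (fst q)" for q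
  using fourier_integral_slice[OF int, of "fst q" "snd q"] by simp
 have "AE q in frequencies. fourier_integral f q = fourier f q"
 proof (rule L2_tendsto_pointwise_AE[OF L2_measurable[OF fourier_integral_x_trunc_L2[OF f]] fourier_L2_tendsto[OF f]])
  show "AE z in frequencies. (\<lambda>n. fourier_integral (x_trunc n f) z) \<longlonglongrightarrow> fourier_integral f z"
   using fourier_integral_x_trunc_tendsto[OF f int] unfolding fi by (intro AE_I2) (metis prod.collapse)
  show "fourier_integral f \<in> freq_measurable" by (intro fourier_integral_measurable L2_measurable f)
 qed
 then show ?thesis by eventually_elim (simp add: fi)
qed

text \<open>The inequality on the line is summed over the modes \<open>\<eta>\<close> in \<open>S\<close>, with Parseval's
 identity in \<open>y\<close> on the right.\<close>

theorem hardy_moments_cylinder: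
 fixes k :: nat
 assumes \<theta>: "real k + 1/2 < \<theta>" "\<theta> < real k + 3/2"
 shows "\<exists>C\<ge>0. \<forall>f S. f \<in> L2 cylinder \<longrightarrow> weighted \<theta> f \<in> L2 cylinder \<longrightarrow> (\<forall>\<eta>\<in>S. \<forall>l\<le>k. moment f l \<eta> = 0) \<longrightarrow>
  freq_weight (- 2 * \<theta>) (\<lambda>q. indicator S (snd q) * fourier f q)
  \<le> ennreal C * x_energy \<theta> f"
proof -
 obtain C where C: "0 \<le> C" and hardy: "\<And>s :: real \<Rightarrow> complex.
  (\<forall>l\<le>k. integrable lborel (\<lambda>x. of_real (x ^ l) * s x) \<and> (LINT x|lborel. of_real (x ^ l) * s x) = 0) \<Longrightarrow>
  (\<integral>\<^sup>+\<xi>. ennreal (\<bar>\<xi>\<bar> powr (- 2 * \<theta>)) * nsq (line_transform s \<xi>) \<partial>lborel)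
  \<le> ennreal C * (\<integral>\<^sup>+x. ennreal (\<bar>x\<bar> powr (2 * \<theta>)) * nsq (s x) \<partial>lborel)"
  using hardy_moments[OF \<theta>] by blast
 show ?thesis
 proof (intro exI[of _ "C * (2 * pi)"] conjI allI impI)
  show "0 \<le> C * (2 * pi)" using C by simp
  fix f S assume f: "f \<in> L2 cylinder" and w: "weighted \<theta> f \<in> L2 cylinder" and mom: "\<forall>\<eta>\<in>S. \<forall>l\<le>k. moment f l \<eta> = 0"
  have int: "integrable cylinder (\<lambda>z. of_real (fst z ^ l) * f z)" if "l \<le> k" for l
   using \<theta> that by (intro weighted_power_integrable[OF w]) auto
  have int0: "integrable cylinder f" using int[of 0] by simp
  define g where "g q = fourier_integral f q" for q
  have gm: "g \<in> borel_measurable (lborel \<Otimes>\<^sub>M count_space UNIV)"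
   using fourier_integral_measurable[OF L2_measurable[OF f]] unfolding g_def by (simp add: frequencies_def)
  have gi: "g (\<xi>, \<eta>) = line_transform (slice f \<eta>) \<xi>" for \<xi> \<eta>
   unfolding g_def by (rule fourier_integral_slice[OF int0])
  have ind: "(\<lambda>p. ennreal (indicator S (snd p))) \<in> borel_measurable (lborel \<Otimes>\<^sub>M count_space (UNIV :: int set))"
   by (rule measurable_compose[OF measurable_snd]) simp
  have "freq_weight (- 2 * \<theta>) (\<lambda>q. indicator S (snd q) * fourier f q)
   = (\<integral>\<^sup>+q. ennreal (indicator S (snd q)) * (fst_powr (- 2 * \<theta>) q * nsq (g q)) \<partial>frequencies)"
   unfolding freq_weight_def using fourier_eq_line_transform[OF f int0]
   by (intro nn_integral_cong_AE, eventually_elim) (auto simp: gi[symmetric] indicator_def norm_mult)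
  also have "... = (\<integral>\<^sup>+\<eta>. (\<integral>\<^sup>+\<xi>. ennreal (indicator S \<eta>) * (ennreal (\<bar>\<xi>\<bar> powr (- 2 * \<theta>)) * nsq (line_transform (slice f \<eta>) \<xi>)) \<partial>lborel) \<partial>count_space UNIV)"
   unfolding frequencies_def gi[symmetric] using gm ind
   by (subst line_int.nn_integral_snd[symmetric]) (auto intro!: nn_integral_cong)
  also have "... \<le> (\<integral>\<^sup>+\<eta>. ennreal C * (\<integral>\<^sup>+x. ennreal (\<bar>x\<bar> powr (2 * \<theta>)) * nsq (slice f \<eta> x) \<partial>lborel) \<partial>count_space UNIV)"
  proof (rule nn_integral_mono)
   fix \<eta> :: int
   show "(\<integral>\<^sup>+\<xi>. ennreal (indicator S \<eta>) * (ennreal (\<bar>\<xi>\<bar> powr (- 2 * \<theta>)) * nsq (line_transform (slice f \<eta>) \<xi>)) \<partial>lborel)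
    \<le> ennreal C * (\<integral>\<^sup>+x. ennreal (\<bar>x\<bar> powr (2 * \<theta>)) * nsq (slice f \<eta> x) \<partial>lborel)"
   proof (cases "\<eta> \<in> S")
    case True
    have "(\<integral>\<^sup>+\<xi>. ennreal (\<bar>\<xi>\<bar> powr (- 2 * \<theta>)) * nsq (line_transform (slice f \<eta>) \<xi>) \<partial>lborel)
     \<le> ennreal C * (\<integral>\<^sup>+x. ennreal (\<bar>x\<bar> powr (2 * \<theta>)) * nsq (slice f \<eta> x) \<partial>lborel)"
    proof (rule hardy, intro allI impI conjI)
     fix l assume l: "l \<le> k"
     show "integrable lborel (\<lambda>x. of_real (x ^ l) * slice f \<eta> x)" by (rule slice_power(1)[OF int[OF l]])
     show "(LINT x|lborel. of_real (x ^ l) * slice f \<eta> x) = 0"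
      using mom True l slice_power(2)[OF int[OF l], of \<eta>] by simp
    qed
    then show ?thesis using True by simp
   qed simp
  qed
  also have "... = ennreal C * (\<integral>\<^sup>+\<eta>. (\<integral>\<^sup>+x. ennreal (\<bar>x\<bar> powr (2 * \<theta>)) * nsq (slice f \<eta> x) \<partial>lborel) \<partial>count_space UNIV)"
   by (rule nn_integral_cmult) simp
  also have "(\<integral>\<^sup>+\<eta>. (\<integral>\<^sup>+x. ennreal (\<bar>x\<bar> powr (2 * \<theta>)) * nsq (slice f \<eta> x) \<partial>lborel) \<partial>count_space UNIV)
   = ennreal (2 * pi) * x_energy \<theta> f"
   unfolding x_energy_def by (rule slice_parseval[OF f, of "\<lambda>x. ennreal (\<bar>x\<bar> powr (2 * \<theta>))"]) measurable
  finally show "freq_weight (- 2 * \<theta>) (\<lambda>q. indicator S (snd q) * fourier f q)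
   \<le> ennreal (C * (2 * pi)) * x_energy \<theta> f" using C by (subst ennreal_mult) (auto simp: mult.assoc)
 qed
qed

section \<open>The Taylor remainder at the endpoint\<close>

text \<open>The average over the segment from \<open>0\<close> to \<open>\<xi>\<close> that dominates the integral form of the
 Taylor remainder.\<close>

definition radial_average :: "(real \<times> int \<Rightarrow> complex) \<Rightarrow> real \<times> int \<Rightarrow> ennreal" where
 "radial_average \<Psi> z = (\<integral>\<^sup>+r. indicator {0..1} r * ennreal (cmod (\<Psi> (r * fst z, snd z))) \<partial>(lborel :: real measure))"

definition half_const :: ennreal where
 "half_const = (\<integral>\<^sup>+r. ennreal (r powr (-1/2)) * indicator {0..1} r \<partial>(lborel :: real measure))"

lemma half_const_finite: "half_const < \<infinity>" unfolding half_const_def by (rule nn_integral_powr_at_0) simp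

lemma radial_average_joint_measurable:
 assumes "\<Psi> \<in> freq_measurable"
 shows "(\<lambda>(r, z). \<Psi> (r * fst z, snd z)) \<in> borel_measurable (lborel \<Otimes>\<^sub>M frequencies)"
  and "(\<lambda>(z, r). \<Psi> (r * fst z, snd z)) \<in> borel_measurable (frequencies \<Otimes>\<^sub>M lborel)"
proof -
 have [measurable]: "\<Psi> \<in> borel_measurable (lborel \<Otimes>\<^sub>M count_space UNIV)" using assms by (simp add: frequencies_def)
 show "(\<lambda>(r, z). \<Psi> (r * fst z, snd z)) \<in> borel_measurable (lborel \<Otimes>\<^sub>M frequencies)"
  "(\<lambda>(z, r). \<Psi> (r * fst z, snd z)) \<in> borel_measurable (frequencies \<Otimes>\<^sub>M lborel)"
  unfolding frequencies_def by measurable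
qed

lemma radial_average_measurable:
 assumes "\<Psi> \<in> freq_measurable"
 shows "radial_average \<Psi> \<in> freq_measurable"
proof -
 have "(\<lambda>p. indicator {0..1} (snd p) * ennreal (cmod (case p of (z, r) \<Rightarrow> \<Psi> (r * fst z, snd z)))) \<in> borel_measurable (frequencies \<Otimes>\<^sub>M lborel)"
  using radial_average_joint_measurable(2)[OF assms] by measurable
 from lborel.borel_measurable_nn_integral_fst[OF this] show ?thesis by (simp add: radial_average_def[abs_def])
qed

lemma radial_slice_measurable:
 assumes "\<Psi> \<in> freq_measurable"
 shows "(\<lambda>r. \<Psi> (r * fst z, snd z)) \<in> borel_measurable borel"
proof -
 have [measurable]: "\<Psi> \<in> borel_measurable (lborel \<Otimes>\<^sub>M count_space UNIV)" using assms by (simp add: frequencies_def)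
 show ?thesis by measurable
qed

text \<open>Hardy's inequality for averages. The Cauchy--Schwarz inequality with the factors \<open>r powr (- 1/4)\<close> and
 \<open>r powr (1/4)\<close> and a dilation by \<open>r\<close> give the same integral \<open>half_const\<close> twice.\<close>

lemma radial_average_bound:
 assumes \<Psi>: "\<Psi> \<in> freq_measurable" and s: "- 1 \<le> s" "s \<le> 0"
 shows "(\<integral>\<^sup>+z. fst_powr s z * (radial_average \<Psi> z)\<^sup>2 \<partial>frequencies) \<le> half_const\<^sup>2 * freq_weight s \<Psi>"
proof -
 define p where "p r z = nsq (\<Psi> (r * fst z, snd z))" for r z
 define w where "w r = ennreal (r powr (1/2)) * indicator {0..1} r" for r :: real
 note [measurable] = radial_slice_measurable[OF \<Psi>] \<Psi>
 have cs: "(radial_average \<Psi> z)\<^sup>2 \<le> half_const * (\<integral>\<^sup>+r. w r * p r z \<partial>lborel)" for z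
 proof -
  have split: "radial_average \<Psi> z = (\<integral>\<^sup>+r. (ennreal (r powr (-1/4)) * indicator {0..1} r) *
    (ennreal (r powr (1/4)) * indicator {0..1} r * ennreal (cmod (\<Psi> (r * fst z, snd z)))) \<partial>lborel)"
   unfolding radial_average_def using AE_lborel_singleton[of "0::real"]
  proof (intro nn_integral_cong_AE, eventually_elim)
   case (elim r)
   have "ennreal (r powr (-1/4)) * ennreal (r powr (1/4)) = 1" if "r \<in> {0..1}"
    using that elim by (simp add: ennreal_mult[symmetric] powr_add[symmetric])
   then show ?case by (auto simp: indicator_def mult.assoc[symmetric])
  qed
  have cs: "(radial_average \<Psi> z)\<^sup>2 \<le> (\<integral>\<^sup>+r. (ennreal (r powr (-1/4)) * indicator {0..1} r)\<^sup>2 \<partial>lborel) *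
   (\<integral>\<^sup>+r. (ennreal (r powr (1/4)) * indicator {0..1} r * ennreal (cmod (\<Psi> (r * fst z, snd z))))\<^sup>2 \<partial>lborel)"
   unfolding split by (rule Cauchy_Schwarz_nn_integral) measurable
  have f1: "(\<integral>\<^sup>+r. (ennreal (r powr (-1/4)) * indicator {0..1} r)\<^sup>2 \<partial>lborel) = half_const"
   unfolding half_const_def
  proof (rule nn_integral_cong)
   fix r :: real
   have "(r powr (-1/4))\<^sup>2 = r powr (-1/2)" by (simp add: power2_eq_square powr_add[symmetric])
   then show "(ennreal (r powr (-1/4)) * indicator {0..1} r)\<^sup>2 = ennreal (r powr (-1/2)) * indicator {0..1} r"
    by (simp add: power_mult_distrib ennreal_power indicator_def)
  qed
  have f2: "(\<integral>\<^sup>+r. (ennreal (r powr (1/4)) * indicator {0..1} r * ennreal (cmod (\<Psi> (r * fst z, snd z))))\<^sup>2 \<partial>lborel)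
   = (\<integral>\<^sup>+r. w r * p r z \<partial>lborel)"
  proof (rule nn_integral_cong)
   fix r :: real
   have "(r powr (1/4))\<^sup>2 = r powr (1/2)" by (simp add: power2_eq_square powr_add[symmetric])
   then show "(ennreal (r powr (1/4)) * indicator {0..1} r * ennreal (cmod (\<Psi> (r * fst z, snd z))))\<^sup>2 = w r * p r z"
    by (simp add: w_def p_def power_mult_distrib ennreal_power indicator_def)
  qed
  show ?thesis using cs unfolding f1 f2 .
 qed
 have pm: "(\<lambda>(r, z). w r * (fst_powr s z * p r z)) \<in> borel_measurable (lborel \<Otimes>\<^sub>M frequencies)"
 proof -
  have [measurable]: "(\<lambda>q. \<Psi> (fst q * fst (snd q), snd (snd q))) \<in> borel_measurable (lborel \<Otimes>\<^sub>M frequencies)"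
   using radial_average_joint_measurable(1)[OF \<Psi>] by (simp add: case_prod_unfold)
  show ?thesis unfolding p_def w_def case_prod_unfold by measurable
 qed
 have p1: "(\<lambda>r. w r * p r z) \<in> borel_measurable lborel" for z unfolding w_def p_def by measurable
 have "(\<integral>\<^sup>+z. fst_powr s z * (radial_average \<Psi> z)\<^sup>2 \<partial>frequencies)
  \<le> (\<integral>\<^sup>+z. half_const * (\<integral>\<^sup>+r. w r * (fst_powr s z * p r z) \<partial>lborel) \<partial>frequencies)"
 proof (rule nn_integral_mono)
  fix z :: "real \<times> int"
  have "fst_powr s z * (radial_average \<Psi> z)\<^sup>2 \<le> fst_powr s z * (half_const * (\<integral>\<^sup>+r. w r * p r z \<partial>lborel))"
   by (intro mult_left_mono cs) simp
  also have "... = half_const * (fst_powr s z * (\<integral>\<^sup>+r. w r * p r z \<partial>lborel))" by (rule mult.left_commute)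
  also have "fst_powr s z * (\<integral>\<^sup>+r. w r * p r z \<partial>lborel) = (\<integral>\<^sup>+r. w r * (fst_powr s z * p r z) \<partial>lborel)"
   by (subst nn_integral_cmult[OF p1, symmetric]) (simp only: mult.left_commute)
  finally show "fst_powr s z * (radial_average \<Psi> z)\<^sup>2 \<le> half_const * (\<integral>\<^sup>+r. w r * (fst_powr s z * p r z) \<partial>lborel)" .
 qed
 also have "... = half_const * (\<integral>\<^sup>+z. (\<integral>\<^sup>+r. w r * (fst_powr s z * p r z) \<partial>lborel) \<partial>frequencies)"
 proof (rule nn_integral_cmult)
  have "(\<lambda>(z, r). w r * (fst_powr s z * p r z)) \<in> borel_measurable (frequencies \<Otimes>\<^sub>M lborel)"
   using measurable_pair_swap[OF pm] by simp
  from lborel.borel_measurable_nn_integral_fst[OF this]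
  show "(\<lambda>z. \<integral>\<^sup>+r. w r * (fst_powr s z * p r z) \<partial>lborel) \<in> freq_measurable" by simp
 qed
 also have "(\<integral>\<^sup>+z. (\<integral>\<^sup>+r. w r * (fst_powr s z * p r z) \<partial>lborel) \<partial>frequencies)
  = (\<integral>\<^sup>+r. (\<integral>\<^sup>+z. w r * (fst_powr s z * p r z) \<partial>frequencies) \<partial>lborel)"
  using line_freq.Fubini'[OF pm] by simp
 also have "... \<le> (\<integral>\<^sup>+r. ennreal (r powr (-1/2)) * indicator {0..1} r * freq_weight s \<Psi> \<partial>lborel)"
  using AE_lborel_singleton[of "0::real"]
 proof (intro nn_integral_mono_AE, eventually_elim)
  case (elim r)
  have qm: "(\<lambda>z. fst_powr s z * p r z) \<in> freq_measurable"
  proof -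
   have [measurable]: "\<Psi> \<in> borel_measurable (lborel \<Otimes>\<^sub>M count_space UNIV)" using \<Psi> by (simp add: frequencies_def)
   show ?thesis unfolding p_def frequencies_def by measurable
  qed
  show ?case
  proof (cases "r \<in> {0..1}")
   case True
   then have r: "0 < r" "r \<le> 1" using elim by auto
   have "(\<integral>\<^sup>+z. fst_powr s z * p r z \<partial>frequencies) = ennreal (r powr (- 1 - s)) * freq_weight s \<Psi>"
   proof -
    have "(\<integral>\<^sup>+z. ennreal (r powr s) * (fst_powr s z * p r z) \<partial>frequencies) = ennreal (1 / r) * freq_weight s \<Psi>"
     using nn_integral_freq_scale[of "\<lambda>z. fst_powr s z * nsq (\<Psi> z)" r] r
     by (simp add: freq_weight_def p_def abs_mult powr_mult ennreal_mult mult.assoc)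
    then have "ennreal (r powr (- s)) * (ennreal (r powr s) * (\<integral>\<^sup>+z. fst_powr s z * p r z \<partial>frequencies))
     = ennreal (r powr (- s)) * (ennreal (1 / r) * freq_weight s \<Psi>)" by (simp add: nn_integral_cmult[OF qm])
    moreover have "r powr (- s) * r powr s = 1" using r by (simp add: powr_add[symmetric])
    moreover have "r powr (- s) * (1 / r) = r powr (- 1 - s)" using r by (simp add: powr_diff powr_minus field_simps)
    then have "ennreal (r powr (- s)) * ennreal (1 / r) = ennreal (r powr (- 1 - s))"
     using r by (subst ennreal_mult[symmetric]) auto
    ultimately show ?thesis by (simp add: mult.assoc[symmetric] ennreal_mult[symmetric])
   qed
   then have "(\<integral>\<^sup>+z. w r * (fst_powr s z * p r z) \<partial>frequencies) = ennreal (r powr (1/2) * r powr (- 1 - s)) * freq_weight s \<Psi>"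
    using True by (simp add: nn_integral_cmult[OF qm] w_def ennreal_mult mult.assoc)
   also have "r powr (1/2) * r powr (- 1 - s) = r powr (- 1/2 - s)" by (simp add: powr_add[symmetric])
   also have "ennreal (r powr (- 1/2 - s)) * freq_weight s \<Psi> \<le> ennreal (r powr (- 1/2)) * freq_weight s \<Psi>"
    using r s by (intro mult_right_mono ennreal_leI powr_mono') auto
   finally show ?thesis using True by simp
  qed (simp add: w_def)
 qed
 also have "... = half_const * freq_weight s \<Psi>" unfolding half_const_def by (rule nn_integral_multc) measurable
 finally show ?thesis by (simp add: power2_eq_square mult.assoc mult_left_mono)
qed

lemma exp_taylor_remainder:
 fixes u :: real
 assumes k: "1 \<le> k"
 shows "(LINT r|lborel. indicator {0..1} r *\<^sub>R (((1 - r) ^ (k - 1) / fact (k - 1)) *\<^sub>R ((- \<i> * of_real u) ^ k * exp (- \<i> * of_real u * of_real r))))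
  = cowave u - (\<Sum>l<k. (- \<i> * of_real u) ^ l / fact l)"
proof -
 define g where "g r = ((1 - r) ^ (k - 1) / fact (k - 1)) *\<^sub>R ((- \<i> * of_real u) ^ k * exp (- \<i> * of_real u * of_real r))" for r :: real
 define D where "D l r = (- \<i> * of_real u) ^ l * exp (- \<i> * of_real u * of_real r)" for l and r :: real
 have "((\<lambda>x. ((1 - x) ^ (k - 1) / fact (k - 1)) *\<^sub>R D k x) has_integral D 0 1 - (\<Sum>l<k. ((1 - 0) ^ l / fact l) *\<^sub>R D l 0)) {0..1}"
 proof (rule Taylor_has_integral[of k D "D 0" 0 1])
  show "0 < k" using k by simp
  show "D 0 = D 0" "(0::real) \<le> 1" by simp_all
  fix m and r :: real
  assume "m < k" "0 \<le> r" "r \<le> 1"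
  have "((\<lambda>x. (- \<i> * of_real u) ^ m * exp (- \<i> * of_real u * x)) has_field_derivative
    (- \<i> * of_real u) ^ m * (exp (- \<i> * of_real u * of_real r) * (- \<i> * of_real u))) (at (of_real r))"
   by (auto intro!: derivative_eq_intros)
  from has_vector_derivative_real_field[OF this, of "{0..1}"]
  show "(D m has_vector_derivative D (Suc m) r) (at r within {0..1})"
   unfolding D_def by (simp only: power_Suc mult_ac)
 qed
 moreover have "(\<lambda>x. ((1 - x) ^ (k - 1) / fact (k - 1)) *\<^sub>R D k x) = g"
  by (simp only: g_def D_def fun_eq_iff) simp
 ultimately have "(g has_integral D 0 1 - (\<Sum>l<k. ((1 - 0) ^ l / fact l) *\<^sub>R D l 0)) {0..1}" by simp
 moreover have "set_integrable lborel {0..1} g"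
  unfolding set_integrable_def g_def by (intro borel_integrable_compact) (auto intro!: continuous_intros)
 then have "(g has_integral (LINT r|lborel. indicator {0..1} r *\<^sub>R g r)) {0..1}"
  using has_integral_set_lebesgue set_borel_integral_eq_integral(2)[of "{0..1}" g] set_borel_integral_eq_integral(1)[of "{0..1}" g]
  by (simp add: set_lebesgue_integral_def integrable_integral)
 ultimately have "(LINT r|lborel. indicator {0..1} r *\<^sub>R g r) = D 0 1 - (\<Sum>l<k. ((1 - 0) ^ l / fact l) *\<^sub>R D l 0)"
  using has_integral_unique by blast
 then show ?thesis by (simp add: g_def D_def scaleR_conv_of_real)
qed

text \<open>The Taylor remainder of the exponential in integral form, integrated against \<open>s\<close>. Exchanging the
 integrals turns it into an average of the transform of \<open>x\<^sup>k s\<close> at the frequencies \<open>r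
 \<xi>\<close>.\<close>

lemma line_transform_taylor:
 fixes s :: "real \<Rightarrow> complex"
 assumes k: "1 \<le> k" and int: "\<And>l. l \<le> k \<Longrightarrow> integrable lborel (\<lambda>x. of_real (x ^ l) * s x)"
 shows "ennreal (cmod (line_transform s \<xi> - (\<Sum>l<k. (- \<i> * of_real \<xi>) ^ l / fact l * (LINT x|lborel. of_real (x ^ l) * s x))))
  \<le> ennreal (\<bar>\<xi>\<bar> ^ k) * (\<integral>\<^sup>+r. indicator {0..1} r * ennreal (cmod (line_transform (\<lambda>x. of_real (x ^ k) * s x) (r * \<xi>))) \<partial>lborel)"
proof -
 have s: "integrable lborel s" using int[of 0] by simp
 have [measurable]: "s \<in> borel_measurable borel" using s by auto
 define b :: "real \<Rightarrow> real" where "b r = indicator {0..1} r * ((1 - r) ^ (k - 1) / fact (k - 1))" for r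
 have [measurable]: "b \<in> borel_measurable borel" unfolding b_def by measurable
 define q where "q x r = (- \<i> * of_real \<xi>) ^ k * of_real (b r) * (of_real (x ^ k) * s x * cowave (x * (r * \<xi>)))" for x r
 have b_le: "\<bar>b r\<bar> \<le> indicator {0..1} r" for r
 proof (cases "r \<in> {0..1}")
  case True
  then have "(1 - r) ^ (k - 1) \<le> 1" by (intro power_le_one) auto
  moreover have "1 \<le> (fact (k - 1) :: real)" by (rule fact_ge_1)
  ultimately have "(1 - r) ^ (k - 1) \<le> fact (k - 1)" by (rule order_trans)
  then have "(1 - r) ^ (k - 1) / fact (k - 1) \<le> 1" by (subst divide_le_eq_1) (simp add: fact_gt_zero)
  then show ?thesis using True by (simp add: b_def)
 qed (simp add: b_def)
 have bi: "integrable lborel b"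
  by (rule Bochner_Integration.integrable_bound[of lborel "indicator {0..1} :: real \<Rightarrow> real"]) (use b_le in auto)
 have qi: "integrable (lborel \<Otimes>\<^sub>M lborel) (\<lambda>(x, r). q x r)"
 proof (rule lborel_pair.Fubini_integrable)
  show "(\<lambda>(x, r). q x r) \<in> borel_measurable (lborel \<Otimes>\<^sub>M lborel)" unfolding q_def by measurable
  have n: "norm (q x r) = (\<bar>\<xi>\<bar> ^ k * norm (of_real (x ^ k) * s x)) * \<bar>b r\<bar>" for x r
   by (simp add: q_def norm_mult norm_power)
  show "integrable lborel (\<lambda>x. LINT r|lborel. norm (case (x, r) of (x, r) \<Rightarrow> q x r))"
   using int[of k] by (simp only: prod.case n integral_mult_right_zero) (intro integrable_mult_left integrable_mult_right integrable_norm, simp)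
  have "integrable lborel (\<lambda>r. q x r)" for x
  proof (rule Bochner_Integration.integrable_bound[where f="\<lambda>r. (\<bar>\<xi>\<bar> ^ k * norm (of_real (x ^ k) * s x)) * b r"])
   show "integrable lborel (\<lambda>r. (\<bar>\<xi>\<bar> ^ k * norm (of_real (x ^ k) * s x)) * b r)" using bi by (rule integrable_mult_right)
   show "q x \<in> borel_measurable lborel" unfolding q_def by measurable
   show "AE r in lborel. norm (q x r) \<le> norm ((\<bar>\<xi>\<bar> ^ k * norm (of_real (x ^ k) * s x)) * b r)"
    unfolding n by (simp add: abs_mult)
  qed
  then show "AE x in lborel. integrable lborel (\<lambda>r. case (x, r) of (x, r) \<Rightarrow> q x r)" by simp
 qed
 have rem: "(LINT r|lborel. q x r) = s x * (cowave (x * \<xi>) - (\<Sum>l<k. (- \<i> * of_real (x * \<xi>)) ^ l / fact l))" for x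
 proof -
  have "q x r = s x * (indicator {0..1} r *\<^sub>R (((1 - r) ^ (k - 1) / fact (k - 1)) *\<^sub>R
   ((- \<i> * of_real (x * \<xi>)) ^ k * exp (- \<i> * of_real (x * \<xi>) * of_real r))))" for r
  proof -
   have "- \<i> * complex_of_real (x * \<xi>) = (- \<i> * of_real \<xi>) * of_real x" by simp
   then have p: "(- \<i> * complex_of_real (x * \<xi>)) ^ k = (- \<i> * of_real \<xi>) ^ k * of_real (x ^ k)"
    by (simp only: power_mult_distrib of_real_power)
   show ?thesis unfolding q_def b_def p by (simp add: scaleR_conv_of_real mult_ac)
  qed
  then show ?thesis unfolding exp_taylor_remainder[OF k, of "x * \<xi>", symmetric] by (simp only: integral_mult_right_zero)
 qed
 have inner: "(LINT x|lborel. q x r) = (- \<i> * of_real \<xi>) ^ k * of_real (b r) * line_transform (\<lambda>x. of_real (x ^ k) * s x) (r * \<xi>)" for r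
  unfolding q_def line_transform_def by (rule integral_mult_right_zero)
 have "line_transform s \<xi> - (\<Sum>l<k. (- \<i> * of_real \<xi>) ^ l / fact l * (LINT x|lborel. of_real (x ^ l) * s x))
  = (LINT x|lborel. s x * cowave (x * \<xi>) - (\<Sum>l<k. (- \<i> * of_real \<xi>) ^ l / fact l * (of_real (x ^ l) * s x)))"
 proof -
  have i: "integrable lborel (\<lambda>x. (- \<i> * of_real \<xi>) ^ l / fact l * (of_real (x ^ l) * s x))" if "l \<in> {..<k}" for l
   using that by (intro integrable_mult_right int) simp
  have "(LINT x|lborel. (\<Sum>l<k. (- \<i> * of_real \<xi>) ^ l / fact l * (of_real (x ^ l) * s x)))
   = (\<Sum>l<k. (- \<i> * of_real \<xi>) ^ l / fact l * (LINT x|lborel. of_real (x ^ l) * s x))"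
   using i by (subst Bochner_Integration.integral_sum) (auto intro!: sum.cong)
  moreover have "(LINT x|lborel. s x * cowave (x * \<xi>) - (\<Sum>l<k. (- \<i> * of_real \<xi>) ^ l / fact l * (of_real (x ^ l) * s x)))
   = line_transform s \<xi> - (LINT x|lborel. (\<Sum>l<k. (- \<i> * of_real \<xi>) ^ l / fact l * (of_real (x ^ l) * s x)))"
   unfolding line_transform_def
   by (rule Bochner_Integration.integral_diff[OF line_transform_integrable[OF s] Bochner_Integration.integrable_sum[OF i]])
  ultimately show ?thesis by (simp only:)
 qed
 also have "... = (LINT x|lborel. LINT r|lborel. q x r)"
 proof (rule Bochner_Integration.integral_cong[OF refl])
  fix x
  have "(\<Sum>l<k. (- \<i> * of_real \<xi>) ^ l / fact l * (of_real (x ^ l) * s x)) = s x * (\<Sum>l<k. (- \<i> * of_real (x * \<xi>)) ^ l / fact l)"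
   unfolding sum_distrib_left
  proof (intro sum.cong refl)
   fix l
   have "- \<i> * complex_of_real (x * \<xi>) = (- \<i> * of_real \<xi>) * of_real x" by simp
   then have p: "(- \<i> * complex_of_real (x * \<xi>)) ^ l = (- \<i> * of_real \<xi>) ^ l * of_real (x ^ l)"
    by (simp only: power_mult_distrib of_real_power)
   show "(- \<i> * of_real \<xi>) ^ l / fact l * (of_real (x ^ l) * s x) = s x * ((- \<i> * of_real (x * \<xi>)) ^ l / fact l)"
    unfolding p by (simp add: mult_ac)
  qed
  then show "s x * cowave (x * \<xi>) - (\<Sum>l<k. (- \<i> * of_real \<xi>) ^ l / fact l * (of_real (x ^ l) * s x)) = (LINT r|lborel. q x r)"
   unfolding rem by (simp only: right_diff_distrib)
 qed
 also have "... = (LINT r|lborel. LINT x|lborel. q x r)" by (rule lborel_pair.Fubini_integral[symmetric, OF qi])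
 finally have eq: "line_transform s \<xi> - (\<Sum>l<k. (- \<i> * of_real \<xi>) ^ l / fact l * (LINT x|lborel. of_real (x ^ l) * s x))
  = (LINT r|lborel. LINT x|lborel. q x r)" .
 have m: "(\<lambda>r. indicator {0..1} r * ennreal (cmod (line_transform (\<lambda>x. of_real (x ^ k) * s x) (r * \<xi>)))) \<in> borel_measurable lborel"
  by measurable
 have "ennreal (cmod (LINT r|lborel. LINT x|lborel. q x r)) \<le> (\<integral>\<^sup>+r. ennreal (norm (LINT x|lborel. q x r)) \<partial>lborel)"
  by (rule integral_norm_bound_ennreal[OF lborel_pair.integrable_snd[OF qi]])
 also have "... \<le> (\<integral>\<^sup>+r. ennreal (\<bar>\<xi>\<bar> ^ k) * (indicator {0..1} r * ennreal (cmod (line_transform (\<lambda>x. of_real (x ^ k) * s x) (r * \<xi>)))) \<partial>lborel)"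
 proof (rule nn_integral_mono)
  fix r :: real
  let ?L = "cmod (line_transform (\<lambda>x. of_real (x ^ k) * s x) (r * \<xi>))"
  have "norm (LINT x|lborel. q x r) = \<bar>\<xi>\<bar> ^ k * (\<bar>b r\<bar> * ?L)"
   unfolding inner by (simp add: norm_mult norm_power mult.assoc)
  also have "... \<le> \<bar>\<xi>\<bar> ^ k * (indicator {0..1} r * ?L)"
   by (intro mult_left_mono mult_right_mono b_le) auto
  finally have "ennreal (norm (LINT x|lborel. q x r)) \<le> ennreal (\<bar>\<xi>\<bar> ^ k * (indicator {0..1} r * ?L))" by (rule ennreal_leI)
  also have "... = ennreal (\<bar>\<xi>\<bar> ^ k) * (indicator {0..1} r * ennreal ?L)"
   by (subst ennreal_mult) (auto simp: indicator_def)
  finally show "ennreal (norm (LINT x|lborel. q x r)) \<le> ennreal (\<bar>\<xi>\<bar> ^ k) * (indicator {0..1} r * ennreal ?L)" .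
 qed
 also have "... = ennreal (\<bar>\<xi>\<bar> ^ k) * (\<integral>\<^sup>+r. indicator {0..1} r * ennreal (cmod (line_transform (\<lambda>x. of_real (x ^ k) * s x) (r * \<xi>))) \<partial>lborel)"
  by (rule nn_integral_cmult[OF m])
 finally show ?thesis unfolding eq .
qed

lemma fourier_integral_taylor:
 assumes k: "1 \<le> k" and int: "\<And>l. l \<le> k \<Longrightarrow> integrable cylinder (\<lambda>z. of_real (fst z ^ l) * g z)"
 shows "ennreal (cmod (fourier_integral g q - (\<Sum>l<k. (- \<i> * of_real (fst q)) ^ l / fact l * moment g l (snd q))))
  \<le> ennreal (\<bar>fst q\<bar> ^ k) * radial_average (fourier_integral (x_power k g)) q"
proof -
 have int0: "integrable cylinder g" using int[of 0] by simp
 have pow: "integrable cylinder (x_power k g)" using int[of k] by (simp add: x_power_def case_prod_unfold)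
 have sl: "slice (x_power k g) \<eta> = (\<lambda>x. of_real (x ^ k) * slice g \<eta> x)" for \<eta>
  unfolding slice_def circle_coeff_def x_power_def by (simp add: mult.assoc)
 have F: "fourier_integral g q = line_transform (slice g (snd q)) (fst q)"
  using fourier_integral_slice[OF int0, of "fst q" "snd q"] by simp
 have mom: "(\<Sum>l<k. (- \<i> * of_real (fst q)) ^ l / fact l * moment g l (snd q))
  = (\<Sum>l<k. (- \<i> * of_real (fst q)) ^ l / fact l * (LINT x|lborel. of_real (x ^ l) * slice g (snd q) x))"
  using slice_power(2)[OF int] by (intro sum.cong refl) auto
 show ?thesis unfolding F mom radial_average_def fourier_integral_slice[OF pow] sl
  by (rule line_transform_taylor[OF k slice_power(1)[OF int]])
qed

lemma x_power_L2:
 assumes f: "f \<in> borel_measurable cylinder" and w: "weighted \<theta> f \<in> L2 cylinder" and l: "real l \<le> \<theta>"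
 shows "x_power l f \<in> L2 cylinder"
proof -
 have eq: "x_power l f = (\<lambda>z. of_real (fst z ^ l) * f z)" by (simp add: x_power_def case_prod_unfold)
 have [measurable]: "fst \<in> borel_measurable cylinder" unfolding cylinder_eq by measurable
 have m: "x_power l f \<in> borel_measurable cylinder" unfolding eq using f by measurable
 have "energy cylinder (x_power l f) \<le> energy cylinder (weighted \<theta> f)"
 proof (rule energy_mono)
  fix z :: "real \<times> real"
  have "\<bar>fst z\<bar> ^ l \<le> japanese (fst z) ^ l" using japanese_ge(2)[of "fst z"] by (intro power_mono) auto
  also have "... = japanese (fst z) powr real l" using japanese_ge(1)[of "fst z"] by (simp add: powr_realpow)
  also have "... \<le> japanese (fst z) powr \<theta>" using japanese_ge(1)[of "fst z"] l by (intro powr_mono) auto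
  finally show "cmod (x_power l f z) \<le> cmod (weighted \<theta> f z)"
   unfolding eq weighted_eq by (simp add: norm_mult norm_power mult_right_mono)
 qed
 then show ?thesis using m w unfolding L2_iff_energy by (auto intro: le_less_trans)
qed

lemma x_power_x_trunc: "x_power l (x_trunc n f) = x_trunc n (x_power l f)" by (auto simp: x_power_def x_trunc_def)

lemma moment_x_trunc_tendsto:
 assumes f: "f \<in> L2 cylinder" and int: "integrable cylinder (\<lambda>z. of_real (fst z ^ l) * f z)"
  and int': "\<And>n. integrable cylinder (\<lambda>z. of_real (fst z ^ l) * x_trunc n f z)"
 shows "(\<lambda>n. moment (x_trunc n f) l \<eta>) \<longlonglongrightarrow> moment f l \<eta>"
proof -
 have eq: "moment (x_trunc n f) l \<eta> = (LINT x|lborel. (if \<bar>x\<bar> \<le> real n then of_real (x ^ l) * slice f \<eta> x else 0))" for n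
  unfolding slice_power(2)[OF int'] slice_x_trunc by (intro Bochner_Integration.integral_cong refl) auto
 show ?thesis unfolding eq slice_power(2)[OF int] by (rule truncated_integral_tendsto[OF slice_power(1)[OF int]])
qed

lemma freq_weight_eq_energy:
 "freq_weight (- 2 * \<theta>) G = energy frequencies (\<lambda>z. of_real (\<bar>fst z\<bar> powr (- \<theta>)) * G z)"
 unfolding freq_weight_def energy_def
proof (rule nn_integral_cong)
 fix z :: "real \<times> int"
 have "(\<bar>fst z\<bar> powr (- \<theta>))\<^sup>2 = \<bar>fst z\<bar> powr (- 2 * \<theta>)" by (simp add: power2_eq_square powr_add[symmetric])
 then show "fst_powr (- 2 * \<theta>) z * nsq (G z) = nsq (of_real (\<bar>fst z\<bar> powr (- \<theta>)) * G z)"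
  by (subst ennreal_mult[symmetric]) (auto simp: norm_mult power_mult_distrib)
qed

lemma radial_average_triangle:
 assumes a: "a \<in> freq_measurable" and b: "b \<in> freq_measurable"
 shows "radial_average a z \<le> radial_average b z + radial_average (\<lambda>z. a z - b z) z"
proof -
 note [measurable] = radial_slice_measurable[OF a] radial_slice_measurable[OF b]
 have "radial_average b z + radial_average (\<lambda>z. a z - b z) z =
  (\<integral>\<^sup>+r. indicator {0..1} r * ennreal (cmod (b (r * fst z, snd z)))
   + indicator {0..1} r * ennreal (cmod (a (r * fst z, snd z) - b (r * fst z, snd z))) \<partial>lborel)"
  unfolding radial_average_def by (rule nn_integral_add[symmetric]) measurable
 moreover have "radial_average a z \<le> ..." unfolding radial_average_def
 proof (rule nn_integral_mono)
  fix r :: real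
  have "cmod (a (r * fst z, snd z)) \<le> cmod (b (r * fst z, snd z)) + cmod (a (r * fst z, snd z) - b (r * fst z, snd z))"
   by (metis add_diff_cancel_left' diff_add_cancel norm_triangle_ineq add.commute)
  then have "ennreal (cmod (a (r * fst z, snd z))) \<le> ennreal (cmod (b (r * fst z, snd z))) + ennreal (cmod (a (r * fst z, snd z) - b (r * fst z, snd z)))"
   by (simp add: ennreal_plus[symmetric] ennreal_leI del: ennreal_plus)
  then show "indicator {0..1} r * ennreal (cmod (a (r * fst z, snd z)))
   \<le> indicator {0..1} r * ennreal (cmod (b (r * fst z, snd z)))
   + indicator {0..1} r * ennreal (cmod (a (r * fst z, snd z) - b (r * fst z, snd z)))"
   unfolding distrib_left[symmetric] by (rule mult_left_mono) simp
 qed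
 ultimately show ?thesis by simp
qed

lemma ennreal_square_add_le: "(a + b)\<^sup>2 \<le> 2 * (a\<^sup>2 + b\<^sup>2)" for a b :: ennreal
proof (cases "a = top \<or> b = top")
 case True then show ?thesis by (auto simp: ennreal_mult_eq_top_iff power2_eq_square)
next
 case False
 then obtain x y where xy: "a = ennreal x" "b = ennreal y" "0 \<le> x" "0 \<le> y" by (metis ennreal_cases)
 have "(x + y)\<^sup>2 \<le> 2 * (x\<^sup>2 + y\<^sup>2)" using sum_squares_bound[of x y] by (simp add: power2_sum)
 then have "ennreal ((x + y)\<^sup>2) \<le> ennreal (2 * (x\<^sup>2 + y\<^sup>2))" by (rule ennreal_leI)
 also have "... = 2 * (a\<^sup>2 + b\<^sup>2)" using xy by (simp add: ennreal_mult ennreal_power[symmetric])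
 also have "ennreal ((x + y)\<^sup>2) = (a + b)\<^sup>2" using xy by (simp add: ennreal_power[symmetric])
 finally show ?thesis .
qed

text \<open>For \<open>\<theta> = k + 1/2\<close> the function \<open>x\<^sup>k f\<close> is square integrable but need not be
 integrable, so the remainder estimate is applied to truncations. The errors tend to \<open>0\<close> only in the
 unweighted norm; therefore small frequencies are cut off first, and the cutoff is removed after the truncation.\<close>

theorem endpoint_taylor:
 assumes k: "1 \<le> k" and f: "f \<in> L2 cylinder" and w: "weighted (real k + 1/2) f \<in> L2 cylinder"
 shows "freq_weight (- 2 * (real k + 1/2)) (\<lambda>q. fourier f q - (\<Sum>l<k. (- \<i> * of_real (fst q)) ^ l / fact l * moment f l (snd q)))
  \<le> 2 * half_const\<^sup>2 * freq_weight (- 1) (fourier (x_power k f))"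
proof -
 have fm: "f \<in> borel_measurable cylinder" by (rule L2_measurable[OF f])
 have fn: "x_trunc n f \<in> L2 cylinder" for n by (rule x_trunc_L2(1)[OF f])
 have pow: "x_power l f \<in> L2 cylinder" if "l \<le> k" for l using that by (intro x_power_L2[OF fm w]) auto
 have int_n: "integrable cylinder (\<lambda>z. of_real (fst z ^ l) * x_trunc n f z)" if "l \<le> k" for l n
  using x_trunc_integrable[OF pow[OF that], of n] unfolding x_power_x_trunc[symmetric]
  by (simp add: x_power_def case_prod_unfold)
 have int: "integrable cylinder (\<lambda>z. of_real (fst z ^ l) * f z)" if "l < k" for l
  using that by (intro weighted_power_integrable[OF w]) auto
 have int0: "integrable cylinder f" using int[of 0] k by simp
 define R where "R n q = fourier_integral (x_trunc n f) q - (\<Sum>l<k. (- \<i> * of_real (fst q)) ^ l / fact l * moment (x_trunc n f) l (snd q))" for n q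
 define R0 where "R0 q = fourier f q - (\<Sum>l<k. (- \<i> * of_real (fst q)) ^ l / fact l * moment f l (snd q))" for q
 define \<Phi> where "\<Phi> = fourier (x_power k f)"
 define \<Psi> where "\<Psi> n = fourier_integral (x_trunc n (x_power k f))" for n
 let ?D = "\<lambda>n q. \<Psi> n q - \<Phi> q"
 have \<Phi>m: "\<Phi> \<in> freq_measurable" unfolding \<Phi>_def by (intro L2_measurable fourier_L2 pow) simp
 have \<Psi>m: "\<Psi> n \<in> freq_measurable" for n
  unfolding \<Psi>_def by (intro L2_measurable fourier_integral_x_trunc_L2 pow) simp
 have dm: "(?D n) \<in> freq_measurable" for n using \<Psi>m \<Phi>m by (rule borel_measurable_diff)
 have snd_m: "(\<lambda>q. \<phi> (snd q)) \<in> freq_measurable" for \<phi> :: "int \<Rightarrow> complex"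
  unfolding frequencies_def by (rule measurable_compose[OF measurable_snd]) simp
 have Rm: "R n \<in> freq_measurable" for n
 proof -
  have [measurable]: "fourier_integral (x_trunc n f) \<in> freq_measurable"
   by (intro fourier_integral_measurable L2_measurable fn)
  note [measurable] = snd_m
  show ?thesis unfolding R_def[abs_def] by measurable
 qed
 have Rlim: "AE q in frequencies. (\<lambda>n. R n q) \<longlonglongrightarrow> R0 q" using fourier_eq_line_transform[OF f int0]
 proof eventually_elim
  case (elim q)
  have "(\<lambda>n. fourier_integral (x_trunc n f) q) \<longlonglongrightarrow> fourier f q"
   using fourier_integral_x_trunc_tendsto[OF f int0, of "fst q" "snd q"] by (simp add: elim)
  moreover have "(\<lambda>n. moment (x_trunc n f) l (snd q)) \<longlonglongrightarrow> moment f l (snd q)" if "l \<in> {..<k}" for l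
   using that by (intro moment_x_trunc_tendsto[OF f int int_n]) auto
  ultimately show ?case unfolding R_def R0_def by (intro tendsto_diff tendsto_sum tendsto_mult tendsto_const)
 qed
 define H where "H j n q = of_real (indicator {1 / real (Suc j)..} \<bar>fst q\<bar> * \<bar>fst q\<bar> powr (- (real k + 1/2))) * R n q" for j n q
 define H0 where "H0 j q = of_real (indicator {1 / real (Suc j)..} \<bar>fst q\<bar> * \<bar>fst q\<bar> powr (- (real k + 1/2))) * R0 q" for j q
 define B where "B = 2 * half_const\<^sup>2 * freq_weight (- 1) \<Phi>"
 define e where "e n = energy frequencies (?D n)" for n
 have e0: "e \<longlonglongrightarrow> 0"
  using fourier_L2_tendsto[OF pow[of k]] unfolding L2_tendsto_def' e_def \<Phi>_def \<Psi>_def by simp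
 have Hm: "H j n \<in> freq_measurable" for j n
 proof -
  note [measurable] = Rm
  show ?thesis unfolding H_def[abs_def] by measurable
 qed
 (* Where the modulus of the frequency is at least 1 / (j + 1), the weight is bounded, 
    so that the truncation error only enters through its unweighted energy e n. *)
 have Hle: "energy frequencies (H j n) \<le> B + ennreal (2 * real (Suc j)) * half_const\<^sup>2 * e n" for j n
 proof -
  note [measurable] = radial_average_measurable[OF \<Phi>m] radial_average_measurable[OF dm]
  let ?a = "\<lambda>q. fst_powr (- 1) q * (radial_average \<Phi> q)\<^sup>2"
  let ?b = "\<lambda>q. fst_powr 0 q * (radial_average (?D n) q)\<^sup>2"
  have "energy frequencies (H j n) \<le> (\<integral>\<^sup>+q. 2 * ?a q + ennreal (2 * real (Suc j)) * ?b q \<partial>frequencies)"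
   unfolding energy_def using AE_frequencies_nonzero
  proof (intro nn_integral_mono_AE, eventually_elim)
   case (elim q)
   show ?case
   proof (cases "\<bar>fst q\<bar> \<in> {1 / real (Suc j)..}")
    case True
    define x where "x = \<bar>fst q\<bar>"
    have x: "0 < x" "1 / real (Suc j) \<le> x" using elim True by (auto simp: x_def)
    have xj: "x powr (- 1) \<le> real (Suc j)" using x by (simp add: powr_minus field_simps)
    have "ennreal (cmod (R n q)) \<le> ennreal (x ^ k) * radial_average (\<Psi> n) q"
     unfolding R_def \<Psi>_def x_power_x_trunc[symmetric] x_def by (rule fourier_integral_taylor[OF k int_n])
    also have "... \<le> ennreal (x ^ k) * (radial_average \<Phi> q + radial_average (?D n) q)"
     by (intro mult_left_mono radial_average_triangle \<Psi>m \<Phi>m) simp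
    finally have "(ennreal (x powr (- (real k + 1/2))) * ennreal (cmod (R n q)))\<^sup>2 \<le>
     (ennreal (x powr (- (real k + 1/2))) * (ennreal (x ^ k) * (radial_average \<Phi> q + radial_average (?D n) q)))\<^sup>2"
     by (intro power_mono mult_left_mono) auto
    also have "... = ennreal (x powr (- 1)) * (radial_average \<Phi> q + radial_average (?D n) q)\<^sup>2"
    proof -
     have "x powr (- (real k + 1/2)) * x ^ k = x powr (- (1/2))"
      using x by (simp add: powr_realpow[symmetric] powr_add[symmetric])
     then have "ennreal (x powr (- (real k + 1/2))) * ennreal (x ^ k) = ennreal (x powr (- (1/2)))"
      using x by (subst ennreal_mult[symmetric]) auto
     moreover have "(ennreal (x powr (- (1/2))))\<^sup>2 = ennreal (x powr (- 1))"
      by (subst ennreal_power) (simp_all add: power2_eq_square powr_add[symmetric])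
     ultimately show ?thesis by (simp add: mult.assoc[symmetric] power_mult_distrib)
    qed
    also have "... \<le> ennreal (x powr (- 1)) * (2 * ((radial_average \<Phi> q)\<^sup>2 + (radial_average (?D n) q)\<^sup>2))"
     by (intro mult_left_mono ennreal_square_add_le) simp
    also have "... = 2 * (ennreal (x powr (- 1)) * (radial_average \<Phi> q)\<^sup>2) + 2 * ennreal (x powr (- 1)) * (radial_average (?D n) q)\<^sup>2"
     by (simp add: distrib_left mult_ac)
    also have "... \<le> 2 * (ennreal (x powr (- 1)) * (radial_average \<Phi> q)\<^sup>2) + ennreal (2 * real (Suc j)) * (radial_average (?D n) q)\<^sup>2"
    proof -
     have "2 * ennreal (x powr (- 1)) = ennreal (2 * x powr (- 1))" using ennreal_mult[of 2 "x powr (- 1)"] by simp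
     also have "... \<le> ennreal (2 * real (Suc j))" by (rule ennreal_leI, rule mult_left_mono[OF xj]) simp
     finally show ?thesis by (intro add_left_mono mult_right_mono) auto
    qed
    finally have main: "(ennreal (x powr (- (real k + 1/2))) * ennreal (cmod (R n q)))\<^sup>2
     \<le> 2 * (ennreal (x powr (- 1)) * (radial_average \<Phi> q)\<^sup>2) + ennreal (2 * real (Suc j)) * (radial_average (?D n) q)\<^sup>2" .
    have "cmod (H j n q) = x powr (- (real k + 1/2)) * cmod (R n q)"
     using True unfolding H_def norm_mult norm_of_real x_def by simp
    then have "nsq (H j n q) = (ennreal (x powr (- (real k + 1/2))) * ennreal (cmod (R n q)))\<^sup>2"
     by (simp add: ennreal_mult[symmetric] ennreal_power)
    then show ?thesis using main elim unfolding x_def[symmetric] by (simp add: x_def)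
   qed (simp add: H_def)
  qed
  also have "... = 2 * (\<integral>\<^sup>+q. ?a q \<partial>frequencies) + ennreal (2 * real (Suc j)) * (\<integral>\<^sup>+q. ?b q \<partial>frequencies)"
   by (subst nn_integral_add) (auto simp del: powr_zero_eq_one simp: nn_integral_cmult)
  also have "... \<le> 2 * (half_const\<^sup>2 * freq_weight (- 1) \<Phi>) + ennreal (2 * real (Suc j)) * (half_const\<^sup>2 * freq_weight 0 (?D n))"
   by (intro add_mono mult_left_mono radial_average_bound \<Phi>m dm) auto
  also have "freq_weight 0 (?D n) = e n" unfolding freq_weight_def e_def energy_def using AE_frequencies_nonzero
   by (intro nn_integral_cong_AE, eventually_elim) simp
  finally show ?thesis by (simp add: B_def mult.assoc)
 qed
 have H0le: "energy frequencies (H0 j) \<le> B" for j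
 proof -
  have "energy frequencies (H0 j) \<le> liminf (\<lambda>n. energy frequencies (H j n))"
  proof (rule energy_fatou[OF Hm])
   show "AE z in frequencies. (\<lambda>n. H j n z) \<longlonglongrightarrow> H0 j z"
    using Rlim unfolding H_def H0_def by eventually_elim (intro tendsto_mult tendsto_const)
  qed
  also have "... \<le> liminf (\<lambda>n. B + ennreal (2 * real (Suc j)) * half_const\<^sup>2 * e n)"
   by (intro Liminf_mono always_eventually allI Hle)
  also have "... = B"
  proof (rule lim_imp_Liminf)
   have "ennreal (2 * real (Suc j)) * half_const\<^sup>2 < top"
    using half_const_finite by (simp add: ennreal_mult_less_top power2_eq_square)
   then have "(\<lambda>n. ennreal (2 * real (Suc j)) * half_const\<^sup>2 * e n) \<longlonglongrightarrow> ennreal (2 * real (Suc j)) * half_const\<^sup>2 * 0"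
    by (intro ennreal_tendsto_cmult e0)
   from tendsto_add[OF tendsto_const this, of B]
   show "(\<lambda>n. B + ennreal (2 * real (Suc j)) * half_const\<^sup>2 * e n) \<longlonglongrightarrow> B" by simp
  qed simp
  finally show ?thesis .
 qed
 have R0m: "R0 \<in> freq_measurable"
 proof -
  have [measurable]: "fourier f \<in> freq_measurable" by (intro L2_measurable fourier_L2 f)
  note [measurable] = snd_m
  show ?thesis unfolding R0_def[abs_def] by measurable
 qed
 have "energy frequencies (\<lambda>q. of_real (\<bar>fst q\<bar> powr (- (real k + 1/2))) * R0 q) \<le> B"
 proof (rule energy_limit_bound[where F=H0])
  show "H0 j \<in> freq_measurable" for j
  proof -
   note [measurable] = R0m
   show ?thesis unfolding H0_def[abs_def] by measurable
  qed
  show "AE q in frequencies. (\<lambda>j. H0 j q) \<longlonglongrightarrow> of_real (\<bar>fst q\<bar> powr (- (real k + 1/2))) * R0 q"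
   using AE_frequencies_nonzero
  proof eventually_elim
   case (elim q)
   then obtain N where N: "inverse (real (Suc N)) < \<bar>fst q\<bar>" using reals_Archimedean[of "\<bar>fst q\<bar>"] by auto
   show ?case
   proof (rule tendsto_eventually, rule eventually_sequentiallyI[of N])
    fix j assume j: "N \<le> j"
    have "1 / real (Suc j) \<le> 1 / real (Suc N)" using j by (intro divide_left_mono) auto
    then have "1 / real (Suc j) \<le> \<bar>fst q\<bar>" using N by (simp add: inverse_eq_divide)
    then show "H0 j q = of_real (\<bar>fst q\<bar> powr (- (real k + 1/2))) * R0 q" by (simp add: H0_def)
   qed
  qed
  show "\<forall>\<^sub>F j in sequentially. energy frequencies (H0 j) \<le> B" using H0le by simp
 qed
 then show ?thesis unfolding freq_weight_eq_energy B_def \<Phi>_def R0_def .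
qed

section \<open>From frequency estimates to weighted norms\<close>

lemma fst_cylinder_measurable [measurable]: "fst \<in> borel_measurable cylinder" unfolding cylinder_eq by measurable

lemma weighted_measurable:
 "f \<in> borel_measurable cylinder \<Longrightarrow> weighted \<theta> f \<in> borel_measurable cylinder"
 unfolding weighted_eq[abs_def] by measurable

lemma japanese_powr_le:
 assumes "0 \<le> \<theta>"
 shows "japanese x powr (2 * \<theta>) \<le> 2 powr \<theta> * (1 + \<bar>x\<bar> powr (2 * \<theta>))"
proof -
 have j: "japanese x powr (2 * \<theta>) = (1 + \<bar>x\<bar>\<^sup>2) powr \<theta>"
 proof -
  have "japanese x powr (2 * \<theta>) = (japanese x powr 2) powr \<theta>" by (simp add: powr_powr)
  also have "japanese x powr 2 = (japanese x)\<^sup>2" using japanese_ge(1)[of x] by simp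
  also have "... = 1 + \<bar>x\<bar>\<^sup>2" by (simp add: japanese_def)
  finally show ?thesis .
 qed
 have "1 + \<bar>x\<bar>\<^sup>2 \<le> 2 * max 1 (\<bar>x\<bar>\<^sup>2)" by auto
 then have "(1 + \<bar>x\<bar>\<^sup>2) powr \<theta> \<le> (2 * max 1 (\<bar>x\<bar>\<^sup>2)) powr \<theta>" using assms by (intro powr_mono2) auto
 also have "... = 2 powr \<theta> * (max 1 (\<bar>x\<bar>\<^sup>2)) powr \<theta>" by (rule powr_mult)
 also have "(max 1 (\<bar>x\<bar>\<^sup>2)) powr \<theta> \<le> 1 + \<bar>x\<bar> powr (2 * \<theta>)"
 proof (cases "\<bar>x\<bar>\<^sup>2 \<le> 1")
  case False
  then have "\<bar>x\<bar> \<noteq> 0" by auto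
  then have "\<bar>x\<bar>\<^sup>2 = \<bar>x\<bar> powr 2" by simp
  then have "(\<bar>x\<bar>\<^sup>2) powr \<theta> = \<bar>x\<bar> powr (2 * \<theta>)" by (simp only: powr_powr)
  then show ?thesis using False by (simp add: max_def)
 qed (simp add: max_def)
 finally show ?thesis unfolding j by simp
qed

lemma energy_weighted:
 "energy cylinder (weighted \<theta> f) = (\<integral>\<^sup>+z. ennreal (japanese (fst z) powr (2 * \<theta>)) * nsq (f z) \<partial>cylinder)"
 unfolding energy_def
proof (rule nn_integral_cong)
 fix z :: "real \<times> real"
 have "(japanese (fst z) powr \<theta>)\<^sup>2 = japanese (fst z) powr (2 * \<theta>)" by (simp add: power2_eq_square powr_add[symmetric])
 then show "nsq (weighted \<theta> f z) = ennreal (japanese (fst z) powr (2 * \<theta>)) * nsq (f z)"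
  by (subst ennreal_mult[symmetric]) (auto simp: weighted_eq norm_mult power_mult_distrib)
qed

lemma energy_weighted_le:
 assumes f[measurable]: "f \<in> borel_measurable cylinder" and \<theta>: "0 \<le> \<theta>"
 shows "energy cylinder (weighted \<theta> f) \<le> ennreal (2 powr \<theta>) * (energy cylinder f + x_energy \<theta> f)"
proof -
 have "energy cylinder (weighted \<theta> f) \<le> (\<integral>\<^sup>+z. ennreal (2 powr \<theta>) * (nsq (f z) + fst_powr (2 * \<theta>) z * nsq (f z)) \<partial>cylinder)"
  unfolding energy_weighted
 proof (rule nn_integral_mono)
  fix z :: "real \<times> real"
  have "ennreal (japanese (fst z) powr (2 * \<theta>)) \<le> ennreal (2 powr \<theta> * (1 + \<bar>fst z\<bar> powr (2 * \<theta>)))"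
   by (intro ennreal_leI japanese_powr_le \<theta>)
  also have "... = ennreal (2 powr \<theta>) * (1 + fst_powr (2 * \<theta>) z)" by (subst ennreal_mult) auto
  finally have "ennreal (japanese (fst z) powr (2 * \<theta>)) * nsq (f z) \<le>
   ennreal (2 powr \<theta>) * (1 + fst_powr (2 * \<theta>) z) * nsq (f z)" by (rule mult_right_mono) simp
  then show "ennreal (japanese (fst z) powr (2 * \<theta>)) * nsq (f z) \<le>
   ennreal (2 powr \<theta>) * (nsq (f z) + fst_powr (2 * \<theta>) z * nsq (f z))"
   by (simp add: distrib_left distrib_right mult.assoc)
 qed
 also have "... = ennreal (2 powr \<theta>) * (energy cylinder f + x_energy \<theta> f)"
  unfolding energy_def x_energy_def by (subst nn_integral_cmult) (auto intro!: arg_cong2[where f="(*)"] nn_integral_add)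
 finally show ?thesis .
qed

lemma energy_weighted_mono:
 assumes "\<alpha> \<le> \<beta>"
 shows "energy cylinder (weighted \<alpha> f) \<le> energy cylinder (weighted \<beta> f)" unfolding energy_weighted
 using japanese_ge(1) assms by (intro nn_integral_mono mult_right_mono ennreal_leI powr_mono) auto

lemma x_energy_le_weighted:
 assumes "0 \<le> \<theta>"
 shows "x_energy \<theta> f \<le> energy cylinder (weighted \<theta> f)" unfolding energy_weighted x_energy_def
 using japanese_ge(2) assms by (intro nn_integral_mono mult_right_mono ennreal_leI powr_mono2) auto

lemma weighted_0: "weighted 0 f = f" using japanese_ge(1) by (auto simp: weighted_eq fun_eq_iff) (metis not_one_le_zero)

lemma energy_le_weighted: "0 \<le> \<theta> \<Longrightarrow> energy cylinder f \<le> energy cylinder (weighted \<theta> f)"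
 using energy_weighted_mono[of 0 \<theta> f] by (simp add: weighted_0)

lemma weighted_L2:
 assumes f: "f \<in> L2 cylinder" and w: "f \<in> L2_weight \<theta>" and \<theta>: "0 \<le> \<theta>"
 shows "weighted \<theta> f \<in> L2 cylinder"
proof -
 have [measurable]: "f \<in> borel_measurable cylinder" by (rule L2_measurable[OF f])
 have "x_energy \<theta> f = energy (density cylinder (\<lambda>(x, y). ennreal (\<bar>x\<bar> powr (2 * \<theta>)))) f"
  unfolding x_energy_def energy_def by (subst nn_integral_density) (auto simp: case_prod_unfold)
 then have "x_energy \<theta> f < \<infinity>" using w unfolding L2_weight_def L2_iff_energy by simp
 moreover have "energy cylinder f < \<infinity>" using f unfolding L2_iff_energy by simp
 ultimately have "ennreal (2 powr \<theta>) * (energy cylinder f + x_energy \<theta> f) < \<infinity>"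
  by (simp add: ennreal_mult_less_top)
 then show ?thesis using energy_weighted_le[OF L2_measurable[OF f] \<theta>] weighted_measurable[OF L2_measurable[OF f]]
  unfolding L2_iff_energy by (auto intro: le_less_trans)
qed

lemma x_energy_x_power: "x_energy (1/2) (x_power k f) = x_energy (real k + 1/2) f" unfolding x_energy_def
proof (rule nn_integral_cong)
 fix z :: "real \<times> real"
 have "\<bar>fst z\<bar> powr (2 * (1/2)) * (\<bar>fst z\<bar> ^ k)\<^sup>2 = \<bar>fst z\<bar> powr (2 * (real k + 1/2))"
 proof (cases "fst z = 0")
  case False
  then have "(\<bar>fst z\<bar> ^ k)\<^sup>2 = \<bar>fst z\<bar> powr (2 * real k)"
   by (simp add: power2_eq_square powr_realpow[symmetric] powr_add[symmetric])
  then show ?thesis by (simp only: powr_add[symmetric]) (simp add: algebra_simps)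
 qed simp
 then have "fst_powr (2 * (real k + 1/2)) z = fst_powr (2 * (1/2)) z * ennreal ((\<bar>fst z\<bar> ^ k)\<^sup>2)"
  by (subst ennreal_mult[symmetric]) auto
 moreover have "nsq (x_power k f z) = ennreal ((\<bar>fst z\<bar> ^ k)\<^sup>2) * nsq (f z)"
  by (subst ennreal_mult[symmetric]) (auto simp: x_power_def case_prod_unfold norm_mult norm_power power_mult_distrib)
 ultimately show "fst_powr (2 * (1/2)) z * nsq (x_power k f z) =
  fst_powr (2 * (real k + 1/2)) z * nsq (f z)" by (simp only: mult.assoc)
qed

lemma Hs0_norm_energy:
 assumes f: "f \<in> Hs0 \<theta>"
 shows "energy frequencies (\<lambda>z. of_real (japanese (fst z) powr \<theta>) * fourier f z) = ennreal ((2 * pi)\<^sup>2 * (Hs0_norm \<theta> f)\<^sup>2)"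
proof -
 define g where "g = (\<lambda>z. of_real (japanese (fst z) powr \<theta>) * fourier f z)"
 have g: "g \<in> L2 frequencies" using f by (simp add: Hs0_def g_def case_prod_unfold)
 have "ennreal ((Hs0_norm \<theta> f)\<^sup>2) = energy cylinder (inverse_fourier g)"
  using energy_eq_L2_norm[OF inverse_fourier_L2[OF g]]
  by (simp add: Hs0_norm_def J_x_def fourier_multiplier_def g_def case_prod_unfold)
 also have "... = ennreal (1 / (2 * pi)\<^sup>2) * energy frequencies g" by (rule inverse_fourier_energy[OF g])
 finally have "ennreal ((2 * pi)\<^sup>2) * ennreal ((Hs0_norm \<theta> f)\<^sup>2) = ennreal ((2 * pi)\<^sup>2) * ennreal (1 / (2 * pi)\<^sup>2) * energy frequencies g"
  by (simp only: mult.assoc)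
 also have "ennreal ((2 * pi)\<^sup>2) * ennreal (1 / (2 * pi)\<^sup>2) = 1" by (subst ennreal_mult[symmetric]) auto
 finally show ?thesis unfolding g_def[symmetric] by (simp add: ennreal_mult)
qed

lemma freq_weight_Hs0:
 assumes f: "f \<in> Hs0 \<theta>" and \<theta>: "0 \<le> \<theta>"
 shows "freq_weight (2 * \<theta>) (fourier f) \<le> ennreal ((2 * pi)\<^sup>2 * (Hs0_norm \<theta> f)\<^sup>2)"
 unfolding Hs0_norm_energy[OF f, symmetric] freq_weight_def energy_def
proof (rule nn_integral_mono)
 fix z :: "real \<times> int"
 have "\<bar>fst z\<bar> powr (2 * \<theta>) = (\<bar>fst z\<bar> powr \<theta>)\<^sup>2" by (simp add: power2_eq_square powr_add[symmetric])
 also have "... \<le> (japanese (fst z) powr \<theta>)\<^sup>2" using japanese_ge(2) \<theta> by (intro power_mono powr_mono2) auto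
 finally have "\<bar>fst z\<bar> powr (2 * \<theta>) * (cmod (fourier f z))\<^sup>2 \<le> (japanese (fst z) powr \<theta>)\<^sup>2 * (cmod (fourier f z))\<^sup>2"
  by (rule mult_right_mono) simp
 then have "ennreal (\<bar>fst z\<bar> powr (2 * \<theta>) * (cmod (fourier f z))\<^sup>2) \<le> nsq (of_real (japanese (fst z) powr \<theta>) * fourier f z)"
  by (intro ennreal_leI) (simp add: norm_mult power_mult_distrib)
 then show "fst_powr (2 * \<theta>) z * nsq (fourier f z) \<le> nsq (of_real (japanese (fst z) powr \<theta>) * fourier f z)"
  by (simp add: ennreal_mult)
qed

lemma japanese_time:
 assumes "0 \<le> s" "s \<le> 2 * \<theta>"
 shows "\<bar>t\<bar> powr s \<le> (japanese t powr \<theta>)\<^sup>2"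
proof -
 have "\<bar>t\<bar> powr s \<le> japanese t powr s" using japanese_ge(2)[of t] assms by (intro powr_mono2) auto
 also have "... \<le> japanese t powr (2 * \<theta>)" using japanese_ge(1)[of t] assms by (intro powr_mono) auto
 also have "... = (japanese t powr \<theta>)\<^sup>2" by (simp add: power2_eq_square powr_add[symmetric])
 finally show ?thesis .
qed

text \<open>Powers \<open>\<bar>t\<bar> powr s\<close> with \<open>s \<le> 2 \<theta>\<close> fit into the squared factor
 \<open>\<langle>t\<rangle> powr \<theta>\<close>.\<close>

lemma absorb_time:
 assumes s: "0 \<le> s" "s \<le> 2 * \<theta>" and K: "0 \<le> K" and E: "E \<le> ennreal K * ennreal (B\<^sup>2)"
 shows "ennreal (\<bar>t\<bar> powr s) * E \<le> ennreal K * ennreal ((japanese t powr \<theta> * B)\<^sup>2)"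
proof -
 have "ennreal (\<bar>t\<bar> powr s) * E \<le> ennreal ((japanese t powr \<theta>)\<^sup>2) * (ennreal K * ennreal (B\<^sup>2))"
  by (intro mult_mono ennreal_leI japanese_time s E) auto
 also have "... = ennreal K * ennreal ((japanese t powr \<theta> * B)\<^sup>2)"
  unfolding power_mult_distrib by (subst ennreal_mult) (auto simp: mult_ac)
 finally show ?thesis .
qed

lemma absorb_no_time:
 assumes \<theta>: "0 \<le> \<theta>" and E: "E \<le> ennreal K * ennreal (B\<^sup>2)"
 shows "E \<le> ennreal K * ennreal ((japanese t powr \<theta> * B)\<^sup>2)"
proof -
 have "1 \<le> japanese t powr \<theta>" using japanese_ge(1) \<theta> by (intro ge_one_powr_ge_zero) auto
 then have "1 * B\<^sup>2 \<le> (japanese t powr \<theta>)\<^sup>2 * B\<^sup>2" by (intro mult_right_mono one_le_power) auto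
 then have "ennreal (B\<^sup>2) \<le> ennreal ((japanese t powr \<theta> * B)\<^sup>2)" by (intro ennreal_leI) (simp add: power_mult_distrib)
 then show ?thesis using E by (meson mult_left_mono order_trans zero_le)
qed

text \<open>The singular term of \<open>diff_energy_propagator\<close>.\<close>

definition sine_weight :: "real \<Rightarrow> real \<Rightarrow> (real \<times> real \<Rightarrow> complex) \<Rightarrow> ennreal" where
 "sine_weight \<theta> t f = freq_weight (- 2 * \<theta>) (\<lambda>z. of_real (sin (t * ((fst z)\<^sup>2 + (of_int (snd z))\<^sup>2))) * fourier f z)"

lemma energy_weighted_bound:
 assumes f: "weighted \<theta> f \<in> L2 cylinder" and \<theta>: "0 \<le> \<theta>" and B: "L2_norm cylinder (weighted \<theta> f) \<le> B"
 shows "energy cylinder (weighted \<theta> f) \<le> ennreal (B\<^sup>2)"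
 unfolding energy_eq_L2_norm[OF f] using B L2_norm_nonneg by (intro ennreal_leI power_mono) auto

lemma diff_energy_fourier_finite:
 assumes N: "1 \<le> N" and \<theta>: "0 < \<theta>" "\<theta> < real N"
 shows "\<exists>K>0. \<forall>f\<in>L2 cylinder. diff_energy N \<theta> (fourier f) = ennreal K * x_energy \<theta> f"
proof (intro exI conjI ballI)
 define d where "d = enn2real (diff_const N \<theta>)"
 have d: "diff_const N \<theta> = ennreal d" using diff_const_finite[OF \<theta>] by (simp add: d_def)
 have "0 < d" using diff_const_pos[of N \<theta>] d by (simp add: ennreal_less_zero_iff)
 then show "0 < (2 * pi)\<^sup>2 * d" by simp
 fix f assume f: "f \<in> L2 cylinder"
 show "diff_energy N \<theta> (fourier f) = ennreal ((2 * pi)\<^sup>2 * d) * x_energy \<theta> f"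
  unfolding diff_energy_fourier[OF f N] d using \<open>0 < d\<close> by (subst ennreal_mult) auto
qed

text \<open>The transfer of a bound for the singular weight back to physical space. The bound \<open>B\<close> stands for the sum
 of norms on the right-hand side of the inequality to be proved.\<close>

theorem weighted_bound_propagator:
 assumes \<theta>: "0 < \<theta>" and K: "0 \<le> K"
 shows "\<exists>C>0. \<forall>f t B. f \<in> Hs0 \<theta> \<inter> L2_weight \<theta> \<longrightarrow> L2_norm cylinder (weighted \<theta> f) \<le> B \<longrightarrow> Hs0_norm \<theta> f \<le> B \<longrightarrow>
  sine_weight \<theta> t f \<le> ennreal K * ennreal ((japanese t powr \<theta> * B)\<^sup>2) \<longrightarrow>
  weighted_bound \<theta> (U t f) (C * japanese t powr \<theta> * B)"
proof -
 (* Differences of order m measure f and differences of order 3 m its evolution; both orders exceed \<theta>. *)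
 obtain m0 where "\<theta> < real m0" using reals_Archimedean2 by blast
 define m where "m = Suc m0"
 have m: "1 \<le> m" "\<theta> < real m" "1 \<le> 3 * m" "\<theta> < real (3 * m)" using \<open>\<theta> < real m0\<close> by (auto simp: m_def)
 obtain Cp where Cp: "0 \<le> Cp" and bnd: "\<And>t F. F \<in> freq_measurable \<Longrightarrow>
  diff_energy (3 * m) \<theta> (\<lambda>z. wave (t * omega (fst z) (snd z)) * F z)
  \<le> ennreal Cp * (diff_energy m \<theta> F + ennreal (\<bar>t\<bar> powr (2 * \<theta>)) * freq_weight (2 * \<theta>) F
   + ennreal (\<bar>t\<bar> powr \<theta>) * energy frequencies F
   + freq_weight (- 2 * \<theta>) (\<lambda>z. of_real (sin (t * ((fst z)\<^sup>2 + (of_int (snd z))\<^sup>2))) * F z))"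
  using diff_energy_propagator[OF m(1) \<theta> m(2)] by blast
 obtain K1 where K1: "0 < K1" and dK1: "\<And>f. f \<in> L2 cylinder \<Longrightarrow> diff_energy m \<theta> (fourier f) = ennreal K1 * x_energy \<theta> f"
  using diff_energy_fourier_finite[OF m(1) \<theta> m(2)] by blast
 obtain K3 where K3: "0 < K3" and dK3: "\<And>f. f \<in> L2 cylinder \<Longrightarrow> diff_energy (3 * m) \<theta> (fourier f) = ennreal K3 * x_energy \<theta> f"
  using diff_energy_fourier_finite[OF m(3) \<theta> m(4)] by blast
 let ?Q = "Cp * (K1 + (2 * pi)\<^sup>2 + (2 * pi)\<^sup>2 + K)"
 define L where "L = 2 powr \<theta> * (1 + 1 / K3 * ?Q)"
 have L0: "0 < L" unfolding L_def using K K1 K3 Cp by (intro mult_pos_pos add_pos_nonneg) auto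
 show ?thesis
 proof (intro exI[of _ "sqrt L"] conjI allI impI)
  show "0 < sqrt L" using L0 by simp
  fix f t B
  assume f: "f \<in> Hs0 \<theta> \<inter> L2_weight \<theta>" and B: "L2_norm cylinder (weighted \<theta> f) \<le> B" and B': "Hs0_norm \<theta> f \<le> B"
   and S: "sine_weight \<theta> t f \<le> ennreal K * ennreal ((japanese t powr \<theta> * B)\<^sup>2)"
  have fL: "f \<in> L2 cylinder" using f by (simp add: Hs0_def)
  have wL: "weighted \<theta> f \<in> L2 cylinder" using f \<theta> by (intro weighted_L2[OF fL]) auto
  have B0: "0 \<le> B" using B L2_norm_nonneg[of cylinder "weighted \<theta> f"] by linarith
  define a where "a = ennreal ((japanese t powr \<theta> * B)\<^sup>2)"
  define M where "M z = wave (t * omega (fst z) (snd z)) * fourier f z" for z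
  have Fm: "fourier f \<in> freq_measurable" by (intro L2_measurable fourier_L2 fL)
  have Mm: "M \<in> freq_measurable"
  proof -
   have [measurable]: "fourier f \<in> freq_measurable" by (rule Fm)
   have [measurable]: "(\<lambda>z. real_of_int (snd z)) \<in> freq_measurable" unfolding frequencies_def by measurable
   show ?thesis unfolding M_def[abs_def] omega_def by measurable
  qed
  have Me: "energy frequencies M = energy frequencies (fourier f)" unfolding energy_def M_def by (simp add: norm_mult)
  have M_L2: "M \<in> L2 frequencies" using Mm Me fourier_L2[OF fL] by (simp add: L2_iff_energy)
  have U: "U t f = inverse_fourier M" by (simp add: U_def fourier_multiplier_def M_def[abs_def] case_prod_unfold)
  have UL: "U t f \<in> L2 cylinder" unfolding U by (rule inverse_fourier_L2[OF M_L2])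
  have wB: "energy cylinder (weighted \<theta> f) \<le> ennreal (B\<^sup>2)" by (rule energy_weighted_bound[OF wL _ B]) (use \<theta> in simp)
  have e1: "energy cylinder f \<le> ennreal 1 * ennreal (B\<^sup>2)"
   using order_trans[OF energy_le_weighted wB] \<theta> by simp
  have x1: "x_energy \<theta> f \<le> ennreal (B\<^sup>2)" using order_trans[OF x_energy_le_weighted wB] \<theta> by simp
  have eU: "energy cylinder (U t f) = energy cylinder f"
  proof -
   have "energy cylinder (U t f) = ennreal (1 / (2 * pi)\<^sup>2) * (ennreal ((2 * pi)\<^sup>2) * energy cylinder f)"
    unfolding U inverse_fourier_energy[OF M_L2] Me fourier_energy[OF fL] ..
   also have "... = (ennreal (1 / (2 * pi)\<^sup>2) * ennreal ((2 * pi)\<^sup>2)) * energy cylinder f" by (simp only: mult.assoc)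
   also have "ennreal (1 / (2 * pi)\<^sup>2) * ennreal ((2 * pi)\<^sup>2) = 1" by (subst ennreal_mult[symmetric]) auto
   finally show ?thesis by simp
  qed
  have d1: "diff_energy m \<theta> (fourier f) \<le> ennreal K1 * a"
   unfolding dK1[OF fL] a_def by (rule absorb_no_time) (use \<theta> x1 in \<open>auto intro: mult_left_mono\<close>)
  have d2: "ennreal (\<bar>t\<bar> powr (2 * \<theta>)) * freq_weight (2 * \<theta>) (fourier f) \<le> ennreal ((2 * pi)\<^sup>2) * a"
   unfolding a_def
  proof (rule absorb_time)
   have "0 \<le> Hs0_norm \<theta> f" unfolding Hs0_norm_def by (rule L2_norm_nonneg)
   then have "ennreal ((2 * pi)\<^sup>2 * (Hs0_norm \<theta> f)\<^sup>2) \<le> ennreal ((2 * pi)\<^sup>2 * B\<^sup>2)"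
    using B' by (intro ennreal_leI mult_left_mono power_mono) auto
   also have "... = ennreal ((2 * pi)\<^sup>2) * ennreal (B\<^sup>2)" by (rule ennreal_mult) auto
   finally show "freq_weight (2 * \<theta>) (fourier f) \<le> ennreal ((2 * pi)\<^sup>2) * ennreal (B\<^sup>2)"
    using freq_weight_Hs0[of f \<theta>] f \<theta> by (auto intro: order_trans)
  qed (use \<theta> in auto)
  have d3: "ennreal (\<bar>t\<bar> powr \<theta>) * energy frequencies (fourier f) \<le> ennreal ((2 * pi)\<^sup>2) * a"
   unfolding a_def
  proof (rule absorb_time)
   show "energy frequencies (fourier f) \<le> ennreal ((2 * pi)\<^sup>2) * ennreal (B\<^sup>2)"
    unfolding fourier_energy[OF fL] using e1 by (intro mult_left_mono) auto
  qed (use \<theta> in auto)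
  have "ennreal K3 * x_energy \<theta> (U t f) = diff_energy (3 * m) \<theta> M" unfolding dK3[OF UL, symmetric] unfolding U
   by (intro diff_energy_cong_AE fourier_inverse_fourier M_L2 L2_measurable fourier_L2 inverse_fourier_L2)
  also have "... \<le> ennreal Cp * (ennreal K1 * a + ennreal ((2 * pi)\<^sup>2) * a + ennreal ((2 * pi)\<^sup>2) * a + ennreal K * a)"
   unfolding M_def[abs_def] using S unfolding sine_weight_def a_def[symmetric]
   by (intro order_trans[OF bnd[OF Fm]] mult_left_mono add_mono d1 d2 d3) auto
  also have "... = ennreal ?Q * a"
  proof -
   have "ennreal K1 * a + ennreal p * a + ennreal q * a + ennreal K * a = ennreal (K1 + p + q + K) * a" if "0 \<le> p" "0 \<le> q" for p q
    using K K1 that by (simp add: distrib_right)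
   from this[of "(2 * pi)\<^sup>2" "(2 * pi)\<^sup>2"]
   have "ennreal K1 * a + ennreal ((2 * pi)\<^sup>2) * a + ennreal ((2 * pi)\<^sup>2) * a + ennreal K * a
    = ennreal (K1 + (2 * pi)\<^sup>2 + (2 * pi)\<^sup>2 + K) * a" by simp
   moreover have "ennreal ?Q = ennreal Cp * ennreal (K1 + (2 * pi)\<^sup>2 + (2 * pi)\<^sup>2 + K)"
    using Cp K K1 by (intro ennreal_mult) auto
   ultimately show ?thesis by (simp only: mult.assoc)
  qed
  finally have "ennreal (1 / K3) * (ennreal K3 * x_energy \<theta> (U t f)) \<le> ennreal (1 / K3) * (ennreal ?Q * a)"
   by (rule mult_left_mono) simp
  moreover have "ennreal (1 / K3) * ennreal K3 = 1" using K3 by (subst ennreal_mult[symmetric]) auto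
  moreover have "ennreal (1 / K3) * ennreal ?Q = ennreal (1 / K3 * ?Q)" using K3 Cp K K1 by (subst ennreal_mult) auto
  ultimately have xU: "x_energy \<theta> (U t f) \<le> ennreal (1 / K3 * ?Q) * a" by (simp only: mult.assoc[symmetric] mult_1)
  have "energy cylinder (weighted \<theta> (U t f)) \<le> ennreal (2 powr \<theta>) * (energy cylinder (U t f) + x_energy \<theta> (U t f))"
   using \<theta> by (intro energy_weighted_le L2_measurable UL) auto
  also have "... \<le> ennreal (2 powr \<theta>) * (ennreal 1 * a + ennreal (1 / K3 * ?Q) * a)"
  proof (intro mult_left_mono add_mono xU)
   show "energy cylinder (U t f) \<le> ennreal 1 * a"
    unfolding eU a_def by (rule absorb_no_time[OF _ e1]) (use \<theta> in simp)
  qed simp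
  also have "... = ennreal L * a"
  proof -
   have "0 \<le> 1 / K3 * ?Q" using K3 Cp K K1 by auto
   then show ?thesis unfolding L_def distrib_right[symmetric] by (subst ennreal_mult) (auto simp: mult.assoc)
  qed
  also have "... = ennreal ((sqrt L * japanese t powr \<theta> * B)\<^sup>2)"
   unfolding a_def using L0 by (subst ennreal_mult[symmetric]) (auto simp: power_mult_distrib)
  finally have e: "energy cylinder (weighted \<theta> (U t f)) \<le> ennreal ((sqrt L * japanese t powr \<theta> * B)\<^sup>2)" .
  have wUL: "weighted \<theta> (U t f) \<in> L2 cylinder"
   using e weighted_measurable[OF L2_measurable[OF UL]] unfolding L2_iff_energy by (auto intro: le_less_trans)
  have "(L2_norm cylinder (weighted \<theta> (U t f)))\<^sup>2 \<le> (sqrt L * japanese t powr \<theta> * B)\<^sup>2"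
   using e unfolding energy_eq_L2_norm[OF wUL] by (simp add: ennreal_le_iff)
  then have "L2_norm cylinder (weighted \<theta> (U t f)) \<le> sqrt L * japanese t powr \<theta> * B"
   by (rule power2_le_imp_le) (use B0 L0 in auto)
  then show "weighted_bound \<theta> (U t f) (sqrt L * japanese t powr \<theta> * B)" using wUL by (simp add: weighted_bound_def)
 qed
qed

section \<open>The singular term in each range of the weight\<close>

lemma freq_weight_mono:
 "(\<And>z. cmod (a z) \<le> cmod (b z)) \<Longrightarrow> freq_weight s a \<le> freq_weight s b"
 unfolding freq_weight_def by (intro nn_integral_mono mult_left_mono ennreal_leI power_mono) auto

lemma sine_weight_le: "sine_weight \<theta> t f \<le> freq_weight (- 2 * \<theta>) (fourier f)"
 unfolding sine_weight_def by (intro freq_weight_mono) (simp add: norm_mult mult_left_le_one_le)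

lemma Hs0_weight_data:
 assumes f: "f \<in> Hs0 \<theta> \<inter> L2_weight \<theta>" and \<theta>: "0 \<le> \<theta>" and B: "L2_norm cylinder (weighted \<theta> f) \<le> B"
 shows "f \<in> L2 cylinder" "weighted \<theta> f \<in> L2 cylinder" "energy cylinder (weighted \<theta> f) \<le> ennreal (B\<^sup>2)"
  "x_energy \<theta> f \<le> ennreal (B\<^sup>2)" "energy frequencies (fourier f) \<le> ennreal ((2 * pi)\<^sup>2) * ennreal (B\<^sup>2)"
proof -
 show f': "f \<in> L2 cylinder" using f by (simp add: Hs0_def)
 show w: "weighted \<theta> f \<in> L2 cylinder" using f \<theta> by (intro weighted_L2[OF f']) auto
 show e: "energy cylinder (weighted \<theta> f) \<le> ennreal (B\<^sup>2)" by (rule energy_weighted_bound[OF w \<theta> B])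
 show "x_energy \<theta> f \<le> ennreal (B\<^sup>2)" by (rule order_trans[OF x_energy_le_weighted[OF \<theta>] e])
 show "energy frequencies (fourier f) \<le> ennreal ((2 * pi)\<^sup>2) * ennreal (B\<^sup>2)"
  unfolding fourier_energy[OF f'] by (intro mult_left_mono order_trans[OF energy_le_weighted[OF \<theta>] e]) simp
qed

lemma hardy_low_cylinder:
 assumes \<theta>: "0 < \<theta>" "\<theta> < 1/2"
 shows "\<exists>K\<ge>0. \<forall>f\<in>L2 cylinder. freq_weight (- 2 * \<theta>) (fourier f) \<le> ennreal K * x_energy \<theta> f"
proof -
 obtain C where C: "0 \<le> C" "\<And>G. G \<in> freq_measurable \<Longrightarrow> energy frequencies G < \<infinity> \<Longrightarrow>
  freq_weight (- 2 * \<theta>) G \<le> ennreal C * diff_energy 1 \<theta> G" using hardy_low[OF \<theta>] by blast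
 obtain K where K: "0 < K" "\<And>f. f \<in> L2 cylinder \<Longrightarrow> diff_energy 1 \<theta> (fourier f) = ennreal K * x_energy \<theta> f"
  using diff_energy_fourier_finite[of 1 \<theta>] \<theta> by force
 show ?thesis
 proof (intro exI[of _ "C * K"] conjI ballI)
  show "0 \<le> C * K" using C K by simp
  fix f assume f: "f \<in> L2 cylinder"
  have "freq_weight (- 2 * \<theta>) (fourier f) \<le> ennreal C * diff_energy 1 \<theta> (fourier f)"
   using fourier_L2[OF f] unfolding L2_iff_energy by (intro C) auto
  then show "freq_weight (- 2 * \<theta>) (fourier f) \<le> ennreal (C * K) * x_energy \<theta> f"
   unfolding K(2)[OF f] using C K by (subst ennreal_mult) (auto simp: mult.assoc)
 qed
qed

lemma hilbert_x_fourier: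
 assumes g: "g \<in> L2 cylinder"
 defines "S \<equiv> \<lambda>z. - \<i> * (of_real (sgn (fst z)) * fourier g z)"
 shows "S \<in> L2 frequencies" "hilbert_x g = inverse_fourier S" "hilbert_x g \<in> L2 cylinder"
proof -
 have [measurable]: "fourier g \<in> freq_measurable" by (intro L2_measurable fourier_L2 g)
 have "S \<in> freq_measurable" unfolding S_def by measurable
 moreover have "energy frequencies S \<le> energy frequencies (fourier g)"
  by (rule energy_mono) (auto simp: S_def norm_mult abs_sgn_eq)
 ultimately show S: "S \<in> L2 frequencies" using fourier_L2[OF g] unfolding L2_iff_energy by (auto intro: le_less_trans)
 show h: "hilbert_x g = inverse_fourier S" by (simp add: hilbert_x_def fourier_multiplier_def S_def case_prod_unfold mult.assoc)
 show "hilbert_x g \<in> L2 cylinder" unfolding h by (rule inverse_fourier_L2[OF S])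
qed

text \<open>\<open>hardy_half\<close> in physical space: multiplication by \<open>sgn \<xi>\<close> is the Hilbert transform up to
 the unimodular constant \<open>- i\<close>.\<close>

lemma hardy_hilbert:
 shows "\<exists>K\<ge>0. \<forall>g\<in>L2 cylinder. freq_weight (- 1) (fourier g) \<le> ennreal K * (x_energy (1/2) g + x_energy (1/2) (hilbert_x g))"
proof -
 obtain K where K: "0 < K" "\<And>f. f \<in> L2 cylinder \<Longrightarrow> diff_energy 1 (1/2) (fourier f) = ennreal K * x_energy (1/2) f"
  using diff_energy_fourier_finite[of 1 "1/2"] by force
 show ?thesis
 proof (intro exI[of _ "9/2 * K"] conjI ballI)
  show "0 \<le> 9/2 * K" using K by simp
  fix g assume g: "g \<in> L2 cylinder"
  define S where "S z = of_real (sgn (fst z)) * fourier g z" for z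
  have Fm: "fourier g \<in> freq_measurable" by (intro L2_measurable fourier_L2 g)
  note iS = hilbert_x_fourier(1)[OF g, folded S_def] and h = hilbert_x_fourier(2)[OF g, folded S_def]
   and hL = hilbert_x_fourier(3)[OF g]
  have "ennreal K * x_energy (1/2) (hilbert_x g) = diff_energy 1 (1/2) (\<lambda>z. - \<i> * S z)"
   unfolding K(2)[OF hL, symmetric] unfolding h
   by (intro diff_energy_cong_AE fourier_inverse_fourier iS L2_measurable fourier_L2 inverse_fourier_L2)
  also have "... = diff_energy 1 (1/2) S" using diff_energy_unimodular[of "\<lambda>_. - \<i>" 1 1 "1/2" S] by simp
  finally have dS: "diff_energy 1 (1/2) S = ennreal K * x_energy (1/2) (hilbert_x g)" ..
  have "freq_weight (- 1) (fourier g) \<le> ennreal (9/2) * (ennreal K * x_energy (1/2) g + ennreal K * x_energy (1/2) (hilbert_x g))"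
   using hardy_half[OF Fm] unfolding S_def[symmetric] dS K(2)[OF g] .
  also have "... = ennreal (9/2 * K) * (x_energy (1/2) g + x_energy (1/2) (hilbert_x g))"
   unfolding distrib_left[symmetric] using K by (subst ennreal_mult) (auto simp: mult.assoc)
  finally show "freq_weight (- 1) (fourier g) \<le> ennreal (9/2 * K) * (x_energy (1/2) g + x_energy (1/2) (hilbert_x g))" .
 qed
qed

lemma abs_sin_le_min:
 fixes u :: real
 shows "\<bar>sin u\<bar> \<le> min 1 \<bar>u\<bar>" using abs_sin_x_le_abs_x[of u] abs_sin_le_one[of u] by simp

lemma sin_square_le_powr:
 fixes u :: real
 assumes "0 < \<theta>" "\<theta> \<le> 2"
 shows "(sin u)\<^sup>2 \<le> \<bar>u\<bar> powr \<theta>"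
proof (cases "\<bar>u\<bar> \<le> 1")
 case True
 show ?thesis
 proof (cases "u = 0")
  case False
  have "\<bar>sin u\<bar>\<^sup>2 \<le> \<bar>u\<bar>\<^sup>2" using abs_sin_x_le_abs_x[of u] by (intro power_mono) auto
  also have "... = \<bar>u\<bar> powr 2" using False by simp
  also have "... \<le> \<bar>u\<bar> powr \<theta>" using True False assms by (intro powr_mono') auto
  finally show ?thesis by simp
 qed simp
next
 case False
 have "\<bar>sin u\<bar>\<^sup>2 \<le> 1" using abs_sin_le_one[of u] by (simp add: abs_square_le_1)
 also have "1 \<le> \<bar>u\<bar> powr \<theta>" using False assms by (intro ge_one_powr_ge_zero) auto
 finally show ?thesis by simp
qed

text \<open>In the mode \<open>\<eta> = 0\<close> the sine vanishes at \<open>\<xi> = 0\<close> to second order. If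
 \<open>\<theta> \<le> 2\<close>, this alone cancels the weight; otherwise it lowers the exponent from
 \<open>\<theta>\<close> to \<open>\<theta> - 2\<close>, and the Hardy inequalities need two moments fewer.\<close>

lemma zero_mode_sine:
 fixes k :: nat
 assumes \<theta>: "real k + 1/2 < \<theta>" "\<theta> < real k + 3/2"
 shows "\<exists>K\<ge>0. \<forall>f t B. f \<in> Hs0 \<theta> \<inter> L2_weight \<theta> \<longrightarrow> L2_norm cylinder (weighted \<theta> f) \<le> B \<longrightarrow>
  (2 \<le> k \<longrightarrow> (\<forall>l\<le>k - 2. moment f l 0 = 0)) \<longrightarrow>
  freq_weight (- 2 * \<theta>) (\<lambda>z. indicator {0} (snd z) * (of_real (sin (t * (fst z)\<^sup>2)) * fourier f z))
  \<le> ennreal K * ennreal ((japanese t powr \<theta> * B)\<^sup>2)"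
proof (cases "\<theta> \<le> 2")
 case le2: True
 have \<theta>0: "0 < \<theta>" using \<theta> by linarith
 show ?thesis
 proof (intro exI[of _ "(2 * pi)\<^sup>2"] conjI allI impI)
  show "0 \<le> (2 * pi)\<^sup>2" by simp
  fix f t B
  assume f: "f \<in> Hs0 \<theta> \<inter> L2_weight \<theta>" and B: "L2_norm cylinder (weighted \<theta> f) \<le> B"
  note dat = Hs0_weight_data[OF f less_imp_le[OF \<theta>0] B]
  have [measurable]: "fourier f \<in> freq_measurable" by (intro L2_measurable fourier_L2 dat)
  have "freq_weight (- 2 * \<theta>) (\<lambda>z. indicator {0} (snd z) * (of_real (sin (t * (fst z)\<^sup>2)) * fourier f z))
   \<le> (\<integral>\<^sup>+z. ennreal (\<bar>t\<bar> powr \<theta>) * nsq (fourier f z) \<partial>frequencies)"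
   unfolding freq_weight_def using AE_frequencies_nonzero
  proof (intro nn_integral_mono_AE, eventually_elim)
   case (elim z)
   have "(sin (t * (fst z)\<^sup>2))\<^sup>2 \<le> \<bar>t * (fst z)\<^sup>2\<bar> powr \<theta>" by (rule sin_square_le_powr[OF \<theta>0 le2])
   also have "\<bar>t * (fst z)\<^sup>2\<bar> = \<bar>t\<bar> * \<bar>fst z\<bar> powr 2" using elim by (simp add: abs_mult)
   also have "(\<bar>t\<bar> * \<bar>fst z\<bar> powr 2) powr \<theta> = \<bar>t\<bar> powr \<theta> * \<bar>fst z\<bar> powr (2 * \<theta>)" by (simp only: powr_mult powr_powr)
   finally have "\<bar>fst z\<bar> powr (- 2 * \<theta>) * (sin (t * (fst z)\<^sup>2))\<^sup>2 \<le> \<bar>fst z\<bar> powr (- 2 * \<theta>) * (\<bar>t\<bar> powr \<theta> * \<bar>fst z\<bar> powr (2 * \<theta>))"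
    by (rule mult_left_mono) simp
   also have "... = \<bar>t\<bar> powr \<theta> * (\<bar>fst z\<bar> powr (- 2 * \<theta>) * \<bar>fst z\<bar> powr (2 * \<theta>))" by (rule mult.left_commute)
   also have "\<bar>fst z\<bar> powr (- 2 * \<theta>) * \<bar>fst z\<bar> powr (2 * \<theta>) = 1" using elim by (simp add: powr_add[symmetric])
   finally have "\<bar>fst z\<bar> powr (- 2 * \<theta>) * (sin (t * (fst z)\<^sup>2))\<^sup>2 \<le> \<bar>t\<bar> powr \<theta>" by simp
   then have "\<bar>fst z\<bar> powr (- 2 * \<theta>) * (sin (t * (fst z)\<^sup>2))\<^sup>2 * (cmod (fourier f z))\<^sup>2 \<le> \<bar>t\<bar> powr \<theta> * (cmod (fourier f z))\<^sup>2"
    by (rule mult_right_mono) simp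
   then have "ennreal (\<bar>fst z\<bar> powr (- 2 * \<theta>) * ((sin (t * (fst z)\<^sup>2))\<^sup>2 * (cmod (fourier f z))\<^sup>2)) \<le> ennreal (\<bar>t\<bar> powr \<theta> * (cmod (fourier f z))\<^sup>2)"
    by (intro ennreal_leI) (simp only: mult.assoc)
   then have "fst_powr (- 2 * \<theta>) z * ennreal ((sin (t * (fst z)\<^sup>2))\<^sup>2 * (cmod (fourier f z))\<^sup>2) \<le> ennreal (\<bar>t\<bar> powr \<theta>) * nsq (fourier f z)"
    by (subst (asm) ennreal_mult, simp, simp, subst (asm) ennreal_mult) auto
   then show ?case by (cases "snd z = 0") (auto simp: norm_mult power_mult_distrib)
  qed
  also have "... = ennreal (\<bar>t\<bar> powr \<theta>) * energy frequencies (fourier f)"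
   unfolding energy_def by (rule nn_integral_cmult) measurable
  also have "... \<le> ennreal ((2 * pi)\<^sup>2) * ennreal ((japanese t powr \<theta> * B)\<^sup>2)"
   by (rule absorb_time[OF _ _ _ dat(5)]) (use \<theta>0 in auto)
  finally show "freq_weight (- 2 * \<theta>) (\<lambda>z. indicator {0} (snd z) * (of_real (sin (t * (fst z)\<^sup>2)) * fourier f z))
   \<le> ennreal ((2 * pi)\<^sup>2) * ennreal ((japanese t powr \<theta> * B)\<^sup>2)" .
 qed
next
 case gt2: False
 then have k: "1 \<le> k" using \<theta> by linarith
 have "\<exists>K\<ge>0. \<forall>f. f \<in> L2 cylinder \<longrightarrow> weighted \<theta> f \<in> L2 cylinder \<longrightarrow> (2 \<le> k \<longrightarrow> (\<forall>l\<le>k - 2. moment f l 0 = 0)) \<longrightarrow>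
  freq_weight (- 2 * (\<theta> - 2)) (\<lambda>z. indicator {0} (snd z) * fourier f z) \<le> ennreal K * x_energy (\<theta> - 2) f"
 proof (cases "2 \<le> k")
  case True
  then have k': "real (k - 2) = real k - 2" by simp
  obtain C where C: "0 \<le> C" "\<And>f S. f \<in> L2 cylinder \<Longrightarrow> weighted (\<theta> - 2) f \<in> L2 cylinder \<Longrightarrow> (\<forall>\<eta>\<in>S. \<forall>l\<le>k - 2. moment f l \<eta> = 0) \<Longrightarrow>
   freq_weight (- 2 * (\<theta> - 2)) (\<lambda>z. indicator S (snd z) * fourier f z) \<le> ennreal C * x_energy (\<theta> - 2) f"
   using hardy_moments_cylinder[of "k - 2" "\<theta> - 2"] \<theta> unfolding k' by force
  show ?thesis
  proof (intro exI[of _ C] conjI allI impI C)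
   fix f assume f: "f \<in> L2 cylinder" "weighted \<theta> f \<in> L2 cylinder" and mom: "2 \<le> k \<longrightarrow> (\<forall>l\<le>k - 2. moment f l 0 = 0)"
   show "weighted (\<theta> - 2) f \<in> L2 cylinder"
    using f energy_weighted_mono[of "\<theta> - 2" \<theta> f] weighted_measurable[OF L2_measurable[OF f(1)]]
    unfolding L2_iff_energy by (auto intro: le_less_trans)
   show "\<forall>\<eta>\<in>{0}. \<forall>l\<le>k - 2. moment f l \<eta> = 0" using mom True by simp
  qed
 next
  case False
  then have "k = 1" using k by simp
  then obtain C where C: "0 \<le> C" "\<And>f. f \<in> L2 cylinder \<Longrightarrow> freq_weight (- 2 * (\<theta> - 2)) (fourier f) \<le> ennreal C * x_energy (\<theta> - 2) f"
   using hardy_low_cylinder[of "\<theta> - 2"] \<theta> gt2 by force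
  show ?thesis
   by (intro exI[of _ C] conjI allI impI C(1) order_trans[OF freq_weight_mono C(2)]) (auto simp: norm_mult indicator_def)
 qed
 then obtain K where K: "0 \<le> K" "\<And>f. f \<in> L2 cylinder \<Longrightarrow> weighted \<theta> f \<in> L2 cylinder \<Longrightarrow> (2 \<le> k \<longrightarrow> (\<forall>l\<le>k - 2. moment f l 0 = 0)) \<Longrightarrow>
  freq_weight (- 2 * (\<theta> - 2)) (\<lambda>z. indicator {0} (snd z) * fourier f z) \<le> ennreal K * x_energy (\<theta> - 2) f" by blast
 show ?thesis
 proof (intro exI[of _ K] conjI allI impI K(1))
  fix f t B
  assume f: "f \<in> Hs0 \<theta> \<inter> L2_weight \<theta>" and B: "L2_norm cylinder (weighted \<theta> f) \<le> B"
   and mom: "2 \<le> k \<longrightarrow> (\<forall>l\<le>k - 2. moment f l 0 = 0)"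
  have \<theta>0: "0 \<le> \<theta>" using gt2 by simp
  note dat = Hs0_weight_data[OF f \<theta>0 B]
  define G where "G z = indicator {0} (snd z) * fourier f z" for z
  have [measurable]: "G \<in> freq_measurable"
  proof -
   have [measurable]: "fourier f \<in> freq_measurable" by (intro L2_measurable fourier_L2 dat)
   have [measurable]: "(\<lambda>z. indicator {0} (snd z) :: complex) \<in> freq_measurable"
    unfolding frequencies_def by (rule measurable_compose[OF measurable_snd]) simp
   show ?thesis unfolding G_def[abs_def] by measurable
  qed
  have "freq_weight (- 2 * \<theta>) (\<lambda>z. indicator {0} (snd z) * (of_real (sin (t * (fst z)\<^sup>2)) * fourier f z))
   \<le> (\<integral>\<^sup>+z. ennreal (\<bar>t\<bar> powr 2) * (fst_powr (- 2 * (\<theta> - 2)) z * nsq (G z)) \<partial>frequencies)"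
   unfolding freq_weight_def using AE_frequencies_nonzero
  proof (intro nn_integral_mono_AE, eventually_elim)
   case (elim z)
   let ?x = "\<bar>fst z\<bar>"
   have "\<bar>sin (t * (fst z)\<^sup>2)\<bar>\<^sup>2 \<le> \<bar>t * (fst z)\<^sup>2\<bar>\<^sup>2" by (intro power_mono abs_sin_x_le_abs_x) auto
   also have "... = \<bar>t\<bar>\<^sup>2 * ?x ^ 4" by (simp add: abs_mult power_mult_distrib power_mult[symmetric])
   also have "\<bar>t\<bar>\<^sup>2 = \<bar>t\<bar> powr 2" by simp
   also have "?x ^ 4 = ?x powr 4" using elim by (simp add: powr_realpow[of ?x 4, symmetric])
   finally have "?x powr (- 2 * \<theta>) * (sin (t * (fst z)\<^sup>2))\<^sup>2 \<le> ?x powr (- 2 * \<theta>) * (\<bar>t\<bar> powr 2 * ?x powr 4)"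
    unfolding power2_abs by (rule mult_left_mono) simp
   also have "... = \<bar>t\<bar> powr 2 * (?x powr (- 2 * \<theta>) * ?x powr 4)" by (rule mult.left_commute)
   also have "?x powr (- 2 * \<theta>) * ?x powr 4 = ?x powr (- 2 * (\<theta> - 2))" unfolding powr_add[symmetric] by (simp add: algebra_simps)
   finally have "?x powr (- 2 * \<theta>) * (sin (t * (fst z)\<^sup>2))\<^sup>2 * (cmod (G z))\<^sup>2 \<le> \<bar>t\<bar> powr 2 * ?x powr (- 2 * (\<theta> - 2)) * (cmod (G z))\<^sup>2"
    by (rule mult_right_mono) simp
   then have "ennreal (?x powr (- 2 * \<theta>) * ((sin (t * (fst z)\<^sup>2))\<^sup>2 * (cmod (G z))\<^sup>2)) \<le> ennreal (\<bar>t\<bar> powr 2 * (?x powr (- 2 * (\<theta> - 2)) * (cmod (G z))\<^sup>2))"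
    unfolding mult.assoc by (rule ennreal_leI)
   also have "... = ennreal (\<bar>t\<bar> powr 2) * (ennreal (?x powr (- 2 * (\<theta> - 2))) * nsq (G z))"
    by (subst ennreal_mult, simp, simp, subst ennreal_mult) auto
   also have "ennreal (?x powr (- 2 * \<theta>) * ((sin (t * (fst z)\<^sup>2))\<^sup>2 * (cmod (G z))\<^sup>2))
    = ennreal (?x powr (- 2 * \<theta>)) * ennreal ((sin (t * (fst z)\<^sup>2))\<^sup>2 * (cmod (G z))\<^sup>2)"
    by (rule ennreal_mult) auto
   also have "(sin (t * (fst z)\<^sup>2))\<^sup>2 * (cmod (G z))\<^sup>2 = (cmod (indicator {0} (snd z) * (of_real (sin (t * (fst z)\<^sup>2)) * fourier f z)))\<^sup>2"
    by (simp add: G_def norm_mult power_mult_distrib)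
   finally show ?case .
  qed
  also have "... = ennreal (\<bar>t\<bar> powr 2) * freq_weight (- 2 * (\<theta> - 2)) G"
   unfolding freq_weight_def by (rule nn_integral_cmult) measurable
  also have "... \<le> ennreal K * ennreal ((japanese t powr \<theta> * B)\<^sup>2)"
  proof (rule absorb_time)
   have "x_energy (\<theta> - 2) f \<le> energy cylinder (weighted \<theta> f)"
    using x_energy_le_weighted[of "\<theta> - 2" f] energy_weighted_mono[of "\<theta> - 2" \<theta> f] gt2 by (auto intro: order_trans)
   also have "... \<le> ennreal (B\<^sup>2)" by (rule dat)
   finally show "freq_weight (- 2 * (\<theta> - 2)) G \<le> ennreal K * ennreal (B\<^sup>2)"
    unfolding G_def[abs_def] by (intro order_trans[OF K(2)[OF dat(1,2) mom]] mult_left_mono) auto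
  qed (use K gt2 in auto)
  finally show "freq_weight (- 2 * \<theta>) (\<lambda>z. indicator {0} (snd z) * (of_real (sin (t * (fst z)\<^sup>2)) * fourier f z))
   \<le> ennreal K * ennreal ((japanese t powr \<theta> * B)\<^sup>2)" .
 qed
qed

text \<open>The bound for the singular weight under an additional hypothesis \<open>A\<close> on \<open>f\<close> and the bound
 \<open>B\<close>. The hypothesis collects the moment conditions and, at the endpoints, the norm of a Hilbert
 transform.\<close>

definition sine_estimate :: "real \<Rightarrow> ((real \<times> real \<Rightarrow> complex) \<Rightarrow> real \<Rightarrow> bool) \<Rightarrow> bool" where
 "sine_estimate \<theta> A \<longleftrightarrow> (\<exists>K\<ge>0. \<forall>f t B. f \<in> Hs0 \<theta> \<inter> L2_weight \<theta> \<longrightarrow> L2_norm cylinder (weighted \<theta> f) \<le> B \<longrightarrow>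
  A f B \<longrightarrow> sine_weight \<theta> t f \<le> ennreal K * ennreal ((japanese t powr \<theta> * B)\<^sup>2))"

lemma weighted_bound_of_sine_estimate:
 assumes \<theta>: "0 < \<theta>" and A: "sine_estimate \<theta> A"
  and P: "\<And>f. P f \<Longrightarrow> f \<in> Hs0 \<theta> \<inter> L2_weight \<theta> \<and> L2_norm cylinder (weighted \<theta> f) \<le> N f \<and> Hs0_norm \<theta> f \<le> N f \<and> A f (N f)"
 shows "\<exists>C>0. \<forall>f. P f \<longrightarrow> (\<forall>t. weighted_bound \<theta> (U t f) (C * japanese t powr \<theta> * N f))"
proof -
 obtain K where K: "0 \<le> K" "\<forall>f t B. f \<in> Hs0 \<theta> \<inter> L2_weight \<theta> \<longrightarrow> L2_norm cylinder (weighted \<theta> f) \<le> B \<longrightarrow>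
  A f B \<longrightarrow> sine_weight \<theta> t f \<le> ennreal K * ennreal ((japanese t powr \<theta> * B)\<^sup>2)"
  using A unfolding sine_estimate_def by blast
 show ?thesis using weighted_bound_propagator[OF \<theta> K(1)] P K(2) by meson
qed

text \<open>For \<open>\<eta> \<noteq> 0\<close> the sine is bounded by \<open>1\<close> and all moments up to order
 \<open>k\<close> are needed; the mode \<open>\<eta> = 0\<close> is \<open>zero_mode_sine\<close>.\<close>

lemma sine_moments:
 fixes k :: nat
 assumes \<theta>: "real k + 1/2 < \<theta>" "\<theta> < real k + 3/2"
 shows "sine_estimate \<theta> (\<lambda>f B. (\<forall>\<eta>. \<eta> \<noteq> 0 \<longrightarrow> (\<forall>l\<le>k. moment f l \<eta> = 0)) \<and> (2 \<le> k \<longrightarrow> (\<forall>l\<le>k - 2. moment f l 0 = 0)))"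
proof -
 have \<theta>0: "0 \<le> \<theta>" using \<theta> by linarith
 obtain C where C: "0 \<le> C" "\<And>f S. f \<in> L2 cylinder \<Longrightarrow> weighted \<theta> f \<in> L2 cylinder \<Longrightarrow> (\<forall>\<eta>\<in>S. \<forall>l\<le>k. moment f l \<eta> = 0) \<Longrightarrow>
   freq_weight (- 2 * \<theta>) (\<lambda>z. indicator S (snd z) * fourier f z) \<le> ennreal C * x_energy \<theta> f"
  using hardy_moments_cylinder[OF \<theta>] by blast
 obtain K where K: "0 \<le> K" "\<And>f t B. f \<in> Hs0 \<theta> \<inter> L2_weight \<theta> \<Longrightarrow> L2_norm cylinder (weighted \<theta> f) \<le> B \<Longrightarrow>
  (2 \<le> k \<longrightarrow> (\<forall>l\<le>k - 2. moment f l 0 = 0)) \<Longrightarrow>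
  freq_weight (- 2 * \<theta>) (\<lambda>z. indicator {0} (snd z) * (of_real (sin (t * (fst z)\<^sup>2)) * fourier f z))
  \<le> ennreal K * ennreal ((japanese t powr \<theta> * B)\<^sup>2)" using zero_mode_sine[OF \<theta>] by blast
 show ?thesis unfolding sine_estimate_def
 proof (intro exI[of _ "C + K"] conjI allI impI)
  show "0 \<le> C + K" using C K by simp
  fix f t B
  assume f: "f \<in> Hs0 \<theta> \<inter> L2_weight \<theta>" and B: "L2_norm cylinder (weighted \<theta> f) \<le> B"
   and "(\<forall>\<eta>. \<eta> \<noteq> 0 \<longrightarrow> (\<forall>l\<le>k. moment f l \<eta> = 0)) \<and> (2 \<le> k \<longrightarrow> (\<forall>l\<le>k - 2. moment f l 0 = 0))"
  then have mom: "\<forall>\<eta>. \<eta> \<noteq> 0 \<longrightarrow> (\<forall>l\<le>k. moment f l \<eta> = 0)" and mom0: "2 \<le> k \<longrightarrow> (\<forall>l\<le>k - 2. moment f l 0 = 0)" by blast+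
  note dat = Hs0_weight_data[OF f \<theta>0 B]
  let ?u = "\<lambda>z. indicator (- {0}) (snd z) * fourier f z"
  let ?v = "\<lambda>z. indicator {0} (snd z) * (of_real (sin (t * (fst z)\<^sup>2)) * fourier f z)"
  have Fm: "fourier f \<in> freq_measurable" by (intro L2_measurable fourier_L2 dat)
  have m: "(\<lambda>z. \<phi> (snd z)) \<in> freq_measurable" for \<phi> :: "int \<Rightarrow> complex"
   unfolding frequencies_def by (rule measurable_compose[OF measurable_snd]) simp
  have um: "?u \<in> freq_measurable" and vm: "?v \<in> freq_measurable"
   using Fm m[of "indicator (- {0})"] m[of "indicator {0}"] by measurable
  have "sine_weight \<theta> t f \<le> (\<integral>\<^sup>+z. fst_powr (- 2 * \<theta>) z * nsq (?u z)
    + fst_powr (- 2 * \<theta>) z * nsq (?v z) \<partial>frequencies)" unfolding sine_weight_def freq_weight_def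
  proof (rule nn_integral_mono)
   fix z :: "real \<times> int"
   have "(cmod (of_real (sin (t * ((fst z)\<^sup>2 + (of_int (snd z))\<^sup>2))) * fourier f z))\<^sup>2 \<le> (cmod (?u z))\<^sup>2 + (cmod (?v z))\<^sup>2"
   proof (cases "snd z = 0")
    case False
    have "cmod (of_real (sin (t * ((fst z)\<^sup>2 + (of_int (snd z))\<^sup>2))) * fourier f z) \<le> cmod (fourier f z)"
     by (simp add: norm_mult mult_left_le_one_le)
    then show ?thesis using False by (simp add: power_mono)
   qed simp
   from ennreal_leI[OF this] have "nsq (of_real (sin (t * ((fst z)\<^sup>2 + (of_int (snd z))\<^sup>2))) * fourier f z) \<le> nsq (?u z) + nsq (?v z)"
    by (simp only: ennreal_plus zero_le_power2)
   then show "fst_powr (- 2 * \<theta>) z * nsq (of_real (sin (t * ((fst z)\<^sup>2 + (of_int (snd z))\<^sup>2))) * fourier f z)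
    \<le> fst_powr (- 2 * \<theta>) z * nsq (?u z) + fst_powr (- 2 * \<theta>) z * nsq (?v z)"
    unfolding distrib_left[symmetric] by (rule mult_left_mono) simp
  qed
  also have "... = freq_weight (- 2 * \<theta>) ?u + freq_weight (- 2 * \<theta>) ?v" unfolding freq_weight_def
  proof (rule nn_integral_add)
   note [measurable] = um vm
   show "(\<lambda>z. fst_powr (- 2 * \<theta>) z * nsq (?u z)) \<in> freq_measurable"
    "(\<lambda>z. fst_powr (- 2 * \<theta>) z * nsq (?v z)) \<in> freq_measurable" by measurable
  qed
  also have "... \<le> ennreal C * ennreal ((japanese t powr \<theta> * B)\<^sup>2) + ennreal K * ennreal ((japanese t powr \<theta> * B)\<^sup>2)"
  proof (intro add_mono K(2)[OF f B mom0])
   have "freq_weight (- 2 * \<theta>) ?u \<le> ennreal C * x_energy \<theta> f" using mom by (intro C dat) auto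
   also have "... \<le> ennreal C * ennreal (B\<^sup>2)" by (intro mult_left_mono dat) simp
   finally show "freq_weight (- 2 * \<theta>) ?u \<le> ennreal C * ennreal ((japanese t powr \<theta> * B)\<^sup>2)" by (rule absorb_no_time[OF \<theta>0])
  qed
  also have "... = ennreal (C + K) * ennreal ((japanese t powr \<theta> * B)\<^sup>2)" using C K by (simp add: distrib_right)
  finally show "sine_weight \<theta> t f \<le> ennreal (C + K) * ennreal ((japanese t powr \<theta> * B)\<^sup>2)" .
 qed
qed

lemma freq_weight_add_le:
 assumes a[measurable]: "a \<in> freq_measurable" and b[measurable]: "b \<in> freq_measurable"
 shows "freq_weight (- 2 * \<theta>) (\<lambda>z. a z + b z) \<le> 2 * (freq_weight (- 2 * \<theta>) a + freq_weight (- 2 * \<theta>) b)"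
proof -
 have "freq_weight (- 2 * \<theta>) (\<lambda>z. a z + b z)
  = energy frequencies (\<lambda>z. of_real (\<bar>fst z\<bar> powr (- \<theta>)) * a z + of_real (\<bar>fst z\<bar> powr (- \<theta>)) * b z)"
  unfolding freq_weight_eq_energy by (simp only: distrib_left)
 also have "... \<le> 2 * (freq_weight (- 2 * \<theta>) a + freq_weight (- 2 * \<theta>) b)"
  unfolding freq_weight_eq_energy by (rule energy_add_le2) measurable
 finally show ?thesis .
qed

text \<open>By scaling with \<open>\<bar>t\<bar> powr (1/2)\<close>: the sine is at most the square of \<open>min 1 (\<bar>t\<bar>
 powr (1/2) \<bar>\<xi>\<bar>)\<close>, and the fourth power of this cutoff is integrable against
 \<open>\<bar>\<xi>\<bar> powr (- 3)\<close>.\<close>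

lemma sine_zero_mode_singular:
 shows "(\<integral>\<^sup>+z. indicator {0} (snd z) * (sing 1 (fst z) * ennreal ((sin (t * (fst z)\<^sup>2))\<^sup>2)) \<partial>frequencies)
  \<le> ennreal (\<bar>t\<bar> powr 1) * cutoff_const 4 1"
proof -
 have [measurable]: "(\<lambda>p. indicator {0} (snd p) :: ennreal) \<in> borel_measurable (lborel \<Otimes>\<^sub>M count_space (UNIV :: int set))"
  by (rule measurable_compose[OF measurable_snd]) simp
 have m: "(\<lambda>p. indicator {0} (snd p) * (sing 1 (fst p) * ennreal ((sin (t * (fst p)\<^sup>2))\<^sup>2))) \<in> borel_measurable (lborel \<Otimes>\<^sub>M count_space (UNIV :: int set))"
  by measurable
 have "(\<integral>\<^sup>+z. indicator {0} (snd z) * (sing 1 (fst z) * ennreal ((sin (t * (fst z)\<^sup>2))\<^sup>2)) \<partial>frequencies)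
  = (\<integral>\<^sup>+\<eta>. (\<integral>\<^sup>+\<xi>. indicator {0} \<eta> * (sing 1 \<xi> * ennreal ((sin (t * \<xi>\<^sup>2))\<^sup>2)) \<partial>lborel) \<partial>count_space (UNIV :: int set))"
  unfolding frequencies_def using m by (subst line_int.nn_integral_snd[symmetric]) (auto simp: case_prod_unfold)
 also have "... = (\<integral>\<^sup>+\<eta>. (\<integral>\<^sup>+\<xi>. sing 1 \<xi> * ennreal ((sin (t * \<xi>\<^sup>2))\<^sup>2) \<partial>lborel) * indicator {0} \<eta> \<partial>count_space (UNIV :: int set))"
  by (intro nn_integral_cong) (auto simp: indicator_def)
 also have "... = (\<integral>\<^sup>+\<xi>. sing 1 \<xi> * ennreal ((sin (t * \<xi>\<^sup>2))\<^sup>2) \<partial>lborel)"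
  by (subst nn_integral_cmult_indicator) auto
 also have "... \<le> (\<integral>\<^sup>+\<xi>. sing 1 \<xi> * ennreal (min 1 \<bar>sqrt \<bar>t\<bar> * \<xi>\<bar> ^ 4) \<partial>lborel)"
 proof (intro nn_integral_mono mult_left_mono ennreal_leI)
  fix \<xi> :: real
  have "\<bar>t * \<xi>\<^sup>2\<bar> = \<bar>sqrt \<bar>t\<bar> * \<xi>\<bar>\<^sup>2" by (simp add: abs_mult power_mult_distrib)
  then have "min 1 \<bar>t * \<xi>\<^sup>2\<bar> = (min 1 \<bar>sqrt \<bar>t\<bar> * \<xi>\<bar>)\<^sup>2" by (simp only: min_one_square abs_ge_zero)
  then have "\<bar>sin (t * \<xi>\<^sup>2)\<bar> \<le> (min 1 \<bar>sqrt \<bar>t\<bar> * \<xi>\<bar>)\<^sup>2"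
   using abs_sin_le_min[of "t * \<xi>\<^sup>2"] by (simp only:)
  then have "\<bar>sin (t * \<xi>\<^sup>2)\<bar>\<^sup>2 \<le> ((min 1 \<bar>sqrt \<bar>t\<bar> * \<xi>\<bar>)\<^sup>2)\<^sup>2" by (rule power_mono) simp
  also have "... = min 1 \<bar>sqrt \<bar>t\<bar> * \<xi>\<bar> ^ 4" by (simp only: power_mult[symmetric]) simp
  finally show "(sin (t * \<xi>\<^sup>2))\<^sup>2 \<le> min 1 \<bar>sqrt \<bar>t\<bar> * \<xi>\<bar> ^ 4" by simp
 qed simp
 also have "... = ennreal (\<bar>sqrt \<bar>t\<bar>\<bar> powr (2 * 1)) * cutoff_const 4 1" by (rule cutoff_scaled) simp
 also have "\<bar>sqrt \<bar>t\<bar>\<bar> powr (2 * 1) = \<bar>t\<bar> powr 1" by (cases "t = 0") auto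
 finally show ?thesis .
qed

text \<open>The transform is split into its Taylor polynomial and the remainder of \<open>endpoint_taylor\<close>. By the moment
 conditions the polynomial vanishes for \<open>\<eta> \<noteq> 0\<close>, and only its term of degree \<open>k -
 1\<close> is left for \<open>\<eta> = 0\<close>; that term leaves the weight \<open>\<bar>\<xi>\<bar> powr (-
 3)\<close> of \<open>sine_zero_mode_singular\<close>.\<close>

lemma sine_endpoint:
 fixes k :: nat
 assumes k: "1 \<le> k"
 defines "\<theta> \<equiv> real k + 1/2"
 shows "sine_estimate \<theta> (\<lambda>f B. hilbert_x (x_power k f) \<in> L2_weight (1/2) \<and> L2_norm cylinder (weighted (1/2) (hilbert_x (x_power k f))) \<le> B \<and>
  (\<forall>\<eta>. \<eta> \<noteq> 0 \<longrightarrow> (\<forall>l\<le>k - 1. moment f l \<eta> = 0)) \<and> (2 \<le> k \<longrightarrow> (\<forall>l\<le>k - 2. moment f l 0 = 0)))"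
proof -
 have \<theta>0: "0 \<le> \<theta>" by (simp add: \<theta>_def)
 obtain j where j: "k = Suc j" using k by (cases k) auto
 obtain Kh where Kh: "0 \<le> Kh" "\<And>g. g \<in> L2 cylinder \<Longrightarrow> freq_weight (- 1) (fourier g) \<le> ennreal Kh * (x_energy (1/2) g + x_energy (1/2) (hilbert_x g))"
  using hardy_hilbert by blast
 have jk: "real j + 1/2 < \<theta>" by (simp add: \<theta>_def j)
 obtain Cm where Cm: "0 \<le> Cm" "\<And>f. weighted \<theta> f \<in> L2 cylinder \<Longrightarrow> nsq (moment f j 0) \<le> ennreal Cm * energy cylinder (weighted \<theta> f)"
  using moment_bound[OF jk] by blast
 define h where "h = enn2real half_const"
 have h: "half_const = ennreal h" "0 \<le> h" using half_const_finite by (simp_all add: h_def)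
 define c where "c = enn2real (cutoff_const 4 1)"
 have c: "cutoff_const 4 1 = ennreal c" "0 \<le> c" using cutoff_const_finite[of 1 4] by (simp_all add: c_def)
 define K1 where "K1 = 2 * h\<^sup>2 * (Kh * 2)"
 define K2 where "K2 = Cm * c"
 have K12: "0 \<le> K1" "0 \<le> K2" using Kh Cm h c by (auto simp: K1_def K2_def)
 show ?thesis unfolding sine_estimate_def
 proof (intro exI[of _ "2 * (K1 + K2)"] conjI allI impI, goal_cases)
  case 1 show "0 \<le> 2 * (K1 + K2)" using K12 by simp
 next
  case (2 f t B)
  then have f: "f \<in> Hs0 \<theta> \<inter> L2_weight \<theta>" and B: "L2_norm cylinder (weighted \<theta> f) \<le> B"
   and hw: "hilbert_x (x_power k f) \<in> L2_weight (1/2)" and hB: "L2_norm cylinder (weighted (1/2) (hilbert_x (x_power k f))) \<le> B"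
   and mom: "\<forall>\<eta>. \<eta> \<noteq> 0 \<longrightarrow> (\<forall>l\<le>k - 1. moment f l \<eta> = 0)" and mom0: "2 \<le> k \<longrightarrow> (\<forall>l\<le>k - 2. moment f l 0 = 0)" by blast+
  note dat = Hs0_weight_data[OF f \<theta>0 B]
  define a where "a = ennreal ((japanese t powr \<theta> * B)\<^sup>2)"
  define P where "P z = (\<Sum>l<k. (- \<i> * of_real (fst z)) ^ l / fact l * moment f l (snd z))" for z
  define sn where "sn z = sin (t * ((fst z)\<^sup>2 + (of_int (snd z))\<^sup>2))" for z :: "real \<times> int"
  have [measurable]: "fourier f \<in> freq_measurable" by (intro L2_measurable fourier_L2 dat)
  have m: "(\<lambda>z. \<phi> (snd z)) \<in> freq_measurable" for \<phi> :: "int \<Rightarrow> complex"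
   unfolding frequencies_def by (rule measurable_compose[OF measurable_snd]) simp
  have [measurable]: "(\<lambda>z. real_of_int (snd z)) \<in> freq_measurable" unfolding frequencies_def by measurable
  have [measurable]: "sn \<in> freq_measurable" unfolding sn_def[abs_def] by measurable
  have [measurable]: "P \<in> freq_measurable"
  proof -
   note [measurable] = m
   show ?thesis unfolding P_def[abs_def] by measurable
  qed
  have g: "x_power k f \<in> L2 cylinder" by (rule x_power_L2[OF L2_measurable[OF dat(1)] dat(2)]) (simp add: \<theta>_def)
  have R: "freq_weight (- 2 * \<theta>) (\<lambda>z. of_real (sn z) * (fourier f z - P z)) \<le> ennreal K1 * a"
  proof -
   have hL: "weighted (1/2) (hilbert_x (x_power k f)) \<in> L2 cylinder"
    by (rule weighted_L2[OF hilbert_x_fourier(3)[OF g] hw]) simp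
   have e1: "x_energy (1/2) (x_power k f) \<le> ennreal (B\<^sup>2)" using dat(4) by (simp add: x_energy_x_power \<theta>_def)
   have e2: "x_energy (1/2) (hilbert_x (x_power k f)) \<le> ennreal (B\<^sup>2)"
    by (rule order_trans[OF x_energy_le_weighted energy_weighted_bound[OF hL _ hB]]) auto
   have "freq_weight (- 2 * \<theta>) (\<lambda>z. of_real (sn z) * (fourier f z - P z)) \<le> freq_weight (- 2 * \<theta>) (\<lambda>z. fourier f z - P z)"
    by (intro freq_weight_mono) (simp add: norm_mult mult_left_le_one_le sn_def)
   also have "... \<le> 2 * half_const\<^sup>2 * freq_weight (- 1) (fourier (x_power k f))"
    using endpoint_taylor[OF k dat(1)] dat(2) unfolding P_def \<theta>_def by simp
   also have "... \<le> 2 * half_const\<^sup>2 * (ennreal Kh * (ennreal (B\<^sup>2) + ennreal (B\<^sup>2)))"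
    by (intro mult_left_mono order_trans[OF Kh(2)[OF g]] add_mono e1 e2) auto
   also have "... = ennreal K1 * ennreal (B\<^sup>2)"
   proof -
    have "2 * half_const\<^sup>2 = ennreal (2 * h\<^sup>2)" 
     unfolding h(1) ennreal_power[OF h(2)] using ennreal_mult[of 2 "h\<^sup>2"] by simp
    moreover have "ennreal Kh * (ennreal (B\<^sup>2) + ennreal (B\<^sup>2)) = ennreal (Kh * 2) * ennreal (B\<^sup>2)"
     using Kh ennreal_mult[of Kh 2] by (simp add: mult_2 mult.assoc)
    moreover have "ennreal K1 = ennreal (2 * h\<^sup>2) * ennreal (Kh * 2)" unfolding K1_def using Kh by (intro ennreal_mult) auto
    ultimately show ?thesis by (simp only: mult.assoc)
   qed
   finally show ?thesis unfolding a_def by (rule absorb_no_time[OF \<theta>0])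
  qed
  have Q: "freq_weight (- 2 * \<theta>) (\<lambda>z. of_real (sn z) * P z) \<le> ennreal K2 * a"
  proof -
   define \<mu> where "\<mu> = (cmod (moment f j 0))\<^sup>2"
   have "freq_weight (- 2 * \<theta>) (\<lambda>z. of_real (sn z) * P z)
    \<le> (\<integral>\<^sup>+z. ennreal \<mu> * (indicator {0} (snd z) * (sing 1 (fst z) * ennreal ((sin (t * (fst z)\<^sup>2))\<^sup>2))) \<partial>frequencies)"
    unfolding freq_weight_def using AE_frequencies_nonzero
   proof (intro nn_integral_mono_AE, eventually_elim)
    case (elim z)
    let ?x = "\<bar>fst z\<bar>"
    show ?case
    proof (cases "snd z = 0")
     case False
     then have "P z = 0" unfolding P_def using mom k by (intro sum.neutral) auto
     then show ?thesis by simp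
    next
     case True
     have "P z = (\<Sum>l<j. (- \<i> * of_real (fst z)) ^ l / fact l * moment f l 0) + (- \<i> * of_real (fst z)) ^ j / fact j * moment f j 0"
      unfolding P_def j True by (rule sum.lessThan_Suc)
     also have "(\<Sum>l<j. (- \<i> * of_real (fst z)) ^ l / fact l * moment f l 0) = 0"
      using mom0 j by (intro sum.neutral) auto
     finally have "cmod (P z) = ?x ^ j / fact j * cmod (moment f j 0)" by (simp add: norm_mult norm_power norm_divide)
     also have "... \<le> ?x ^ j * cmod (moment f j 0)"
      using fact_ge_1[of j, where 'a=real] by (intro mult_right_mono) (auto simp: divide_le_eq mult_le_cancel_left1)
     finally have "(cmod (P z))\<^sup>2 \<le> (?x ^ j * cmod (moment f j 0))\<^sup>2" by (intro power_mono) auto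
     also have "... = (?x ^ j)\<^sup>2 * \<mu>" by (simp add: \<mu>_def power_mult_distrib)
     finally have "(?x powr (- 2 * \<theta>) * (sn z)\<^sup>2) * (cmod (P z))\<^sup>2 \<le> (?x powr (- 2 * \<theta>) * (sn z)\<^sup>2) * ((?x ^ j)\<^sup>2 * \<mu>)"
      by (rule mult_left_mono) simp
     also have "... = \<mu> * ((?x powr (- 2 * \<theta>) * (?x ^ j)\<^sup>2) * (sn z)\<^sup>2)" by (simp only: mult_ac)
     also have "?x powr (- 2 * \<theta>) * (?x ^ j)\<^sup>2 = ?x powr (- 1 - 2 * 1)"
     proof -
      have "(?x ^ j)\<^sup>2 = ?x powr (2 * real j)"
       using elim by (simp add: power2_eq_square powr_realpow[symmetric] powr_add[symmetric])
      then have "?x powr (- 2 * \<theta>) * (?x ^ j)\<^sup>2 = ?x powr (- 2 * \<theta> + 2 * real j)" by (simp only: powr_add)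
      also have "- 2 * \<theta> + 2 * real j = - 1 - 2 * 1" by (simp add: \<theta>_def j)
      finally show ?thesis .
     qed
     finally have "ennreal (?x powr (- 2 * \<theta>) * ((sn z)\<^sup>2 * (cmod (P z))\<^sup>2)) \<le> ennreal (\<mu> * (?x powr (- 1 - 2 * 1) * (sn z)\<^sup>2))"
      unfolding mult.assoc by (rule ennreal_leI)
     also have "... = ennreal \<mu> * (sing 1 (fst z) * ennreal ((sn z)\<^sup>2))"
      unfolding sing_def by (subst ennreal_mult, simp add: \<mu>_def, simp, subst ennreal_mult) auto
     also have "ennreal (?x powr (- 2 * \<theta>) * ((sn z)\<^sup>2 * (cmod (P z))\<^sup>2)) = ennreal (?x powr (- 2 * \<theta>)) * ennreal ((sn z)\<^sup>2 * (cmod (P z))\<^sup>2)"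
      by (rule ennreal_mult) auto
     also have "(sn z)\<^sup>2 * (cmod (P z))\<^sup>2 = (cmod (of_real (sn z) * P z))\<^sup>2" by (simp add: norm_mult power_mult_distrib)
     finally have "ennreal (?x powr (- 2 * \<theta>)) * nsq (of_real (sn z) * P z)
      \<le> ennreal \<mu> * (sing 1 (fst z) * ennreal ((sn z)\<^sup>2))" .
     moreover have "sn z = sin (t * (fst z)\<^sup>2)" using True by (simp add: sn_def)
     ultimately show ?thesis using True by simp
    qed
   qed
   also have "... = ennreal \<mu> * (\<integral>\<^sup>+z. indicator {0} (snd z) * (sing 1 (fst z) * ennreal ((sin (t * (fst z)\<^sup>2))\<^sup>2)) \<partial>frequencies)"
   proof (rule nn_integral_cmult)
    have [measurable]: "(\<lambda>z. indicator {0} (snd z) :: ennreal) \<in> freq_measurable"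
     unfolding frequencies_def by (rule measurable_compose[OF measurable_snd]) simp
    show "(\<lambda>z. indicator {0} (snd z) * (sing 1 (fst z) * ennreal ((sin (t * (fst z)\<^sup>2))\<^sup>2))) \<in> freq_measurable"
     by measurable
   qed
   also have "... \<le> ennreal Cm * ennreal (B\<^sup>2) * (ennreal (\<bar>t\<bar> powr 1) * cutoff_const 4 1)"
   proof (intro mult_mono sine_zero_mode_singular)
    have "ennreal \<mu> \<le> ennreal Cm * energy cylinder (weighted \<theta> f)" unfolding \<mu>_def by (rule Cm(2)[OF dat(2)])
    also have "... \<le> ennreal Cm * ennreal (B\<^sup>2)" by (intro mult_left_mono dat) simp
    finally show "ennreal \<mu> \<le> ennreal Cm * ennreal (B\<^sup>2)" .
   qed auto
   also have "... = ennreal (\<bar>t\<bar> powr 1) * (ennreal K2 * ennreal (B\<^sup>2))"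
    unfolding K2_def c(1) using Cm c by (subst ennreal_mult[of Cm c]) (auto simp: mult_ac)
   also have "... \<le> ennreal K2 * a"
    unfolding a_def by (rule absorb_time[OF _ _ K12(2) order_refl]) (auto simp: \<theta>_def)
   finally show ?thesis .
  qed
  have "sine_weight \<theta> t f = freq_weight (- 2 * \<theta>) (\<lambda>z. of_real (sn z) * (fourier f z - P z) + of_real (sn z) * P z)"
   unfolding sine_weight_def sn_def by (simp add: algebra_simps)
  also have "... \<le> 2 * (freq_weight (- 2 * \<theta>) (\<lambda>z. of_real (sn z) * (fourier f z - P z)) + freq_weight (- 2 * \<theta>) (\<lambda>z. of_real (sn z) * P z))"
   by (rule freq_weight_add_le) measurable
  also have "... \<le> 2 * (ennreal K1 * a + ennreal K2 * a)" by (intro mult_left_mono add_mono R Q) auto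
  also have "... = ennreal (2 * (K1 + K2)) * a"
  proof -
   have "ennreal (2 * (K1 + K2)) = ennreal 2 * ennreal (K1 + K2)" using K12 by (intro ennreal_mult) auto
   then show ?thesis using K12 by (simp add: distrib_right mult.assoc)
  qed
  finally show "sine_weight \<theta> t f \<le> ennreal (2 * (K1 + K2)) * ennreal ((japanese t powr \<theta> * B)\<^sup>2)" unfolding a_def .
 qed
qed

lemma Hs0_norm_nonneg: "0 \<le> Hs0_norm \<theta> f" by (simp add: Hs0_norm_def L2_norm_nonneg)

lemma sine_low:
 assumes \<theta>: "0 < \<theta>" "\<theta> < 1/2"
 shows "sine_estimate \<theta> (\<lambda>f B. True)"
proof -
 obtain K where K: "0 \<le> K" "\<And>f. f \<in> L2 cylinder \<Longrightarrow> freq_weight (- 2 * \<theta>) (fourier f) \<le> ennreal K * x_energy \<theta> f"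
  using hardy_low_cylinder[OF \<theta>] by blast
 show ?thesis unfolding sine_estimate_def
 proof (intro exI[of _ K] conjI allI impI K(1))
  fix f t B
  assume f: "f \<in> Hs0 \<theta> \<inter> L2_weight \<theta>" and B: "L2_norm cylinder (weighted \<theta> f) \<le> B"
  note dat = Hs0_weight_data[OF f less_imp_le[OF \<theta>(1)] B]
  have "sine_weight \<theta> t f \<le> ennreal K * x_energy \<theta> f" by (rule order_trans[OF sine_weight_le K(2)[OF dat(1)]])
  also have "... \<le> ennreal K * ennreal (B\<^sup>2)" by (intro mult_left_mono dat) simp
  finally show "sine_weight \<theta> t f \<le> ennreal K * ennreal ((japanese t powr \<theta> * B)\<^sup>2)"
   by (rule absorb_no_time[OF less_imp_le[OF \<theta>(1)]])
 qed
qed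

lemma sine_half:
 "sine_estimate (1/2) (\<lambda>f B. hilbert_x f \<in> L2_weight (1/2) \<and> L2_norm cylinder (weighted (1/2) (hilbert_x f)) \<le> B)"
proof -
 obtain K where K: "0 \<le> K" "\<And>g. g \<in> L2 cylinder \<Longrightarrow> freq_weight (- 1) (fourier g) \<le> ennreal K * (x_energy (1/2) g + x_energy (1/2) (hilbert_x g))"
  using hardy_hilbert by blast
 show ?thesis unfolding sine_estimate_def
 proof (intro exI[of _ "K * 2"] conjI allI impI, goal_cases)
  case 1 show "0 \<le> K * 2" using K by simp
 next
  case (2 f t B)
  then have f: "f \<in> Hs0 (1/2) \<inter> L2_weight (1/2)" and B: "L2_norm cylinder (weighted (1/2) f) \<le> B"
   and hw: "hilbert_x f \<in> L2_weight (1/2)" and hB: "L2_norm cylinder (weighted (1/2) (hilbert_x f)) \<le> B" by blast+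
  have half: "0 \<le> (1/2 :: real)" by simp
  note dat = Hs0_weight_data[OF f half B]
  have hL: "weighted (1/2) (hilbert_x f) \<in> L2 cylinder" by (rule weighted_L2[OF hilbert_x_fourier(3)[OF dat(1)] hw half])
  have e2: "x_energy (1/2) (hilbert_x f) \<le> ennreal (B\<^sup>2)"
   by (rule order_trans[OF x_energy_le_weighted[OF half] energy_weighted_bound[OF hL half hB]])
  have "sine_weight (1/2) t f \<le> freq_weight (- 1) (fourier f)" using sine_weight_le[of "1/2" t f] by simp
  also have "... \<le> ennreal K * (ennreal (B\<^sup>2) + ennreal (B\<^sup>2))"
   by (intro order_trans[OF K(2)[OF dat(1)]] mult_left_mono add_mono dat e2) auto
  also have "... = ennreal (K * 2) * ennreal (B\<^sup>2)" using K ennreal_mult[of K 2] by (simp add: mult_2 mult.assoc)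
  finally show "sine_weight (1/2) t f \<le> ennreal (K * 2) * ennreal ((japanese t powr (1/2) * B)\<^sup>2)"
   by (rule absorb_no_time[OF half])
 qed
qed

theorem theorem1p1:
  shows "(\<forall>\<theta>::real. 0 < \<theta> \<and> \<theta> < 1/2 \<longrightarrow>
      (\<exists>C>0. \<forall>f. f \<in> Hs0 \<theta> \<inter> L2_weight \<theta> \<longrightarrow>
        (\<forall>t::real. weighted_bound \<theta> (U t f)
          (C * japanese t powr \<theta> * (L2_norm cylinder (weighted \<theta> f) + Hs0_norm \<theta> f)))))
    \<and> (\<exists>C>0. \<forall>f. f \<in> Hs0 (1/2) \<inter> L2_weight (1/2) \<and> hilbert_x f \<in> L2_weight (1/2) \<longrightarrow>
      (\<forall>t::real. weighted_bound (1/2) (U t f)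
        (C * japanese t powr (1/2) *
          (L2_norm cylinder (weighted (1/2) f) + L2_norm cylinder (weighted (1/2) (hilbert_x f))
           + Hs0_norm (1/2) f))))
    \<and> (\<forall>\<theta>::real. 1/2 < \<theta> \<and> \<theta> < 3/2 \<longrightarrow>
      (\<exists>C>0. \<forall>f. f \<in> Hs0 \<theta> \<inter> L2_weight \<theta> \<and> (\<forall>\<eta>. \<eta> \<noteq> 0 \<longrightarrow> moment f 0 \<eta> = 0) \<longrightarrow>
        (\<forall>t::real. weighted_bound \<theta> (U t f)
          (C * japanese t powr \<theta> * (L2_norm cylinder (weighted \<theta> f) + Hs0_norm \<theta> f)))))
    \<and> (\<forall>(k::nat) \<theta>::real. 1 \<le> k \<and> real k + 1/2 \<le> \<theta> \<and> \<theta> < real k + 3/2 \<longrightarrow>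
      (\<theta> = real k + 1/2 \<longrightarrow>
        (\<exists>C>0. \<forall>f. f \<in> Hs0 \<theta> \<inter> L2_weight \<theta>
            \<and> (\<forall>\<eta>. \<eta> \<noteq> 0 \<longrightarrow> (\<forall>l\<le>k - 1. moment f l \<eta> = 0))
            \<and> (2 \<le> k \<longrightarrow> (\<forall>l\<le>k - 2. moment f l 0 = 0))
            \<and> hilbert_x (x_power k f) \<in> L2_weight (1/2) \<longrightarrow>
          (\<forall>t::real. weighted_bound \<theta> (U t f)
            (C * japanese t powr \<theta> *
              (L2_norm cylinder (weighted \<theta> f)
               + L2_norm cylinder (weighted (1/2) (hilbert_x (x_power k f)))
               + Hs0_norm \<theta> f)))))
      \<and> (real k + 1/2 < \<theta> \<longrightarrow>
        (\<exists>C>0. \<forall>f. f \<in> Hs0 \<theta> \<inter> L2_weight \<theta>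
            \<and> (\<forall>\<eta>. \<eta> \<noteq> 0 \<longrightarrow> (\<forall>l\<le>k - 1. moment f l \<eta> = 0))
            \<and> (2 \<le> k \<longrightarrow> (\<forall>l\<le>k - 2. moment f l 0 = 0))
            \<and> (\<forall>\<eta>. \<eta> \<noteq> 0 \<longrightarrow> moment f k \<eta> = 0) \<longrightarrow>
          (\<forall>t::real. weighted_bound \<theta> (U t f)
            (C * japanese t powr \<theta> * (L2_norm cylinder (weighted \<theta> f) + Hs0_norm \<theta> f))))))"
proof (intro conjI allI impI, goal_cases)
 case (1 \<theta>)
 then show ?case
  by (intro weighted_bound_of_sine_estimate[OF _ sine_low[of \<theta>]]) (auto simp: L2_norm_nonneg Hs0_norm_nonneg)
next
 case 2
 show ?case by (intro weighted_bound_of_sine_estimate[OF _ sine_half]) (auto simp: L2_norm_nonneg Hs0_norm_nonneg)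
next
 case (3 \<theta>)
 then show ?case
  by (intro weighted_bound_of_sine_estimate[OF _ sine_moments[of 0 \<theta>]]) (auto simp: L2_norm_nonneg Hs0_norm_nonneg)
next
 case (4 k \<theta>)
 then have k: "1 \<le> k" and \<theta>: "\<theta> = real k + 1/2" by auto
 show ?case unfolding \<theta>
  by (rule weighted_bound_of_sine_estimate[OF _ sine_endpoint[OF k]]) (simp, simp add: L2_norm_nonneg Hs0_norm_nonneg)
next
 case (5 k \<theta>)
 then have \<theta>: "real k + 1/2 < \<theta>" "\<theta> < real k + 3/2" and k: "1 \<le> k" by auto
 have split: "(\<forall>l\<le>k. a l = (0::complex)) \<longleftrightarrow> (\<forall>l\<le>k - 1. a l = 0) \<and> a k = 0" for a
  using k by (metis diff_le_self le_SucE le_trans order_refl Suc_diff_1 less_eq_Suc_le One_nat_def)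
 show ?case by (rule weighted_bound_of_sine_estimate[OF _ sine_moments[OF \<theta>]], use \<theta> in linarith)
   (simp add: split L2_norm_nonneg Hs0_norm_nonneg)
qed

end
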